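(* Suppose that for each $\varepsilon>0$ there is $C_\varepsilon>0$ such that $|\tau^*(\alpha)-\tau^*(\beta)|_g\le C_\varepsilon|\alpha-\beta|_g$ for all $x\in M$ and $\alpha,\beta\in T_x^*M$ with $|\tau^*(\alpha)-\tau^*(\beta)|_g\ge\varepsilon$. Given an initial function $u_0\in H^1(M;\mathbf H)$, let $(u_t)_{t\ge0}\subset H^1(M;\mathbf H)$ be the gradient curve of $\mathcal E$ starting from $u_0$ (constructed as the limit of the discrete approximation scheme). Then $(u_t)_{t\ge0}$ solves the heat equation $\partial_tu_t=\mathbf\Delta^{\mathbf H}_{\mathfrak m}u_t$ in the weak sense that $$\int_0^\infty\!\int_M\partial_t\phi\cdot u_t\,d\mathfrak m\,dt=\int_0^\infty\!\int_Md\phi_t(\nabla u_t)\,d\mathfrak m\,dt$$ for all $\phi\in C_c^\infty((0,\infty)\times M)$, where $\phi_t:=\phi(t,\cdot)$. Moreover, for all $t>0$, the distributional Laplacian $\mathbf\Delta^{\mathbf H}_{\mathfrak m}u_t$ is absolutely continuous with respect to $\mathfrak m$ and its density function coincides with $\nabla(-\mathcal E)(u_t)$. In particular, for all $t>0$, $$\|\mathbf\Delta^{\mathbf H}_{\mathfrak m}u_t\|_{L^2}=\|\nabla(-\mathcal E)(u_t)\|_{L^2}=|\nabla(-\mathcal E)|(u_t).$$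
   Context: $M$ is a compact connected $C^\infty$-manifold without boundary of dimension $n\ge2$, with a fixed positive $C^\infty$-measure $\mathfrak m$ and an auxiliary Riemannian metric $g$. Lagrangian: a function $\mathbf L:TM\to[0,\infty)$ with (1) $\mathbf L\in C^1(TM)\cap C^\infty(TM\setminus 0_{TM})$ and $\mathbf L\equiv0$ on the zero section $0_{TM}$; (2) (super-linearity) for some complete Riemannian metric $g$ and $C>0$, $\mathbf L(v)\ge|v|_g-C$ for all $v$; (3) for every $x$, $\mathbf L|_{T_xM}$ has positive-definite Hessian at every $v\in T_xM\setminus\{0\}$. Hamiltonian: $\mathbf H(\alpha):=\sup_{v\in T_xM}\{\alpha(v)-\mathbf L(v)\}$, $\alpha\in T_x^*M$. A fixed $\mathbf L$ with Hamiltonian $\mathbf H$ is given. Legendre transform: $\tau^*(\alpha)=\sum_i\mathbf H_{\alpha_i}(\alpha)\partial_{x^i}$ in coordinates $\alpha=\sum\alpha_idx^i$; $\nabla u(x):=\tau^*(du_x)$. The distributional Laplacian $\mathbf\Delta^{\mathbf H}_{\mathfrak m}u=\mathrm{div}_{\mathfrak m}(\nabla u)$ is given by $\int_M\phi\,\mathbf\Delta^{\mathbf H}_{\mathfrak m}u\,d\mathfrak m=-\int_Md\phi(\nabla u)\,d\mathfrak m$ for $\phi\in C^\infty(M)$. $H^1(M;\mathbf H)$ is the (convex) set of weakly differentiable $u\in L^2(M;\mathfrak m)$ with $\mathbf H(du)\in L^1(M;\mathfrak m)$. Energy: $\mathcal E(u)=\int_M\mathbf H(du)\,d\mathfrak m$,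 regarded as a convex lower semi-continuous functional on $L^2(M;\mathfrak m)$ (with value $+\infty$ outside $H^1(M;\mathbf H)$). For $u\in H^1(M;\mathbf H)$, $$|\nabla(-\mathcal E)|(u):=\max\Big\{\limsup_{\bar u\to u}\frac{\mathcal E(u)-\mathcal E(\bar u)}{\|\bar u-u\|_{L^2}},0\Big\},$$ with $\bar u\in H^1(M;\mathbf H)$ and $\bar u\to u$ in $L^2(M;\mathfrak m)$. If $0<|\nabla(-\mathcal E)|(u)<\infty$, $\nabla(-\mathcal E)(u)$ is the unique $w\in L^2(M;\mathfrak m)$ with $\|w\|_{L^2}=|\nabla(-\mathcal E)|(u)$ and $\limsup_{\bar w\to w}\lim_{t\downarrow0}\frac{\mathcal E(u)-\mathcal E(u+t\bar w)}{t\|\bar w\|_{L^2}}=|\nabla(-\mathcal E)|(u)$ ($\bar w\to w$ in $L^2$); if $|\nabla(-\mathcal E)|(u)=0$, $\nabla(-\mathcal E)(u):=0$. Gradient curve: for $u_0\in H^1(M;\mathbf H)$ and $\delta>0$ let $\mathsf U_\delta(u_0)\in H^1(M;\mathbf H)$ be the unique minimizer of $u\mapsto\mathcal E(u)+\|u-u_0\|_{L^2}^2/(2\delta)$. For $t>0$, $u_t:=\lim_{k\to\infty}(\mathsf U_{t/k})^k(u_0)$ in $L^2(M;\mathfrak m)$ (the limit is known to exist, $u_t\to u_0$ as $t\downarrow0$, $\mathcal E(u_t)\le\mathcal E(u_0)$, and $|\nabla(-\mathcal E)|(u_t)<\infty$ for all $t>0$). $(u_t)_{t\ge0}$ is called the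 gradient curve of $\mathcal E$ from $u_0$. *)

theory Defs
  imports "HOL-Analysis.Analysis"
begin

section \<open>Functions of class \<open>C\<^sup>k\<close> on open subsets of normed spaces\<close>

abbreviation dir_deriv :: "('a::real_normed_vector \<Rightarrow> 'b::real_normed_vector) \<Rightarrow> 'a \<Rightarrow> 'a \<Rightarrow> 'b" where
  "dir_deriv f x \<equiv> frechet_derivative f (at x)"

text \<open>These two notions are only meant for open \<open>S\<close>.\<close>

primrec Ck_on :: "nat \<Rightarrow> 'a::euclidean_space set \<Rightarrow> ('a \<Rightarrow> 'b::real_normed_vector) \<Rightarrow> bool" where
  "Ck_on 0 S f \<longleftrightarrow> continuous_on S f"
| "Ck_on (Suc k) S f \<longleftrightarrow> f differentiable_on S \<and> (\<forall>v. Ck_on k S (\<lambda>x. dir_deriv f x v))"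

definition smooth_on :: "'a::euclidean_space set \<Rightarrow> ('a \<Rightarrow> 'b::real_normed_vector) \<Rightarrow> bool" where
  "smooth_on S f \<longleftrightarrow> (\<forall>k. Ck_on k S f)"

definition test_function :: "'a::euclidean_space set \<Rightarrow> ('a \<Rightarrow> real) \<Rightarrow> bool" where
  "test_function S \<psi> \<longleftrightarrow>
     smooth_on UNIV \<psi> \<and> (\<exists>K. compact K \<and> K \<subseteq> S \<and> (\<forall>x. x \<notin> K \<longrightarrow> \<psi> x = 0))"

definition hessian :: "('a::real_normed_vector \<Rightarrow> real) \<Rightarrow> 'a \<Rightarrow> 'a \<Rightarrow> 'a \<Rightarrow> real" where
  "hessian f v w1 w2 = dir_deriv (\<lambda>v'. dir_deriv f v' w2) v w1"

definition gradient_vec :: "('a::euclidean_space \<Rightarrow> real) \<Rightarrow> 'a \<Rightarrow> 'a" where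
  "gradient_vec f x = (\<Sum>b\<in>Basis. dir_deriv f x b *\<^sub>R b)"


section \<open>Smooth manifolds\<close>

text \<open>The manifold \<open>M\<close> is the whole type \<open>'m\<close>, modelled on \<open>'e\<close> (so \<open>n = DIM('e)\<close>).
  A chart is a pair of its domain and its coordinate map; the values of the latter outside the
  domain are irrelevant.  An atlas need not be maximal.\<close>

type_synonym ('m, 'e) chart = "'m set \<times> ('m \<Rightarrow> 'e)"

abbreviation cdom :: "('m, 'e) chart \<Rightarrow> 'm set" where "cdom c \<equiv> fst c"
abbreviation cmap :: "('m, 'e) chart \<Rightarrow> 'm \<Rightarrow> 'e" where "cmap c \<equiv> snd c"
abbreviation cran :: "('m, 'e) chart \<Rightarrow> 'e set" where "cran c \<equiv> cmap c ` cdom c"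

definition cinv :: "('m, 'e) chart \<Rightarrow> 'e \<Rightarrow> 'm" where
  "cinv c = inv_into (cdom c) (cmap c)"

definition smooth_atlas ::
  "('m::{t2_space,second_countable_topology}, 'e::euclidean_space) chart set \<Rightarrow> bool" where
  "smooth_atlas A \<longleftrightarrow>
     (\<forall>c\<in>A. open (cdom c) \<and> open (cran c) \<and> homeomorphism (cdom c) (cran c) (cmap c) (cinv c)) \<and>
     (\<Union>c\<in>A. cdom c) = UNIV \<and>
     (\<forall>c\<in>A. \<forall>d\<in>A. smooth_on (cmap c ` (cdom c \<inter> cdom d)) (cmap d \<circ> cinv c))"

definition charts_at :: "('m, 'e) chart set \<Rightarrow> 'm \<Rightarrow> ('m, 'e) chart set" where
  "charts_at A p = {c \<in> A. p \<in> cdom c}"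

definition smooth_fun ::
  "('m, 'e::euclidean_space) chart set \<Rightarrow> ('m \<Rightarrow> real) \<Rightarrow> bool" where
  "smooth_fun A f \<longleftrightarrow> (\<forall>c\<in>A. smooth_on (cran c) (f \<circ> cinv c))"


subsection \<open>Tangent and cotangent vectors\<close>

text \<open>A (co)tangent vector at \<open>p\<close> is the family of its component vectors \<open>(v\<^sup>i)\<close>, resp.
  \<open>(\<alpha>\<^sub>i)\<close> with \<open>\<alpha> = \<Sum>\<alpha>\<^sub>i dx\<^sup>i\<close>, in all the charts around \<open>p\<close>; the components in different
  charts are related by the Jacobian of the transition map, resp. by its transpose.  The value
  at charts not containing \<open>p\<close> is fixed to be \<open>0\<close>, so that families correspond one-to-one to
  (co)tangent vectors and the vector space operations are pointwise.\<close>

type_synonym ('m, 'e) tvec = "('m, 'e) chart \<Rightarrow> 'e"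
type_synonym ('m, 'e) covec = "('m, 'e) chart \<Rightarrow> 'e"

text \<open>\<open>\<Sum>w\<^sup>i \<partial>\<^sub>i\<close> and \<open>\<Sum>a\<^sub>i dx\<^sup>i\<close> at \<open>p\<close> with respect to the chart \<open>c\<close>:\<close>

definition tvec_of ::
  "('m, 'e::euclidean_space) chart set \<Rightarrow> ('m, 'e) chart \<Rightarrow> 'm \<Rightarrow> 'e \<Rightarrow> ('m, 'e) tvec" where
  "tvec_of A c p w =
     (\<lambda>d. if d \<in> charts_at A p then dir_deriv (cmap d \<circ> cinv c) (cmap c p) w else 0)"

definition covec_of ::
  "('m, 'e::euclidean_space) chart set \<Rightarrow> ('m, 'e) chart \<Rightarrow> 'm \<Rightarrow> 'e \<Rightarrow> ('m, 'e) covec" where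
  "covec_of A c p a =
     (\<lambda>d. if d \<in> charts_at A p then adjoint (dir_deriv (cmap c \<circ> cinv d) (cmap d p)) a else 0)"

definition tangent_space ::
  "('m, 'e::euclidean_space) chart set \<Rightarrow> 'm \<Rightarrow> ('m, 'e) tvec set" where
  "tangent_space A p = {v. \<forall>c\<in>charts_at A p. v = tvec_of A c p (v c)}"

definition cotangent_space ::
  "('m, 'e::euclidean_space) chart set \<Rightarrow> 'm \<Rightarrow> ('m, 'e) covec set" where
  "cotangent_space A p = {\<alpha>. \<forall>c\<in>charts_at A p. \<alpha> = covec_of A c p (\<alpha> c)}"

text \<open>The pairing \<open>\<alpha>(v)\<close>; the choice of the chart does not matter.\<close>

definition pairing ::
  "('m, 'e::euclidean_space) chart set \<Rightarrow> 'm \<Rightarrow> ('m, 'e) covec \<Rightarrow> ('m, 'e) tvec \<Rightarrow> real" where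
  "pairing A p \<alpha> v = (let c = (SOME c. c \<in> charts_at A p) in \<alpha> c \<bullet> v c)"

text \<open>The differential of a smooth function:\<close>

definition differential ::
  "('m, 'e::euclidean_space) chart set \<Rightarrow> ('m \<Rightarrow> real) \<Rightarrow> 'm \<Rightarrow> ('m, 'e) covec" where
  "differential A f p =
     (\<lambda>c. if c \<in> charts_at A p then gradient_vec (f \<circ> cinv c) (cmap c p) else 0)"


subsection \<open>Riemannian metrics\<close>

definition riemannian_metric ::
  "('m, 'e::euclidean_space) chart set \<Rightarrow> ('m \<Rightarrow> ('m, 'e) tvec \<Rightarrow> ('m, 'e) tvec \<Rightarrow> real) \<Rightarrow> bool" where
  "riemannian_metric A g \<longleftrightarrow>
     (\<forall>p. \<forall>c\<in>charts_at A p. bilinear (\<lambda>v w. g p (tvec_of A c p v) (tvec_of A c p w))) \<and>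
     (\<forall>p. \<forall>v\<in>tangent_space A p. \<forall>w\<in>tangent_space A p. g p v w = g p w v) \<and>
     (\<forall>p. \<forall>v\<in>tangent_space A p. v \<noteq> (\<lambda>_. 0) \<longrightarrow> g p v v > 0) \<and>
     (\<forall>c\<in>A. \<forall>v w. smooth_on (cran c)
        (\<lambda>x. g (cinv c x) (tvec_of A c (cinv c x) v) (tvec_of A c (cinv c x) w)))"

definition tnorm ::
  "('m \<Rightarrow> ('m, 'e) tvec \<Rightarrow> ('m, 'e) tvec \<Rightarrow> real) \<Rightarrow> 'm \<Rightarrow> ('m, 'e) tvec \<Rightarrow> real" where
  "tnorm g p v = sqrt (g p v v)"

definition conorm ::
  "('m, 'e::euclidean_space) chart set \<Rightarrow> ('m \<Rightarrow> ('m, 'e) tvec \<Rightarrow> ('m, 'e) tvec \<Rightarrow> real) \<Rightarrow>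
   'm \<Rightarrow> ('m, 'e) covec \<Rightarrow> real" where
  "conorm A g p \<alpha> = (SUP v\<in>{v \<in> tangent_space A p. tnorm g p v \<le> 1}. pairing A p \<alpha> v)"

text \<open>The library's \<open>piecewise_C1_differentiable_on\<close> allows the derivative to be unbounded near
  the exceptional points; curves without finite length are excluded in \<open>riemannian_dist\<close>.\<close>

definition C1_curve ::
  "('m::topological_space, 'e::euclidean_space) chart set \<Rightarrow> (real \<Rightarrow> 'm) \<Rightarrow> bool" where
  "C1_curve A \<gamma> \<longleftrightarrow> path \<gamma> \<and>
     (\<forall>c\<in>A. \<forall>a b. 0 \<le> a \<and> a \<le> b \<and> b \<le> 1 \<and> \<gamma> ` {a..b} \<subseteq> cdom c \<longrightarrow>
        (cmap c \<circ> \<gamma>) piecewise_C1_differentiable_on {a..b})"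

definition velocity ::
  "('m, 'e::euclidean_space) chart set \<Rightarrow> (real \<Rightarrow> 'm) \<Rightarrow> real \<Rightarrow> ('m, 'e) tvec" where
  "velocity A \<gamma> t =
     (\<lambda>c. if c \<in> charts_at A (\<gamma> t) then vector_derivative (cmap c \<circ> \<gamma>) (at t) else 0)"

definition riemannian_dist ::
  "('m::topological_space, 'e::euclidean_space) chart set \<Rightarrow>
   ('m \<Rightarrow> ('m, 'e) tvec \<Rightarrow> ('m, 'e) tvec \<Rightarrow> real) \<Rightarrow> 'm \<Rightarrow> 'm \<Rightarrow> real" where
  "riemannian_dist A g p q =
     (INF \<gamma>\<in>{\<gamma>. C1_curve A \<gamma> \<and> pathstart \<gamma> = p \<and> pathfinish \<gamma> = q \<and>
             (\<lambda>t. tnorm g (\<gamma> t) (velocity A \<gamma> t)) integrable_on {0..1}}.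
        integral {0..1} (\<lambda>t. tnorm g (\<gamma> t) (velocity A \<gamma> t)))"

definition complete_metric ::
  "('m::topological_space, 'e::euclidean_space) chart set \<Rightarrow>
   ('m \<Rightarrow> ('m, 'e) tvec \<Rightarrow> ('m, 'e) tvec \<Rightarrow> real) \<Rightarrow> bool" where
  "complete_metric A g \<longleftrightarrow>
     (\<forall>s :: nat \<Rightarrow> 'm. (\<forall>e>0. \<exists>N. \<forall>i\<ge>N. \<forall>j\<ge>N. riemannian_dist A g (s i) (s j) < e) \<longrightarrow>
        (\<exists>p. (\<lambda>i. riemannian_dist A g (s i) p) \<longlonglongrightarrow> 0))"


subsection \<open>Positive smooth measures\<close>

definition smooth_measure ::
  "('m::topological_space, 'e::euclidean_space) chart set \<Rightarrow> 'm measure \<Rightarrow> bool" where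
  "smooth_measure A m \<longleftrightarrow> sets m = sets borel \<and>
     (\<forall>c\<in>A. \<exists>\<rho>. smooth_on (cran c) \<rho> \<and> (\<forall>x\<in>cran c. \<rho> x > 0) \<and>
        distr (restrict_space m (cdom c)) borel (cmap c) =
        density lborel (\<lambda>x. ennreal (indicator (cran c) x * \<rho> x)))"


section \<open>Lagrangian, Hamiltonian, Legendre transform\<close>

definition lagrangian ::
  "('m::topological_space, 'e::euclidean_space) chart set \<Rightarrow> ('m \<Rightarrow> ('m, 'e) tvec \<Rightarrow> real) \<Rightarrow> bool" where
  "lagrangian A L \<longleftrightarrow>
     (\<forall>p. \<forall>v\<in>tangent_space A p. L p v \<ge> 0) \<and>
     (\<forall>c\<in>A. Ck_on 1 (cran c \<times> UNIV) (\<lambda>(x, w). L (cinv c x) (tvec_of A c (cinv c x) w))) \<and>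
     (\<forall>c\<in>A. smooth_on (cran c \<times> (UNIV - {0})) (\<lambda>(x, w). L (cinv c x) (tvec_of A c (cinv c x) w))) \<and>
     (\<forall>p. L p (\<lambda>_. 0) = 0) \<and>
     (\<exists>g C. riemannian_metric A g \<and> complete_metric A g \<and> C > 0 \<and>
        (\<forall>p. \<forall>v\<in>tangent_space A p. L p v \<ge> tnorm g p v - C)) \<and>
     (\<forall>p. \<forall>c\<in>charts_at A p. \<forall>v. v \<noteq> 0 \<longrightarrow>
        (\<forall>w. w \<noteq> 0 \<longrightarrow> hessian (\<lambda>v. L p (tvec_of A c p v)) v w w > 0))"

text \<open>The growth condition in \<open>lagrangian\<close> alone does not exclude the value \<open>\<infinity>\<close>
  for the supremum, hence the codomain \<open>ereal\<close>.\<close>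

definition hamiltonian ::
  "('m, 'e::euclidean_space) chart set \<Rightarrow> ('m \<Rightarrow> ('m, 'e) tvec \<Rightarrow> real) \<Rightarrow>
   'm \<Rightarrow> ('m, 'e) covec \<Rightarrow> ereal" where
  "hamiltonian A L p \<alpha> = (SUP v\<in>tangent_space A p. ereal (pairing A p \<alpha> v - L p v))"

definition legendre ::
  "('m, 'e::euclidean_space) chart set \<Rightarrow> ('m \<Rightarrow> ('m, 'e) tvec \<Rightarrow> real) \<Rightarrow>
   'm \<Rightarrow> ('m, 'e) covec \<Rightarrow> ('m, 'e) tvec" where
  "legendre A L p \<alpha> =
     (\<lambda>c. if c \<in> charts_at A p
          then gradient_vec (\<lambda>a. real_of_ereal (hamiltonian A L p (covec_of A c p a))) (\<alpha> c)
          else 0)"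


section \<open>Weak differentials and energy\<close>

text \<open>Elements of \<open>L\<^sup>2(M;m)\<close> are represented by Borel functions, and all notions below are
  invariant under almost everywhere equality.\<close>

definition L2 :: "'m measure \<Rightarrow> ('m \<Rightarrow> real) set" where
  "L2 m = {u \<in> borel_measurable m. integrable m (\<lambda>x. (u x)\<^sup>2)}"

definition L2norm :: "'m measure \<Rightarrow> ('m \<Rightarrow> real) \<Rightarrow> real" where
  "L2norm m u = sqrt (\<integral>x. (u x)\<^sup>2 \<partial>m)"

text \<open>The filter \<open>v \<rightarrow> u\<close> in \<open>L\<^sup>2(M;m)\<close>, with \<open>\<parallel>v - u\<parallel> > 0\<close>:\<close>

definition L2_at :: "'m measure \<Rightarrow> ('m \<Rightarrow> real) \<Rightarrow> ('m \<Rightarrow> real) filter" where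
  "L2_at m u = inf (filtercomap (\<lambda>v. L2norm m (v - u)) (at_right 0)) (principal (L2 m))"

definition locally_integrable :: "'e::euclidean_space set \<Rightarrow> ('e \<Rightarrow> real) \<Rightarrow> bool" where
  "locally_integrable S f \<longleftrightarrow> (\<forall>K. compact K \<and> K \<subseteq> S \<longrightarrow> set_integrable lborel K f)"

definition is_weak_differential ::
  "('m, 'e::euclidean_space) chart set \<Rightarrow> ('m \<Rightarrow> real) \<Rightarrow> ('m \<Rightarrow> ('m, 'e) covec) \<Rightarrow> bool" where
  "is_weak_differential A u \<eta> \<longleftrightarrow>
     (\<forall>p. \<eta> p \<in> cotangent_space A p) \<and>
     (\<forall>c\<in>A. locally_integrable (cran c) (\<lambda>x. u (cinv c x)) \<and>
        (\<forall>b\<in>Basis. locally_integrable (cran c) (\<lambda>x. \<eta> (cinv c x) c \<bullet> b) \<and>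
           (\<forall>\<psi>. test_function (cran c) \<psi> \<longrightarrow>
              (\<integral>x. u (cinv c x) * dir_deriv \<psi> x b \<partial>lborel) =
              - (\<integral>x. (\<eta> (cinv c x) c \<bullet> b) * \<psi> x \<partial>lborel))))"

definition weakly_differentiable ::
  "('m, 'e::euclidean_space) chart set \<Rightarrow> ('m \<Rightarrow> real) \<Rightarrow> bool" where
  "weakly_differentiable A u \<longleftrightarrow> (\<exists>\<eta>. is_weak_differential A u \<eta>)"

text \<open>\<open>du\<close>, unique up to a null set:\<close>

definition weak_differential ::
  "('m, 'e::euclidean_space) chart set \<Rightarrow> ('m \<Rightarrow> real) \<Rightarrow> 'm \<Rightarrow> ('m, 'e) covec" where
  "weak_differential A u = (SOME \<eta>. is_weak_differential A u \<eta>)"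

definition H1 ::
  "('m, 'e::euclidean_space) chart set \<Rightarrow> ('m \<Rightarrow> ('m, 'e) tvec \<Rightarrow> real) \<Rightarrow> 'm measure \<Rightarrow>
   ('m \<Rightarrow> real) set" where
  "H1 A L m = {u \<in> L2 m. weakly_differentiable A u \<and>
     (AE x in m. \<bar>hamiltonian A L x (weak_differential A u x)\<bar> \<noteq> \<infinity>) \<and>
     integrable m (\<lambda>x. real_of_ereal (hamiltonian A L x (weak_differential A u x)))}"

definition energy ::
  "('m, 'e::euclidean_space) chart set \<Rightarrow> ('m \<Rightarrow> ('m, 'e) tvec \<Rightarrow> real) \<Rightarrow> 'm measure \<Rightarrow>
   ('m \<Rightarrow> real) \<Rightarrow> ereal" where
  "energy A L m u =
     (if u \<in> H1 A L m
      then ereal (\<integral>x. real_of_ereal (hamiltonian A L x (weak_differential A u x)) \<partial>m)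
      else \<infinity>)"

definition slope ::
  "('m, 'e::euclidean_space) chart set \<Rightarrow> ('m \<Rightarrow> ('m, 'e) tvec \<Rightarrow> real) \<Rightarrow> 'm measure \<Rightarrow>
   ('m \<Rightarrow> real) \<Rightarrow> ereal" where
  "slope A L m u =
     max (Limsup (inf (L2_at m u) (principal (H1 A L m)))
            (\<lambda>v. (energy A L m u - energy A L m v) / ereal (L2norm m (v - u)))) 0"

text \<open>\<open>\<nabla>(-E)(u)\<close>, unique up to a null set if the slope is finite.  The inner limit may be
  \<open>-\<infinity>\<close> since \<open>E(u + t z)\<close> may be \<open>\<infinity>\<close>.\<close>

definition grad_neg_energy ::
  "('m, 'e::euclidean_space) chart set \<Rightarrow> ('m \<Rightarrow> ('m, 'e) tvec \<Rightarrow> real) \<Rightarrow> 'm measure \<Rightarrow>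
   ('m \<Rightarrow> real) \<Rightarrow> 'm \<Rightarrow> real" where
  "grad_neg_energy A L m u =
     (if slope A L m u = 0 then (\<lambda>_. 0)
      else (SOME w. w \<in> L2 m \<and> ereal (L2norm m w) = slope A L m u \<and>
        Limsup (L2_at m w) (\<lambda>z. Lim (at_right 0)
          (\<lambda>t. (energy A L m u - energy A L m (\<lambda>x. u x + t * z x)) / ereal (t * L2norm m z)))
        = slope A L m u))"


section \<open>Gradient curves\<close>

definition resolvent ::
  "('m, 'e::euclidean_space) chart set \<Rightarrow> ('m \<Rightarrow> ('m, 'e) tvec \<Rightarrow> real) \<Rightarrow> 'm measure \<Rightarrow>
   real \<Rightarrow> ('m \<Rightarrow> real) \<Rightarrow> 'm \<Rightarrow> real" where
  "resolvent A L m \<delta> v =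
     arg_min (\<lambda>u. energy A L m u + ereal ((L2norm m (u - v))\<^sup>2 / (2 * \<delta>))) (\<lambda>u. u \<in> H1 A L m)"

definition gradient_curve ::
  "('m, 'e::euclidean_space) chart set \<Rightarrow> ('m \<Rightarrow> ('m, 'e) tvec \<Rightarrow> real) \<Rightarrow> 'm measure \<Rightarrow>
   ('m \<Rightarrow> real) \<Rightarrow> (real \<Rightarrow> 'm \<Rightarrow> real) \<Rightarrow> bool" where
  "gradient_curve A L m u0 u \<longleftrightarrow>
     (AE x in m. u 0 x = u0 x) \<and> (\<forall>t\<ge>0. u t \<in> H1 A L m) \<and>
     (\<forall>t>0. (\<lambda>k. L2norm m ((resolvent A L m (t / real k) ^^ k) u0 - u t)) \<longlonglongrightarrow> 0)"


section \<open>Laplacian and weak heat equation\<close>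

text \<open>\<open>\<nabla>u\<close> for weakly differentiable \<open>u\<close>:\<close>

definition gradient_field ::
  "('m, 'e::euclidean_space) chart set \<Rightarrow> ('m \<Rightarrow> ('m, 'e) tvec \<Rightarrow> real) \<Rightarrow> ('m \<Rightarrow> real) \<Rightarrow>
   'm \<Rightarrow> ('m, 'e) tvec" where
  "gradient_field A L u x = legendre A L x (weak_differential A u x)"

text \<open>The function \<open>d\<phi>(\<nabla>u)\<close>:\<close>

definition dpair ::
  "('m, 'e::euclidean_space) chart set \<Rightarrow> ('m \<Rightarrow> ('m, 'e) tvec \<Rightarrow> real) \<Rightarrow>
   ('m \<Rightarrow> real) \<Rightarrow> ('m \<Rightarrow> real) \<Rightarrow> 'm \<Rightarrow> real" where
  "dpair A L \<phi> u x = pairing A x (differential A \<phi> x) (gradient_field A L u x)"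

text \<open>A distribution is a functional on \<open>C\<^sup>\<infinity>(M)\<close>.  The Laplacian of \<open>u\<close> makes sense only if the
  integrals defining it converge, which is recorded separately.\<close>

definition laplacian ::
  "('m, 'e::euclidean_space) chart set \<Rightarrow> ('m \<Rightarrow> ('m, 'e) tvec \<Rightarrow> real) \<Rightarrow> 'm measure \<Rightarrow>
   ('m \<Rightarrow> real) \<Rightarrow> ('m \<Rightarrow> real) \<Rightarrow> real" where
  "laplacian A L m u \<phi> = - (\<integral>x. dpair A L \<phi> u x \<partial>m)"

definition laplacian_defined ::
  "('m, 'e::euclidean_space) chart set \<Rightarrow> ('m \<Rightarrow> ('m, 'e) tvec \<Rightarrow> real) \<Rightarrow> 'm measure \<Rightarrow>
   ('m \<Rightarrow> real) \<Rightarrow> bool" where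
  "laplacian_defined A L m u \<longleftrightarrow> (\<forall>\<phi>. smooth_fun A \<phi> \<longrightarrow> integrable m (dpair A L \<phi> u))"

text \<open>The distribution \<open>T\<close> is absolutely continuous with respect to \<open>m\<close> with density \<open>f\<close>:\<close>

definition has_distr_density ::
  "('m, 'e::euclidean_space) chart set \<Rightarrow> 'm measure \<Rightarrow> (('m \<Rightarrow> real) \<Rightarrow> real) \<Rightarrow> ('m \<Rightarrow> real) \<Rightarrow> bool" where
  "has_distr_density A m T f \<longleftrightarrow>
     integrable m f \<and> (\<forall>\<phi>. smooth_fun A \<phi> \<longrightarrow> T \<phi> = (\<integral>x. \<phi> x * f x \<partial>m))"

definition distr_density ::
  "('m, 'e::euclidean_space) chart set \<Rightarrow> 'm measure \<Rightarrow> (('m \<Rightarrow> real) \<Rightarrow> real) \<Rightarrow> 'm \<Rightarrow> real" where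
  "distr_density A m T = (SOME f. has_distr_density A m T f)"

definition spacetime_test_function ::
  "('m::topological_space, 'e::euclidean_space) chart set \<Rightarrow> (real \<Rightarrow> 'm \<Rightarrow> real) \<Rightarrow> bool" where
  "spacetime_test_function A \<phi> \<longleftrightarrow>
     (\<forall>c\<in>A. smooth_on ({0<..} \<times> cran c) (\<lambda>(t, x). \<phi> t (cinv c x))) \<and>
     (\<exists>K. compact K \<and> K \<subseteq> {0<..} \<times> UNIV \<and> (\<forall>t>0. \<forall>x. (t, x) \<notin> K \<longrightarrow> \<phi> t x = 0))"

text \<open>The integrability conditions say that both iterated integrals converge.\<close>

definition weak_heat_solution ::
  "('m::topological_space, 'e::euclidean_space) chart set \<Rightarrow> ('m \<Rightarrow> ('m, 'e) tvec \<Rightarrow> real) \<Rightarrow>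
   'm measure \<Rightarrow> (real \<Rightarrow> 'm \<Rightarrow> real) \<Rightarrow> bool" where
  "weak_heat_solution A L m u \<longleftrightarrow>
     (\<forall>\<phi>. spacetime_test_function A \<phi> \<longrightarrow>
        (\<forall>t>0. integrable m (\<lambda>x. deriv (\<lambda>s. \<phi> s x) t * u t x)) \<and>
        (\<forall>t>0. integrable m (dpair A L (\<phi> t) (u t))) \<and>
        set_integrable lborel {0<..} (\<lambda>t. \<integral>x. deriv (\<lambda>s. \<phi> s x) t * u t x \<partial>m) \<and>
        set_integrable lborel {0<..} (\<lambda>t. \<integral>x. dpair A L (\<phi> t) (u t) x \<partial>m) \<and>
        (LINT t:{0<..}|lborel. (\<integral>x. deriv (\<lambda>s. \<phi> s x) t * u t x \<partial>m)) =
        (LINT t:{0<..}|lborel. (\<integral>x. dpair A L (\<phi> t) (u t) x \<partial>m)))"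

end

theory Submission
  imports Defs "HOL-Library.Function_Algebras"
begin

text \<open>
  Compactness of M and the growth hypothesis on the Legendre transform give a dual Hamiltonian
  that is finite, strictly convex, superlinear and whose derivative grows at most linearly, both
  uniformly on M. Strict convexity is uniform up to a small multiple of the energy density, so
  a sequence with bounded energy and vanishing midpoint defects has differentials that are Cauchy
  in L1. This replaces weak compactness in proving that resolvents exist and that the slope
  bounds of the discrete scheme survive the passage to the limit.

  Comparing two discrete chains of different step sizes (as in Crandall and Liggett) turns the
  discrete evolution variational inequality into one for the limit curve:
  the squared distance from u(t) to z decreases at rate at least twice E(u(t)) - E(z).
  Hence u(t) has a subgradient xi(t) whose norm is the slope, u is locally Lipschitz in time, and
  testing with z = u(t) \<plusminus> \<epsilon>\<phi> identifies the right derivative of the inner product of u(t) with a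
  smooth \<phi> with both the pairing of -xi(t) with \<phi> and the negative first variation of the energy,
  the integral of -d\<phi>(\<nabla>u(t)). So -xi(t) is the density of the Laplacian, and the weak equation
  follows by integrating difference quotients in time.
\<close>

section \<open>Convex functionals and the implicit Euler scheme\<close>

text \<open>The hypothesis on the Legendre transform enters with \<epsilon> = 1 and \<beta> = 0: it
  bounds a velocity v by a multiple of 1 + |P v|, where P is the fibre derivative of the Lagrangian.
  So P is proper, hence onto by invariance of domain, and the supremum defining the Hamiltonian is
  finite; the condition \<open>L p v \<ge> tnorm g p v - C\<close> is too weak for that. The same
  bound makes d\<phi>(\<nabla>u) integrable once du is in L1, which is all the integrability of du
  that is carried along. The Lagrangian need not be twice differentiable on the zero section, so no
  quantitative convexity is available there; a compactness argument replaces it, at the price of an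
  error proportional to the energy density. In time only one-sided information exists: the
  variational inequality yields a right derivative at every t, and \<xi>(t) is chosen pointwise,
  with no measurability built in. Hence the weak equation does not come from a fundamental theorem
  of calculus. The difference quotients of (u(t), \<phi>(t)) integrate to 0 by translation
  invariance, are bounded by Lipschitz estimates, and hand their measurability to their
  limit.\<close>

text \<open>The functions in L2, not identified when equal almost everywhere, only form a space with a
  semidefinite inner product.\<close>

locale semi_hilbert =
  fixes V :: "'v::real_vector set" and ip :: "'v \<Rightarrow> 'v \<Rightarrow> real"
  assumes V_subspace: "subspace V"
    and ip_sym: "u \<in> V \<Longrightarrow> v \<in> V \<Longrightarrow> ip u v = ip v u"
    and ip_add: "u \<in> V \<Longrightarrow> v \<in> V \<Longrightarrow> w \<in> V \<Longrightarrow> ip (u + v) w = ip u w + ip v w"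
    and ip_scale: "u \<in> V \<Longrightarrow> w \<in> V \<Longrightarrow> ip (c *\<^sub>R u) w = c * ip u w"
    and ip_nonneg: "u \<in> V \<Longrightarrow> ip u u \<ge> 0"
    and V_complete: "(\<And>i. f i \<in> V) \<Longrightarrow> \<forall>e>0. \<exists>N. \<forall>i\<ge>N. \<forall>j\<ge>N. ip (f i - f j) (f i - f j) < e \<Longrightarrow>
        \<exists>l\<in>V. (\<lambda>i::nat. ip (f i - l) (f i - l)) \<longlonglongrightarrow> 0"
begin

definition nsq :: "'v \<Rightarrow> real" where "nsq u = ip u u"
definition nrm :: "'v \<Rightarrow> real" where "nrm u = sqrt (nsq u)"

lemma V_add [simp]: "u \<in> V \<Longrightarrow> v \<in> V \<Longrightarrow> u + v \<in> V"
  and V_diff [simp]: "u \<in> V \<Longrightarrow> v \<in> V \<Longrightarrow> u - v \<in> V"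
  and V_scale [simp]: "u \<in> V \<Longrightarrow> c *\<^sub>R u \<in> V"
  and V_minus [simp]: "u \<in> V \<Longrightarrow> - u \<in> V"
  using V_subspace by (auto simp: subspace_add subspace_diff subspace_scale subspace_neg)

lemma ip_add_right: "u \<in> V \<Longrightarrow> v \<in> V \<Longrightarrow> w \<in> V \<Longrightarrow> ip w (u + v) = ip w u + ip w v"
  by (metis ip_add ip_sym V_add)

lemma ip_scale_right: "u \<in> V \<Longrightarrow> w \<in> V \<Longrightarrow> ip w (c *\<^sub>R u) = c * ip w u"
  by (metis ip_scale ip_sym V_scale)

lemma ip_diff: "u \<in> V \<Longrightarrow> v \<in> V \<Longrightarrow> w \<in> V \<Longrightarrow> ip (u - v) w = ip u w - ip v w"
  using ip_add[of u "(-1) *\<^sub>R v" w] ip_scale[of v w "-1"] by simp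

lemma ip_diff_right: "u \<in> V \<Longrightarrow> v \<in> V \<Longrightarrow> w \<in> V \<Longrightarrow> ip w (u - v) = ip w u - ip w v"
  by (metis ip_diff ip_sym V_diff)

lemmas ip_simps = ip_add ip_add_right ip_scale ip_scale_right ip_diff ip_diff_right

lemma nsq_nonneg [simp]: "u \<in> V \<Longrightarrow> 0 \<le> nsq u"
  by (simp add: nsq_def ip_nonneg)

lemma nrm_nonneg [simp]: "u \<in> V \<Longrightarrow> 0 \<le> nrm u"
  by (simp add: nrm_def)

lemma nrm_sq: "u \<in> V \<Longrightarrow> (nrm u)\<^sup>2 = nsq u"
  by (simp add: nrm_def)

lemma nsq_add: "u \<in> V \<Longrightarrow> v \<in> V \<Longrightarrow> nsq (u + v) = nsq u + 2 * ip u v + nsq v"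
  by (simp add: nsq_def ip_simps ip_sym[of v u])

lemma nsq_diff: "u \<in> V \<Longrightarrow> v \<in> V \<Longrightarrow> nsq (u - v) = nsq u - 2 * ip u v + nsq v"
  by (simp add: nsq_def ip_simps ip_sym[of v u])

lemma nsq_scale: "u \<in> V \<Longrightarrow> nsq (c *\<^sub>R u) = c\<^sup>2 * nsq u"
  by (simp add: nsq_def ip_simps power2_eq_square)

lemma nsq_neg: "u \<in> V \<Longrightarrow> nsq (- u) = nsq u"
  using nsq_scale[of u "-1"] by simp

lemma nsq_zero [simp]: "nsq 0 = 0"
  using nsq_scale[of 0 0] V_subspace by (simp add: subspace_0)

lemma nrm_scale: "u \<in> V \<Longrightarrow> nrm (c *\<^sub>R u) = \<bar>c\<bar> * nrm u"
  by (simp add: nrm_def nsq_scale real_sqrt_mult)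

lemma nsq_minus_commute: "u \<in> V \<Longrightarrow> v \<in> V \<Longrightarrow> nsq (u - v) = nsq (v - u)"
  by (simp add: nsq_diff ip_sym[of v u])

lemma nrm_minus_commute: "u \<in> V \<Longrightarrow> v \<in> V \<Longrightarrow> nrm (u - v) = nrm (v - u)"
  by (simp add: nrm_def nsq_minus_commute)

text \<open>The form is only semidefinite, so the discriminant argument splits: if nsq v = 0 the
  polynomial in t degenerates to an affine function, nonnegative everywhere only when
  \<open>ip u v\<close> = 0; otherwise its value at the minimizer \<open>ip u v / nsq v\<close>
  gives the claim.\<close>

lemma Cauchy_Schwarz_sq:
  assumes "u \<in> V" "v \<in> V" shows "(ip u v)\<^sup>2 \<le> nsq u * nsq v"
proof -
  have q: "0 \<le> nsq u - 2 * t * ip u v + t\<^sup>2 * nsq v" for t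
    using nsq_nonneg[of "u - t *\<^sub>R v"] assms by (simp add: nsq_diff nsq_scale ip_simps)
  show ?thesis
  proof (cases "nsq v = 0")
    case True
    have "ip u v = 0"
    proof (rule ccontr)
      assume n: "ip u v \<noteq> 0"
      \<comment> \<open>At this t the affine function takes the value -1.\<close>
      show False using q[of "(nsq u + 1) / (2 * ip u v)"] n True by simp
    qed
    then show ?thesis using True by simp
  next
    case False
    then have p: "nsq v > 0" using nsq_nonneg[OF assms(2)] by linarith
    have "0 \<le> nsq u - (ip u v)\<^sup>2 / nsq v"
      using q[of "ip u v / nsq v"] p by (simp add: power2_eq_square field_simps)
    then show ?thesis using p by (simp add: field_simps)
  qed
qed

lemma Cauchy_Schwarz: "u \<in> V \<Longrightarrow> v \<in> V \<Longrightarrow> \<bar>ip u v\<bar> \<le> nrm u * nrm v"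
  using real_sqrt_le_mono[OF Cauchy_Schwarz_sq[of u v]] by (simp add: nrm_def real_sqrt_mult)

lemma nrm_triangle:
  assumes "u \<in> V" "v \<in> V" shows "nrm (u + v) \<le> nrm u + nrm v"
proof -
  have "nsq (u + v) \<le> (nrm u + nrm v)\<^sup>2"
    using Cauchy_Schwarz[OF assms] assms by (simp add: nsq_add power2_sum nrm_sq)
  then show ?thesis unfolding nrm_def[of "u+v"]
    using assms by (intro real_le_lsqrt) auto
qed

lemma nrm_triangle_diff: "u \<in> V \<Longrightarrow> v \<in> V \<Longrightarrow> w \<in> V \<Longrightarrow> nrm (u - w) \<le> nrm (u - v) + nrm (v - w)"
  using nrm_triangle[of "u - v" "v - w"] by simp

lemma nrm_triangle_reverse:
  assumes "u \<in> V" "v \<in> V" shows "\<bar>nrm u - nrm v\<bar> \<le> nrm (u - v)"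
  using nrm_triangle[of "u - v" v] nrm_triangle[of "v - u" u] nrm_minus_commute[of u v] assms by simp

lemma nrm_tendsto_diff:
  assumes "(\<lambda>k. nrm (v k - u)) \<longlonglongrightarrow> 0" "\<And>k. v k \<in> V" "u \<in> V" "z \<in> V"
  shows "(\<lambda>k. nrm (v k - z)) \<longlonglongrightarrow> nrm (u - z)"
proof -
  have "(\<lambda>k. nrm (v k - z) - nrm (u - z)) \<longlonglongrightarrow> 0"
  proof (rule Lim_null_comparison[OF _ assms(1)])
    show "\<forall>\<^sub>F k in sequentially. norm (nrm (v k - z) - nrm (u - z)) \<le> nrm (v k - u)"
      using nrm_triangle_reverse[of "v k - z" "u - z" for k] assms by simp
  qed
  then show ?thesis by (simp add: LIM_zero_iff)
qed

lemma nsq_tendsto_diff: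
  assumes "(\<lambda>k. nrm (v k - u)) \<longlonglongrightarrow> 0" "\<And>k. v k \<in> V" "u \<in> V" "z \<in> V"
  shows "(\<lambda>k. nsq (v k - z)) \<longlonglongrightarrow> nsq (u - z)"
  using tendsto_power[OF nrm_tendsto_diff[OF assms], of 2] assms by (simp add: nrm_sq)

lemma ip_tendsto:
  assumes "(\<lambda>k. nrm (v k - u)) \<longlonglongrightarrow> 0" "\<And>k. v k \<in> V" "u \<in> V" "z \<in> V"
  shows "(\<lambda>k. ip (v k) z) \<longlonglongrightarrow> ip u z"
proof -
  have "(\<lambda>k. ip (v k) z - ip u z) \<longlonglongrightarrow> 0"
  proof (rule Lim_null_comparison[OF _ tendsto_mult_left_zero[OF assms(1), of "nrm z"]])
    show "\<forall>\<^sub>F k in sequentially. norm (ip (v k) z - ip u z) \<le> nrm (v k - u) * nrm z"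
      using Cauchy_Schwarz[of "v k - u" z for k] assms by (simp add: ip_simps)
  qed
  then show ?thesis by (simp add: LIM_zero_iff)
qed

lemma nrm_Cauchy:
  assumes "(\<lambda>k. nrm (v k - u)) \<longlonglongrightarrow> 0" "\<And>k. v k \<in> V" "u \<in> V" "e > 0"
  shows "\<exists>N. \<forall>j\<ge>N. \<forall>k\<ge>N. nrm (v j - v k) < e"
proof -
  obtain N where N: "\<And>k. k \<ge> N \<Longrightarrow> nrm (v k - u) < e / 2"
    using LIMSEQ_D[OF assms(1), of "e/2"] assms by auto
  show ?thesis
  proof (intro exI allI impI)
    fix j k assume "j \<ge> N" "k \<ge> N"
    then show "nrm (v j - v k) < e"
      using nrm_triangle_diff[of "v j" u "v k"] nrm_minus_commute[of u "v k"] N[of j] N[of k] assms by auto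
  qed
qed

lemma complete_nrm:
  assumes "\<And>i. f i \<in> V" "\<And>e. e > 0 \<Longrightarrow> \<exists>N. \<forall>i\<ge>N. \<forall>j\<ge>N. nsq (f i - f j) < e"
  obtains l where "l \<in> V" "(\<lambda>i. nrm (f i - l)) \<longlonglongrightarrow> 0"
proof -
  obtain l where l: "l \<in> V" "(\<lambda>i. nsq (f i - l)) \<longlonglongrightarrow> 0"
    using V_complete[of f] assms unfolding nsq_def by blast
  have "(\<lambda>i. sqrt (nsq (f i - l))) \<longlonglongrightarrow> sqrt 0" using l(2) by (rule tendsto_real_sqrt)
  then show ?thesis using that l(1) unfolding nrm_def by simp
qed

end

text \<open>The last assumption is lower semicontinuity restricted to sequences with vanishing midpoint
  defects; the sequences met below (minimizing sequences and limits of the discrete scheme) are of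
  this kind.\<close>

locale energy_flow = semi_hilbert V ip for V :: "'v::real_vector set" and ip +
  fixes D :: "'v set" and E :: "'v \<Rightarrow> real"
  assumes D_V: "D \<subseteq> V"
    and D_convex: "u \<in> D \<Longrightarrow> v \<in> D \<Longrightarrow> 0 \<le> t \<Longrightarrow> t \<le> 1 \<Longrightarrow> (1 - t) *\<^sub>R u + t *\<^sub>R v \<in> D"
    and E_convex: "u \<in> D \<Longrightarrow> v \<in> D \<Longrightarrow> 0 \<le> t \<Longrightarrow> t \<le> 1 \<Longrightarrow>
        E ((1 - t) *\<^sub>R u + t *\<^sub>R v) \<le> (1 - t) * E u + t * E v"
    and E_nonneg: "u \<in> D \<Longrightarrow> 0 \<le> E u"
    and E_closed: "\<lbrakk>\<And>k::nat. w k \<in> D; \<And>k. E (w k) \<le> B; u \<in> V; (\<lambda>k. nrm (w k - u)) \<longlonglongrightarrow> 0;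
        \<forall>e>0. \<exists>N. \<forall>j\<ge>N. \<forall>k\<ge>N. (E (w j) + E (w k)) / 2 - E ((1/2) *\<^sub>R w j + (1/2) *\<^sub>R w k) < e\<rbrakk>
        \<Longrightarrow> u \<in> D \<and> E u \<le> B"
begin

lemma DV [simp]: "u \<in> D \<Longrightarrow> u \<in> V"
  using D_V by auto

lemma mid_D: "u \<in> D \<Longrightarrow> v \<in> D \<Longrightarrow> (1/2) *\<^sub>R u + (1/2) *\<^sub>R v \<in> D"
  using D_convex[of u v "1/2"] by simp

lemma mid_E: "u \<in> D \<Longrightarrow> v \<in> D \<Longrightarrow> E ((1/2) *\<^sub>R u + (1/2) *\<^sub>R v) \<le> (E u + E v) / 2"
  using E_convex[of u v "1/2"] by (simp add: field_simps)

section \<open>Subgradients and single implicit Euler steps\<close>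

definition subgrad :: "'v \<Rightarrow> 'v \<Rightarrow> bool" where
  "subgrad \<xi> u \<longleftrightarrow> \<xi> \<in> V \<and> u \<in> D \<and> (\<forall>z\<in>D. E u + ip \<xi> (z - u) \<le> E z)"

text \<open>One implicit Euler step of size \<delta> from v: u minimizes the Moreau-Yosida
  functional. This is a relation because minimizers are only determined up to vectors of norm
  zero.\<close>

definition is_min :: "real \<Rightarrow> 'v \<Rightarrow> 'v \<Rightarrow> bool" where
  "is_min \<delta> v u \<longleftrightarrow> u \<in> D \<and> (\<forall>z\<in>D. E u + nsq (u - v) / (2 * \<delta>) \<le> E z + nsq (z - v) / (2 * \<delta>))"

text \<open>The parallelogram law for a - v and b - v. The negative term is the strict convexity of
  the penalty, which makes minimizing sequences Cauchy.\<close>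

lemma mid_nsq:
  assumes "a \<in> V" "b \<in> V" "v \<in> V"
  shows "nsq ((1/2) *\<^sub>R a + (1/2) *\<^sub>R b - v) = (nsq (a - v) + nsq (b - v)) / 2 - nsq (a - b) / 4"
  using assms
  by (simp add: nsq_def ip_simps ip_sym[of b a] ip_sym[of v a] ip_sym[of v b] field_simps)

text \<open>The midpoint of two almost minimizers cannot beat the infimum, so their combined excess
  bounds both the convexity defect of E and nsq (w j - w k) / (8\<delta>). The second bound yields a
  limit by completeness; the first is exactly the condition under which \<open>E_closed\<close>
  keeps the limit in the domain.\<close>

lemma min_exists:
  assumes v: "v \<in> V" and \<delta>: "\<delta> > 0" and ne: "D \<noteq> {}"
  shows "\<exists>u. is_min \<delta> v u"
proof -
  define \<Phi> where "\<Phi> z = E z + nsq (z - v) / (2 * \<delta>)" for z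
  define I where "I = (INF z\<in>D. \<Phi> z)"
  have \<Phi>0: "0 \<le> \<Phi> z" if "z \<in> D" for z
    unfolding \<Phi>_def using E_nonneg that v \<delta> by (intro add_nonneg_nonneg) auto
  have bdd: "bdd_below (\<Phi> ` D)" using \<Phi>0 by (auto intro!: bdd_belowI[of _ 0])
  have Ile: "I \<le> \<Phi> z" if "z \<in> D" for z
    unfolding I_def using cINF_lower[OF bdd that] .
  have "\<exists>z\<in>D. \<Phi> z < I + 1 / real (Suc k)" for k
    unfolding I_def by (rule cInf_lessD[of "\<Phi> ` D", simplified]) (use ne in auto)
  then obtain w where w: "\<And>k. w k \<in> D" "\<And>k. \<Phi> (w k) < I + 1 / real (Suc k)"
    by metis
  have wV [simp]: "w k \<in> V" for k using w by auto
  have key: "((E (w j) + E (w k)) / 2 - E ((1/2) *\<^sub>R w j + (1/2) *\<^sub>R w k)) + nsq (w j - w k) / (8 * \<delta>)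
      \<le> (1 / real (Suc j) + 1 / real (Suc k)) / 2" for j k
  proof -
    have "I \<le> \<Phi> ((1/2) *\<^sub>R w j + (1/2) *\<^sub>R w k)" by (intro Ile mid_D w)
    also have "\<dots> = E ((1/2) *\<^sub>R w j + (1/2) *\<^sub>R w k) + ((nsq (w j - v) + nsq (w k - v)) / 2 - nsq (w j - w k) / 4) / (2 * \<delta>)"
      unfolding \<Phi>_def using v by (simp only: mid_nsq wV)
    finally have split: "I \<le> E ((1/2) *\<^sub>R w j + (1/2) *\<^sub>R w k) + (nsq (w j - v) / (2 * \<delta>) + nsq (w k - v) / (2 * \<delta>)) / 2 - nsq (w j - w k) / (8 * \<delta>)"
      using \<delta> by (simp add: diff_divide_distrib add_divide_distrib)
    then have "I \<le> (\<Phi> (w j) + \<Phi> (w k)) / 2 - ((E (w j) + E (w k)) / 2 - E ((1/2) *\<^sub>R w j + (1/2) *\<^sub>R w k)) - nsq (w j - w k) / (8 * \<delta>)"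
      unfolding \<Phi>_def using split by (simp add: add_divide_distrib)
    moreover have "d + p \<le> (rj + rk) / 2"
      if "i \<le> (a + b) / 2 - d - p" "a < i + rj" "b < i + rk" for a b d p i rj rk :: real
      using that by (simp add: field_simps)
    ultimately show ?thesis using w(2)[of j] w(2)[of k] by blast
  qed
  have small: "\<exists>N. \<forall>j\<ge>N. \<forall>k\<ge>N. (1 / real (Suc j) + 1 / real (Suc k)) / 2 < e" if "e > 0" for e :: real
  proof -
    obtain N where N: "1 / real (Suc N) < e" using \<open>e > 0\<close> nat_approx_posE by blast
    have "1 / real (Suc j) < e" if "j \<ge> N" for j
    proof -
      have "1 / real (Suc j) \<le> 1 / real (Suc N)" using that by (simp add: frac_le)
      then show ?thesis using N by simp
    qed
    note N' = this
    have "(1 / real (Suc j) + 1 / real (Suc k)) / 2 < e" if "j \<ge> N" "k \<ge> N" for j k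
    proof -
      have "(a + b) / 2 < e" if "a < e" "b < e" for a b :: real using that by simp
      then show ?thesis using N'[OF that(1)] N'[OF that(2)] by blast
    qed
    then show ?thesis by blast
  qed
  have dpos: "0 \<le> (E (w j) + E (w k)) / 2 - E ((1/2) *\<^sub>R w j + (1/2) *\<^sub>R w k)" for j k
    using mid_E[of "w j" "w k"] w by simp
  have C: "\<exists>N. \<forall>i\<ge>N. \<forall>j\<ge>N. nsq (w i - w j) < e" if "e > 0" for e
  proof -
    obtain N where N: "\<forall>j\<ge>N. \<forall>k\<ge>N. (1 / real (Suc j) + 1 / real (Suc k)) / 2 < e / (8 * \<delta>)"
      using small[OF divide_pos_pos[OF \<open>e > 0\<close>, of "8 * \<delta>"]] \<delta> by auto
    have "nsq (w i - w j) < e" if "i \<ge> N" "j \<ge> N" for i j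
    proof -
      have "nsq (w i - w j) / (8 * \<delta>) < e / (8 * \<delta>)"
        using key[of i j] dpos[of i j] N that by (smt (verit))
      then show ?thesis using \<delta> by (simp add: divide_less_cancel)
    qed
    then show ?thesis by blast
  qed
  obtain u where u: "u \<in> V" "(\<lambda>i. nrm (w i - u)) \<longlonglongrightarrow> 0"
    using complete_nrm[of w] C by auto
  have nn: "(\<lambda>i. nsq (w i - v)) \<longlonglongrightarrow> nsq (u - v)"
    using nsq_tendsto_diff[OF u(2)] u v by auto
  have def: "\<forall>e>0. \<exists>N. \<forall>j\<ge>N. \<forall>k\<ge>N. (E (w j) + E (w k)) / 2 - E ((1/2) *\<^sub>R w j + (1/2) *\<^sub>R w k) < e"
  proof (intro allI impI)
    fix e :: real assume "e > 0"
    then obtain N where N: "\<forall>j\<ge>N. \<forall>k\<ge>N. (1 / real (Suc j) + 1 / real (Suc k)) / 2 < e"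
      using small by blast
    show "\<exists>N. \<forall>j\<ge>N. \<forall>k\<ge>N. (E (w j) + E (w k)) / 2 - E ((1/2) *\<^sub>R w j + (1/2) *\<^sub>R w k) < e"
    proof (intro exI allI impI)
      fix j k assume "N \<le> j" "N \<le> k"
      moreover have "0 \<le> nsq (w j - w k) / (8 * \<delta>)" using \<delta> by simp
      ultimately show "(E (w j) + E (w k)) / 2 - E ((1/2) *\<^sub>R w j + (1/2) *\<^sub>R w k) < e"
        using key[of j k] N by (smt (verit))
    qed
  qed
  \<comment> \<open>\<open>E_closed\<close> accepts a single bound for the whole sequence, whereas
    the bounds here vary with k. Dropping an initial segment puts all of them below the limit plus
    \<eta>, and \<eta> is removed afterwards.\<close>
  have B: "u \<in> D \<and> E u \<le> I - nsq (u - v) / (2 * \<delta>) + \<eta>" if "\<eta> > 0" for \<eta>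
  proof -
    have "(\<lambda>k. I + 1 / real (Suc k) - nsq (w k - v) / (2 * \<delta>)) \<longlonglongrightarrow> I + 0 - nsq (u - v) / (2 * \<delta>)"
      by (intro tendsto_intros nn LIMSEQ_Suc[OF lim_1_over_n]) (use \<delta> in auto)
    then have "\<forall>\<^sub>F k in sequentially. I + 1 / real (Suc k) - nsq (w k - v) / (2 * \<delta>) < I - nsq (u - v) / (2 * \<delta>) + \<eta>"
      using that by (intro order_tendstoD) auto
    then obtain N where N: "\<And>k. k \<ge> N \<Longrightarrow> I + 1 / real (Suc k) - nsq (w k - v) / (2 * \<delta>) < I - nsq (u - v) / (2 * \<delta>) + \<eta>"
      by (auto simp: eventually_sequentially)
    show ?thesis
    proof (rule E_closed[where w="\<lambda>k. w (k + N)"])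
      show "E (w (k + N)) \<le> I - nsq (u - v) / (2 * \<delta>) + \<eta>" for k
        using N[of "k + N"] w(2)[of "k + N"] unfolding \<Phi>_def by auto
      show "(\<lambda>k. nrm (w (k + N) - u)) \<longlonglongrightarrow> 0" using u(2) by (rule LIMSEQ_ignore_initial_segment)
      show "\<forall>e>0. \<exists>Na. \<forall>j\<ge>Na. \<forall>k\<ge>Na. (E (w (j + N)) + E (w (k + N))) / 2 - E ((1 / 2) *\<^sub>R w (j + N) + (1 / 2) *\<^sub>R w (k + N)) < e"
        using def by (meson trans_le_add1)
    qed (use w u in auto)
  qed
  then have "u \<in> D" and "E u \<le> I - nsq (u - v) / (2 * \<delta>)"
    using zero_less_one field_le_epsilon by blast+
  then have "is_min \<delta> v u"
    unfolding is_min_def using Ile unfolding \<Phi>_def by force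
  then show ?thesis ..
qed

text \<open>The Euler-Lagrange inequality of the step: compare u with (1 - t) u + t z, divide by t
  and let t tend to 0. The quadratic part of the penalty contributes only
  \<open>t * B\<close>.\<close>

lemma min_subgrad:
  assumes m: "is_min \<delta> v u" and v: "v \<in> V" and \<delta>: "\<delta> > 0"
  shows "subgrad ((1/\<delta>) *\<^sub>R (v - u)) u"
  unfolding subgrad_def
proof (intro conjI ballI)
  show u: "u \<in> D" using m by (auto simp: is_min_def)
  show "(1/\<delta>) *\<^sub>R (v - u) \<in> V" using u v by auto
  fix z assume z: "z \<in> D"
  define A where "A = E u - E z - ip (u - v) (z - u) / \<delta>"
  define B where "B = nsq (z - u) / (2 * \<delta>)"
  have "A \<le> t * B" if t: "0 < t" "t \<le> 1" for t
  proof -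
    let ?w = "(1 - t) *\<^sub>R u + t *\<^sub>R z"
    have w: "?w \<in> D" using D_convex[OF u z] t by auto
    have e: "?w - v = (u - v) + t *\<^sub>R (z - u)" by (simp add: algebra_simps)
    have "E u + nsq (u - v) / (2 * \<delta>) \<le> E ?w + nsq (?w - v) / (2 * \<delta>)"
      using m w unfolding is_min_def by blast
    also have "\<dots> \<le> (1 - t) * E u + t * E z + nsq (?w - v) / (2 * \<delta>)"
      using E_convex[OF u z, of t] t by auto
    also have "nsq (?w - v) = nsq (u - v) + 2 * t * ip (u - v) (z - u) + t\<^sup>2 * nsq (z - u)"
      unfolding e using u z v by (subst nsq_add) (auto simp: ip_scale_right nsq_scale)
    finally have "t * A \<le> t * (t * B)"
      unfolding A_def B_def using \<delta> by (simp add: field_simps power2_eq_square)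
    then show ?thesis using t by simp
  qed
  note AB = this
  have "A \<le> 0"
  proof (rule tendsto_lowerbound)
    show "((\<lambda>t. t * B) \<longlongrightarrow> 0) (at_right 0)" by (auto intro!: tendsto_eq_intros)
    show "\<forall>\<^sub>F t in at_right 0. A \<le> t * B"
      unfolding eventually_at_right_field by (intro exI[of _ 1]) (use AB in auto)
  qed auto
  then show "E u + ip ((1 / \<delta>) *\<^sub>R (v - u)) (z - u) \<le> E z"
    unfolding A_def using u v z by (simp add: ip_simps diff_divide_distrib)
qed

lemma subgrad_mono:
  assumes "subgrad \<xi> u" "subgrad \<zeta> v" shows "0 \<le> ip (\<xi> - \<zeta>) (u - v)"
proof -
  have "E u + ip \<xi> (v - u) \<le> E v" "E v + ip \<zeta> (u - v) \<le> E u" "\<xi> \<in> V" "\<zeta> \<in> V" "u \<in> V" "v \<in> V"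
    using assms unfolding subgrad_def by auto
  then show ?thesis by (simp add: ip_simps)
qed

lemma subgrad_lower:
  assumes "subgrad \<xi> u" "z \<in> D" shows "E u - nrm \<xi> * nrm (z - u) \<le> E z"
proof -
  have "E u + ip \<xi> (z - u) \<le> E z" "\<xi> \<in> V" "u \<in> V" using assms unfolding subgrad_def by auto
  then show ?thesis using Cauchy_Schwarz[of \<xi> "z - u"] assms by auto
qed

section \<open>Implicit Euler chains: dissipation, variational inequality, comparison of step
  sizes\<close>

definition euler_chain :: "real \<Rightarrow> (nat \<Rightarrow> 'v) \<Rightarrow> bool" where
  "euler_chain \<delta> x \<longleftrightarrow> \<delta> > 0 \<and> x 0 \<in> D \<and> (\<forall>n. is_min \<delta> (x n) (x (Suc n)))"

text \<open>The negative discrete velocity of step n. It is a subgradient at the endpoint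
  \<open>x (Suc n)\<close>, not at \<open>x n\<close>, which accounts for the index shifts
  below.\<close>

definition eul_grad :: "real \<Rightarrow> (nat \<Rightarrow> 'v) \<Rightarrow> nat \<Rightarrow> 'v" where
  "eul_grad \<delta> x n = (1/\<delta>) *\<^sub>R (x n - x (Suc n))"

lemma chain_D: "euler_chain \<delta> x \<Longrightarrow> x n \<in> D"
  by (cases n) (auto simp: euler_chain_def is_min_def)

lemma chain_V: "euler_chain \<delta> x \<Longrightarrow> x n \<in> V"
  using chain_D by auto

lemma chain_subgrad: "euler_chain \<delta> x \<Longrightarrow> subgrad (eul_grad \<delta> x n) (x (Suc n))"
  unfolding eul_grad_def using chain_V[of \<delta> x n] by (intro min_subgrad) (auto simp: euler_chain_def)

text \<open>The discrete evolution variational inequality. With x = \<open>x n\<close> and y =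
  \<open>x (Suc n)\<close>, it is the subgradient inequality at y rewritten by 2 (x - y, z - y) = |x
  - y|^2 + |y - z|^2 - |x - z|^2, the first square being dropped.\<close>

lemma chain_evi:
  assumes c: "euler_chain \<delta> x" and z: "z \<in> D"
  shows "nsq (x (Suc n) - z) - nsq (x n - z) \<le> 2 * \<delta> * (E z - E (x (Suc n)))"
proof -
  note V = chain_V[OF c, of n] chain_V[OF c, of "Suc n"] DV[OF z]
  have \<delta>: "\<delta> > 0" using c by (auto simp: euler_chain_def)
  have "E (x (Suc n)) + ip (eul_grad \<delta> x n) (z - x (Suc n)) \<le> E z"
    using chain_subgrad[OF c] z unfolding subgrad_def by auto
  then have "ip (x n - x (Suc n)) (z - x (Suc n)) \<le> \<delta> * (E z - E (x (Suc n)))"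
    unfolding eul_grad_def using \<delta> V by (simp only: ip_scale V_diff) (simp add: field_simps)
  moreover have "2 * ip (x n - x (Suc n)) (z - x (Suc n)) = nsq (x n - x (Suc n)) + nsq (x (Suc n) - z) - nsq (x n - z)"
    using V by (simp add: nsq_def ip_simps ip_sym[of z "x n"] ip_sym[of z "x (Suc n)"] ip_sym[of "x (Suc n)" "x n"])
  moreover have "0 \<le> nsq (x n - x (Suc n))" using V by simp
  ultimately have "nsq (x (Suc n) - z) - nsq (x n - z) \<le> 2 * (\<delta> * (E z - E (x (Suc n))))" by linarith
  then show ?thesis by (simp only: mult.assoc)
qed

text \<open>The competitor is the old point \<open>x n\<close>, for which the penalty
  vanishes.\<close>

lemma chain_E_step:
  assumes c: "euler_chain \<delta> x"
  shows "E (x (Suc n)) + \<delta> / 2 * nsq (eul_grad \<delta> x n) \<le> E (x n)"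
proof -
  note V = chain_V[OF c, of n] chain_V[OF c, of "Suc n"]
  have \<delta>: "\<delta> > 0" using c by (auto simp: euler_chain_def)
  have "E (x (Suc n)) + nsq (x (Suc n) - x n) / (2 * \<delta>) \<le> E (x n) + nsq (x n - x n) / (2 * \<delta>)"
    using c chain_D[OF c] unfolding euler_chain_def is_min_def by blast
  moreover have "nsq (x n - x n) = 0" by simp
  moreover have "nsq (eul_grad \<delta> x n) = nsq (x (Suc n) - x n) / \<delta>\<^sup>2"
    unfolding eul_grad_def using V by (simp add: nsq_scale nsq_minus_commute[of "x n"] power_divide)
  ultimately show ?thesis using \<delta> by (simp add: power2_eq_square)
qed

lemma chain_E_decr: "euler_chain \<delta> x \<Longrightarrow> i \<le> n \<Longrightarrow> E (x n) \<le> E (x i)"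
proof (rule lift_Suc_antimono_le[of "\<lambda>n. E (x n)"])
  fix n assume c: "euler_chain \<delta> x"
  have "0 \<le> \<delta> / 2 * nsq (eul_grad \<delta> x n)"
    using c chain_subgrad[OF c, of n] by (auto simp: euler_chain_def subgrad_def)
  then show "E (x (Suc n)) \<le> E (x n)" using chain_E_step[OF c, of n] by simp
qed

text \<open>Two consecutive points of the chain differ by \<delta> times the new gradient b.
  Monotonicity of the subdifferential therefore reads (a - b, b) \<ge> 0 with a the old gradient, so
  |b|^2 \<le> (a, b).\<close>

lemma chain_grad_decr:
  assumes c: "euler_chain \<delta> x"
  shows "nsq (eul_grad \<delta> x (Suc n)) \<le> nsq (eul_grad \<delta> x n)"
proof -
  let ?a = "eul_grad \<delta> x n" and ?b = "eul_grad \<delta> x (Suc n)"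
  have \<delta>: "\<delta> > 0" using c by (auto simp: euler_chain_def)
  have V: "?a \<in> V" "?b \<in> V" using chain_subgrad[OF c] unfolding subgrad_def by auto
  have "0 \<le> ip (?a - ?b) (x (Suc n) - x (Suc (Suc n)))"
    using subgrad_mono[OF chain_subgrad[OF c] chain_subgrad[OF c]] .
  also have "x (Suc n) - x (Suc (Suc n)) = \<delta> *\<^sub>R ?b"
    using \<delta> by (simp add: eul_grad_def)
  finally have "0 \<le> \<delta> * ip (?a - ?b) ?b" using V by (simp add: ip_scale_right)
  then have "0 \<le> ip (?a - ?b) ?b" using \<delta> by (simp add: zero_le_mult_iff)
  then have "nsq ?b \<le> ip ?a ?b" using V by (simp add: nsq_def ip_simps)
  moreover have "0 \<le> nsq (?a - ?b)" using V by simp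
  ultimately show ?thesis using V by (simp add: nsq_diff)
qed

text \<open>E is nonnegative, so the energy lost over n + 1 steps is at most \<open>E (x 0)\<close>;
  each loss dominates \<delta>/2 times a squared gradient, and the last gradient is the
  smallest.\<close>

lemma chain_grad_bound:
  assumes c: "euler_chain \<delta> x"
  shows "real (Suc n) * \<delta> * nsq (eul_grad \<delta> x n) \<le> 2 * E (x 0)"
proof -
  have \<delta>: "\<delta> > 0" using c by (auto simp: euler_chain_def)
  have anti: "nsq (eul_grad \<delta> x n) \<le> nsq (eul_grad \<delta> x i)" if "i \<le> n" for i n
    using lift_Suc_antimono_le[of "\<lambda>n. nsq (eul_grad \<delta> x n)", OF chain_grad_decr[OF c] that] .
  have "E (x (Suc n)) + (\<Sum>i\<le>n. \<delta> / 2 * nsq (eul_grad \<delta> x i)) \<le> E (x 0)" for n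
  proof (induction n)
    case 0 then show ?case using chain_E_step[OF c, of 0] by simp
  next
    case (Suc n) then show ?case using chain_E_step[OF c, of "Suc n"] by simp
  qed
  from this[of n] have "(\<Sum>i\<le>n. \<delta> / 2 * nsq (eul_grad \<delta> x i)) \<le> E (x 0)"
    using E_nonneg[OF chain_D[OF c, of "Suc n"]] by linarith
  moreover have "(\<Sum>i\<le>n. \<delta> / 2 * nsq (eul_grad \<delta> x n)) \<le> (\<Sum>i\<le>n. \<delta> / 2 * nsq (eul_grad \<delta> x i))"
    using anti \<delta> by (intro sum_mono mult_left_mono) auto
  ultimately show ?thesis by (simp add: field_simps)
qed

text \<open>Energy decreases along the chain, so the energy in each of the n one-step inequalities
  may be replaced by the final one.\<close>

lemma chain_evi_sum:
  assumes c: "euler_chain \<delta> x" and z: "z \<in> D"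
  shows "nsq (x (i + n) - z) - nsq (x i - z) \<le> 2 * (real n * \<delta>) * (E z - E (x (i + n)))"
proof (induction n)
  case 0 then show ?case by simp
next
  case (Suc n)
  have \<delta>: "\<delta> > 0" using c by (auto simp: euler_chain_def)
  have "E (x (Suc (i + n))) \<le> E (x (i + n))" using chain_E_decr[OF c] by simp
  then have "2 * (real n * \<delta>) * (E z - E (x (i + n))) \<le> 2 * (real n * \<delta>) * (E z - E (x (Suc (i + n))))"
    using \<delta> by (intro mult_left_mono) auto
  with Suc chain_evi[OF c z, of "i + n"] show ?case by (simp add: algebra_simps)
qed

lemma chain_dist_start:
  assumes c: "euler_chain \<delta> x"
  shows "nsq (x n - x 0) \<le> 2 * E (x 0) * (real n * \<delta>)"
proof -
  have \<delta>: "\<delta> > 0" using c by (auto simp: euler_chain_def)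
  have "nsq (x 0 - x 0) = 0" by simp
  moreover have "0 \<le> 2 * (real n * \<delta>) * E (x n)" using E_nonneg chain_D[OF c] \<delta> by simp
  ultimately show ?thesis
    using chain_evi_sum[OF c chain_D[OF c, of 0], of 0 n] by (simp add: algebra_simps)
qed

text \<open>With a the difference of the two new points, the two mixed differences are a - \<mu>
  \<zeta> and a + \<sigma> \<xi>. In the weighted sum of their squares the cross terms add up to 2
  \<sigma> \<mu> (a, \<xi> - \<zeta>), which is nonnegative by monotonicity.\<close>

lemma chain_compare_step:
  assumes x: "euler_chain \<sigma> x" and y: "euler_chain \<mu> y"
  shows "(\<sigma> + \<mu>) * nsq (x (Suc n) - y (Suc m)) \<le> \<sigma> * nsq (x (Suc n) - y m) + \<mu> * nsq (x n - y (Suc m))"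
proof -
  have pos: "\<sigma> > 0" "\<mu> > 0" using x y by (auto simp: euler_chain_def)
  define a where "a = x (Suc n) - y (Suc m)"
  define \<xi> where "\<xi> = eul_grad \<sigma> x n"
  define \<zeta> where "\<zeta> = eul_grad \<mu> y m"
  have V: "a \<in> V" "\<xi> \<in> V" "\<zeta> \<in> V" using chain_subgrad[OF x] chain_subgrad[OF y] chain_V[OF x] chain_V[OF y]
    unfolding a_def \<xi>_def \<zeta>_def subgrad_def by auto
  have 1: "x (Suc n) - y m = a - \<mu> *\<^sub>R \<zeta>" "x n - y (Suc m) = a + \<sigma> *\<^sub>R \<xi>"
    using pos by (auto simp: a_def \<xi>_def \<zeta>_def eul_grad_def)
  have "0 \<le> ip (\<xi> - \<zeta>) a"
    unfolding a_def \<xi>_def \<zeta>_def by (rule subgrad_mono[OF chain_subgrad[OF x] chain_subgrad[OF y]])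
  then have "ip a \<zeta> \<le> ip a \<xi>" using V by (simp add: ip_diff ip_sym[of a \<xi>] ip_sym[of a \<zeta>])
  then have "0 \<le> 2 * \<sigma> * \<mu> * (ip a \<xi> - ip a \<zeta>)" using pos by simp
  moreover have "0 \<le> \<sigma> * (\<mu>\<^sup>2 * nsq \<zeta>)" "0 \<le> \<mu> * (\<sigma>\<^sup>2 * nsq \<xi>)" using pos V by auto
  ultimately show ?thesis unfolding 1 a_def[symmetric] using V
    by (simp add: nsq_add nsq_diff nsq_scale ip_scale_right algebra_simps)
qed

text \<open>The natural bound is a multiple of the square root of the numerator on the right, as in Crandall
  and Liggett's estimate. It is linearized by AM-GM with a parameter \<open>\<epsilon>\<close> so that it is
  preserved by the linear recursion of the previous lemma.\<close>

lemma chain_compare: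
  assumes x: "euler_chain \<sigma> x" and y: "euler_chain \<mu> y" and xy: "x 0 = y 0" and e: "\<epsilon> > 0"
  shows "nsq (x n - y m) \<le> 2 * E (x 0) * (\<epsilon> / 2 +
     ((real n * \<sigma> - real m * \<mu>)\<^sup>2 + real n * \<sigma>\<^sup>2 + real m * \<mu>\<^sup>2) / (2 * \<epsilon>))" (is "_ \<le> _ * ?F n m")
proof -
  have pos: "\<sigma> > 0" "\<mu> > 0" using x y by (auto simp: euler_chain_def)
  have E0: "0 \<le> 2 * E (x 0)" using E_nonneg chain_D[OF x] by simp
  have amgm: "a \<le> \<epsilon> / 2 + (a\<^sup>2 + b) / (2 * \<epsilon>)" if "b \<ge> 0" for a b :: real
  proof -
    have "0 \<le> (\<epsilon> - a)\<^sup>2 + b" using that by simp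
    then show ?thesis using e by (simp add: field_simps power2_eq_square)
  qed
  have lin: "s * (c * f) + r * (c * g) = c * (s * f + r * g)" for s c f r g :: real
    by (simp add: algebra_simps)
  have lin2: "s * (h + p / c) + r * (h + q / c) = (s + r) * (h + d / c)"
    if "s * p + r * q = (s + r) * d" for s r h p q d c :: real
  proof -
    have "s * (h + p / c) + r * (h + q / c) = (s + r) * h + (s * p + r * q) / c"
      by (simp add: algebra_simps add_divide_distrib)
    then show ?thesis unfolding that by (simp add: algebra_simps)
  qed
  show ?thesis
  proof (induction n arbitrary: m)
    case 0
    \<comment> \<open>On the axes the squared distance to the start grows linearly in time; AM-GM
      with a = m \<mu> puts this linear bound below \<open>?F 0 m\<close>.\<close>
    have "nsq (x 0 - y m) \<le> 2 * E (x 0) * (real m * \<mu>)"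
      using chain_dist_start[OF y, of m] xy chain_V[OF y] by (simp add: nsq_minus_commute[of "y m"])
    also have "\<dots> \<le> 2 * E (x 0) * ?F 0 m"
      using amgm[of "real m * \<mu>\<^sup>2" "real m * \<mu>"] E0 by (intro mult_left_mono) auto
    finally show ?case .
  next
    case (Suc n)
    note IHn = this
    show ?case
    proof (induction m)
      case 0
      have "nsq (x (Suc n) - y 0) \<le> 2 * E (x 0) * (real (Suc n) * \<sigma>)"
        using chain_dist_start[OF x, of "Suc n"] xy by simp
      also have "\<dots> \<le> 2 * E (x 0) * ?F (Suc n) 0"
        using amgm[of "real (Suc n) * \<sigma>\<^sup>2" "real (Suc n) * \<sigma>"] E0 by (intro mult_left_mono) auto
      finally show ?case .
    next
      case (Suc m)
      have "(\<sigma> + \<mu>) * nsq (x (Suc n) - y (Suc m)) \<le> \<sigma> * nsq (x (Suc n) - y m) + \<mu> * nsq (x n - y (Suc m))"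
        by (rule chain_compare_step[OF x y])
      also have "\<dots> \<le> \<sigma> * (2 * E (x 0) * ?F (Suc n) m) + \<mu> * (2 * E (x 0) * ?F n (Suc m))"
        using Suc IHn[of "Suc m"] pos by (intro add_mono mult_left_mono) auto
      also have "\<dots> = 2 * E (x 0) * (\<sigma> * ?F (Suc n) m + \<mu> * ?F n (Suc m))" by (rule lin)
      \<comment> \<open>The numerator of \<open>?F\<close> solves the recursion with equality: the
        cross terms from lowering m and from lowering n cancel, and the remainder \<sigma> \<mu>^2 +
        \<mu> \<sigma>^2 is absorbed by the summands linear in n and m.\<close>
      also have "\<sigma> * ?F (Suc n) m + \<mu> * ?F n (Suc m) = (\<sigma> + \<mu>) * ?F (Suc n) (Suc m)"
        by (rule lin2) (simp add: algebra_simps power2_eq_square)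
      also have "2 * E (x 0) * ((\<sigma> + \<mu>) * ?F (Suc n) (Suc m)) = (\<sigma> + \<mu>) * (2 * E (x 0) * ?F (Suc n) (Suc m))"
        by (rule mult.left_commute)
      finally have "(\<sigma> + \<mu>) * nsq (x (Suc n) - y (Suc m)) \<le> (\<sigma> + \<mu>) * (2 * E (x 0) * ?F (Suc n) (Suc m))" .
      then show ?case using pos by (simp only: mult_le_cancel_left_pos add_pos_pos)
    qed
  qed
qed

text \<open>The uniform slope bound makes the midpoint defects tend to zero.\<close>

lemma slope_bound_limit:
  assumes v: "\<And>k. v k \<in> D" and u: "u \<in> V" and lim: "(\<lambda>k. nrm (v k - u)) \<longlonglongrightarrow> 0"
    and S: "S \<ge> 0" "\<And>k z. z \<in> D \<Longrightarrow> E (v k) - S * nrm (z - v k) \<le> E z"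
  shows "u \<in> D" "(\<lambda>k. E (v k)) \<longlonglongrightarrow> E u" "z \<in> D \<Longrightarrow> E u - S * nrm (z - u) \<le> E z"
proof -
  have vV [simp]: "v k \<in> V" for k using v by simp
  have d: "E (v j) - E (v k) \<le> S * nrm (v j - v k)" for j k
    using S(2)[OF v, of j k] nrm_minus_commute[of "v j" "v k"] by simp
  have cau: "\<exists>N. \<forall>j\<ge>N. \<forall>k\<ge>N. S * nrm (v j - v k) < e" if e: "e > 0" for e
  proof -
    have "e / (S + 1) > 0" using S(1) e by simp
    then obtain N where N: "\<forall>j\<ge>N. \<forall>k\<ge>N. nrm (v j - v k) < e / (S + 1)"
      using nrm_Cauchy[OF lim vV u] by blast
    have "S * nrm (v j - v k) < e" if jk: "j \<ge> N" "k \<ge> N" for j k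
    proof -
      have "S * nrm (v j - v k) \<le> (S + 1) * nrm (v j - v k)" by (simp add: algebra_simps)
      also have "\<dots> < e" using N jk S(1) by (simp add: field_simps)
      finally show ?thesis .
    qed
    then show ?thesis by blast
  qed
  have "Cauchy (\<lambda>k. E (v k))"
  proof (rule CauchyI)
    fix e :: real assume "e > 0"
    then obtain N where N: "\<forall>j\<ge>N. \<forall>k\<ge>N. S * nrm (v j - v k) < e" using cau by blast
    have "norm (E (v j) - E (v k)) < e" if "j \<ge> N" "k \<ge> N" for j k
    proof -
      have "S * nrm (v j - v k) < e" "S * nrm (v k - v j) < e" using N that by blast+
      then show ?thesis using d[of j k] d[of k j] by (simp add: abs_if)
    qed
    then show "\<exists>M. \<forall>m\<ge>M. \<forall>n\<ge>M. norm (E (v m) - E (v n)) < e" by blast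
  qed
  then obtain e where e: "(\<lambda>k. E (v k)) \<longlonglongrightarrow> e" using Cauchy_convergent convergent_def by blast
  have half: "(1/2) *\<^sub>R a + (1/2) *\<^sub>R b - a = (1/2) *\<^sub>R b - (1/2) *\<^sub>R a" "(1/2) *\<^sub>R b + (1/2) *\<^sub>R a - a = (1/2) *\<^sub>R b - (1/2) *\<^sub>R a" for a b :: 'v
  proof -
    have a: "a = (1/2) *\<^sub>R a + (1/2) *\<^sub>R a" by (simp flip: scaleR_left_distrib)
    have "x + y - (x + x) = y - x" "y + x - (x + x) = y - x" for x y :: 'v by simp_all
    from this[of "(1/2) *\<^sub>R a" "(1/2) *\<^sub>R b", folded a]
    show "(1/2) *\<^sub>R a + (1/2) *\<^sub>R b - a = (1/2) *\<^sub>R b - (1/2) *\<^sub>R a" "(1/2) *\<^sub>R b + (1/2) *\<^sub>R a - a = (1/2) *\<^sub>R b - (1/2) *\<^sub>R a"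
      by auto
  qed
  have def: "\<forall>e>0. \<exists>N. \<forall>j\<ge>N. \<forall>k\<ge>N. (E (v j) + E (v k)) / 2 - E ((1/2) *\<^sub>R v j + (1/2) *\<^sub>R v k) < e"
  proof (intro allI impI)
    fix e :: real assume "e > 0"
    then obtain N where N: "\<forall>j\<ge>N. \<forall>k\<ge>N. S * nrm (v j - v k) < e" using cau by blast
    \<comment> \<open>The midpoint lies at half the distance from either end, so the two slope
      inequalities tested with it bound the defect.\<close>
    have "(E (v j) + E (v k)) / 2 - E ((1/2) *\<^sub>R v j + (1/2) *\<^sub>R v k) \<le> S * nrm (v j - v k)" for j k
    proof -
      let ?m = "(1/2) *\<^sub>R v j + (1/2) *\<^sub>R v k"
      have m: "?m - v j = (1/2) *\<^sub>R (v k - v j)" "?m - v k = (1/2) *\<^sub>R (v j - v k)"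
        using half by (auto simp: scaleR_diff_right)
      have "E (v j) - S * nrm (?m - v j) \<le> E ?m" "E (v k) - S * nrm (?m - v k) \<le> E ?m"
        using S(2)[OF mid_D[OF v v]] by auto
      moreover have "nrm (?m - v j) = nrm (v j - v k) / 2" "nrm (?m - v k) = nrm (v j - v k) / 2"
        unfolding m by (auto simp: nrm_scale nrm_minus_commute[of "v k"])
      moreover have "0 \<le> S * nrm (v j - v k)" using S(1) by simp
      moreover have "(a + b) / 2 - c \<le> S * r" if "a - S * x \<le> c" "b - S * y \<le> c" "x = r / 2" "y = r / 2" "0 \<le> S * r"
        for a b c x y r using that by (simp add: field_simps)
      ultimately show ?thesis by blast
    qed
    then show "\<exists>N. \<forall>j\<ge>N. \<forall>k\<ge>N. (E (v j) + E (v k)) / 2 - E ((1/2) *\<^sub>R v j + (1/2) *\<^sub>R v k) < e"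
      using N by (meson le_less_trans)
  qed
  have B: "u \<in> D \<and> E u \<le> e + \<eta>" if "\<eta> > 0" for \<eta>
  proof -
    have "\<forall>\<^sub>F k in sequentially. E (v k) < e + \<eta>"
      using e that by (intro order_tendstoD) auto
    then obtain N where N: "\<And>k. k \<ge> N \<Longrightarrow> E (v k) < e + \<eta>" by (auto simp: eventually_sequentially)
    show ?thesis
    proof (rule E_closed[where w="\<lambda>k. v (k + N)"])
      show "E (v (k + N)) \<le> e + \<eta>" for k using N[of "k + N"] by auto
      show "(\<lambda>k. nrm (v (k + N) - u)) \<longlonglongrightarrow> 0" using lim by (rule LIMSEQ_ignore_initial_segment)
      show "\<forall>e>0. \<exists>Na. \<forall>j\<ge>Na. \<forall>k\<ge>Na. (E (v (j + N)) + E (v (k + N))) / 2 - E ((1 / 2) *\<^sub>R v (j + N) + (1 / 2) *\<^sub>R v (k + N)) < e"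
        using def by (meson trans_le_add1)
    qed (use v u in auto)
  qed
  then show uD: "u \<in> D" using zero_less_one by blast
  have Eu: "E u \<le> e" using B field_le_epsilon by blast
  \<comment> \<open>Closedness gave E u \<le> e. The reverse inequality is the slope inequality at
    \<open>v k\<close> tested with u itself, which is now known to lie in D.\<close>
  have "(\<lambda>k. E (v k) - S * nrm (v k - u)) \<longlonglongrightarrow> e - S * 0" by (intro tendsto_intros e lim)
  moreover have "E (v k) - S * nrm (v k - u) \<le> E u" for k
    using S(2)[OF uD, of k] nrm_minus_commute[of u "v k"] u by simp
  ultimately have "e \<le> E u" by (intro LIMSEQ_le_const2) auto
  then have eq: "e = E u" using Eu by simp
  then show "(\<lambda>k. E (v k)) \<longlonglongrightarrow> E u" using e by simp
  show "E u - S * nrm (z - u) \<le> E z" if z: "z \<in> D"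
  proof (rule LIMSEQ_le_const2)
    have zV: "z \<in> V" using z by simp
    have "(\<lambda>k. E (v k) - S * nrm (v k - z)) \<longlonglongrightarrow> E u - S * nrm (u - z)"
      using e unfolding eq by (intro tendsto_intros nrm_tendsto_diff lim vV u zV)
    then show "(\<lambda>k. E (v k) - S * nrm (v k - z)) \<longlonglongrightarrow> E u - S * nrm (z - u)"
      unfolding nrm_minus_commute[OF zV u] .
    show "\<exists>N. \<forall>n\<ge>N. E (v n) - S * nrm (v n - z) \<le> E z"
      using S(2)[OF z] unfolding nrm_minus_commute[OF zV vV] by blast
  qed
qed

section \<open>Limits of Euler chains\<close>

definition resolvent_map :: "(real \<Rightarrow> 'v \<Rightarrow> 'v) \<Rightarrow> bool" where
  "resolvent_map J \<longleftrightarrow> (\<forall>\<delta>>0. \<forall>v\<in>D. is_min \<delta> v (J \<delta> v))"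

lemma resolvent_chain:
  assumes "resolvent_map J" "\<delta> > 0" "x0 \<in> D"
  shows "euler_chain \<delta> (\<lambda>n. (J \<delta> ^^ n) x0)"
proof -
  have D: "(J \<delta> ^^ n) x0 \<in> D" for n
    by (induction n) (use assms in \<open>auto simp: resolvent_map_def is_min_def\<close>)
  show ?thesis unfolding euler_chain_def
    using assms D by (auto simp: resolvent_map_def)
qed

text \<open>The slope bound at time t comes from n steps of size \<open>\<delta> = t / n\<close>: the slopes decrease along a
  chain, and the sum of \<open>\<delta> / 2\<close> times their squares is at most the initial energy.\<close>

definition evi_curve :: "'v \<Rightarrow> (real \<Rightarrow> 'v) \<Rightarrow> bool" where
  "evi_curve x0 u \<longleftrightarrow> (\<forall>t>0. u t \<in> D \<and>
     (\<forall>z\<in>D. E (u t) - sqrt (2 * E x0 / t) * nrm (z - u t) \<le> E z)) \<and>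
     (\<forall>s t z. 0 < s \<longrightarrow> s < t \<longrightarrow> z \<in> D \<longrightarrow> nsq (u t - z) - nsq (u s - z) \<le> 2 * (t - s) * (E z - E (u t)))"

lemma evi_curve_D: "evi_curve x0 u \<Longrightarrow> t > 0 \<Longrightarrow> u t \<in> D"
  and evi_curve_slope: "evi_curve x0 u \<Longrightarrow> t > 0 \<Longrightarrow> z \<in> D \<Longrightarrow> E (u t) - sqrt (2 * E x0 / t) * nrm (z - u t) \<le> E z"
  and evi_curve_evi: "evi_curve x0 u \<Longrightarrow> 0 < s \<Longrightarrow> s < t \<Longrightarrow> z \<in> D \<Longrightarrow>
    nsq (u t - z) - nsq (u s - z) \<le> 2 * (t - s) * (E z - E (u t))"
  by (auto simp: evi_curve_def)

lemma euler_limit_slope: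
  assumes J: "resolvent_map J" and x0: "x0 \<in> D" and t: "t > 0" and u: "u \<in> V"
    and lim: "(\<lambda>k. nrm ((J (t / real k) ^^ k) x0 - u)) \<longlonglongrightarrow> 0"
  shows "u \<in> D" "(\<lambda>k. E ((J (t / real k) ^^ k) x0)) \<longlonglongrightarrow> E u"
    "z \<in> D \<Longrightarrow> E u - sqrt (2 * E x0 / t) * nrm (z - u) \<le> E z"
proof -
  define S where "S = sqrt (2 * E x0 / t)"
  have S0: "S \<ge> 0" unfolding S_def using E_nonneg[OF x0] t by simp
  \<comment> \<open>Shifted by one so that the step size t / (k + 1) is positive for every k; the
    conclusion is moved back to the unshifted sequence at the end.\<close>
  define v where "v k = (J (t / real (Suc k)) ^^ Suc k) x0" for k
  have ch: "euler_chain (t / real (Suc k)) (\<lambda>n. (J (t / real (Suc k)) ^^ n) x0)" for k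
    using resolvent_chain[OF J _ x0] t by simp
  have vD: "v k \<in> D" for k unfolding v_def using chain_D[OF ch] .
  have vl: "(\<lambda>k. nrm (v k - u)) \<longlonglongrightarrow> 0" unfolding v_def using lim by (rule LIMSEQ_Suc)
  have sl: "E (v k) - S * nrm (z - v k) \<le> E z" if z: "z \<in> D" for k z
  proof -
    let ?\<xi> = "eul_grad (t / real (Suc k)) (\<lambda>n. (J (t / real (Suc k)) ^^ n) x0) k"
    have sg: "subgrad ?\<xi> (v k)" unfolding v_def using chain_subgrad[OF ch] .
    have "real (Suc k) * (t / real (Suc k)) * nsq ?\<xi> \<le> 2 * E x0"
      using chain_grad_bound[OF ch, of k k] by simp
    then have "t * nsq ?\<xi> \<le> 2 * E x0" by simp
    then have "nsq ?\<xi> \<le> 2 * E x0 / t" using t by (simp add: field_simps)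
    then have "nrm ?\<xi> \<le> S" unfolding nrm_def S_def by (rule real_sqrt_le_mono)
    then have "nrm ?\<xi> * nrm (z - v k) \<le> S * nrm (z - v k)"
      using z vD by (intro mult_right_mono) auto
    then show ?thesis using subgrad_lower[OF sg z] by simp
  qed
  note L = slope_bound_limit[of v u S, OF vD u vl S0 sl]
  show "u \<in> D" by (rule L(1))
  show "(\<lambda>k. E ((J (t / real k) ^^ k) x0)) \<longlonglongrightarrow> E u"
    using L(2) unfolding v_def by (rule LIMSEQ_imp_Suc)
  show "z \<in> D \<Longrightarrow> E u - sqrt (2 * E x0 / t) * nrm (z - u) \<le> E z"
    using L(3) unfolding S_def .
qed

text \<open>The points u s and u t are limits of chains with different step sizes, s / k and t / k,
  so the summed inequality of one chain does not relate them directly. The t-chain is stopped at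
  index i = floor (k s / t), that is at time about s, and \<open>chain_compare\<close> shows that it
  is then close to the k-th point of the s-chain. The inequality between the indices i and k of the
  t-chain passes to the limit.\<close>

lemma euler_limit_evi:
  assumes J: "resolvent_map J" and x0: "x0 \<in> D"
    and u: "\<And>t. t > 0 \<Longrightarrow> u t \<in> V"
    and lim: "\<And>t. t > 0 \<Longrightarrow> (\<lambda>k. nrm ((J (t / real k) ^^ k) x0 - u t)) \<longlonglongrightarrow> 0"
    and st: "0 < s" "s < t" and z: "z \<in> D"
  shows "nsq (u t - z) - nsq (u s - z) \<le> 2 * (t - s) * (E z - E (u t))"
proof -
  have t: "t > 0" using st by simp
  define i where "i k = nat \<lfloor>real k * s / t\<rfloor>" for k
  define x where "x k n = (J (t / real k) ^^ n) x0" for k n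
  define y where "y k n = (J (s / real k) ^^ n) x0" for k n
  have cx: "euler_chain (t / real k) (x k)" if "k > 0" for k
    unfolding x_def using resolvent_chain[OF J _ x0] t that by simp
  have cy: "euler_chain (s / real k) (y k)" if "k > 0" for k
    unfolding y_def using resolvent_chain[OF J _ x0] st that by simp
  have i1: "real (i k) \<le> real k * s / t" "real k * s / t - 1 < real (i k)" for k
  proof -
    have "0 \<le> real k * s / t" using st by simp
    then show "real (i k) \<le> real k * s / t" "real k * s / t - 1 < real (i k)" unfolding i_def by linarith+
  qed
  have ilim: "(\<lambda>k. real (i k) * (t / real k)) \<longlonglongrightarrow> s"
  proof (rule tendsto_sandwich)
    have "s - t / real k \<le> real (i k) * (t / real k)" "real (i k) * (t / real k) \<le> s" if "k > 0" for k
    proof -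
      have "(real k * s / t - 1) * (t / real k) \<le> real (i k) * (t / real k)"
        using i1[of k] t by (intro mult_right_mono) auto
      moreover have "(real k * s / t - 1) * (t / real k) = s - t / real k"
        using that t by (simp add: field_simps)
      ultimately show "s - t / real k \<le> real (i k) * (t / real k)" by simp
      have "real (i k) * (t / real k) \<le> real k * s / t * (t / real k)"
        using i1[of k] t by (intro mult_right_mono) auto
      then show "real (i k) * (t / real k) \<le> s" using that t by (simp add: field_simps)
    qed
    then show "\<forall>\<^sub>F k in sequentially. s - t / real k \<le> real (i k) * (t / real k)"
      "\<forall>\<^sub>F k in sequentially. real (i k) * (t / real k) \<le> s"
      by (auto intro!: eventually_sequentiallyI[of 1])
    show "(\<lambda>k. s - t / real k) \<longlonglongrightarrow> s"
      using tendsto_diff[OF tendsto_const[of s] lim_const_over_n[of t]] by simp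
  qed auto
  have ik: "i k \<le> k" for k
  proof -
    have "real k * s / t \<le> real k" using st mult_left_mono[of s t "real k"] by (simp add: field_simps)
    then show ?thesis using i1[of k] by linarith
  qed
  \<comment> \<open>The numerator of the bound in \<open>chain_compare\<close> at the indices i k
    and k: the squared mismatch of the elapsed times, plus two terms of order 1 / k.\<close>
  define Dk where "Dk k = (real (i k) * (t / real k) - real k * (s / real k))\<^sup>2 + real (i k) * (t / real k)\<^sup>2 + real k * (s / real k)\<^sup>2" for k
  have Dlim: "Dk \<longlonglongrightarrow> 0"
  proof -
    have "(\<lambda>k. (real (i k) * (t / real k) - s)\<^sup>2 + (real (i k) * (t / real k)) * (t / real k) + s * (s / real k))
        \<longlonglongrightarrow> (s - s)\<^sup>2 + s * 0 + s * 0"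
      by (intro tendsto_intros ilim lim_const_over_n)
    then have "(\<lambda>k. (real (i k) * (t / real k) - s)\<^sup>2 + (real (i k) * (t / real k)) * (t / real k) + s * (s / real k)) \<longlonglongrightarrow> 0"
      by simp
    moreover have "\<forall>\<^sub>F k in sequentially. (real (i k) * (t / real k) - s)\<^sup>2 + (real (i k) * (t / real k)) * (t / real k) + s * (s / real k) = Dk k"
      unfolding Dk_def by (rule eventually_sequentiallyI[of 1]) (simp add: power2_eq_square)
    ultimately show ?thesis by (rule Lim_transform_eventually)
  qed
  have cmp: "nsq (x k (i k) - y k k) \<le> 2 * E x0 * (\<epsilon> / 2 + Dk k / (2 * \<epsilon>))" if "k > 0" "\<epsilon> > 0" for k \<epsilon>
    using chain_compare[OF cx cy _ that(2), of k k "i k" k] that unfolding Dk_def by (simp add: x_def y_def)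
  have xV: "x k n \<in> V" if "k > 0" for k n using chain_V[OF cx[OF that]] .
  have yV: "y k n \<in> V" if "k > 0" for k n using chain_V[OF cy[OF that]] .
  have E0: "0 \<le> E x0" using E_nonneg[OF x0] .
  have sqlim: "(\<lambda>k. nsq (x k (i k) - y k k)) \<longlonglongrightarrow> 0"
  proof (rule LIMSEQ_I)
    fix r :: real assume r: "r > 0"
    \<comment> \<open>Then 2 E(x0) (\<epsilon> / 2) = r E(x0) / (E(x0) + 1) < r, and for this fixed
      \<epsilon> the term with Dk tends to 0.\<close>
    define \<epsilon> where "\<epsilon> = r / (E x0 + 1)"
    have \<epsilon>: "\<epsilon> > 0" unfolding \<epsilon>_def using r E0 by simp
    have "(\<lambda>k. 2 * E x0 * (\<epsilon> / 2 + Dk k / (2 * \<epsilon>))) \<longlonglongrightarrow> 2 * E x0 * (\<epsilon> / 2 + 0 / (2 * \<epsilon>))"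
      by (intro tendsto_intros Dlim) (use \<epsilon> in auto)
    moreover have "2 * E x0 * (\<epsilon> / 2 + 0 / (2 * \<epsilon>)) < r"
      unfolding \<epsilon>_def using r E0 by (simp add: field_simps)
    ultimately have "\<forall>\<^sub>F k in sequentially. 2 * E x0 * (\<epsilon> / 2 + Dk k / (2 * \<epsilon>)) < r"
      by (rule order_tendstoD)
    then have "\<forall>\<^sub>F k in sequentially. norm (nsq (x k (i k) - y k k) - 0) < r"
      using eventually_gt_at_top[of 0]
    proof eventually_elim
      case (elim k)
      have "0 \<le> nsq (x k (i k) - y k k)" using xV yV elim by simp
      then show ?case using cmp[OF _ \<epsilon>, of k] elim by simp
    qed
    then show "\<exists>no. \<forall>n\<ge>no. norm (nsq (x n (i n) - y n n) - 0) < r"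
      by (simp add: eventually_sequentially)
  qed
  have wlim: "(\<lambda>k. nrm (x k (i k) - u s)) \<longlonglongrightarrow> 0"
  proof (rule Lim_null_comparison)
    show "\<forall>\<^sub>F k in sequentially. norm (nrm (x k (i k) - u s)) \<le> nrm (x k (i k) - y k k) + nrm (y k k - u s)"
      using xV yV u[OF st(1)] nrm_triangle_diff
      by (intro eventually_sequentiallyI[of 1]) auto
    have "(\<lambda>k. nrm (x k (i k) - y k k)) \<longlonglongrightarrow> 0"
      using tendsto_real_sqrt[OF sqlim] unfolding nrm_def by simp
    from tendsto_add[OF this lim[OF st(1)]]
    show "(\<lambda>k. nrm (x k (i k) - y k k) + nrm (y k k - u s)) \<longlonglongrightarrow> 0" by (simp add: y_def)
  qed
  have zV: "z \<in> V" using z by simp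
  have A: "(\<lambda>k. nsq (x (Suc k) (i (Suc k)) - z)) \<longlonglongrightarrow> nsq (u s - z)"
    by (rule nsq_tendsto_diff[OF LIMSEQ_Suc[OF wlim] _ u[OF st(1)] zV]) (simp add: xV)
  have B: "(\<lambda>k. nsq (x (Suc k) (Suc k) - z)) \<longlonglongrightarrow> nsq (u t - z)"
  proof (rule nsq_tendsto_diff[OF _ _ u[OF t] zV])
    show "(\<lambda>k. nrm (x (Suc k) (Suc k) - u t)) \<longlonglongrightarrow> 0"
      using LIMSEQ_Suc[OF lim[OF t]] unfolding x_def .
  qed (rule xV, simp)
  have C: "(\<lambda>k. E (x (Suc k) (Suc k))) \<longlonglongrightarrow> E (u t)"
    using LIMSEQ_Suc[OF euler_limit_slope(2)[OF J x0 t u[OF t] lim[OF t]]] unfolding x_def .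
  have F: "(\<lambda>k. real (Suc k - i (Suc k)) * (t / real (Suc k))) \<longlonglongrightarrow> t - s"
  proof -
    have "real (Suc k - i (Suc k)) * (t / real (Suc k)) = t - real (i (Suc k)) * (t / real (Suc k))" for k
      using ik[of "Suc k"] by (simp add: of_nat_diff field_simps)
    then show ?thesis using tendsto_diff[OF tendsto_const[of t] LIMSEQ_Suc[OF ilim]] by simp
  qed
  show ?thesis
  proof (rule LIMSEQ_le)
    show "(\<lambda>k. nsq (x (Suc k) (Suc k) - z) - nsq (x (Suc k) (i (Suc k)) - z)) \<longlonglongrightarrow> nsq (u t - z) - nsq (u s - z)"
      by (intro tendsto_intros A B)
    show "(\<lambda>k. 2 * (real (Suc k - i (Suc k)) * (t / real (Suc k))) * (E z - E (x (Suc k) (Suc k)))) \<longlonglongrightarrow> 2 * (t - s) * (E z - E (u t))"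
      by (intro tendsto_intros F C)
    show "\<exists>N. \<forall>k\<ge>N. nsq (x (Suc k) (Suc k) - z) - nsq (x (Suc k) (i (Suc k)) - z)
        \<le> 2 * (real (Suc k - i (Suc k)) * (t / real (Suc k))) * (E z - E (x (Suc k) (Suc k)))"
      using chain_evi_sum[OF cx z, of "Suc k" "i (Suc k)" "Suc k - i (Suc k)" for k] ik by simp
  qed
qed

lemma euler_limit_evi_curve:
  assumes "resolvent_map J" "x0 \<in> D" "\<And>t. t > 0 \<Longrightarrow> u t \<in> V"
    and "\<And>t. t > 0 \<Longrightarrow> (\<lambda>k. nrm ((J (t / real k) ^^ k) x0 - u t)) \<longlonglongrightarrow> 0"
  shows "evi_curve x0 u"
  unfolding evi_curve_def
  using euler_limit_slope(1,3)[OF assms(1,2)] euler_limit_evi[OF assms(1,2,3,4)] assms(3,4) by blast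

section \<open>Subgradients from slope bounds, and the right derivative in time\<close>

lemma slope_bound_subgrad:
  assumes u: "u \<in> D" and S: "S \<ge> 0" "\<And>z. z \<in> D \<Longrightarrow> E u - S * nrm (z - u) \<le> E z"
  obtains \<xi> where "subgrad \<xi> u" "nrm \<xi> \<le> S"
proof -
  \<comment> \<open>Yosida approximation: w n is a resolvent of u with step size la n, and \<xi> n
    the resulting subgradient at w n. Monotonicity makes \<xi> n converge strongly, so completeness
    does the work of weak compactness.\<close>
  define la where "la n = 1 / real (Suc n)" for n
  have la0: "la n > 0" for n by (simp add: la_def)
  have uV: "u \<in> V" using u by simp
  obtain w where w: "\<And>n. is_min (la n) u (w n)"
    using min_exists[OF uV la0] u by (metis empty_iff)
  define \<xi> where "\<xi> n = (1 / la n) *\<^sub>R (u - w n)" for n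
  have sg: "subgrad (\<xi> n) (w n)" for n
    unfolding \<xi>_def by (rule min_subgrad[OF w uV la0])
  have wD: "w n \<in> D" and \<xi>V: "\<xi> n \<in> V" for n using sg[of n] by (auto simp: subgrad_def)
  have uw: "u - w n = la n *\<^sub>R \<xi> n" for n unfolding \<xi>_def using la0[of n] by simp
  have nwu: "nrm (w n - u) = la n * nrm (\<xi> n)" for n
    using nrm_minus_commute[of "w n" u] wD[of n] uV la0[of n] uw[of n] by (simp add: nrm_scale \<xi>V)
  have Ewu: "E u - S * (la n * nrm (\<xi> n)) \<le> E (w n)" for n
    using S(2)[OF wD[of n]] nwu[of n] by simp
  \<comment> \<open>The subgradient inequality at w n tested with u gives E(w) + la |\<xi>|^2 \<le>
    E(u), and the slope bound gives E(u) - S la |\<xi>| \<le> E(w); together |\<xi>|^2 \<le> S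
    |\<xi>|.\<close>
  have bd: "nrm (\<xi> n) \<le> S" for n
  proof -
    have "E (w n) + la n * nsq (\<xi> n) \<le> E u"
      using sg[of n] u uw[of n] \<xi>V[of n] by (auto simp: subgrad_def ip_scale_right nsq_def)
    with Ewu[of n] have "la n * nsq (\<xi> n) \<le> la n * (S * nrm (\<xi> n))" by (simp add: algebra_simps)
    then have "nrm (\<xi> n) * nrm (\<xi> n) \<le> S * nrm (\<xi> n)"
      using la0[of n] nrm_sq[OF \<xi>V[of n]] by (simp add: power2_eq_square)
    then show ?thesis using S(1) nrm_nonneg[OF \<xi>V[of n]] by (cases "nrm (\<xi> n) = 0") auto
  qed
  \<comment> \<open>Since w i - w j = la j \<xi> j - la i \<xi> i, monotonicity gives la j |\<xi> i
    - \<xi> j|^2 \<le> (la i - la j) ((\<xi> i, \<xi> j) - |\<xi> i|^2). So the last factor is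
    nonnegative when la i > la j, and expanding the square yields the claim. It also shows that the
    norms increase, which makes the sequence Cauchy.\<close>
  have dec: "nsq (\<xi> i - \<xi> j) \<le> nsq (\<xi> j) - nsq (\<xi> i)" if "i \<le> j" for i j
  proof -
    have la: "la j \<le> la i" unfolding la_def using that by (simp add: frac_le)
    have "w i - w j = la j *\<^sub>R \<xi> j - la i *\<^sub>R \<xi> i" unfolding uw[symmetric] by simp
    then have "0 \<le> ip (\<xi> i - \<xi> j) (la j *\<^sub>R \<xi> j - la i *\<^sub>R \<xi> i)"
      using subgrad_mono[OF sg sg, of i j] by simp
    then have k: "la j * nsq (\<xi> i - \<xi> j) \<le> (la i - la j) * (ip (\<xi> i) (\<xi> j) - nsq (\<xi> i))"
      using \<xi>V by (simp add: nsq_def ip_simps ip_sym[of "\<xi> j" "\<xi> i"] algebra_simps)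
    have d0: "0 \<le> nsq (\<xi> i - \<xi> j)" using \<xi>V by simp
    have e: "nsq (\<xi> i - \<xi> j) = nsq (\<xi> i) + nsq (\<xi> j) - 2 * ip (\<xi> i) (\<xi> j)"
      using \<xi>V by (simp add: nsq_diff)
    show ?thesis
    proof (cases "la i = la j")
      case True
      then have "nsq (\<xi> i - \<xi> j) \<le> 0" using k la0[of j] by (simp add: mult_le_0_iff)
      moreover have "i = j" using True by (simp add: la_def)
      ultimately show ?thesis by simp
    next
      case False
      then have "0 \<le> (la i - la j) * (ip (\<xi> i) (\<xi> j) - nsq (\<xi> i))"
        using k d0 la0[of j] by (meson mult_nonneg_nonneg less_imp_le order_trans)
      then have "0 \<le> ip (\<xi> i) (\<xi> j) - nsq (\<xi> i)" using False la by (simp add: zero_le_mult_iff)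
      then show ?thesis using e by simp
    qed
  qed
  have cau: "\<exists>N. \<forall>i\<ge>N. \<forall>j\<ge>N. nsq (\<xi> i - \<xi> j) < e" if e: "e > 0" for e
  proof -
    have inc: "incseq (\<lambda>n. nsq (\<xi> n))"
    proof (rule incseq_SucI)
      fix n
      have "0 \<le> nsq (\<xi> n - \<xi> (Suc n))" using \<xi>V by simp
      then show "nsq (\<xi> n) \<le> nsq (\<xi> (Suc n))" using dec[of n "Suc n"] by simp
    qed
    have "nsq (\<xi> n) \<le> S\<^sup>2" for n
      using power_mono[OF bd[of n], of 2] \<xi>V by (simp add: nrm_sq)
    then obtain l where "(\<lambda>n. nsq (\<xi> n)) \<longlonglongrightarrow> l" using incseq_convergent[OF inc] by metis
    then have "Cauchy (\<lambda>n. nsq (\<xi> n))" by (rule LIMSEQ_imp_Cauchy)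
    then obtain N where N: "\<forall>m\<ge>N. \<forall>n\<ge>N. norm (nsq (\<xi> m) - nsq (\<xi> n)) < e"
      using CauchyD[OF _ e] by blast
    have "nsq (\<xi> i - \<xi> j) < e" if ij: "i \<ge> N" "j \<ge> N" for i j
    proof -
      have n: "norm (nsq (\<xi> i) - nsq (\<xi> j)) < e" using N ij by blast
      show ?thesis
      proof (cases "i \<le> j")
        case True then show ?thesis using dec[of i j] n by simp
      next
        case False then show ?thesis using dec[of j i] n nsq_minus_commute[OF \<xi>V \<xi>V, of i j] by simp
      qed
    qed
    then show ?thesis by blast
  qed
  obtain x where x: "x \<in> V" "(\<lambda>n. nrm (\<xi> n - x)) \<longlonglongrightarrow> 0"
    using complete_nrm[of \<xi>] \<xi>V cau by blast
  have lalim: "la \<longlonglongrightarrow> 0" unfolding la_def by (rule LIMSEQ_Suc[OF lim_1_over_n])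
  have "subgrad x u" unfolding subgrad_def
  proof (intro conjI ballI)
    fix z assume z: "z \<in> D"
    have zu: "z - u \<in> V" using z u by simp
    have "E u - S * (la n * S) + ip (\<xi> n) (z - u) \<le> E z" for n
    proof -
      have "S * (la n * nrm (\<xi> n)) \<le> S * (la n * S)"
        using bd[of n] la0[of n] S(1) by (intro mult_left_mono) auto
      then have 1: "E u - S * (la n * S) \<le> E (w n)" using Ewu[of n] by simp
      have "z - w n = (z - u) + la n *\<^sub>R \<xi> n" unfolding uw[symmetric] by simp
      then have "ip (\<xi> n) (z - w n) = ip (\<xi> n) (z - u) + la n * nsq (\<xi> n)"
        using zu \<xi>V by (simp only: ip_add_right ip_scale_right V_scale nsq_def)
      moreover have "0 \<le> la n * nsq (\<xi> n)" using la0[of n] \<xi>V by simp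
      moreover have "E (w n) + ip (\<xi> n) (z - w n) \<le> E z" using sg[of n] z by (simp add: subgrad_def)
      ultimately show ?thesis using 1 by linarith
    qed
    moreover have "(\<lambda>n. E u - S * (la n * S) + ip (\<xi> n) (z - u)) \<longlonglongrightarrow> E u - S * (0 * S) + ip x (z - u)"
      by (intro tendsto_intros lalim ip_tendsto[OF x(2) \<xi>V x(1) zu])
    ultimately have "E u - S * (0 * S) + ip x (z - u) \<le> E z" by (intro LIMSEQ_le_const2) auto
    then show "E u + ip x (z - u) \<le> E z" by simp
  qed (use x u in auto)
  moreover have "nrm x \<le> S"
  proof (rule LIMSEQ_le_const2)
    have z: "0 \<in> V" using V_subspace by (rule subspace_0)
    show "(\<lambda>n. nrm (\<xi> n)) \<longlonglongrightarrow> nrm x" using nrm_tendsto_diff[OF x(2) \<xi>V x(1) z] by simp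
    show "\<exists>N. \<forall>n\<ge>N. nrm (\<xi> n) \<le> S" using bd by blast
  qed
  ultimately show ?thesis using that by blast
qed

text \<open>With z = u s the variational inequality bounds r^2, for r = |u t - u s|, by 2 (t - s)
  (E(u s) - E(u t)), and the subgradient at u s bounds this energy difference by |\<xi>| r; one
  factor r cancels.\<close>

lemma evi_lipschitz:
  assumes evi: "evi_curve x0 u" and st: "0 < s" "s \<le> t" and \<xi>: "subgrad \<xi> (u s)"
  shows "nrm (u t - u s) \<le> 2 * (t - s) * nrm \<xi>"
proof (cases "s = t")
  case True
  then show ?thesis by (simp add: nrm_def)
next
  case False
  have D: "u s \<in> D" "u t \<in> D" using evi_curve_D[OF evi] st by auto
  define r where "r = nrm (u t - u s)"
  have r0: "r \<ge> 0" unfolding r_def using D by simp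
  have "nsq (u t - u s) - nsq (u s - u s) \<le> 2 * (t - s) * (E (u s) - E (u t))"
    by (rule evi_curve_evi[OF evi st(1) _ D(1)]) (use st False in auto)
  also have "\<dots> \<le> 2 * (t - s) * (nrm \<xi> * r)"
    using subgrad_lower[OF \<xi> D(2)] st unfolding r_def by (intro mult_left_mono) auto
  finally have "r * r \<le> (2 * (t - s) * nrm \<xi>) * r"
    using nrm_sq[of "u t - u s"] D unfolding r_def by (simp add: power2_eq_square)
  moreover have "0 \<le> 2 * (t - s) * nrm \<xi>" using st \<xi> by (simp add: subgrad_def)
  ultimately show ?thesis unfolding r_def[symmetric] using r0 by (cases "r = 0") auto
qed

text \<open>Testing the variational inequality between s and s + h with z = u s + \<sigma>
  \<epsilon> \<psi> produces the inner product of the increment with \<psi>, with sign -\<sigma>.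
  The two signs \<sigma> bound the difference quotient from both sides. \<open>dir\<close> supplies
  the energy of z: a one-sided upper bound in each of the directions \<psi> and -\<psi>, for one
  suitable \<epsilon>, is enough.\<close>

lemma evi_right_derivative:
  assumes evi: "evi_curve x0 u" and s: "0 < s" and \<xi>: "subgrad \<xi> (u s)" and \<psi>: "\<psi> \<in> V"
    and dir: "\<And>\<sigma> \<eta>. \<sigma> \<in> {1, -1} \<Longrightarrow> \<eta> > 0 \<Longrightarrow>
      \<exists>\<epsilon>>0. u s + (\<sigma> * \<epsilon>) *\<^sub>R \<psi> \<in> D \<and> E (u s + (\<sigma> * \<epsilon>) *\<^sub>R \<psi>) - E (u s) \<le> \<epsilon> * (\<sigma> * ip \<xi> \<psi> + \<eta>)"
  shows "((\<lambda>h. (ip (u (s + h)) \<psi> - ip (u s) \<psi>) / h) \<longlongrightarrow> - ip \<xi> \<psi>) (at_right 0)"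
proof -
  define G where "G = ip \<xi> \<psi>"
  define q where "q h = (ip (u (s + h)) \<psi> - ip (u s) \<psi>) / h" for h
  note D = evi_curve_D[OF evi]
  have \<xi>V: "\<xi> \<in> V" using \<xi> by (simp add: subgrad_def)
  have one: "\<forall>\<^sub>F h in at_right 0. - \<sigma> * q h \<le> \<sigma> * G + \<eta>" if \<sigma>: "\<sigma> \<in> {1, -1}" and \<eta>: "\<eta> > 0" for \<sigma> \<eta> :: real
  proof -
    obtain \<epsilon> where \<epsilon>: "\<epsilon> > 0" "u s + (\<sigma> * \<epsilon>) *\<^sub>R \<psi> \<in> D"
      "E (u s + (\<sigma> * \<epsilon>) *\<^sub>R \<psi>) - E (u s) \<le> \<epsilon> * (\<sigma> * G + \<eta> / 2)"
      using dir[OF \<sigma>, of "\<eta> / 2"] \<eta> unfolding G_def by auto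
    define z where "z = u s + (\<sigma> * \<epsilon>) *\<^sub>R \<psi>"
    \<comment> \<open>The last summand is the cost of replacing E(u (s + h)) by E(u s): at most
      |\<xi>| times the Lipschitz bound 2 h |\<xi>|, then divided by \<epsilon>. It disappears
      because \<epsilon> is fixed before h tends to 0.\<close>
    have est: "- \<sigma> * q h \<le> \<sigma> * G + \<eta> / 2 + 2 * h * (nrm \<xi>)\<^sup>2 / \<epsilon>" if h: "h > 0" for h
    proof -
      define d where "d = u (s + h) - u s"
      have dV: "d \<in> V" unfolding d_def using D s h by simp
      have "nsq (u (s + h) - z) - nsq (u s - z) \<le> 2 * h * (E z - E (u (s + h)))"
        using evi_curve_evi[OF evi s _ \<epsilon>(2), of "s + h"] h unfolding z_def by simp
      moreover have "u (s + h) - z = d - (\<sigma> * \<epsilon>) *\<^sub>R \<psi>" "u s - z = - ((\<sigma> * \<epsilon>) *\<^sub>R \<psi>)"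
        by (auto simp: d_def z_def)
      moreover have "nsq (d - (\<sigma> * \<epsilon>) *\<^sub>R \<psi>) - nsq (- ((\<sigma> * \<epsilon>) *\<^sub>R \<psi>)) = nsq d - 2 * (\<sigma> * \<epsilon>) * ip d \<psi>"
        using dV \<psi> by (simp add: nsq_diff ip_scale_right nsq_scale nsq_neg)
      ultimately have "nsq d - 2 * (\<sigma> * \<epsilon>) * ip d \<psi> \<le> 2 * h * (E z - E (u (s + h)))"
        by (simp only:)
      then have 1: "- 2 * (\<sigma> * \<epsilon>) * ip d \<psi> \<le> 2 * h * (E z - E (u (s + h)))"
        using nsq_nonneg[OF dV] by linarith
      have sq: "2 * h * (nrm \<xi>)\<^sup>2 = nrm \<xi> * (2 * h * nrm \<xi>)" by (simp add: power2_eq_square)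
      have "E (u s) - nrm \<xi> * nrm d \<le> E (u (s + h))"
        unfolding d_def using subgrad_lower[OF \<xi> D] s h by simp
      moreover have "nrm \<xi> * nrm d \<le> nrm \<xi> * (2 * h * nrm \<xi>)"
        unfolding d_def using evi_lipschitz[OF evi s _ \<xi>, of "s + h"] h \<xi>V by (intro mult_left_mono) auto
      ultimately have "E z - E (u (s + h)) \<le> \<epsilon> * (\<sigma> * G + \<eta> / 2) + 2 * h * (nrm \<xi>)\<^sup>2"
        using \<epsilon>(3) unfolding z_def[symmetric] sq by linarith
      then have "2 * h * (E z - E (u (s + h))) \<le> 2 * h * (\<epsilon> * (\<sigma> * G + \<eta> / 2) + 2 * h * (nrm \<xi>)\<^sup>2)"
        using h by (intro mult_left_mono) auto
      with 1 have "- 2 * (\<sigma> * \<epsilon>) * ip d \<psi> \<le> 2 * h * (\<epsilon> * (\<sigma> * G + \<eta> / 2) + 2 * h * (nrm \<xi>)\<^sup>2)"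
        by linarith
      moreover have "ip d \<psi> = h * q h" unfolding q_def d_def using h D s \<psi> by (simp add: ip_diff)
      moreover have "(2 * h * \<epsilon>) * (2 * h * (nrm \<xi>)\<^sup>2 / \<epsilon>) = 2 * h * (2 * h * (nrm \<xi>)\<^sup>2)"
        using \<epsilon>(1) by simp
      ultimately have "(2 * h * \<epsilon>) * (- \<sigma> * q h) \<le> (2 * h * \<epsilon>) * (\<sigma> * G + \<eta> / 2 + 2 * h * (nrm \<xi>)\<^sup>2 / \<epsilon>)"
        by (simp add: distrib_left mult_ac)
      moreover have "2 * h * \<epsilon> > 0" using h \<epsilon> by simp
      ultimately show ?thesis by (simp only: mult_le_cancel_left_pos)
    qed
    have "((\<lambda>h. \<sigma> * G + \<eta> / 2 + 2 * h * (nrm \<xi>)\<^sup>2 / \<epsilon>) \<longlongrightarrow> \<sigma> * G + \<eta> / 2 + 2 * 0 * (nrm \<xi>)\<^sup>2 / \<epsilon>) (at_right 0)"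
      by (intro tendsto_intros) (use \<epsilon> in auto)
    then have "\<forall>\<^sub>F h in at_right 0. \<sigma> * G + \<eta> / 2 + 2 * h * (nrm \<xi>)\<^sup>2 / \<epsilon> < \<sigma> * G + \<eta>"
      using \<eta> by (intro order_tendstoD) auto
    then show ?thesis using eventually_at_right_less[of 0]
    proof eventually_elim
      case (elim h)
      then show ?case using est[of h] by linarith
    qed
  qed
  have "(q \<longlongrightarrow> - G) (at_right 0)"
  proof (rule tendstoI)
    fix e :: real assume e: "e > 0"
    from one[of 1 "e/2"] one[of "-1" "e/2"] e
    have "\<forall>\<^sub>F h in at_right 0. - 1 * q h \<le> 1 * G + e/2" "\<forall>\<^sub>F h in at_right 0. - (-1) * q h \<le> (-1) * G + e/2"
      by auto
    then show "\<forall>\<^sub>F h in at_right 0. dist (q h) (- G) < e"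
      by eventually_elim (use e in \<open>auto simp: dist_real_def\<close>)
  qed
  then show ?thesis unfolding q_def G_def .
qed

end

section \<open>Iterated directional derivatives\<close>

lemma differentiable_on_dir_deriv:
  assumes "f differentiable_on S" "open S" "x \<in> S"
  shows "(f has_derivative dir_deriv f x) (at x)"
  using assms by (simp add: differentiable_on_eq_differentiable_at frechet_derivative_works)

lemma dir_deriv_eq: "(f has_derivative D) (at x) \<Longrightarrow> dir_deriv f x = D"
  by (rule frechet_derivative_at[symmetric])

lemma dir_deriv_cong_open:
  assumes "open S" "x \<in> S" "\<And>y. y \<in> S \<Longrightarrow> f y = g y"
  shows "dir_deriv f x = dir_deriv g x"
proof -
  have "(f has_derivative D) (at x) \<longleftrightarrow> (g has_derivative D) (at x)" for D
    using assms by (intro iffI; elim has_derivative_transform_within_open) auto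
  then show ?thesis unfolding frechet_derivative_def by simp
qed

lemma Ck_on_cong:
  assumes "open S" "\<And>y. y \<in> S \<Longrightarrow> f y = g y" "Ck_on k S f"
  shows "Ck_on k S g"
  using assms(2,3)
proof (induction k arbitrary: f g)
  case 0
  then show ?case using continuous_on_cong[of S S f g] by simp
next
  case (Suc k)
  have "g differentiable_on S"
    using Suc.prems has_derivative_transform_within_open[OF _ assms(1), of f _ _ UNIV g] assms(1)
    by (auto simp: differentiable_on_eq_differentiable_at differentiable_def) blast
  moreover have "Ck_on k S (\<lambda>x. dir_deriv g x v)" for v
    by (rule Suc.IH[of "\<lambda>x. dir_deriv f x v"])
      (use Suc.prems dir_deriv_cong_open[OF assms(1), of _ f g] in auto)
  ultimately show ?case by simp
qed

lemma Ck_on_Suc_imp: "Ck_on (Suc k) S f \<Longrightarrow> Ck_on k S f"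
proof (induction k arbitrary: f)
  case 0
  then show ?case by (auto intro: differentiable_imp_continuous_on)
next
  case (Suc k)
  then show ?case by (metis Ck_on.simps(2))
qed

lemma smooth_on_cong: "open S \<Longrightarrow> (\<And>y. y \<in> S \<Longrightarrow> f y = g y) \<Longrightarrow> smooth_on S f \<Longrightarrow> smooth_on S g"
  unfolding smooth_on_def using Ck_on_cong by blast

lemma smooth_on_imp_continuous_on: "smooth_on S f \<Longrightarrow> continuous_on S f"
  unfolding smooth_on_def by (metis Ck_on.simps(1))

lemma smooth_on_imp_differentiable_on: "smooth_on S f \<Longrightarrow> f differentiable_on S"
  unfolding smooth_on_def by (metis Ck_on.simps(2))

lemma smooth_on_dir_deriv: "smooth_on S f \<Longrightarrow> smooth_on S (\<lambda>x. dir_deriv f x v)"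
  unfolding smooth_on_def by (metis Ck_on.simps(2))

lemma Ck_on_const: "Ck_on k S (\<lambda>x. c)"
proof (induction k arbitrary: c)
  case (Suc k)
  have "dir_deriv (\<lambda>x. c) x v = 0" for x :: 'a and v
    by (subst dir_deriv_eq[OF has_derivative_const]) simp
  then show ?case using Suc by simp
qed simp

lemma Ck_on_bounded_linear:
  assumes "bounded_linear h" shows "Ck_on k S h"
proof (cases k)
  case 0
  then show ?thesis using assms by (simp add: linear_continuous_on)
next
  case (Suc j)
  have "dir_deriv h x v = h v" for x v
    by (subst dir_deriv_eq[OF bounded_linear_imp_has_derivative[OF assms]]) simp
  then show ?thesis using Suc assms
    by (auto simp: Ck_on_const differentiable_on_def bounded_linear_imp_differentiable)
qed

lemma Ck_on_compose_linear:
  assumes h: "bounded_linear h" and S: "open S" and f: "Ck_on k S f"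
  shows "Ck_on k S (\<lambda>x. h (f x))"
  using f
proof (induction k arbitrary: f)
  case 0
  then show ?case using bounded_linear.continuous_on[OF h] by simp
next
  case (Suc k)
  then have f: "f differentiable_on S" and d: "\<And>v. Ck_on k S (\<lambda>x. dir_deriv f x v)" by auto
  have D: "((\<lambda>x. h (f x)) has_derivative (\<lambda>v. h (dir_deriv f x v))) (at x)" if "x \<in> S" for x
    using bounded_linear.has_derivative[OF h differentiable_on_dir_deriv[OF f S that]] .
  have "Ck_on k S (\<lambda>x. dir_deriv (\<lambda>x. h (f x)) x v)" for v
    by (rule Ck_on_cong[OF S _ Suc.IH[OF d[of v]]]) (simp add: dir_deriv_eq[OF D])
  moreover have "(\<lambda>x. h (f x)) differentiable_on S"
    using D S by (auto simp: differentiable_on_eq_differentiable_at differentiable_def)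
  ultimately show ?case by simp
qed

lemma Ck_on_add:
  assumes S: "open S" and f: "Ck_on k S f" and g: "Ck_on k S g"
  shows "Ck_on k S (\<lambda>x. f x + g x)"
  using f g
proof (induction k arbitrary: f g)
  case 0
  then show ?case by (simp add: continuous_on_add)
next
  case (Suc k)
  then have f: "f differentiable_on S" "\<And>v. Ck_on k S (\<lambda>x. dir_deriv f x v)"
    and g: "g differentiable_on S" "\<And>v. Ck_on k S (\<lambda>x. dir_deriv g x v)" by auto
  have D: "((\<lambda>x. f x + g x) has_derivative (\<lambda>v. dir_deriv f x v + dir_deriv g x v)) (at x)" if "x \<in> S" for x
    by (intro has_derivative_add differentiable_on_dir_deriv[OF _ S that] f g)
  have "Ck_on k S (\<lambda>x. dir_deriv (\<lambda>x. f x + g x) x v)" for v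
    by (rule Ck_on_cong[OF S _ Suc.IH[OF f(2)[of v] g(2)[of v]]]) (simp add: dir_deriv_eq[OF D])
  then show ?case using f g by (simp add: differentiable_on_add)
qed

lemma (in bounded_bilinear) Ck_on_prod:
  assumes S: "open S" and f: "Ck_on k S f" and g: "Ck_on k S g"
  shows "Ck_on k S (\<lambda>x. prod (f x) (g x))"
  using f g
proof (induction k arbitrary: f g)
  case 0
  then show ?case by (simp add: continuous_on)
next
  case (Suc k)
  then have f: "f differentiable_on S" "\<And>v. Ck_on k S (\<lambda>x. dir_deriv f x v)" "Ck_on k S f"
    and g: "g differentiable_on S" "\<And>v. Ck_on k S (\<lambda>x. dir_deriv g x v)" "Ck_on k S g"
    using Ck_on_Suc_imp[OF Suc.prems(1)] Ck_on_Suc_imp[OF Suc.prems(2)] by auto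
  have D: "((\<lambda>x. prod (f x) (g x)) has_derivative (\<lambda>v. prod (f x) (dir_deriv g x v) + prod (dir_deriv f x v) (g x))) (at x)"
    if "x \<in> S" for x
    by (intro FDERIV differentiable_on_dir_deriv[OF _ S that] f g)
  have "Ck_on k S (\<lambda>x. dir_deriv (\<lambda>x. prod (f x) (g x)) x v)" for v
    by (rule Ck_on_cong[OF S _ Ck_on_add[OF S Suc.IH[OF f(3) g(2)[of v]] Suc.IH[OF f(2)[of v] g(3)]]])
      (simp add: dir_deriv_eq[OF D])
  moreover have "(\<lambda>x. prod (f x) (g x)) differentiable_on S"
    using D S by (auto simp: differentiable_on_eq_differentiable_at differentiable_def)
  ultimately show ?case by simp
qed

lemmas Ck_on_mult = bounded_bilinear.Ck_on_prod[OF bounded_bilinear_mult]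
  and Ck_on_scaleR = bounded_bilinear.Ck_on_prod[OF bounded_bilinear_scaleR]

lemma Ck_on_sum:
  assumes "open S" "\<And>i. i \<in> I \<Longrightarrow> Ck_on k S (f i)"
  shows "Ck_on k S (\<lambda>x. \<Sum>i\<in>I. f i x)"
  using assms by (induction I rule: infinite_finite_induct) (auto intro: Ck_on_const Ck_on_add)

lemma Ck_on_prod_set:
  fixes f :: "'i \<Rightarrow> 'a::euclidean_space \<Rightarrow> real"
  assumes "open S" "\<And>i. i \<in> I \<Longrightarrow> Ck_on k S (f i)"
  shows "Ck_on k S (\<lambda>x. \<Prod>i\<in>I. f i x)"
  using assms by (induction I rule: infinite_finite_induct) (auto intro: Ck_on_const Ck_on_mult)

text \<open>Expanding the inner derivative in the basis writes the derivative of the composite as a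
  finite sum of products in which only derivatives of f in fixed directions are composed with g. The
  induction hypothesis applies to these since it is general in f, with g itself still k times
  differentiable.\<close>

lemma Ck_on_compose:
  fixes g :: "'a::euclidean_space \<Rightarrow> 'b::euclidean_space" and f :: "'b \<Rightarrow> 'c::real_normed_vector"
  assumes S: "open S" and T: "open T" and sub: "g ` S \<subseteq> T" and f: "Ck_on k T f" and g: "Ck_on k S g"
  shows "Ck_on k S (\<lambda>x. f (g x))"
  using f g
proof (induction k arbitrary: f)
  case 0
  then show ?case using sub by (auto intro: continuous_on_compose2)
next
  case (Suc k)
  then have f: "f differentiable_on T" "\<And>v. Ck_on k T (\<lambda>x. dir_deriv f x v)"
    and g: "g differentiable_on S" "\<And>v. Ck_on k S (\<lambda>x. dir_deriv g x v)" "Ck_on k S g"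
    using Ck_on_Suc_imp[OF Suc.prems(2)] by auto
  have D: "((\<lambda>x. f (g x)) has_derivative (\<lambda>v. \<Sum>b\<in>Basis. (dir_deriv g x v \<bullet> b) *\<^sub>R dir_deriv f (g x) b)) (at x)"
    if x: "x \<in> S" for x
  proof -
    have fd: "(f has_derivative dir_deriv f (g x)) (at (g x))"
      using differentiable_on_dir_deriv[OF f(1) T] sub x by auto
    then have l: "linear (dir_deriv f (g x))"
      using has_derivative_bounded_linear bounded_linear.linear by blast
    have comp: "((\<lambda>x. f (g x)) has_derivative (\<lambda>v. dir_deriv f (g x) (dir_deriv g x v))) (at x)"
      using has_derivative_compose[OF differentiable_on_dir_deriv[OF g(1) S x] fd] .
    have rep: "dir_deriv f (g x) w = (\<Sum>b\<in>Basis. (w \<bullet> b) *\<^sub>R dir_deriv f (g x) b)" for w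
    proof -
      have "dir_deriv f (g x) w = dir_deriv f (g x) (\<Sum>b\<in>Basis. (w \<bullet> b) *\<^sub>R b)"
        by (simp add: euclidean_representation)
      also have "\<dots> = (\<Sum>b\<in>Basis. dir_deriv f (g x) ((w \<bullet> b) *\<^sub>R b))" by (rule linear_sum[OF l])
      also have "\<dots> = (\<Sum>b\<in>Basis. (w \<bullet> b) *\<^sub>R dir_deriv f (g x) b)"
        by (intro sum.cong refl linear_scale[OF l])
      finally show ?thesis .
    qed
    show ?thesis using comp by (subst (asm) rep)
  qed
  have "Ck_on k S (\<lambda>x. dir_deriv (\<lambda>x. f (g x)) x v)" for v
  proof (rule Ck_on_cong[OF S])
    show "Ck_on k S (\<lambda>x. \<Sum>b\<in>Basis. (dir_deriv g x v \<bullet> b) *\<^sub>R dir_deriv f (g x) b)"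
      by (intro Ck_on_sum Ck_on_scaleR S Suc.IH f g Ck_on_compose_linear[OF bounded_linear_inner_left])
  qed (simp add: dir_deriv_eq[OF D])
  moreover have "(\<lambda>x. f (g x)) differentiable_on S"
    using D S by (auto simp: differentiable_on_eq_differentiable_at differentiable_def)
  ultimately show ?case by simp
qed

lemma smooth_on_compose:
  fixes g :: "'a::euclidean_space \<Rightarrow> 'b::euclidean_space" and f :: "'b \<Rightarrow> 'c::real_normed_vector"
  assumes "open S" "open T" "g ` S \<subseteq> T" "smooth_on T f" "smooth_on S g"
  shows "smooth_on S (\<lambda>x. f (g x))"
  using assms Ck_on_compose unfolding smooth_on_def by blast

lemma smooth_on_open_cover:
  assumes "open S" "open T" "smooth_on S f" "smooth_on T f"
  shows "smooth_on (S \<union> T) f"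
proof -
  have "Ck_on k (S \<union> T) f" if "Ck_on k S f" "Ck_on k T f" for k
    using that
  proof (induction k arbitrary: f)
    case 0 then show ?case using assms by (simp add: continuous_on_open_Un)
  next
    case (Suc k) then show ?case using assms
      by (auto simp: differentiable_on_eq_differentiable_at open_Un)
  qed
  then show ?thesis using assms by (auto simp: smooth_on_def)
qed

section \<open>Bump functions\<close>

text \<open>For n = 0 this is the classical flat function exp (-1/s), extended by 0. The extra
  powers of 1/s make the family closed under differentiation up to linear combinations, so
  smoothness follows by one induction.\<close>

definition flat :: "nat \<Rightarrow> real \<Rightarrow> real" where
  "flat n s = (if s > 0 then (1 / s) ^ n * exp (- (1 / s)) else 0)"

lemma flat_tendsto_0: "(flat n \<longlongrightarrow> 0) (at_right 0)"
proof -
  have "((\<lambda>s::real. (1/s) ^ n / exp (1/s)) \<longlongrightarrow> 0) (at_right 0)"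
    using filterlim_compose[OF tendsto_power_div_exp_0 filterlim_inverse_at_top_right, of n]
    by (simp add: inverse_eq_divide)
  moreover have "\<forall>\<^sub>F s in at_right 0. (1/s) ^ n / exp (1/s) = flat n s"
    using eventually_at_right_less[of 0] by eventually_elim (simp add: flat_def exp_minus divide_inverse)
  ultimately show ?thesis by (rule Lim_transform_eventually)
qed

lemma flat_has_derivative:
  "(flat n has_real_derivative (flat (n + 2) s - real n * flat (n + 1) s)) (at s)"
proof (cases s "0::real" rule: linorder_cases)
  case less
  have "((\<lambda>_. 0) has_real_derivative 0) (at s)" by simp
  then have "(flat n has_real_derivative 0) (at s)"
    by (rule has_field_derivative_transform_within_open[of _ _ _ "{..<0}"]) (use less in \<open>auto simp: flat_def\<close>)
  then show ?thesis using less by (simp add: flat_def)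
next
  case greater
  have "((\<lambda>s. (1 / s) ^ n * exp (- (1 / s))) has_real_derivative (flat (n + 2) s - real n * flat (n + 1) s)) (at s)"
  proof -
    have i: "((\<lambda>s. 1 / s) has_real_derivative (- ((1 / s) * (1 / s)))) (at s)"
      using DERIV_inverse[of s UNIV] greater by (simp add: inverse_eq_divide power2_eq_square)
    have p: "((\<lambda>s. (1 / s) ^ n) has_real_derivative (real n * ((1 / s) ^ (n - 1) * (- ((1 / s) * (1 / s)))))) (at s)"
      using DERIV_power[OF i, of n] by (simp add: mult_ac)
    have e: "((\<lambda>s. exp (- (1 / s))) has_real_derivative (exp (- (1 / s)) * ((1 / s) * (1 / s)))) (at s)"
      using DERIV_chain2[OF DERIV_exp DERIV_minus[OF i]] by simp
    have pw: "real n * (r ^ (n - 1) * (- (r * r))) = - (real n * r ^ (n + 1))" for r :: real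
      by (cases n) simp_all
    have "((\<lambda>s. (1 / s) ^ n * exp (- (1 / s))) has_real_derivative
        - (real n * (1 / s) ^ (n + 1)) * exp (- (1 / s)) + (exp (- (1 / s)) * ((1 / s) * (1 / s))) * (1 / s) ^ n) (at s)"
      using DERIV_mult[OF p e] unfolding pw by simp
    moreover have "- (real n * (1 / s) ^ (n + 1)) * exp (- (1 / s)) + (exp (- (1 / s)) * ((1 / s) * (1 / s))) * (1 / s) ^ n
        = flat (n + 2) s - real n * flat (n + 1) s"
      using greater by (simp add: flat_def mult_ac)
    ultimately show ?thesis by metis
  qed
  then show ?thesis
    by (rule has_field_derivative_transform_within_open[of _ _ _ "{0<..}"]) (use greater in \<open>auto simp: flat_def\<close>)
next
  case equal
  \<comment> \<open>From the right the difference quotient at 0 is \<open>flat (Suc n)\<close>,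
    which tends to 0; from the left it is constantly 0.\<close>
  have r: "((\<lambda>h. flat n h / h) \<longlongrightarrow> 0) (at_right 0)"
  proof (rule Lim_transform_eventually[OF flat_tendsto_0[of "Suc n"]])
    show "\<forall>\<^sub>F s in at_right 0. flat (Suc n) s = flat n s / s"
      using eventually_at_right_less[of 0] by eventually_elim (simp add: flat_def)
  qed
  have l: "((\<lambda>h. flat n h / h) \<longlongrightarrow> 0) (at_left 0)"
  proof (rule Lim_transform_eventually[OF tendsto_const])
    show "\<forall>\<^sub>F s in at_left 0. 0 = flat n s / s"
      using eventually_at_left_real[of "-1" 0] by (simp add: eventually_at_filter flat_def)
  qed
  have "((\<lambda>h. flat n h / h) \<longlongrightarrow> 0) (at 0)" using filterlim_split_at[OF l r] .
  then show ?thesis using equal by (simp add: DERIV_def flat_def)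
qed

lemma flat_smooth: "Ck_on k UNIV (flat n)"
proof (induction k arbitrary: n)
  case 0
  show ?case using flat_has_derivative DERIV_isCont continuous_at_imp_continuous_on by (simp, blast)
next
  case (Suc k)
  have D: "(flat n has_derivative (\<lambda>v. (flat (n + 2) s - real n * flat (n + 1) s) * v)) (at s)" for s
    using flat_has_derivative[of n s] by (simp add: has_field_derivative_def)
  have "Ck_on k UNIV (\<lambda>s. (flat (n + 2) s + (- real n) * flat (n + 1) s) * v)" for v
    by (intro Ck_on_mult Ck_on_add Ck_on_const Suc.IH open_UNIV)
  then have "Ck_on k UNIV (\<lambda>s. dir_deriv (flat n) s v)" for v
    unfolding dir_deriv_eq[OF D] by simp
  moreover have "flat n differentiable_on UNIV"
    using D by (auto simp: differentiable_on_def differentiable_def)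
  ultimately show ?case by simp
qed

text \<open>Growing n sends the argument of each factor to infinity inside the box, where
  \<open>flat 0\<close> tends to 1, while outside the box some factor is 0. So these functions
  approximate the indicator of the open box with values in [0, 1].\<close>

definition box_bump :: "'a::euclidean_space \<Rightarrow> 'a \<Rightarrow> nat \<Rightarrow> 'a \<Rightarrow> real" where
  "box_bump l u n x = (\<Prod>b\<in>Basis. flat 0 (real (Suc n) * ((x \<bullet> b - l \<bullet> b) * (u \<bullet> b - x \<bullet> b))))"

lemma box_bump_smooth: "smooth_on UNIV (box_bump l u n)"
proof -
  have 1: "Ck_on k UNIV (\<lambda>x::'a. real (Suc n) * ((x \<bullet> b - l \<bullet> b) * (u \<bullet> b - x \<bullet> b)))" for k b
  proof -
    have "Ck_on k UNIV (\<lambda>x::'a. real (Suc n) * ((x \<bullet> b + (- (l \<bullet> b))) * (u \<bullet> b + (-1) * (x \<bullet> b))))"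
      by (intro Ck_on_mult Ck_on_add Ck_on_const open_UNIV Ck_on_bounded_linear bounded_linear_inner_left)
    then show ?thesis by simp
  qed
  show ?thesis unfolding smooth_on_def box_bump_def
    by (intro allI Ck_on_prod_set open_UNIV Ck_on_compose[OF _ _ _ flat_smooth 1]) auto
qed

lemma box_bump_nonneg: "0 \<le> box_bump l u n x"
  unfolding box_bump_def flat_def by (intro prod_nonneg) auto

lemma box_bump_le_1: "box_bump l u n x \<le> 1"
  unfolding box_bump_def flat_def by (intro prod_le_1) auto

text \<open>The assumption on l and u excludes that both differences in a factor are negative; their
  product would then be positive at points outside the box.\<close>

lemma box_bump_tendsto:
  assumes "\<And>b. b \<in> Basis \<Longrightarrow> l \<bullet> b \<le> u \<bullet> b"
  shows "(\<lambda>n. box_bump l u n x) \<longlonglongrightarrow> indicator (box l u) x"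
proof (cases "x \<in> box l u")
  case True
  have "(\<lambda>n. flat 0 (real (Suc n) * ((x \<bullet> b - l \<bullet> b) * (u \<bullet> b - x \<bullet> b)))) \<longlonglongrightarrow> 1" if b: "b \<in> Basis" for b
  proof -
    define c where "c = (x \<bullet> b - l \<bullet> b) * (u \<bullet> b - x \<bullet> b)"
    have c: "c > 0" unfolding c_def using True b by (auto simp: mem_box)
    have "(\<lambda>n. exp (- (inverse c * (1 / real (Suc n))))) \<longlonglongrightarrow> exp (- (inverse c * 0))"
      by (intro tendsto_intros LIMSEQ_Suc[OF lim_1_over_n])
    then show ?thesis unfolding c_def[symmetric] using c by (simp add: flat_def field_simps add_pos_nonneg)
  qed
  then have "(\<lambda>n. box_bump l u n x) \<longlonglongrightarrow> (\<Prod>b\<in>(Basis::'a set). 1)"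
    unfolding box_bump_def by (intro tendsto_prod)
  then show ?thesis using True by simp
next
  case False
  then obtain b where b: "b \<in> Basis" "\<not> (l \<bullet> b < x \<bullet> b \<and> x \<bullet> b < u \<bullet> b)" by (auto simp: mem_box)
  then have "(x \<bullet> b - l \<bullet> b) * (u \<bullet> b - x \<bullet> b) \<le> 0"
    using assms[OF b(1)] by (auto simp: mult_le_0_iff)
  then have "flat 0 (real (Suc n) * ((x \<bullet> b - l \<bullet> b) * (u \<bullet> b - x \<bullet> b))) = 0" for n
    unfolding flat_def by (simp add: mult_less_0_iff not_less mult_nonneg_nonpos)
  then have "box_bump l u n x = 0" for n unfolding box_bump_def using b by auto
  then show ?thesis using False by simp
qed

lemma box_bump_support:
  assumes "\<And>b. b \<in> Basis \<Longrightarrow> l \<bullet> b \<le> u \<bullet> b" "x \<notin> box l u"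
  shows "box_bump l u n x = 0"
proof -
  obtain b where b: "b \<in> Basis" "\<not> (l \<bullet> b < x \<bullet> b \<and> x \<bullet> b < u \<bullet> b)" using assms by (auto simp: mem_box)
  then have "(x \<bullet> b - l \<bullet> b) * (u \<bullet> b - x \<bullet> b) \<le> 0"
    using assms(1)[OF b(1)] by (auto simp: mult_le_0_iff)
  then have "flat 0 (real (Suc n) * ((x \<bullet> b - l \<bullet> b) * (u \<bullet> b - x \<bullet> b))) = 0"
    unfolding flat_def by (simp add: mult_less_0_iff not_less mult_nonneg_nonpos)
  then show ?thesis unfolding box_bump_def using b by auto
qed

lemma box_bump_test_function:
  assumes "\<And>b. b \<in> Basis \<Longrightarrow> l \<bullet> b \<le> u \<bullet> b" "cbox l u \<subseteq> S"
  shows "test_function S (box_bump l u n)"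
  unfolding test_function_def
  using box_bump_smooth box_bump_support[OF assms(1)] assms(2) box_subset_cbox[of l u]
  by (intro conjI exI[of _ "cbox l u"]) (auto, blast)

section \<open>The fundamental lemma of the calculus of variations\<close>

text \<open>Open boxes form an intersection-stable generator of the Borel sets, and the sets over
  which f integrates to 0 form a Dynkin system.\<close>

lemma AE_zero_box_integrals:
  fixes f :: "'a::euclidean_space \<Rightarrow> real"
  assumes f: "integrable lborel f" and box: "\<And>a b. (\<integral>x. indicator (box a b) x * f x \<partial>lborel) = 0"
  shows "AE x in lborel. f x = 0"
proof (rule density_unique_real[OF f])
  show "integrable lborel (\<lambda>x. 0 :: real)" by simp
  fix A :: "'a set" assume "A \<in> sets lborel"
  then have A: "A \<in> sigma_sets UNIV (range (\<lambda>(a, b). box a b :: 'a set))"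
    by (simp add: borel_eq_box)
  have fi: "integrable lborel (\<lambda>x. indicator B x * f x)" if "B \<in> sets borel" for B
    using integrable_mult_indicator[OF _ f, of B] that by simp
  \<comment> \<open>Closure under complements needs the integral over the whole space, obtained by
    exhausting it with cubes.\<close>
  have tot: "(\<integral>x. f x \<partial>lborel) = 0"
  proof (rule LIMSEQ_unique)
    show "(\<lambda>n. \<integral>x. indicator (box (- real n *\<^sub>R One) (real n *\<^sub>R One)) x * f x \<partial>lborel) \<longlonglongrightarrow> (\<integral>x. f x \<partial>lborel)"
    proof (rule integral_dominated_convergence[where w="\<lambda>x. norm (f x)"])
      show "AE x in lborel. (\<lambda>n. indicator (box (- real n *\<^sub>R One) (real n *\<^sub>R One)) x * f x) \<longlonglongrightarrow> f x"
      proof (rule AE_I2)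
        fix x :: 'a
        obtain n where n: "x \<in> box (- real n *\<^sub>R One) (real n *\<^sub>R One)"
          using UN_box_eq_UNIV[where 'a='a] UNIV_I[of x] by (auto simp del: UNIV_I)
        have "x \<in> box (- real k *\<^sub>R One) (real k *\<^sub>R One)" if "k \<ge> n" for k
          using n that by (force simp: mem_box)
        then show "(\<lambda>n. indicator (box (- real n *\<^sub>R One) (real n *\<^sub>R One)) x * f x) \<longlonglongrightarrow> f x"
          by (intro tendsto_eventually eventually_sequentiallyI[of n]) simp
      qed
    qed (use f in \<open>auto simp: indicator_def\<close>)
  qed (simp add: box)
  have st: "Int_stable (range (\<lambda>(a, b). box a b :: 'a set))"
    by (auto simp: Int_stable_def box_Int_box)
  have pw: "range (\<lambda>(a, b). box a b :: 'a set) \<subseteq> Pow UNIV" by auto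
  from st pw A have "(\<integral>x. indicator A x * f x \<partial>lborel) = 0 \<and> A \<in> sets borel"
  proof (induction A rule: sigma_sets_induct_disjoint)
    case (basic A) then show ?case using box by auto
  next
    case empty show ?case by simp
  next
    case (compl A)
    then have "(\<integral>x. indicator (UNIV - A) x * f x \<partial>lborel) = (\<integral>x. f x - indicator A x * f x \<partial>lborel)"
      by (intro Bochner_Integration.integral_cong) (auto simp: indicator_def)
    also have "\<dots> = 0" using compl fi tot f by simp
    finally show ?case using compl by auto
  next
    case (union A)
    then have m: "\<And>i. A i \<in> sets borel" by auto
    have "(\<lambda>n. \<Sum>i<n. \<integral>x. indicator (A i) x * f x \<partial>lborel) \<longlonglongrightarrow> (\<integral>x. indicator (\<Union>i. A i) x * f x \<partial>lborel)"
    proof -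
      have "(\<lambda>n. \<integral>x. indicator (\<Union>i<n. A i) x * f x \<partial>lborel) \<longlonglongrightarrow> (\<integral>x. indicator (\<Union>i. A i) x * f x \<partial>lborel)"
      proof (rule integral_dominated_convergence[where w="\<lambda>x. norm (f x)"])
        show "AE x in lborel. (\<lambda>n. indicator (\<Union>i<n. A i) x * f x) \<longlonglongrightarrow> indicator (\<Union>i. A i) x * f x"
          by (intro AE_I2 tendsto_mult LIMSEQ_indicator_UN tendsto_const)
      qed (use f m in \<open>auto simp: indicator_def\<close>)
      moreover have "(\<integral>x. indicator (\<Union>i<n. A i) x * f x \<partial>lborel) = (\<Sum>i<n. \<integral>x. indicator (A i) x * f x \<partial>lborel)" for n
      proof -
        have "indicator (\<Union>i<n. A i) x = (\<Sum>i<n. indicator (A i) x :: real)" for x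
          using union(1) by (intro indicator_UN_disjoint) (auto simp: disjoint_family_on_def)
        then have "(\<integral>x. indicator (\<Union>i<n. A i) x * f x \<partial>lborel) = (\<integral>x. (\<Sum>i<n. indicator (A i) x * f x) \<partial>lborel)"
          by (simp add: sum_distrib_right)
        also have "\<dots> = (\<Sum>i<n. \<integral>x. indicator (A i) x * f x \<partial>lborel)"
          by (intro Bochner_Integration.integral_sum fi m)
        finally show ?thesis .
      qed
      ultimately show ?thesis by simp
    qed
    then have "(\<integral>x. indicator (\<Union>i. A i) x * f x \<partial>lborel) = 0"
      using union by (simp add: LIMSEQ_const_iff)
    then show ?case using m by auto
  qed
  then show "set_lebesgue_integral lborel A f = set_lebesgue_integral lborel A (\<lambda>x. 0)"
    by (simp add: set_lebesgue_integral_def)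
qed

text \<open>Inside a closed box contained in S, the function cut off to the open box is integrable,
  and its integral over every open sub-box is a limit of integrals against bumps, hence 0. Countably
  many closed boxes then cover S.\<close>

lemma fundamental_lemma:
  fixes f :: "'a::euclidean_space \<Rightarrow> real"
  assumes S: "open S" and f: "locally_integrable S f"
    and zero: "\<And>\<psi>. test_function S \<psi> \<Longrightarrow> (\<integral>x. f x * \<psi> x \<partial>lborel) = 0"
  shows "AE x in lborel. x \<in> S \<longrightarrow> f x = 0"
proof -
  have bx: "AE x in lborel. x \<in> box l u \<longrightarrow> f x = 0" if sub: "cbox l u \<subseteq> S" for l u :: 'a
  proof -
    define F where "F x = indicator (box l u) x * f x" for x
    have C: "set_integrable lborel (cbox l u) f"
      using f sub unfolding locally_integrable_def by (simp add: compact_cbox)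
    then have "set_integrable lborel (box l u) f"
      by (rule set_integrable_subset) (simp_all add: box_subset_cbox)
    then have F: "integrable lborel F" unfolding F_def set_integrable_def by simp
    have "(\<integral>x. indicator (box a b) x * F x \<partial>lborel) = 0" for a b :: 'a
    proof -
      obtain c d where cd: "box a b \<inter> box l u = box c d" using box_Int_box[of a b l u] by blast
      have eq: "(\<lambda>x. indicator (box a b) x * F x) = (\<lambda>x. indicator (box c d) x * f x)"
        unfolding F_def cd[symmetric] by (auto simp: indicator_def)
      show ?thesis
      proof (cases "box c d = {}")
        case True
        then show ?thesis unfolding eq by simp
      next
        case False
        then have le: "\<And>b. b \<in> Basis \<Longrightarrow> c \<bullet> b \<le> d \<bullet> b" by (auto simp: box_ne_empty less_imp_le)
        have "closure (box c d) \<subseteq> closure (box l u)" using cd closure_mono[of "box c d" "box l u"] by auto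
        then have cs: "cbox c d \<subseteq> cbox l u"
          using False closure_box[of c d] closure_minimal[OF box_subset_cbox closed_cbox, of l u] by auto
        have "(\<lambda>n. \<integral>x. f x * box_bump c d n x \<partial>lborel) \<longlonglongrightarrow> (\<integral>x. indicator (box c d) x * f x \<partial>lborel)"
        proof (rule integral_dominated_convergence[where w="\<lambda>x. norm (indicator (cbox l u) x * f x)"])
          have Cm: "(\<lambda>x. indicator (cbox l u) x * f x) \<in> borel_measurable lborel"
            using C unfolding set_integrable_def by auto
          have "(\<lambda>x. indicator (box c d) x * (indicator (cbox l u) x * f x)) \<in> borel_measurable lborel"
            using Cm by measurable
          moreover have "(\<lambda>x. indicator (box c d) x * (indicator (cbox l u) x * f x)) = (\<lambda>x. indicator (box c d) x * f x)"
            using cs box_subset_cbox[of c d] by (auto simp: fun_eq_iff split: split_indicator)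
          ultimately show "(\<lambda>x. indicator (box c d) x * f x) \<in> borel_measurable lborel" by simp
          have bm: "box_bump c d n \<in> borel_measurable borel" for n
            using smooth_on_imp_continuous_on[OF box_bump_smooth] by (rule borel_measurable_continuous_onI)
          have z: "box_bump c d n x = 0" if "x \<notin> cbox l u" for n x
            using box_bump_support[OF le, of x] that cs box_subset_cbox[of c d] by auto
          have "(\<lambda>x. (indicator (cbox l u) x * f x) * box_bump c d n x) \<in> borel_measurable lborel" for n
            using Cm bm[of n] by measurable
          moreover have "(\<lambda>x. (indicator (cbox l u) x * f x) * box_bump c d n x) = (\<lambda>x. f x * box_bump c d n x)" for n
            using z[of _ n] by (auto simp: indicator_def fun_eq_iff)
          ultimately show "(\<lambda>x. f x * box_bump c d n x) \<in> borel_measurable lborel" for n by simp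
          show "integrable lborel (\<lambda>x. norm (indicator (cbox l u) x * f x))"
            using C unfolding set_integrable_def by simp
          show "AE x in lborel. (\<lambda>n. f x * box_bump c d n x) \<longlonglongrightarrow> indicator (box c d) x * f x"
            using box_bump_tendsto[OF le] by (auto intro!: AE_I2 tendsto_eq_intros)
          show "AE x in lborel. norm (f x * box_bump c d n x) \<le> norm (indicator (cbox l u) x * f x)" for n
          proof (rule AE_I2)
            fix x
            show "norm (f x * box_bump c d n x) \<le> norm (indicator (cbox l u) x * f x)"
              using z[of x n] box_bump_nonneg[of c d n x] box_bump_le_1[of c d n x]
                mult_left_mono[of "box_bump c d n x" 1 "\<bar>f x\<bar>"]
              by (cases "x \<in> cbox l u") (auto simp: abs_mult)
          qed
        qed
        moreover have "(\<integral>x. f x * box_bump c d n x \<partial>lborel) = 0" for n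
          by (rule zero[OF box_bump_test_function[OF le]]) (use cs sub in auto)
        ultimately show ?thesis unfolding eq by (simp add: LIMSEQ_const_iff)
      qed
    qed
    from AE_zero_box_integrals[OF F this] show ?thesis
      by eventually_elim (auto simp: F_def)
  qed
  have cb: "AE x in lborel. x \<in> X \<longrightarrow> f x = 0" if X: "X \<subseteq> S" "\<exists>a b. X = cbox a b" for X
  proof -
    obtain a b where ab: "X = cbox a b" using X by blast
    \<comment> \<open>The bumps only see open boxes; the faces of the closed boxes in the countable
      cover form a null set.\<close>
    have "negligible (cbox a b - box a b)" by (rule negligible_frontier_interval)
    then have "cbox a b - box a b \<in> null_sets lborel"
      using null_sets_completion_iff[of "cbox a b - box a b" lborel] by (simp add: negligible_iff_null_sets)
    then have "AE x in lborel. x \<notin> cbox a b - box a b" by (rule AE_not_in)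
    with bx[of a b] X ab show ?thesis by auto
  qed
  obtain D where D: "countable D" "D \<subseteq> Pow S" "\<And>X. X \<in> D \<Longrightarrow> \<exists>a b. X = cbox a b" "\<Union>D = S"
    using open_countable_Union_open_cbox[OF S] by metis
  have "AE x in lborel. \<forall>X\<in>D. x \<in> X \<longrightarrow> f x = 0"
    using D(1) by (subst AE_ball_countable) (use D cb in auto)
  then show ?thesis by eventually_elim (use D(4) in auto)
qed

section \<open>Legendre transforms\<close>

text \<open>Here \<open>x\<close> is a point of a chart, \<open>\<Lambda>\<close> the Lagrangian, \<open>P\<close> its fibre derivative, and \<open>fenchel\<close> the
  Hamiltonian with fibre derivative \<open>Q\<close>.\<close>

locale legendre_family =
  fixes S :: "'x::euclidean_space set" and \<Lambda> :: "'x \<Rightarrow> 'e::euclidean_space \<Rightarrow> real" and P :: "'x \<Rightarrow> 'e \<Rightarrow> 'e"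
  assumes S_open: "open S"
    and der: "\<And>x v. x \<in> S \<Longrightarrow> (\<Lambda> x has_derivative (\<lambda>h. P x v \<bullet> h)) (at v)"
    and P_cont: "continuous_on (S \<times> UNIV) (\<lambda>(x, v). P x v)"
    and \<Lambda>_cont: "continuous_on (S \<times> UNIV) (\<lambda>(x, v). \<Lambda> x v)"
    and P_mono: "\<And>x v w. x \<in> S \<Longrightarrow> v \<noteq> w \<Longrightarrow> 0 < (P x v - P x w) \<bullet> (v - w)"
begin

definition fenchel_e :: "'x \<Rightarrow> 'e \<Rightarrow> ereal" where
  "fenchel_e x a = (SUP w. ereal (a \<bullet> w - \<Lambda> x w))"

definition fenchel :: "'x \<Rightarrow> 'e \<Rightarrow> real" where
  "fenchel x a = real_of_ereal (fenchel_e x a)"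

lemma P_cont_slice: "x \<in> S \<Longrightarrow> continuous_on UNIV (P x)"
proof -
  assume x: "x \<in> S"
  have "continuous_on UNIV (\<lambda>v. (x, v))" by (intro continuous_intros)
  then have "continuous_on UNIV (\<lambda>v. (\<lambda>(x, v). P x v) (x, v))"
    by (rule continuous_on_compose2[OF P_cont]) (use x in auto)
  then show ?thesis by simp
qed

lemma P_inj: "x \<in> S \<Longrightarrow> inj (P x)"
  by (rule injI) (metis P_mono diff_self inner_zero_left less_irrefl)

text \<open>The mean value theorem along the segment, with strict monotonicity of P at the
  intermediate point.\<close>

lemma tangent_less:
  assumes x: "x \<in> S" and vw: "v \<noteq> w"
  shows "\<Lambda> x v + P x v \<bullet> (w - v) < \<Lambda> x w"
proof -
  define \<phi> where "\<phi> t = \<Lambda> x (v + t *\<^sub>R (w - v))" for t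
  have d: "(\<phi> has_real_derivative (P x (v + t *\<^sub>R (w - v)) \<bullet> (w - v))) (at t)" for t
  proof -
    have "((\<lambda>t. v + t *\<^sub>R (w - v)) has_derivative (\<lambda>h. h *\<^sub>R (w - v))) (at t)"
      by (auto intro!: derivative_eq_intros)
    from has_derivative_compose[OF this der[OF x]]
    show ?thesis unfolding \<phi>_def has_field_derivative_def by (simp add: mult_commute_abs)
  qed
  obtain \<theta> where \<theta>: "0 < \<theta>" "\<theta> < 1" "\<phi> 1 - \<phi> 0 = (1 - 0) * (P x (v + \<theta> *\<^sub>R (w - v)) \<bullet> (w - v))"
    using MVT2[of 0 1 \<phi> "\<lambda>t. P x (v + t *\<^sub>R (w - v)) \<bullet> (w - v)"] d by auto
  have "0 < (P x (v + \<theta> *\<^sub>R (w - v)) - P x v) \<bullet> (v + \<theta> *\<^sub>R (w - v) - v)"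
    by (rule P_mono[OF x]) (use \<theta> vw in auto)
  then have "0 < \<theta> * ((P x (v + \<theta> *\<^sub>R (w - v)) - P x v) \<bullet> (w - v))" by simp
  then have "P x v \<bullet> (w - v) < P x (v + \<theta> *\<^sub>R (w - v)) \<bullet> (w - v)"
    using \<theta> by (simp add: zero_less_mult_iff inner_diff_left)
  then show ?thesis using \<theta>(3) unfolding \<phi>_def by simp
qed

lemma tangent_le:
  assumes "x \<in> S" shows "\<Lambda> x v + P x v \<bullet> (w - v) \<le> \<Lambda> x w"
  using tangent_less[OF assms, of v w] by (cases "v = w") auto

lemma fenchel_e_lower: "ereal (a \<bullet> w - \<Lambda> x w) \<le> fenchel_e x a"
  unfolding fenchel_e_def by (rule SUP_upper) simp

lemma fenchel_e_P:
  assumes x: "x \<in> S" shows "fenchel_e x (P x v) = ereal (P x v \<bullet> v - \<Lambda> x v)"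
proof (rule antisym)
  show "fenchel_e x (P x v) \<le> ereal (P x v \<bullet> v - \<Lambda> x v)"
    unfolding fenchel_e_def
    using tangent_le[OF x, of v] by (intro SUP_least) (simp add: inner_diff_right algebra_simps)
qed (rule fenchel_e_lower)

lemma fenchel_P: "x \<in> S \<Longrightarrow> fenchel x (P x v) = P x v \<bullet> v - \<Lambda> x v"
  by (simp add: fenchel_def fenchel_e_P)

text \<open>P is only continuous, so no inverse function theorem applies. Instead, at a = P w the
  supremum is explicit and the first-order remainder equals \<Lambda> v - \<Lambda> w - P w (v - w).
  It lies between 0 and (P w - P v) (w - v), hence is at most |a - P v| |w - v|. Invariance of
  domain makes the range of P open and its inverse continuous, so w tends to v. Surjectivity of P is
  not assumed here.\<close>

lemma fenchel_has_derivative: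
  assumes x: "x \<in> S" shows "(fenchel x has_derivative (\<lambda>h. v \<bullet> h)) (at (P x v))"
proof -
  have op: "open (range (P x))"
    by (rule invariance_of_domain[OF P_cont_slice[OF x] open_UNIV P_inj[OF x]])
  define q where "q = inv (P x)"
  have qP: "q (P x w) = w" for w unfolding q_def using P_inj[OF x] by simp
  have qc: "continuous_on (range (P x)) q"
    unfolding q_def by (rule continuous_on_inverse_open[OF open_UNIV P_cont_slice[OF x]]) (use P_inj[OF x] in auto)
  have "isCont q (P x v)" using qc op by (simp add: continuous_on_eq_continuous_at)
  then have "(q \<longlongrightarrow> v) (at (P x v))" by (simp add: isCont_def qP)
  then have lim: "((\<lambda>a. norm (q a - v)) \<longlongrightarrow> 0) (at (P x v))"
    using LIM_zero_iff[of q v] tendsto_norm_zero by blast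
  have est: "norm (fenchel x a - fenchel x (P x v) - v \<bullet> (a - P x v)) / norm (a - P x v) \<le> norm (q a - v)"
    if a: "a \<in> range (P x)" "a \<noteq> P x v" for a
  proof -
    obtain w where w: "a = P x w" using a by auto
    have 1: "fenchel x a - fenchel x (P x v) - v \<bullet> (a - P x v) = \<Lambda> x v - \<Lambda> x w - P x w \<bullet> (v - w)"
      using x by (simp add: w fenchel_P inner_diff_left inner_diff_right inner_commute)
    have lo: "0 \<le> \<Lambda> x v - \<Lambda> x w - P x w \<bullet> (v - w)" using tangent_le[OF x, of w v] by simp
    have "\<Lambda> x v - \<Lambda> x w - P x w \<bullet> (v - w) \<le> (P x w - P x v) \<bullet> (w - v)"
      using tangent_le[OF x, of v w] by (simp add: inner_diff_left inner_diff_right)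
    also have "\<dots> \<le> norm (P x w - P x v) * norm (w - v)" by (rule norm_cauchy_schwarz)
    finally have "norm (fenchel x a - fenchel x (P x v) - v \<bullet> (a - P x v)) \<le> norm (a - P x v) * norm (q a - v)"
      unfolding 1 using lo by (simp add: w qP)
    then show ?thesis using a by (simp add: field_simps)
  qed
  have "((\<lambda>a. norm (fenchel x a - fenchel x (P x v) - v \<bullet> (a - P x v)) / norm (a - P x v)) \<longlongrightarrow> 0) (at (P x v))"
  proof (rule Lim_null_comparison[OF _ lim])
    have "\<forall>\<^sub>F a in at (P x v). a \<in> range (P x)"
      using op by (intro eventually_at_in_open') auto
    moreover have "\<forall>\<^sub>F a in at (P x v). a \<noteq> P x v" by (rule eventually_neq_at_within)
    ultimately show "\<forall>\<^sub>F a in at (P x v). norm (norm (fenchel x a - fenchel x (P x v) - v \<bullet> (a - P x v)) / norm (a - P x v)) \<le> norm (q a - v)"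
      by eventually_elim (use est in auto)
  qed
  then show ?thesis
    by (simp add: has_derivative_iff_norm bounded_linear_inner_right)
qed

text \<open>The range of P is open by invariance of domain. It is closed because the growth bound
  keeps the preimages of a convergent sequence bounded, so that a subsequence converges.
  Connectedness of the space concludes.\<close>

lemma P_surj:
  assumes x: "x \<in> S" and bd: "\<And>v. norm v \<le> B + C * norm (P x v)"
  shows "surj (P x)"
proof -
  have "open (range (P x))"
    by (rule invariance_of_domain[OF P_cont_slice[OF x] open_UNIV P_inj[OF x]])
  moreover have "closed (range (P x))"
    unfolding closed_sequential_limits
  proof (intro allI impI, elim conjE)
    fix a :: "nat \<Rightarrow> 'e" and l assume a: "\<forall>n. a n \<in> range (P x)" and l: "a \<longlonglongrightarrow> l"
    have "\<forall>n. \<exists>v. a n = P x v" using a by (simp add: image_iff)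
    then obtain v where v: "\<And>n. a n = P x (v n)" by (auto dest!: choice)
    obtain K where K: "\<And>n. norm (a n) \<le> K" using convergent_imp_Bseq[of a] l by (auto simp: convergent_def Bseq_def)
    have "norm (v n) \<le> B + \<bar>C\<bar> * K" for n
    proof -
      have "C * norm (P x (v n)) \<le> \<bar>C\<bar> * norm (P x (v n))" by (intro mult_right_mono) auto
      also have "\<dots> \<le> \<bar>C\<bar> * K" using K[of n] v by (intro mult_left_mono) auto
      finally show ?thesis using bd[of "v n"] by simp
    qed
    then have "bounded (range v)" by (auto simp: bounded_iff)
    then obtain w r where r: "strict_mono (r :: nat \<Rightarrow> nat)" "(v \<circ> r) \<longlonglongrightarrow> w"
      using bounded_imp_convergent_subsequence[of v] by blast
    have "(\<lambda>n. P x ((v \<circ> r) n)) \<longlonglongrightarrow> P x w"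
      using P_cont_slice[OF x] r(2) by (rule continuous_on_tendsto_compose) auto
    moreover have "(\<lambda>n. P x ((v \<circ> r) n)) \<longlonglongrightarrow> l"
      using LIMSEQ_subseq_LIMSEQ[OF l r(1)] by (simp add: o_def v)
    ultimately have "P x w = l" by (rule LIMSEQ_unique)
    then show "l \<in> range (P x)" by auto
  qed
  ultimately show ?thesis using clopen[of "range (P x)"] by auto
qed

end

locale legendre_full = legendre_family +
  assumes surj: "\<And>x. x \<in> S \<Longrightarrow> surj (P x)" and \<Lambda>_zero: "\<And>x. x \<in> S \<Longrightarrow> \<Lambda> x 0 = 0"
begin

definition Q :: "'a \<Rightarrow> 'b \<Rightarrow> 'b" where "Q x = inv (P x)"

lemma P_Q: "x \<in> S \<Longrightarrow> P x (Q x a) = a"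
  unfolding Q_def using surj by (simp add: surj_f_inv_f)

lemma fenchel_eq: "x \<in> S \<Longrightarrow> fenchel x a = a \<bullet> Q x a - \<Lambda> x (Q x a)"
  using fenchel_P[of x "Q x a"] by (simp add: P_Q)

lemma fenchel_e_eq: "x \<in> S \<Longrightarrow> fenchel_e x a = ereal (fenchel x a)"
  using fenchel_e_P[of x "Q x a"] by (simp add: P_Q fenchel_def)

lemma fenchel_derivative: "x \<in> S \<Longrightarrow> (fenchel x has_derivative (\<lambda>h. Q x a \<bullet> h)) (at a)"
  using fenchel_has_derivative[of x "Q x a"] by (simp add: P_Q)

lemma fenchel_lower: "x \<in> S \<Longrightarrow> a \<bullet> w - \<Lambda> x w \<le> fenchel x a"
  using fenchel_e_lower[of a w x] by (simp add: fenchel_e_eq)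

lemma fenchel_nonneg: "x \<in> S \<Longrightarrow> 0 \<le> fenchel x a"
  using fenchel_lower[of x a 0] by (simp add: \<Lambda>_zero)

text \<open>Joint continuity comes from inverting (x, v) \<mapsto> (x, P x v) as one injective
  continuous map on an open set of the product space; slicewise continuity of the inverses would not
  suffice.\<close>

lemma Q_cont: "continuous_on (S \<times> UNIV) (\<lambda>(x, a). Q x a)"
proof -
  define \<Psi> where "\<Psi> = (\<lambda>(x, v). (x, P x v))"
  have c: "continuous_on (S \<times> UNIV) \<Psi>"
    unfolding \<Psi>_def split_beta' using P_cont by (auto intro!: continuous_intros simp: split_beta')
  have inj: "inj_on \<Psi> (S \<times> UNIV)"
    unfolding \<Psi>_def inj_on_def using P_inj by (auto dest: injD)
  have im: "\<Psi> ` (S \<times> UNIV) = S \<times> UNIV"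
    unfolding \<Psi>_def using P_Q by (auto simp: image_iff) metis
  have "continuous_on (\<Psi> ` (S \<times> UNIV)) (inv_into (S \<times> UNIV) \<Psi>)"
    by (rule continuous_on_inverse_open[OF _ c]) (use inj in \<open>auto simp: S_open open_Times\<close>)
  then have "continuous_on (S \<times> UNIV) (\<lambda>z. snd (inv_into (S \<times> UNIV) \<Psi> z))"
    unfolding im by (intro continuous_intros)
  moreover have "snd (inv_into (S \<times> UNIV) \<Psi> z) = (\<lambda>(x, a). Q x a) z" if zS: "z \<in> S \<times> UNIV" for z
  proof -
    obtain x a where z: "z = (x, a)" "x \<in> S" using zS by (cases z) auto
    have "inv_into (S \<times> UNIV) \<Psi> (\<Psi> (x, Q x a)) = (x, Q x a)"
      using inj z by (intro inv_into_f_f) auto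
    then show ?thesis using z by (simp add: \<Psi>_def P_Q)
  qed
  ultimately show ?thesis by (simp cong: continuous_on_cong)
qed

lemma fenchel_cont: "continuous_on (S \<times> UNIV) (\<lambda>(x, a). fenchel x a)"
proof -
  have "continuous_on (S \<times> UNIV) (\<lambda>z. (fst z, (\<lambda>(x, a). Q x a) z))"
    by (intro continuous_intros Q_cont)
  then have "continuous_on (S \<times> UNIV) (\<lambda>z. (\<lambda>(x, v). \<Lambda> x v) (fst z, (\<lambda>(x, a). Q x a) z))"
    by (rule continuous_on_compose2[OF \<Lambda>_cont]) auto
  then have "continuous_on (S \<times> UNIV) (\<lambda>z. snd z \<bullet> (\<lambda>(x, a). Q x a) z - (\<lambda>(x, v). \<Lambda> x v) (fst z, (\<lambda>(x, a). Q x a) z))"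
    by (intro continuous_intros Q_cont)
  moreover have "snd z \<bullet> (\<lambda>(x, a). Q x a) z - (\<lambda>(x, v). \<Lambda> x v) (fst z, (\<lambda>(x, a). Q x a) z) = (\<lambda>(x, a). fenchel x a) z"
    if "z \<in> S \<times> UNIV" for z using that by (auto simp: fenchel_eq)
  ultimately show ?thesis by (simp cong: continuous_on_cong)
qed

text \<open>Strict convexity dualizes: by the Fenchel equalities this is the strict tangent
  inequality of \<Lambda> at Q x b, evaluated at Q x a.\<close>

lemma fenchel_tangent_less:
  assumes x: "x \<in> S" and ab: "a \<noteq> b"
  shows "fenchel x a + Q x a \<bullet> (b - a) < fenchel x b"
proof -
  have "Q x a \<noteq> Q x b" using P_Q[OF x] ab by metis
  then have "\<Lambda> x (Q x b) + P x (Q x b) \<bullet> (Q x a - Q x b) < \<Lambda> x (Q x a)"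
    by (intro tangent_less[OF x]) auto
  moreover have "Q x a \<bullet> (b - a) = b \<bullet> Q x a - a \<bullet> Q x a" by (simp add: inner_diff_right inner_commute[of "Q x a"])
  ultimately show ?thesis using x by (simp add: fenchel_eq P_Q inner_diff_right)
qed

lemma fenchel_tangent: "x \<in> S \<Longrightarrow> fenchel x a + Q x a \<bullet> (b - a) \<le> fenchel x b"
  using fenchel_tangent_less[of x a b] by (cases "a = b") auto

lemma fenchel_midpoint:
  assumes x: "x \<in> S" and ab: "a \<noteq> b"
  shows "fenchel x ((1/2) *\<^sub>R a + (1/2) *\<^sub>R b) < (fenchel x a + fenchel x b) / 2"
proof -
  define c where "c = (1/2) *\<^sub>R a + (1/2) *\<^sub>R b"
  have s: "(a - c) + (b - c) = 0"
    unfolding c_def by (simp add: algebra_simps flip: scaleR_left_distrib)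
  have "c \<noteq> a"
  proof
    assume "c = a"
    then have "a = b" using s by simp
    then show False using ab by simp
  qed
  then have "fenchel x c + Q x c \<bullet> (a - c) < fenchel x a" by (rule fenchel_tangent_less[OF x])
  moreover have "fenchel x c + Q x c \<bullet> (b - c) \<le> fenchel x b" by (rule fenchel_tangent[OF x])
  moreover have "Q x c \<bullet> (a - c) + Q x c \<bullet> (b - c) = 0" by (simp only: s inner_add_right[symmetric] inner_zero_right)
  moreover have "r < (t + u) / 2" if "r + p < t" "r + q \<le> u" "p + q = 0" for p q r t u :: real
    using that by simp
  ultimately show ?thesis unfolding c_def by blast
qed

text \<open>Test the supremum with the vector of length R in the direction of a; \<Lambda> is
  bounded on the product of K with the ball of radius R.\<close>

lemma fenchel_superlinear:
  assumes K: "compact K" "K \<subseteq> S" and R: "R \<ge> 0"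
  shows "\<exists>C. \<forall>x\<in>K. \<forall>a. R * norm a - C \<le> fenchel x a"
proof -
  have "compact ((\<lambda>(x, v). \<Lambda> x v) ` (K \<times> cball 0 R))"
    using K by (intro compact_continuous_image continuous_on_subset[OF \<Lambda>_cont] compact_Times compact_cball) auto
  then obtain C where C: "\<And>x v. x \<in> K \<Longrightarrow> norm v \<le> R \<Longrightarrow> norm (\<Lambda> x v) \<le> C"
    by (fastforce dest!: compact_imp_bounded simp: bounded_iff)
  have "R * norm a - C \<le> fenchel x a" if x: "x \<in> K" for x a
  proof -
    have "a \<bullet> (R *\<^sub>R sgn a) = R * norm a"
      by (cases "a = 0") (auto simp: sgn_div_norm power2_norm_eq_inner[symmetric] power2_eq_square)
    moreover have "\<Lambda> x (R *\<^sub>R sgn a) \<le> C" using C[OF x, of "R *\<^sub>R sgn a"] R by (cases "a = 0") (auto simp: norm_sgn)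
    ultimately show ?thesis using fenchel_lower[of x a "R *\<^sub>R sgn a"] x K by auto
  qed
  then show ?thesis by blast
qed

text \<open>Uniform convexity in the form used for the Cauchy property of minimizing sequences: a small
  midpoint defect forces two covectors to be close, up to a small multiple of the energy density.\<close>

lemma fenchel_uniform_convex:
  assumes K: "compact K" "K \<subseteq> S" and \<eta>: "\<eta> > 0"
  shows "\<exists>\<kappa>\<ge>0. \<forall>x\<in>K. \<forall>a b. norm (a - b) \<le> \<eta> * (1 + fenchel x a + fenchel x b) +
    \<kappa> * ((fenchel x a + fenchel x b) / 2 - fenchel x ((1/2) *\<^sub>R a + (1/2) *\<^sub>R b))"
proof -
  define d where "d x a b = (fenchel x a + fenchel x b) / 2 - fenchel x ((1/2) *\<^sub>R a + (1/2) *\<^sub>R b)" for x a b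
  have d0: "0 \<le> d x a b" if "x \<in> S" for x a b
  proof (cases "a = b")
    case True then show ?thesis by (simp add: d_def flip: scaleR_left_distrib)
  next
    case False then show ?thesis using fenchel_midpoint[OF that False] by (simp add: d_def)
  qed
  \<comment> \<open>The slope 4 / \<eta> and the radius R = |C| \<eta> + 1 are matched: beyond R the
    constant C costs at most half of the slope, which leaves |a| \<le> (\<eta> / 2)
    \<open>fenchel x a\<close>. The longer of a and b then controls |a - b|.\<close>
  obtain C where C: "\<And>x a. x \<in> K \<Longrightarrow> (4 / \<eta>) * norm a - C \<le> fenchel x a"
    using fenchel_superlinear[OF K, of "4 / \<eta>"] \<eta> by auto
  define R where "R = \<bar>C\<bar> * \<eta> + 1"
  have R: "R > 0" unfolding R_def using \<eta> by (simp add: add_nonneg_pos)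
  have big: "norm a \<le> \<eta> / 2 * fenchel x a" if "x \<in> K" "norm a > R" for x a
  proof -
    have "C * \<eta> \<le> norm a * 2"
    proof -
      have "C * \<eta> \<le> \<bar>C\<bar> * \<eta>" using \<eta> by (intro mult_right_mono) auto
      moreover have "\<bar>C\<bar> * \<eta> + 1 < norm a" using that(2) unfolding R_def .
      ultimately show ?thesis using norm_ge_zero[of a] by linarith
    qed
    moreover have "4 * norm a - C * \<eta> \<le> \<eta> * fenchel x a"
      using C[OF that(1), of a] \<eta> by (simp add: field_simps)
    ultimately show ?thesis by simp
  qed
  \<comment> \<open>The remaining pairs: both covectors in the ball, at distance at least \<eta>. On
    this compact set the defect has a positive minimum k by strict convexity, so 2 R / k times the
    defect exceeds the diameter 2 R.\<close>
  define T where "T = (K \<times> cball 0 R \<times> (cball 0 R :: 'b set)) \<inter> {z. \<eta> \<le> norm (fst (snd z) - snd (snd z))}"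
  have T: "compact T"
    unfolding T_def by (auto intro!: compact_Int_closed compact_Times K closed_Collect_le continuous_intros)
  have dc: "continuous_on T (\<lambda>(x, a, b). d x a b)"
  proof -
    have sub: "\<And>z. z \<in> T \<Longrightarrow> fst z \<in> S" using K by (auto simp: T_def)
    have c: "continuous_on T (\<lambda>z. fenchel (fst z) (f z))" if "continuous_on T f" for f
    proof -
      have "continuous_on T (\<lambda>z. (\<lambda>(x, a). fenchel x a) (fst z, f z))"
        by (rule continuous_on_compose2[OF fenchel_cont, of T "\<lambda>z. (fst z, f z)"]) (use that sub in \<open>auto intro!: continuous_intros\<close>)
      then show ?thesis by simp
    qed
    show ?thesis unfolding d_def split_beta' by (intro continuous_intros c) auto
  qed
  obtain k where k: "k > 0" "\<And>x a b. (x, a, b) \<in> T \<Longrightarrow> k \<le> d x a b"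
  proof (cases "T = {}")
    case True then show ?thesis using that[of 1] by auto
  next
    case False
    obtain z where z: "z \<in> T" "\<And>y. y \<in> T \<Longrightarrow> (\<lambda>(x, a, b). d x a b) z \<le> (\<lambda>(x, a, b). d x a b) y"
      using continuous_attains_inf[OF T False dc] by blast
    obtain x a b where zz: "z = (x, a, b)" by (cases z) auto
    have "x \<in> S" "a \<noteq> b" using z(1) K \<eta> unfolding zz T_def by auto
    then have "0 < d x a b" using fenchel_midpoint by (simp add: d_def)
    then show ?thesis using that[of "d x a b"] z(2) unfolding zz by auto
  qed
  have "norm (a - b) \<le> \<eta> * (1 + fenchel x a + fenchel x b) + (2 * R / k) * d x a b" if x: "x \<in> K" for x a b
  proof -
    have xS: "x \<in> S" using x K by auto
    have n: "0 \<le> fenchel x a" "0 \<le> fenchel x b" "0 \<le> d x a b" using fenchel_nonneg[OF xS] d0[OF xS] by auto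
    have n2: "0 \<le> (2 * R / k) * d x a b" using n R k by simp
    have n3: "0 \<le> \<eta> * fenchel x a" "0 \<le> \<eta> * fenchel x b" using n \<eta> by auto
    have tri: "norm (a - b) \<le> norm a + norm b" by (rule norm_triangle_ineq4)
    consider (A) "norm a > R" "norm b \<le> norm a" | (B) "norm b > R" "norm a \<le> norm b" | (C) "norm a \<le> R" "norm b \<le> R" by linarith
    then show ?thesis
    proof cases
      case A
      then show ?thesis using big[OF x A(1)] tri n2 n3 \<eta> by (simp add: distrib_left)
    next
      case B
      then show ?thesis using big[OF x B(1)] tri n2 n3 \<eta> by (simp add: distrib_left)
    next
      case C
      show ?thesis
      proof (cases "norm (a - b) < \<eta>")
        case True
        then show ?thesis using n2 n3 by (simp add: distrib_left)
      next
        case False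
        then have "(x, a, b) \<in> T" using C x by (auto simp: T_def)
        then have "2 * R \<le> (2 * R / k) * d x a b" using k R by (simp add: field_simps)
        then show ?thesis using tri C n3 \<eta> by (simp add: distrib_left)
      qed
    qed
  qed
  then show ?thesis unfolding d_def using R k by (intro exI[of _ "2 * R / k"]) auto
qed

end

section \<open>The space of square integrable functions\<close>

text \<open>The pointwise vector space structure lets square integrable functions be a subspace of a
  real vector space, as \<open>semi_hilbert\<close> requires.\<close>

instantiation "fun" :: (type, real_vector) real_vector
begin

definition scaleR_fun_def: "r *\<^sub>R f = (\<lambda>x. r *\<^sub>R f x)"

instance
  by standard (simp_all add: scaleR_fun_def fun_eq_iff scaleR_add_right scaleR_add_left)

end

lemma scaleR_fun_apply [simp]: "(r *\<^sub>R f) x = r *\<^sub>R f x"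
  by (simp add: scaleR_fun_def)

text \<open>Fatou's lemma in the form that serves both the completeness of L2 and the lower
  semicontinuity of the energy.\<close>

lemma fatou_bound:
  fixes f :: "nat \<Rightarrow> 'a \<Rightarrow> real"
  assumes f: "\<And>k. integrable M (f k)" "\<And>k. AE x in M. 0 \<le> f k x" "\<And>k. (\<integral>x. f k x \<partial>M) \<le> B"
    and g: "g \<in> borel_measurable M" and lim: "AE x in M. (\<lambda>k. f k x) \<longlonglongrightarrow> g x"
  shows "integrable M g" "(\<integral>x. g x \<partial>M) \<le> B"
proof -
  have all: "AE x in M. \<forall>k. 0 \<le> f k x" using f(2) by (simp add: AE_all_countable)
  have g0: "AE x in M. 0 \<le> g x"
    using all lim by eventually_elim (auto intro: LIMSEQ_le_const)
  have B0: "0 \<le> B" using integral_nonneg_AE[OF f(2)[of 0]] f(3)[of 0] by simp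
  have "(\<integral>\<^sup>+x. ennreal (g x) \<partial>M) = (\<integral>\<^sup>+x. liminf (\<lambda>k. ennreal (f k x)) \<partial>M)"
  proof (rule nn_integral_cong_AE)
    show "AE x in M. ennreal (g x) = liminf (\<lambda>k. ennreal (f k x))"
      using lim by eventually_elim (metis lim_imp_Liminf sequentially_bot tendsto_ennrealI)
  qed
  also have "\<dots> \<le> liminf (\<lambda>k. \<integral>\<^sup>+x. ennreal (f k x) \<partial>M)"
    using f(1) by (intro nn_integral_liminf) auto
  also have "\<dots> \<le> ennreal B"
  proof -
    have "(\<integral>\<^sup>+x. ennreal (f k x) \<partial>M) \<le> ennreal B" for k
      using nn_integral_eq_integral[OF f(1) f(2)] f(3)[of k] by (simp add: ennreal_leI)
    then have "liminf (\<lambda>k. \<integral>\<^sup>+x. ennreal (f k x) \<partial>M) \<le> liminf (\<lambda>k. ennreal B)"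
      by (intro Liminf_mono) auto
    then show ?thesis by (simp add: Liminf_const)
  qed
  finally have le: "(\<integral>\<^sup>+x. ennreal (g x) \<partial>M) \<le> ennreal B" .
  show i: "integrable M g"
  proof (rule integrableI_nonneg[OF g g0])
    show "(\<integral>\<^sup>+x. ennreal (g x) \<partial>M) < \<infinity>" using le by (simp add: le_less_trans)
  qed
  show "(\<integral>x. g x \<partial>M) \<le> B"
    using le B0 unfolding nn_integral_eq_integral[OF i g0] by simp
qed

text \<open>The Riesz-Fischer argument: along a subsequence with L1 gaps below 2^(-k) the sum of the
  pointwise gaps has finite integral, so it is finite almost everywhere and the telescoping series
  converges.\<close>

lemma L1_Cauchy_AE_subseq:
  fixes f :: "nat \<Rightarrow> 'a \<Rightarrow> 'b::{banach, second_countable_topology}"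
  assumes f: "\<And>k. integrable M (f k)"
    and C: "\<And>e. e > 0 \<Longrightarrow> \<exists>N. \<forall>i\<ge>N. \<forall>j\<ge>N. (\<integral>x. norm (f i x - f j x) \<partial>M) < e"
  obtains r g where "strict_mono (r :: nat \<Rightarrow> nat)" "g \<in> borel_measurable M" "AE x in M. (\<lambda>k. f (r k) x) \<longlonglongrightarrow> g x"
proof -
  have "\<forall>k. \<exists>N. \<forall>i\<ge>N. \<forall>j\<ge>N. (\<integral>x. norm (f i x - f j x) \<partial>M) < (1/2)^k"
    using C by simp
  then obtain N where N: "\<And>k i j. i \<ge> N k \<Longrightarrow> j \<ge> N k \<Longrightarrow> (\<integral>x. norm (f i x - f j x) \<partial>M) < (1/2)^k"
    by metis
  \<comment> \<open>The partial sums of N dominate each single N k, and adding k makes the selection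
    strictly increasing.\<close>
  define r where "r k = (\<Sum>i\<le>k. N i) + k" for k
  have sm: "strict_mono r" unfolding r_def by (rule strict_monoI_Suc) simp
  have rN: "r k \<ge> N k" for k unfolding r_def by (cases k) auto
  have rS: "r (Suc k) \<ge> N k" for k using rN[of k] sm by (meson le_trans less_imp_le lessI strict_mono_less)
  define d where "d k x = norm (f (r (Suc k)) x - f (r k) x)" for k x
  have d: "integrable M (d k)" for k unfolding d_def using f by auto
  have dm: "(\<lambda>x. ennreal (d k x)) \<in> borel_measurable M" for k using d by auto
  have "(\<integral>\<^sup>+x. (\<Sum>k. ennreal (d k x)) \<partial>M) = (\<Sum>k. \<integral>\<^sup>+x. ennreal (d k x) \<partial>M)"
    by (rule nn_integral_suminf[OF dm])
  also have "\<dots> \<le> (\<Sum>k. ennreal ((1/2)^k))"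
  proof (intro suminf_le allI)
    fix k
    have "(\<integral>\<^sup>+x. ennreal (d k x) \<partial>M) = ennreal (\<integral>x. d k x \<partial>M)"
      by (rule nn_integral_eq_integral[OF d]) (simp add: d_def)
    also have "\<dots> \<le> ennreal ((1/2)^k)"
      unfolding d_def using N[OF rS rN, of k] by (intro ennreal_leI) auto
    finally show "(\<integral>\<^sup>+x. ennreal (d k x) \<partial>M) \<le> ennreal ((1/2)^k)" .
  qed auto
  also have "\<dots> < \<infinity>"
    by (subst suminf_ennreal2) (auto simp: summable_geometric)
  finally have fin: "(\<integral>\<^sup>+x. (\<Sum>k. ennreal (d k x)) \<partial>M) \<noteq> \<infinity>" by simp
  have "AE x in M. (\<Sum>k. ennreal (d k x)) \<noteq> \<infinity>"
    using nn_integral_PInf_AE[OF _ fin] dm by auto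
  then have conv: "AE x in M. convergent (\<lambda>k. f (r k) x)"
  proof eventually_elim
    case (elim x)
    have "summable (\<lambda>k. d k x)"
      using elim by (intro summable_suminf_not_top) (auto simp: d_def)
    then have "summable (\<lambda>k. f (r (Suc k)) x - f (r k) x)"
      unfolding d_def by (rule summable_norm_cancel)
    then have "convergent (\<lambda>n. \<Sum>k<n. f (r (Suc k)) x - f (r k) x)"
      by (simp add: summable_iff_convergent)
    then have "convergent (\<lambda>n. f (r n) x - f (r 0) x)"
      using sum_lessThan_telescope[of "\<lambda>k. f (r k) x"] by simp
    then obtain l where "(\<lambda>n. f (r n) x - f (r 0) x) \<longlonglongrightarrow> l" by (auto simp: convergent_def)
    from tendsto_add[OF this tendsto_const[of "f (r 0) x"]]
    show ?case by (auto simp: convergent_def)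
  qed
  show ?thesis
  proof (rule that[OF sm])
    show "(\<lambda>x. lim (\<lambda>k. f (r k) x)) \<in> borel_measurable M"
      by (rule borel_measurable_lim_metric) (use f in auto)
    show "AE x in M. (\<lambda>k. f (r k) x) \<longlonglongrightarrow> lim (\<lambda>k. f (r k) x)"
      using conv by eventually_elim (simp add: convergent_LIMSEQ_iff)
  qed
qed

definition L2ip :: "'m measure \<Rightarrow> ('m \<Rightarrow> real) \<Rightarrow> ('m \<Rightarrow> real) \<Rightarrow> real" where
  "L2ip m u v = (\<integral>x. u x * v x \<partial>m)"

lemma L2_mult_integrable:
  assumes "u \<in> L2 m" "v \<in> L2 m" shows "integrable m (\<lambda>x. u x * v x)"
proof (rule Bochner_Integration.integrable_bound)
  show "integrable m (\<lambda>x. (u x)\<^sup>2 + (v x)\<^sup>2)" using assms by (auto simp: L2_def)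
  show "(\<lambda>x. u x * v x) \<in> borel_measurable m" using assms by (auto simp: L2_def)
  have "\<bar>a * b\<bar> \<le> a\<^sup>2 + b\<^sup>2" for a b :: real
  proof -
    have "2 * (\<bar>a\<bar> * \<bar>b\<bar>) \<le> a\<^sup>2 + b\<^sup>2" using sum_squares_bound[of "\<bar>a\<bar>" "\<bar>b\<bar>"] by simp
    moreover have "0 \<le> \<bar>a\<bar> * \<bar>b\<bar>" by simp
    ultimately show ?thesis unfolding abs_mult by linarith
  qed
  then show "AE x in m. norm (u x * v x) \<le> norm ((u x)\<^sup>2 + (v x)\<^sup>2)" by simp
qed

lemma L2_lin:
  assumes "u \<in> L2 m" "v \<in> L2 m" shows "(\<lambda>x. u x + c * v x) \<in> L2 m"
proof -
  have "integrable m (\<lambda>x. (u x)\<^sup>2 + 2 * c * (u x * v x) + c\<^sup>2 * (v x)\<^sup>2)"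
    using assms L2_mult_integrable[OF assms] by (intro Bochner_Integration.integrable_add integrable_mult_right) (auto simp: L2_def)
  moreover have "(u x)\<^sup>2 + 2 * c * (u x * v x) + c\<^sup>2 * (v x)\<^sup>2 = (u x + c * v x)\<^sup>2" for x
    by (simp add: power2_eq_square algebra_simps)
  ultimately show ?thesis using assms by (auto simp: L2_def)
qed

lemma L2_zero: "0 \<in> L2 m"
  by (simp add: L2_def zero_fun_def)

lemma L2_subspace: "subspace (L2 m)"
proof (rule subspaceI)
  show "u + v \<in> L2 m" if "u \<in> L2 m" "v \<in> L2 m" for u v
    using L2_lin[OF that, of 1] by (simp add: plus_fun_def)
  show "c *\<^sub>R u \<in> L2 m" if "u \<in> L2 m" for c u
    using L2_lin[OF L2_zero that, of c] by (simp add: zero_fun_def scaleR_fun_def)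
qed (rule L2_zero)

lemma (in finite_measure) L2_integrable:
  assumes "u \<in> L2 M" shows "integrable M u"
proof (rule Bochner_Integration.integrable_bound)
  show "integrable M (\<lambda>x. (u x)\<^sup>2 + 1)" using assms by (auto simp: L2_def)
  show "u \<in> borel_measurable M" using assms by (auto simp: L2_def)
  have "\<bar>a\<bar> \<le> a\<^sup>2 + 1" for a :: real
    using sum_squares_bound[of "\<bar>a\<bar>" 1] abs_ge_zero[of a] by (simp del: abs_ge_zero)
  then show "AE x in M. norm (u x) \<le> norm ((u x)\<^sup>2 + 1)" by simp
qed

text \<open>On a finite measure space an L2 Cauchy sequence is L1 Cauchy, which yields an almost
  everywhere limit along a subsequence; Fatou's lemma upgrades this to convergence in L2 of the
  whole sequence.\<close>

lemma (in finite_measure) L2_complete: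
  assumes f: "\<And>i. f i \<in> L2 M"
    and C: "\<forall>e>0. \<exists>N. \<forall>i\<ge>N. \<forall>j\<ge>N. L2ip M (f i - f j) (f i - f j) < e"
  shows "\<exists>l\<in>L2 M. (\<lambda>i::nat. L2ip M (f i - l) (f i - l)) \<longlonglongrightarrow> 0"
proof -
  have C': "\<exists>N. \<forall>i\<ge>N. \<forall>j\<ge>N. (\<integral>x. (f i x - f j x)\<^sup>2 \<partial>M) < e" if "e > 0" for e
    using C that by (simp add: L2ip_def power2_eq_square)
  have fd: "(\<lambda>x. f i x - f j x) \<in> L2 M" for i j
    using L2_lin[OF f f, of i "-1" j] by simp
  have fm: "f i \<in> borel_measurable M" for i using f unfolding L2_def by blast
  have fs: "integrable M (\<lambda>x. (f i x - f j x)\<^sup>2)" for i j using fd by (auto simp: L2_def)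
  have L1: "\<exists>N. \<forall>i\<ge>N. \<forall>j\<ge>N. (\<integral>x. norm (f i x - f j x) \<partial>M) < e" if e: "e > 0" for e
  proof -
    \<comment> \<open>With |a| \<le> \<epsilon> / 2 + a^2 / (2 \<epsilon>), a squared distance below
      \<epsilon> e gives an L1 distance below \<epsilon> \<mu>(M) / 2 + e / 2, and this \<epsilon>
      keeps the first summand below e / 2.\<close>
    define \<epsilon> where "\<epsilon> = e / (measure M (space M) + 1)"
    have mm: "measure M (space M) \<ge> 0" by simp
    have \<epsilon>: "\<epsilon> > 0" unfolding \<epsilon>_def using e mm by (intro divide_pos_pos add_nonneg_pos) auto
    obtain N where N: "\<forall>i\<ge>N. \<forall>j\<ge>N. (\<integral>x. (f i x - f j x)\<^sup>2 \<partial>M) < \<epsilon> * e"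
      using C'[of "\<epsilon> * e"] \<epsilon> e by auto
    have "(\<integral>x. norm (f i x - f j x) \<partial>M) < e" if ij: "i \<ge> N" "j \<ge> N" for i j
    proof -
      have "(\<integral>x. norm (f i x - f j x) \<partial>M) \<le> (\<integral>x. \<epsilon> / 2 + (f i x - f j x)\<^sup>2 / (2 * \<epsilon>) \<partial>M)"
      proof (rule integral_mono)
        show "integrable M (\<lambda>x. norm (f i x - f j x))" using L2_integrable[OF fd] by auto
        show "integrable M (\<lambda>x. \<epsilon> / 2 + (f i x - f j x)\<^sup>2 / (2 * \<epsilon>))" using fs by auto
        have "\<bar>a\<bar> \<le> \<epsilon> / 2 + a\<^sup>2 / (2 * \<epsilon>)" for a :: real
        proof -
          have "0 \<le> (\<epsilon> - \<bar>a\<bar>)\<^sup>2" by simp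
          then show ?thesis using \<epsilon> by (simp add: field_simps power2_eq_square)
        qed
        then show "norm (f i x - f j x) \<le> \<epsilon> / 2 + (f i x - f j x)\<^sup>2 / (2 * \<epsilon>)" for x by simp
      qed
      also have "\<dots> = \<epsilon> / 2 * measure M (space M) + (\<integral>x. (f i x - f j x)\<^sup>2 \<partial>M) / (2 * \<epsilon>)"
        using fs by simp
      also have "\<dots> < \<epsilon> / 2 * measure M (space M) + \<epsilon> * e / (2 * \<epsilon>)"
        using N ij \<epsilon> by (intro add_strict_left_mono divide_strict_right_mono) auto
      also have "\<dots> \<le> e"
      proof -
        have "\<epsilon> * (measure M (space M) + 1) = e" unfolding \<epsilon>_def using mm by (simp add: add_nonneg_eq_0_iff)
        then have "\<epsilon> * measure M (space M) \<le> e" using \<epsilon> by (simp add: distrib_left)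
        then show ?thesis using \<epsilon> by simp
      qed
      finally show ?thesis .
    qed
    then show ?thesis by blast
  qed
  obtain r g where r: "strict_mono (r :: nat \<Rightarrow> nat)" and g: "g \<in> borel_measurable M"
    and lim: "AE x in M. (\<lambda>k. f (r k) x) \<longlonglongrightarrow> g x"
    using L1_Cauchy_AE_subseq[of M f, OF L2_integrable[OF f] L1] by blast
  have main: "integrable M (\<lambda>x. (f i x - g x)\<^sup>2) \<and> (\<integral>x. (f i x - g x)\<^sup>2 \<partial>M) \<le> e"
    if N: "\<And>j. j \<ge> N \<Longrightarrow> (\<integral>x. (f i x - f j x)\<^sup>2 \<partial>M) < e" for i N e
  proof -
    have 1: "(\<integral>x. (f i x - f (r (k + N)) x)\<^sup>2 \<partial>M) \<le> e" for k
    proof -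
      have "r (k + N) \<ge> N" using seq_suble[OF r, of "k + N"] by simp
      then show ?thesis using N by (simp add: less_imp_le)
    qed
    have 2: "AE x in M. (\<lambda>k. (f i x - f (r (k + N)) x)\<^sup>2) \<longlonglongrightarrow> (f i x - g x)\<^sup>2"
      using lim
    proof eventually_elim
      case (elim x)
      from LIMSEQ_ignore_initial_segment[OF elim, of N]
      show ?case by (intro tendsto_power tendsto_diff tendsto_const)
    qed
    have 3: "(\<lambda>x. (f i x - g x)\<^sup>2) \<in> borel_measurable M"
      by (intro borel_measurable_power borel_measurable_diff fm g)
    have 4: "AE x in M. 0 \<le> (f i x - f (r (k + N)) x)\<^sup>2" for k by simp
    show ?thesis using fatou_bound[OF fs 4 1 3 2] by blast
  qed
  obtain N0 where N0: "\<forall>i\<ge>N0. \<forall>j\<ge>N0. (\<integral>x. (f i x - f j x)\<^sup>2 \<partial>M) < 1" using C'[of 1] by auto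
  have "(\<lambda>x. f N0 x - g x) \<in> L2 M"
    unfolding L2_def using main[of N0 N0 1] N0 fm[of N0] g by simp
  from L2_lin[OF f[of N0] this, of "-1"] have gL: "g \<in> L2 M" by simp
  have "(\<lambda>i. \<integral>x. (f i x - g x)\<^sup>2 \<partial>M) \<longlonglongrightarrow> 0"
  proof (rule LIMSEQ_I)
    fix e :: real assume e: "e > 0"
    then obtain N where N: "\<forall>i\<ge>N. \<forall>j\<ge>N. (\<integral>x. (f i x - f j x)\<^sup>2 \<partial>M) < e / 2" using C'[of "e/2"] by auto
    have "norm ((\<integral>x. (f i x - g x)\<^sup>2 \<partial>M) - 0) < e" if "i \<ge> N" for i
      using main[of N i "e/2"] N that e by (simp add: abs_of_nonneg integral_nonneg_AE)
    then show "\<exists>no. \<forall>n\<ge>no. norm ((\<integral>x. (f n x - g x)\<^sup>2 \<partial>M) - 0) < e" by blast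
  qed
  then show ?thesis using gL by (intro bexI[of _ g]) (auto simp: L2ip_def power2_eq_square)
qed

lemma (in finite_measure) L2_semi_hilbert: "semi_hilbert (L2 M) (L2ip M)"
proof
  show "subspace (L2 M)" by (rule L2_subspace)
  show "L2ip M u v = L2ip M v u" for u v by (simp add: L2ip_def mult.commute)
  show "L2ip M (u + v) w = L2ip M u w + L2ip M v w" if "u \<in> L2 M" "v \<in> L2 M" "w \<in> L2 M" for u v w
    using Bochner_Integration.integral_add[OF L2_mult_integrable[OF that(1,3)] L2_mult_integrable[OF that(2,3)]]
    by (simp add: L2ip_def distrib_right)
  show "L2ip M (c *\<^sub>R u) w = c * L2ip M u w" for u w c
    by (simp add: L2ip_def mult.assoc)
  show "0 \<le> L2ip M u u" for u by (simp add: L2ip_def)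
qed (rule L2_complete)

lemma L2norm_eq: "L2norm m u = sqrt (L2ip m u u)"
  by (simp add: L2norm_def L2ip_def power2_eq_square)

section \<open>Convex integral functionals of the gradient\<close>

text \<open>\<open>W u \<alpha>\<close> stands for: \<open>\<alpha>\<close> is the weak differential of \<open>u\<close>; \<open>q\<close> is the derivative of \<open>h\<close>.\<close>

locale convex_integrand = finite_measure M for M :: "'m measure" +
  fixes h :: "'m \<Rightarrow> 'e::euclidean_space \<Rightarrow> real" and q :: "'m \<Rightarrow> 'e \<Rightarrow> 'e"
    and W :: "('m \<Rightarrow> real) \<Rightarrow> ('m \<Rightarrow> 'e) \<Rightarrow> bool" and C0 :: real
  assumes h_nonneg: "0 \<le> h x a"
    and h_tangent: "h x a + q x a \<bullet> (b - a) \<le> h x b"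
    and q_bound: "norm (q x a) \<le> C0 * (1 + norm a)"
    and q_cont: "isCont (q x) a"
    and h_cont: "isCont (h x) a"
    and h_meas: "\<alpha> \<in> borel_measurable M \<Longrightarrow> (\<lambda>x. h x (\<alpha> x)) \<in> borel_measurable M"
    and q_meas: "\<alpha> \<in> borel_measurable M \<Longrightarrow> (\<lambda>x. q x (\<alpha> x)) \<in> borel_measurable M"
    and h_uniform: "\<eta> > 0 \<Longrightarrow> \<exists>\<kappa>\<ge>0. \<forall>x a b. norm (a - b) \<le> \<eta> * (1 + h x a + h x b) +
      \<kappa> * ((h x a + h x b) / 2 - h x ((1/2) *\<^sub>R a + (1/2) *\<^sub>R b))"
    and W_integrable: "W u \<alpha> \<Longrightarrow> integrable M \<alpha>"
    and W_unique: "W u \<alpha> \<Longrightarrow> W u \<beta> \<Longrightarrow> AE x in M. \<alpha> x = \<beta> x"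
    and W_lin: "W u \<alpha> \<Longrightarrow> W v \<beta> \<Longrightarrow> W (\<lambda>x. u x + c * v x) (\<lambda>x. \<alpha> x + c *\<^sub>R \<beta> x)"
    and W_zero: "W (\<lambda>x. 0) (\<lambda>x. 0)"
    and W_closed: "(\<And>k::nat. W (us k) (as k)) \<Longrightarrow> (\<And>k. us k \<in> L2 M) \<Longrightarrow> u \<in> L2 M \<Longrightarrow>
      (\<lambda>k. L2norm M (us k - u)) \<longlonglongrightarrow> 0 \<Longrightarrow> integrable M \<alpha> \<Longrightarrow>
      (\<lambda>k. \<integral>x. norm (as k x - \<alpha> x) \<partial>M) \<longlonglongrightarrow> 0 \<Longrightarrow> W u \<alpha>"
begin

definition fin_dom :: "('m \<Rightarrow> real) set" where
  "fin_dom = {u \<in> L2 M. \<exists>\<alpha>. W u \<alpha> \<and> integrable M (\<lambda>x. h x (\<alpha> x))}"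

definition en :: "('m \<Rightarrow> real) \<Rightarrow> real" where
  "en u = (\<integral>x. h x ((SOME \<alpha>. W u \<alpha>) x) \<partial>M)"

lemma W_meas: "W u \<alpha> \<Longrightarrow> \<alpha> \<in> borel_measurable M"
  using W_integrable by auto

lemma en_eq:
  assumes "W u \<alpha>" shows "en u = (\<integral>x. h x (\<alpha> x) \<partial>M)"
proof -
  have s: "W u (SOME \<alpha>. W u \<alpha>)" by (rule someI[of "W u", OF assms])
  have "AE x in M. (SOME \<alpha>. W u \<alpha>) x = \<alpha> x" by (rule W_unique[OF s assms])
  then have "AE x in M. h x ((SOME \<alpha>. W u \<alpha>) x) = h x (\<alpha> x)" by eventually_elim simp
  then show ?thesis unfolding en_def
    by (intro integral_cong_AE h_meas W_meas[OF s] W_meas[OF assms])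
qed

lemma dom_integrable:
  assumes "u \<in> fin_dom" "W u \<alpha>" shows "integrable M (\<lambda>x. h x (\<alpha> x))"
proof -
  obtain \<beta> where \<beta>: "W u \<beta>" "integrable M (\<lambda>x. h x (\<beta> x))" using assms by (auto simp: fin_dom_def)
  have "AE x in M. h x (\<alpha> x) = h x (\<beta> x)" using W_unique[OF assms(2) \<beta>(1)] by eventually_elim simp
  then show ?thesis using \<beta> integrable_cong_AE[OF h_meas[OF W_meas[OF assms(2)]] h_meas[OF W_meas[OF \<beta>(1)]]] by simp
qed

lemma domI: "u \<in> L2 M \<Longrightarrow> W u \<alpha> \<Longrightarrow> integrable M (\<lambda>x. h x (\<alpha> x)) \<Longrightarrow> u \<in> fin_dom"
  by (auto simp: fin_dom_def)

lemma domE: assumes "u \<in> fin_dom" obtains \<alpha> where "W u \<alpha>" "u \<in> L2 M" "integrable M (\<lambda>x. h x (\<alpha> x))"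
  using assms by (auto simp: fin_dom_def)

text \<open>The tangent inequalities at the convex combination c, weighted by 1 - t and t; the
  linear terms cancel.\<close>

lemma h_convex:
  assumes "0 \<le> t" "t \<le> 1"
  shows "h x ((1 - t) *\<^sub>R a + t *\<^sub>R b) \<le> (1 - t) * h x a + t * h x b"
proof -
  define c where "c = (1 - t) *\<^sub>R a + t *\<^sub>R b"
  have s: "(1 - t) *\<^sub>R (a - c) + t *\<^sub>R (b - c) = 0"
    unfolding c_def by (simp add: algebra_simps)
  have "(1 - t) * (h x c + q x c \<bullet> (a - c)) + t * (h x c + q x c \<bullet> (b - c)) \<le> (1 - t) * h x a + t * h x b"
    using assms by (intro add_mono mult_left_mono h_tangent) auto
  moreover have "(1 - t) * (q x c \<bullet> (a - c)) + t * (q x c \<bullet> (b - c)) = 0"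
    using s by (metis inner_add_right inner_scaleR_right inner_zero_right)
  ultimately show ?thesis unfolding c_def[symmetric] by (simp add: algebra_simps)
qed

lemma comb:
  assumes "u \<in> fin_dom" "v \<in> fin_dom" "0 \<le> t" "t \<le> 1"
  shows "(1 - t) *\<^sub>R u + t *\<^sub>R v \<in> fin_dom \<and> en ((1 - t) *\<^sub>R u + t *\<^sub>R v) \<le> (1 - t) * en u + t * en v"
proof -
  obtain \<alpha> where a: "W u \<alpha>" "u \<in> L2 M" "integrable M (\<lambda>x. h x (\<alpha> x))" using assms by (auto elim: domE)
  obtain \<beta> where b: "W v \<beta>" "v \<in> L2 M" "integrable M (\<lambda>x. h x (\<beta> x))" using assms by (auto elim: domE)
  have eq: "(1 - t) *\<^sub>R u + t *\<^sub>R v = (\<lambda>x. (0 + (1 - t) * u x) + t * v x)"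
    by (simp add: scaleR_fun_def plus_fun_def)
  have W: "W ((1 - t) *\<^sub>R u + t *\<^sub>R v) (\<lambda>x. (0 + (1 - t) *\<^sub>R \<alpha> x) + t *\<^sub>R \<beta> x)"
    unfolding eq by (intro W_lin W_zero a b)
  have L: "(1 - t) *\<^sub>R u + t *\<^sub>R v \<in> L2 M"
    using L2_subspace a b by (intro subspace_add subspace_scale)
  have i: "integrable M (\<lambda>x. (1 - t) * h x (\<alpha> x) + t * h x (\<beta> x))" using a b by auto
  have le: "h x ((0 + (1 - t) *\<^sub>R \<alpha> x) + t *\<^sub>R \<beta> x) \<le> (1 - t) * h x (\<alpha> x) + t * h x (\<beta> x)" for x
    using h_convex[OF assms(3,4)] by simp
  have hi: "integrable M (\<lambda>x. h x ((0 + (1 - t) *\<^sub>R \<alpha> x) + t *\<^sub>R \<beta> x))"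
    by (rule Bochner_Integration.integrable_bound[OF i])
      (use le h_nonneg order_trans[OF h_nonneg le] in \<open>auto intro!: h_meas W_meas[OF W, simplified] simp: abs_of_nonneg\<close>)
  have "en ((1 - t) *\<^sub>R u + t *\<^sub>R v) \<le> (\<integral>x. (1 - t) * h x (\<alpha> x) + t * h x (\<beta> x) \<partial>M)"
    unfolding en_eq[OF W] by (rule integral_mono[OF hi i le])
  also have "\<dots> = (1 - t) * en u + t * en v" using a b by (simp add: en_eq)
  finally show ?thesis using domI[OF L W hi] by simp
qed

lemma en_nonneg: "u \<in> fin_dom \<Longrightarrow> 0 \<le> en u"
  by (elim domE) (simp add: en_eq h_nonneg)

interpretation semi_hilbert "L2 M" "L2ip M"
  by (rule L2_semi_hilbert)

lemma nrm_L2norm: "nrm = L2norm M"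
  by (simp add: fun_eq_iff nrm_def nsq_def L2norm_eq)

text \<open>Integrating the uniform convexity estimate bounds the L1 distance of two differentials
  by \<eta> times a fixed constant plus \<kappa> times the midpoint defect. The L1 limit is the
  differential of u by \<open>W_closed\<close>, and Fatou's lemma along an almost everywhere
  convergent subsequence transfers the energy bound.\<close>

lemma en_closed:
  assumes w: "\<And>k::nat. w k \<in> fin_dom" and B: "\<And>k. en (w k) \<le> B" and u: "u \<in> L2 M"
    and lim: "(\<lambda>k. L2norm M (w k - u)) \<longlonglongrightarrow> 0"
    and def: "\<forall>e>0. \<exists>N. \<forall>j\<ge>N. \<forall>k\<ge>N. (en (w j) + en (w k)) / 2 - en ((1/2) *\<^sub>R w j + (1/2) *\<^sub>R w k) < e"
  shows "u \<in> fin_dom \<and> en u \<le> B"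
proof -
  have "\<forall>k. \<exists>\<alpha>. W (w k) \<alpha>" using w by (auto simp: fin_dom_def)
  then obtain \<alpha> where W: "\<And>k. W (w k) (\<alpha> k)" by (auto dest!: choice)
  have wL: "w k \<in> L2 M" for k using w by (auto simp: fin_dom_def)
  have ai: "integrable M (\<alpha> k)" for k by (rule W_integrable[OF W])
  have hi: "integrable M (\<lambda>x. h x (\<alpha> k x))" for k by (rule dom_integrable[OF w W])
  have enw: "en (w k) = (\<integral>x. h x (\<alpha> k x) \<partial>M)" for k by (rule en_eq[OF W])
  have B0: "0 \<le> B" using en_nonneg[OF w, of 0] B[of 0] by simp
  have L1: "\<exists>N. \<forall>i\<ge>N. \<forall>j\<ge>N. (\<integral>x. norm (\<alpha> i x - \<alpha> j x) \<partial>M) < e" if e: "e > 0" for e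
  proof -
    define mm where "mm = measure M (space M)"
    \<comment> \<open>This \<eta> makes the energy-dependent part of the estimate less than e / 2.
      The defect is afterwards taken below e / (2 (\<kappa> + 1)), where \<kappa> depends on
      \<eta>.\<close>
    define \<eta> where "\<eta> = e / (2 * (mm + 2 * B + 1))"
    have mm: "mm + 2 * B + 1 > 0" unfolding mm_def using B0 by (intro add_nonneg_pos add_nonneg_nonneg) auto
    have \<eta>: "\<eta> > 0" unfolding \<eta>_def using e mm by simp
    have \<eta>e: "\<eta> * (mm + 2 * B) < e / 2"
    proof -
      have "e / (2 * X) * X = e / 2" if "X > 0" for X :: real using that by simp
      from this[OF mm] have "\<eta> * (mm + 2 * B + 1) = e / 2" unfolding \<eta>_def .
      then show ?thesis using \<eta> by (simp add: distrib_left)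
    qed
    obtain \<kappa> where \<kappa>: "\<kappa> \<ge> 0" "\<And>x a b. norm (a - b) \<le> \<eta> * (1 + h x a + h x b) +
      \<kappa> * ((h x a + h x b) / 2 - h x ((1/2) *\<^sub>R a + (1/2) *\<^sub>R b))" using h_uniform[OF \<eta>] by blast
    have "0 < e / (2 * (\<kappa> + 1))" using e \<kappa>(1) by simp
    from def[rule_format, OF this]
    obtain N where N: "\<And>j k. j \<ge> N \<Longrightarrow> k \<ge> N \<Longrightarrow> (en (w j) + en (w k)) / 2 - en ((1/2) *\<^sub>R w j + (1/2) *\<^sub>R w k) < e / (2 * (\<kappa> + 1))"
      by blast
    have "(\<integral>x. norm (\<alpha> i x - \<alpha> j x) \<partial>M) < e" if ij: "i \<ge> N" "j \<ge> N" for i j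
    proof -
      have md: "(1/2) *\<^sub>R w i + (1/2) *\<^sub>R w j \<in> fin_dom" using comb[OF w w, of "1/2" i j] by simp
      have "W (\<lambda>x. (0 + (1/2) * w i x) + (1/2) * w j x) (\<lambda>x. (0 + (1/2) *\<^sub>R \<alpha> i x) + (1/2) *\<^sub>R \<alpha> j x)"
        by (intro W_lin W_zero W)
      then have Wm: "W ((1/2) *\<^sub>R w i + (1/2) *\<^sub>R w j) (\<lambda>x. (1/2) *\<^sub>R \<alpha> i x + (1/2) *\<^sub>R \<alpha> j x)"
        by (simp add: scaleR_fun_def plus_fun_def)
      note mi = dom_integrable[OF md Wm]
      have "(\<integral>x. norm (\<alpha> i x - \<alpha> j x) \<partial>M) \<le> (\<integral>x. \<eta> * (1 + h x (\<alpha> i x) + h x (\<alpha> j x)) +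
          \<kappa> * ((h x (\<alpha> i x) + h x (\<alpha> j x)) / 2 - h x ((1/2) *\<^sub>R \<alpha> i x + (1/2) *\<^sub>R \<alpha> j x)) \<partial>M)"
        by (rule integral_mono) (use ai hi mi \<kappa>(2) in auto)
      also have "\<dots> = \<eta> * (mm + en (w i) + en (w j)) + \<kappa> * ((en (w i) + en (w j)) / 2 - en ((1/2) *\<^sub>R w i + (1/2) *\<^sub>R w j))"
        using hi mi by (simp add: enw en_eq[OF Wm] mm_def)
      also have "\<dots> \<le> \<eta> * (mm + 2 * B) + \<kappa> * (e / (2 * (\<kappa> + 1)))"
      proof -
        have "mm + en (w i) + en (w j) \<le> mm + 2 * B" using B[of i] B[of j] by simp
        then show ?thesis
          using N[OF ij] \<eta> \<kappa>(1) by (intro add_mono[OF mult_left_mono mult_left_mono]) auto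
      qed
      also have "\<kappa> * (e / (2 * (\<kappa> + 1))) \<le> e / 2"
        using \<kappa>(1) e by (simp add: field_simps)
      finally show ?thesis using \<eta>e by simp
    qed
    then show ?thesis by blast
  qed
  obtain r g where r: "strict_mono (r :: nat \<Rightarrow> nat)" and g: "g \<in> borel_measurable M"
    and glim: "AE x in M. (\<lambda>k. \<alpha> (r k) x) \<longlonglongrightarrow> g x"
    using L1_Cauchy_AE_subseq[of M \<alpha>, OF ai L1] by blast
  have main: "integrable M (\<lambda>x. norm (\<alpha> i x - g x)) \<and> (\<integral>x. norm (\<alpha> i x - g x) \<partial>M) \<le> e"
    if N: "\<And>j. j \<ge> N \<Longrightarrow> (\<integral>x. norm (\<alpha> i x - \<alpha> j x) \<partial>M) < e" for i N e
  proof -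
    have 1: "(\<integral>x. norm (\<alpha> i x - \<alpha> (r (k + N)) x) \<partial>M) \<le> e" for k
    proof -
      have "r (k + N) \<ge> N" using seq_suble[OF r, of "k + N"] by simp
      then show ?thesis using N by (simp add: less_imp_le)
    qed
    have 2: "AE x in M. (\<lambda>k. norm (\<alpha> i x - \<alpha> (r (k + N)) x)) \<longlonglongrightarrow> norm (\<alpha> i x - g x)"
      using glim
    proof eventually_elim
      case (elim x)
      from LIMSEQ_ignore_initial_segment[OF elim, of N]
      show ?case by (intro tendsto_norm tendsto_diff tendsto_const)
    qed
    have 3: "(\<lambda>x. norm (\<alpha> i x - g x)) \<in> borel_measurable M"
      using W_meas[OF W[of i]] g by measurable
    have 4: "AE x in M. 0 \<le> norm (\<alpha> i x - \<alpha> (r (k + N)) x)" for k by simp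
    have 5: "integrable M (\<lambda>x. norm (\<alpha> i x - \<alpha> (r (k + N)) x))" for k using ai by simp
    show ?thesis using fatou_bound[OF 5 4 1 3 2] by blast
  qed
  obtain N0 where N0: "\<forall>i\<ge>N0. \<forall>j\<ge>N0. (\<integral>x. norm (\<alpha> i x - \<alpha> j x) \<partial>M) < 1" using L1[of 1] by auto
  have "integrable M (\<lambda>x. \<alpha> N0 x - g x)"
    using main[of N0 N0 1] N0 ai[of N0] g by (auto simp: integrable_norm_iff)
  from Bochner_Integration.integrable_diff[OF ai[of N0] this] have gi: "integrable M g" by simp
  have g1: "(\<lambda>k. \<integral>x. norm (\<alpha> k x - g x) \<partial>M) \<longlonglongrightarrow> 0"
  proof (rule LIMSEQ_I)
    fix e :: real assume e: "e > 0"
    then obtain N where N: "\<forall>i\<ge>N. \<forall>j\<ge>N. (\<integral>x. norm (\<alpha> i x - \<alpha> j x) \<partial>M) < e / 2" using L1[of "e/2"] by auto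
    have "norm ((\<integral>x. norm (\<alpha> i x - g x) \<partial>M) - 0) < e" if "i \<ge> N" for i
      using main[of N i "e/2"] N that e by (simp add: abs_of_nonneg integral_nonneg_AE)
    then show "\<exists>no. \<forall>n\<ge>no. norm ((\<integral>x. norm (\<alpha> n x - g x) \<partial>M) - 0) < e" by blast
  qed
  have Wu: "W u g" by (rule W_closed[OF W wL u lim gi g1])
  have "AE x in M. (\<lambda>k. h x (\<alpha> (r k) x)) \<longlonglongrightarrow> h x (g x)"
    using glim by eventually_elim (rule isCont_tendsto_compose[OF h_cont])
  then have "integrable M (\<lambda>x. h x (g x))" "(\<integral>x. h x (g x) \<partial>M) \<le> B"
    using fatou_bound[OF hi _ _ h_meas[OF g], of "\<lambda>k. r k" B] h_nonneg B unfolding enw by auto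
  then show ?thesis using domI[OF u Wu] en_eq[OF Wu] by simp
qed

lemma energy_flow: "energy_flow (L2 M) (L2ip M) fin_dom en"
proof (intro energy_flow.intro[OF L2_semi_hilbert] energy_flow_axioms.intro)
  show "fin_dom \<subseteq> L2 M" by (auto simp: fin_dom_def)
  show "u \<in> fin_dom \<and> en u \<le> B"
    if "\<And>k::nat. w k \<in> fin_dom" "\<And>k. en (w k) \<le> B" "u \<in> L2 M"
      "(\<lambda>k. semi_hilbert.nrm (L2ip M) (w k - u)) \<longlonglongrightarrow> 0"
      "\<forall>e>0. \<exists>N. \<forall>j\<ge>N. \<forall>k\<ge>N. (en (w j) + en (w k)) / 2 - en ((1/2) *\<^sub>R w j + (1/2) *\<^sub>R w k) < e"
    for w B u using en_closed[OF that(1-3) _ that(5)] that(4) unfolding nrm_L2norm by blast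
qed (use comb en_nonneg in auto)

interpretation energy_flow "L2 M" "L2ip M" fin_dom en
  by (rule energy_flow)

section \<open>First variation along directions with bounded differential\<close>

definition smooth_dir :: "('m \<Rightarrow> real) \<Rightarrow> ('m \<Rightarrow> 'e) \<Rightarrow> bool" where
  "smooth_dir \<phi> \<beta> \<longleftrightarrow> \<phi> \<in> L2 M \<and> W \<phi> \<beta> \<and> (\<exists>K. \<forall>x. norm (\<beta> x) \<le> K)"

lemma C0_nonneg: "0 \<le> C0"
  using order_trans[OF norm_ge_zero q_bound[of undefined 0]] by simp

text \<open>q grows at most linearly and \<alpha> is merely in L1, so boundedness of \<beta> is what
  makes the pairing integrable.\<close>

lemma q_pair_integrable:
  assumes "integrable M \<alpha>" "\<beta> \<in> borel_measurable M" "\<And>x. norm (\<beta> x) \<le> K"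
  shows "integrable M (\<lambda>x. q x (\<alpha> x) \<bullet> \<beta> x)"
proof (rule Bochner_Integration.integrable_bound)
  show "integrable M (\<lambda>x. (C0 * (1 + norm (\<alpha> x))) * K)" using assms by auto
  show "(\<lambda>x. q x (\<alpha> x) \<bullet> \<beta> x) \<in> borel_measurable M"
    using assms q_meas[of \<alpha>] by (intro borel_measurable_inner) auto
  have "norm (q x (\<alpha> x) \<bullet> \<beta> x) \<le> (C0 * (1 + norm (\<alpha> x))) * K" for x
  proof -
    have "norm (q x (\<alpha> x) \<bullet> \<beta> x) \<le> norm (q x (\<alpha> x)) * norm (\<beta> x)" using Cauchy_Schwarz_ineq2 by simp
    also have "\<dots> \<le> (C0 * (1 + norm (\<alpha> x))) * K"
      using q_bound assms(3) C0_nonneg by (intro mult_mono) (auto intro: mult_nonneg_nonneg)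
    finally show ?thesis .
  qed
  then show "AE x in M. norm (q x (\<alpha> x) \<bullet> \<beta> x) \<le> norm ((C0 * (1 + norm (\<alpha> x))) * K)"
    by (intro AE_I2) (metis real_norm_def abs_ge_self order_trans)
qed

text \<open>The tangent inequality is taken at the far point \<alpha> + c \<beta> and not at
  \<alpha>: it bounds h there from above by an integrable function, so u + c \<phi> stays in the
  domain for every real c. One inequality thus serves both signs of c.\<close>

lemma smooth_dir_step:
  assumes u: "u \<in> fin_dom" and W: "W u \<alpha>" and sd: "smooth_dir \<phi> \<beta>"
  shows "u + c *\<^sub>R \<phi> \<in> fin_dom \<and> en (u + c *\<^sub>R \<phi>) - en u \<le> c * (\<integral>x. q x (\<alpha> x + c *\<^sub>R \<beta> x) \<bullet> \<beta> x \<partial>M)"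
proof -
  obtain K where K: "\<phi> \<in> L2 M" "W \<phi> \<beta>" "\<And>x. norm (\<beta> x) \<le> K" using sd by (auto simp: smooth_dir_def)
  have eq: "u + c *\<^sub>R \<phi> = (\<lambda>x. u x + c * \<phi> x)" by (simp add: scaleR_fun_def plus_fun_def)
  have Wc: "W (u + c *\<^sub>R \<phi>) (\<lambda>x. \<alpha> x + c *\<^sub>R \<beta> x)" unfolding eq by (rule W_lin[OF W K(2)])
  have L: "u + c *\<^sub>R \<phi> \<in> L2 M"
    unfolding eq using u by (elim domE) (rule L2_lin[OF _ K(1)])
  have qi: "integrable M (\<lambda>x. q x (\<alpha> x + c *\<^sub>R \<beta> x) \<bullet> \<beta> x)"
    by (rule q_pair_integrable[OF W_integrable[OF Wc] W_meas[OF K(2)] K(3)])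
  have hi: "integrable M (\<lambda>x. h x (\<alpha> x))" by (rule dom_integrable[OF u W])
  have le: "h x (\<alpha> x + c *\<^sub>R \<beta> x) \<le> h x (\<alpha> x) + c * (q x (\<alpha> x + c *\<^sub>R \<beta> x) \<bullet> \<beta> x)" for x
    using h_tangent[of x "\<alpha> x + c *\<^sub>R \<beta> x" "\<alpha> x"] by simp
  have i2: "integrable M (\<lambda>x. h x (\<alpha> x) + c * (q x (\<alpha> x + c *\<^sub>R \<beta> x) \<bullet> \<beta> x))" using hi qi by auto
  have hci: "integrable M (\<lambda>x. h x (\<alpha> x + c *\<^sub>R \<beta> x))"
  proof (rule Bochner_Integration.integrable_bound[OF i2])
    show "(\<lambda>x. h x (\<alpha> x + c *\<^sub>R \<beta> x)) \<in> borel_measurable M" by (rule h_meas[OF W_meas[OF Wc]])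
    show "AE x in M. norm (h x (\<alpha> x + c *\<^sub>R \<beta> x)) \<le> norm (h x (\<alpha> x) + c * (q x (\<alpha> x + c *\<^sub>R \<beta> x) \<bullet> \<beta> x))"
      using le h_nonneg by (intro AE_I2) (smt (verit) real_norm_def)
  qed
  have "en (u + c *\<^sub>R \<phi>) \<le> (\<integral>x. h x (\<alpha> x) + c * (q x (\<alpha> x + c *\<^sub>R \<beta> x) \<bullet> \<beta> x) \<partial>M)"
    unfolding en_eq[OF Wc] by (rule integral_mono[OF hci i2 le])
  also have "\<dots> = en u + c * (\<integral>x. q x (\<alpha> x + c *\<^sub>R \<beta> x) \<bullet> \<beta> x \<partial>M)"
    using hi qi by (simp add: en_eq[OF W])
  finally show ?thesis using domI[OF L Wc hci] by simp
qed

text \<open>The one-step estimate with c = \<sigma> \<epsilon> has its integrand evaluated at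
  \<alpha> + \<sigma> \<epsilon> \<beta>; dominated convergence with the bound C0 (1 + |\<alpha>| +
  K) K moves it to \<alpha> as \<epsilon> tends to 0.\<close>

lemma first_variation:
  assumes u: "u \<in> fin_dom" and W: "W u \<alpha>" and sd: "smooth_dir \<phi> \<beta>"
    and \<sigma>: "\<sigma> \<in> {1, -1 :: real}" and \<eta>: "\<eta> > 0"
  shows "\<exists>\<epsilon>>0. u + (\<sigma> * \<epsilon>) *\<^sub>R \<phi> \<in> fin_dom \<and>
    en (u + (\<sigma> * \<epsilon>) *\<^sub>R \<phi>) - en u \<le> \<epsilon> * (\<sigma> * (\<integral>x. q x (\<alpha> x) \<bullet> \<beta> x \<partial>M) + \<eta>)"
proof -
  obtain K where K: "\<phi> \<in> L2 M" "W \<phi> \<beta>" "\<And>x. norm (\<beta> x) \<le> K" using sd by (auto simp: smooth_dir_def)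
  have K0: "K \<ge> 0" using K(3) norm_ge_zero order_trans by blast
  define e where "e n = 1 / real (Suc n)" for n
  have e: "e n > 0" "e n \<le> 1" for n by (auto simp: e_def)
  have el: "e \<longlonglongrightarrow> 0" unfolding e_def by (rule LIMSEQ_Suc[OF lim_1_over_n])
  have am: "\<alpha> \<in> borel_measurable M" "\<beta> \<in> borel_measurable M" using W_meas W K by auto
  have lim: "(\<lambda>n. \<integral>x. q x (\<alpha> x + (\<sigma> * e n) *\<^sub>R \<beta> x) \<bullet> \<beta> x \<partial>M) \<longlonglongrightarrow> (\<integral>x. q x (\<alpha> x) \<bullet> \<beta> x \<partial>M)"
  proof (rule integral_dominated_convergence[where w="\<lambda>x. C0 * (1 + (norm (\<alpha> x) + K)) * K"])
    show "(\<lambda>x. q x (\<alpha> x) \<bullet> \<beta> x) \<in> borel_measurable M" using am q_meas by (intro borel_measurable_inner) auto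
    show "(\<lambda>x. q x (\<alpha> x + (\<sigma> * e n) *\<^sub>R \<beta> x) \<bullet> \<beta> x) \<in> borel_measurable M" for n
      using am by (intro borel_measurable_inner q_meas) auto
    show "integrable M (\<lambda>x. C0 * (1 + (norm (\<alpha> x) + K)) * K)" using W_integrable[OF W] by auto
    show "AE x in M. (\<lambda>n. q x (\<alpha> x + (\<sigma> * e n) *\<^sub>R \<beta> x) \<bullet> \<beta> x) \<longlonglongrightarrow> q x (\<alpha> x) \<bullet> \<beta> x"
    proof (rule AE_I2)
      fix x
      have "(\<lambda>n. \<alpha> x + (\<sigma> * e n) *\<^sub>R \<beta> x) \<longlonglongrightarrow> \<alpha> x + (\<sigma> * 0) *\<^sub>R \<beta> x" by (intro tendsto_intros el)
      then have "(\<lambda>n. \<alpha> x + (\<sigma> * e n) *\<^sub>R \<beta> x) \<longlonglongrightarrow> \<alpha> x" by simp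
      then show "(\<lambda>n. q x (\<alpha> x + (\<sigma> * e n) *\<^sub>R \<beta> x) \<bullet> \<beta> x) \<longlonglongrightarrow> q x (\<alpha> x) \<bullet> \<beta> x"
        by (intro tendsto_inner tendsto_const isCont_tendsto_compose[OF q_cont])
    qed
    show "AE x in M. norm (q x (\<alpha> x + (\<sigma> * e n) *\<^sub>R \<beta> x) \<bullet> \<beta> x) \<le> C0 * (1 + (norm (\<alpha> x) + K)) * K" for n
    proof (rule AE_I2)
      fix x
      have "norm ((\<sigma> * e n) *\<^sub>R \<beta> x) \<le> 1 * K"
        unfolding norm_scaleR using \<sigma> e[of n] K(3)[of x] by (intro mult_mono) auto
      then have 1: "norm (\<alpha> x + (\<sigma> * e n) *\<^sub>R \<beta> x) \<le> norm (\<alpha> x) + K"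
        using norm_triangle_ineq[of "\<alpha> x" "(\<sigma> * e n) *\<^sub>R \<beta> x"] by simp
      have "norm (q x (\<alpha> x + (\<sigma> * e n) *\<^sub>R \<beta> x) \<bullet> \<beta> x) \<le> norm (q x (\<alpha> x + (\<sigma> * e n) *\<^sub>R \<beta> x)) * norm (\<beta> x)"
        using Cauchy_Schwarz_ineq2 by simp
      also have "\<dots> \<le> C0 * (1 + norm (\<alpha> x + (\<sigma> * e n) *\<^sub>R \<beta> x)) * K"
        using q_bound K(3) C0_nonneg by (intro mult_mono) (auto intro: mult_nonneg_nonneg)
      also have "\<dots> \<le> C0 * (1 + (norm (\<alpha> x) + K)) * K"
        using 1 C0_nonneg K0 by (intro mult_right_mono mult_left_mono) auto
      finally show "norm (q x (\<alpha> x + (\<sigma> * e n) *\<^sub>R \<beta> x) \<bullet> \<beta> x) \<le> C0 * (1 + (norm (\<alpha> x) + K)) * K" .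
    qed
  qed
  define G where "G = (\<integral>x. q x (\<alpha> x) \<bullet> \<beta> x \<partial>M)"
  obtain n where n: "\<bar>(\<integral>x. q x (\<alpha> x + (\<sigma> * e n) *\<^sub>R \<beta> x) \<bullet> \<beta> x \<partial>M) - G\<bar> < \<eta>"
    using LIMSEQ_D[OF lim \<eta>] unfolding G_def by auto
  define Gn where "Gn = (\<integral>x. q x (\<alpha> x + (\<sigma> * e n) *\<^sub>R \<beta> x) \<bullet> \<beta> x \<partial>M)"
  have "\<sigma> * Gn \<le> \<sigma> * G + \<eta>" using n \<sigma> unfolding Gn_def[symmetric] by auto
  then have "e n * (\<sigma> * Gn) \<le> e n * (\<sigma> * G + \<eta>)" using e[of n] by (intro mult_left_mono) auto
  then have "(\<sigma> * e n) * Gn \<le> e n * (\<sigma> * G + \<eta>)" by (simp add: mult_ac)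
  moreover note smooth_dir_step[OF u W sd, of "\<sigma> * e n", folded Gn_def]
  ultimately have "u + (\<sigma> * e n) *\<^sub>R \<phi> \<in> fin_dom \<and> en (u + (\<sigma> * e n) *\<^sub>R \<phi>) - en u \<le> e n * (\<sigma> * G + \<eta>)"
    by linarith
  then show ?thesis using e(1)[of n] unfolding G_def by blast
qed

text \<open>A subgradient bounds the energy change from below and the first variation bounds it from
  above, in the directions \<phi> and -\<phi>; so the two linear functionals agree on
  \<phi>.\<close>

lemma subgrad_smooth_dir:
  assumes sg: "subgrad \<xi> u" and W: "W u \<alpha>" and sd: "smooth_dir \<phi> \<beta>"
  shows "L2ip M \<xi> \<phi> = (\<integral>x. q x (\<alpha> x) \<bullet> \<beta> x \<partial>M)"
proof -
  define G where "G = (\<integral>x. q x (\<alpha> x) \<bullet> \<beta> x \<partial>M)"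
  have u: "u \<in> fin_dom" and \<xi>: "\<xi> \<in> L2 M" using sg by (auto simp: subgrad_def)
  have \<phi>: "\<phi> \<in> L2 M" using sd by (auto simp: smooth_dir_def)
  have "\<sigma> * L2ip M \<xi> \<phi> \<le> \<sigma> * G + \<eta>" if \<sigma>: "\<sigma> \<in> {1, -1}" and \<eta>: "\<eta> > 0" for \<sigma> \<eta> :: real
  proof -
    obtain \<epsilon> where \<epsilon>: "\<epsilon> > 0" "u + (\<sigma> * \<epsilon>) *\<^sub>R \<phi> \<in> fin_dom"
      "en (u + (\<sigma> * \<epsilon>) *\<^sub>R \<phi>) - en u \<le> \<epsilon> * (\<sigma> * G + \<eta>)"
      using first_variation[OF u W sd \<sigma> \<eta>] unfolding G_def by blast
    have "en u + L2ip M \<xi> (u + (\<sigma> * \<epsilon>) *\<^sub>R \<phi> - u) \<le> en (u + (\<sigma> * \<epsilon>) *\<^sub>R \<phi>)"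
      using sg \<epsilon>(2) unfolding subgrad_def by blast
    moreover have "L2ip M \<xi> (u + (\<sigma> * \<epsilon>) *\<^sub>R \<phi> - u) = \<epsilon> * (\<sigma> * L2ip M \<xi> \<phi>)"
      using \<xi> \<phi> by (simp add: ip_scale_right)
    ultimately have "\<epsilon> * (\<sigma> * L2ip M \<xi> \<phi>) \<le> \<epsilon> * (\<sigma> * G + \<eta>)" using \<epsilon>(3) by linarith
    then show ?thesis using \<epsilon>(1) by simp
  qed
  note * = this
  have "L2ip M \<xi> \<phi> \<le> G" by (rule field_le_epsilon) (use *[of 1] in simp)
  moreover have "G \<le> L2ip M \<xi> \<phi>"
  proof (rule field_le_epsilon)
    fix e :: real assume "e > 0"
    from *[of "-1", OF _ this] show "G \<le> L2ip M \<xi> \<phi> + e" by simp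
  qed
  ultimately show ?thesis unfolding G_def by simp
qed

end

section \<open>Integration by parts\<close>

lemma integrable_compact_support:
  fixes F :: "'a::euclidean_space \<Rightarrow> real"
  assumes "compact K" "continuous_on K F" "\<And>x. x \<notin> K \<Longrightarrow> F x = 0"
  shows "integrable lborel F"
proof -
  have "integrable lborel (\<lambda>x. indicator K x *\<^sub>R F x)" by (rule borel_integrable_compact[OF assms(1,2)])
  moreover have "(\<lambda>x. indicator K x *\<^sub>R F x) = F" using assms(3) by (auto simp: fun_eq_iff indicator_def)
  ultimately show ?thesis by simp
qed

lemma locally_integrable_mult:
  fixes f g :: "'a::euclidean_space \<Rightarrow> real"
  assumes f: "locally_integrable S f" and K: "compact K" "K \<subseteq> S"
    and g: "continuous_on K g" "\<And>x. x \<notin> K \<Longrightarrow> g x = 0"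
  shows "integrable lborel (\<lambda>x. f x * g x)"
proof -
  have fi: "integrable lborel (\<lambda>x. indicator K x *\<^sub>R f x)"
    using f K by (simp add: locally_integrable_def set_integrable_def)
  have gi: "integrable lborel g" by (rule integrable_compact_support[OF K(1) g])
  obtain B where B: "\<And>x. x \<in> K \<Longrightarrow> norm (g x) \<le> B"
    using compact_imp_bounded[OF compact_continuous_image[OF g(1) K(1)]] by (auto simp: bounded_iff)
  have eq: "(\<lambda>x. (indicator K x *\<^sub>R f x) * g x) = (\<lambda>x. f x * g x)"
    using g(2) by (auto simp: fun_eq_iff indicator_def)
  show ?thesis unfolding eq[symmetric]
  proof (rule Bochner_Integration.integrable_bound)
    show "integrable lborel (\<lambda>x. \<bar>B\<bar> * norm (indicator K x *\<^sub>R f x))" using fi by auto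
    show "(\<lambda>x. (indicator K x *\<^sub>R f x) * g x) \<in> borel_measurable lborel" using fi gi by auto
    have "norm ((indicator K x *\<^sub>R f x) * g x) \<le> \<bar>B\<bar> * norm (indicator K x *\<^sub>R f x)" for x
    proof (cases "x \<in> K")
      case True
      have "norm (g x) \<le> \<bar>B\<bar>" using B[OF True] by simp
      then show ?thesis using True mult_right_mono[of "norm (g x)" "\<bar>B\<bar>" "\<bar>f x\<bar>"] by (simp add: abs_mult mult.commute)
    qed simp
    then show "AE x in lborel. norm ((indicator K x *\<^sub>R f x) * g x) \<le> norm (\<bar>B\<bar> * norm (indicator K x *\<^sub>R f x))"
      by (intro AE_I2) simp
  qed
qed

lemma dir_deriv_support:
  assumes "closed K" "\<And>x. x \<notin> K \<Longrightarrow> g x = 0" "x \<notin> K"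
  shows "dir_deriv g x v = 0"
proof -
  have "dir_deriv g x = dir_deriv (\<lambda>_. 0) x"
    by (rule dir_deriv_cong_open[of "- K"]) (use assms in auto)
  then show ?thesis using dir_deriv_eq[OF has_derivative_const[of 0 "at x"]] by simp
qed

text \<open>The difference quotients in direction b integrate to 0 by translation invariance of
  Lebesgue measure, and converge to the derivative boundedly with common compact support.\<close>

lemma integral_dir_deriv_zero:
  fixes g :: "'a::euclidean_space \<Rightarrow> real"
  assumes d: "g differentiable_on UNIV" and c: "continuous_on UNIV (\<lambda>x. dir_deriv g x b)"
    and K: "compact K" and z: "\<And>x. x \<notin> K \<Longrightarrow> g x = 0"
  shows "(\<integral>x. dir_deriv g x b \<partial>lborel) = 0"
proof -
  have gD: "(g has_derivative dir_deriv g x) (at x)" for x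
    using differentiable_on_dir_deriv[OF d] by simp
  have gc: "continuous_on UNIV g" using d by (rule differentiable_imp_continuous_on)
  have dz: "dir_deriv g x b = 0" if "x \<notin> K" for x
    by (rule dir_deriv_support[OF compact_imp_closed[OF K] _ that]) (rule z)
  obtain B0 where B0: "\<And>x. x \<in> K \<Longrightarrow> norm (dir_deriv g x b) \<le> B0"
    using compact_imp_bounded[OF compact_continuous_image[OF continuous_on_subset[OF c subset_UNIV] K]] by (auto simp: bounded_iff)
  define B where "B = \<bar>B0\<bar>"
  have B: "\<bar>dir_deriv g x b\<bar> \<le> B" for x
    using B0[of x] dz[of x] unfolding B_def by (cases "x \<in> K") auto
  obtain R where R: "\<And>x. x \<in> K \<Longrightarrow> norm x \<le> R" using compact_imp_bounded[OF K] by (auto simp: bounded_iff)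
  have line: "((\<lambda>t. g (x + t *\<^sub>R b)) has_real_derivative dir_deriv g (x + t *\<^sub>R b) b) (at t)" for x t
  proof -
    have "((\<lambda>t. x + t *\<^sub>R b) has_derivative (\<lambda>h. h *\<^sub>R b)) (at t)" by (auto intro!: derivative_eq_intros)
    from has_derivative_compose[OF this gD]
    have "((\<lambda>t. g (x + t *\<^sub>R b)) has_derivative (\<lambda>h. dir_deriv g (x + t *\<^sub>R b) (h *\<^sub>R b))) (at t)" .
    moreover have "dir_deriv g y (h *\<^sub>R b) = dir_deriv g y b * h" for y h
      using linear_scale[OF bounded_linear.linear[OF has_derivative_bounded_linear[OF gD]]] by simp
    ultimately show ?thesis by (simp add: has_field_derivative_def)
  qed
  define e where "e n = 1 / real (Suc n)" for n
  have e: "e n > 0" "e n \<le> 1" for n by (auto simp: e_def)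
  have el: "e \<longlonglongrightarrow> 0" unfolding e_def by (rule LIMSEQ_Suc[OF lim_1_over_n])
  define D where "D n x = (g (x + e n *\<^sub>R b) - g x) / e n" for n x
  have gi: "integrable lborel g" by (rule integrable_compact_support[OF K continuous_on_subset[OF gc] z]) auto
  have ti: "integrable lborel (\<lambda>x. g (x + v))" "(\<integral>x. g (x + v) \<partial>lborel) = (\<integral>x. g x \<partial>lborel)" for v
  proof -
    have m: "(\<lambda>x. x + v) \<in> measurable lborel borel" by simp
    have dd: "distr lborel borel (\<lambda>x. x + v) = lborel"
    proof -
      have "(\<lambda>x. x + v) = (+) v" by (auto simp: add.commute)
      then show ?thesis using lborel_distr_plus[of v] by simp
    qed
    show "integrable lborel (\<lambda>x. g (x + v))"
      using integrable_distr_eq[OF m, of g] gi borel_measurable_continuous_onI[OF gc] unfolding dd by simp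
    show "(\<integral>x. g (x + v) \<partial>lborel) = (\<integral>x. g x \<partial>lborel)"
      using integral_distr[OF m, of g] borel_measurable_continuous_onI[OF gc] unfolding dd by simp
  qed
  have D0: "(\<integral>x. D n x \<partial>lborel) = 0" for n
    unfolding D_def using ti[of "e n *\<^sub>R b"] gi by simp
  have "(\<lambda>n. \<integral>x. D n x \<partial>lborel) \<longlonglongrightarrow> (\<integral>x. dir_deriv g x b \<partial>lborel)"
  \<comment> \<open>All shifts are at most 1, so outside the ball of radius R + |b| both x and x + e
    n b miss the support; inside, the mean value theorem bounds the quotient by B.\<close>
  proof (rule integral_dominated_convergence[where w="\<lambda>x. indicator (cball 0 (R + norm b)) x * B"])
    show "(\<lambda>x. dir_deriv g x b) \<in> borel_measurable lborel"
      using borel_measurable_continuous_onI[OF c] by simp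
    show "D n \<in> borel_measurable lborel" for n
      unfolding D_def using ti(1)[of "e n *\<^sub>R b"] gi by auto
    show "integrable lborel (\<lambda>x::'a. indicator (cball 0 (R + norm b)) x * B)"
      using borel_integrable_compact[of "cball (0::'a) (R + norm b)" "\<lambda>x::'a. B"] by (simp add: compact_cball)
    show "AE x in lborel. (\<lambda>n. D n x) \<longlonglongrightarrow> dir_deriv g x b"
    proof (rule AE_I2)
      fix x
      have "((\<lambda>h. (g (x + h *\<^sub>R b) - g x) / h) \<longlongrightarrow> dir_deriv g x b) (at 0)"
        using line[of x 0] by (simp add: DERIV_def)
      moreover have "filterlim e (at 0) sequentially"
        using el e(1) by (auto simp: filterlim_at intro!: always_eventually) (metis less_irrefl)
      ultimately show "(\<lambda>n. D n x) \<longlonglongrightarrow> dir_deriv g x b"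
        unfolding D_def by (rule filterlim_compose)
    qed
    show "AE x in lborel. norm (D n x) \<le> indicator (cball 0 (R + norm b)) x * B" for n
    proof (rule AE_I2)
      fix x
      show "norm (D n x) \<le> indicator (cball 0 (R + norm b)) x * B"
      proof (cases "x \<in> cball 0 (R + norm b)")
        case True
        obtain t where t: "g (x + e n *\<^sub>R b) - g (x + 0 *\<^sub>R b) = (e n - 0) * dir_deriv g (x + t *\<^sub>R b) b"
          using MVT2[of 0 "e n" "\<lambda>t. g (x + t *\<^sub>R b)" "\<lambda>t. dir_deriv g (x + t *\<^sub>R b) b"] line e(1) by blast
        then have "D n x = dir_deriv g (x + t *\<^sub>R b) b" unfolding D_def using e(1)[of n] by simp
        then show ?thesis using B True by simp
      next
        case False
        then have nx: "norm x > R + norm b" by simp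
        have 1: "x \<notin> K" using R[of x] nx norm_ge_zero[of b] by linarith
        have "norm x \<le> norm (x + e n *\<^sub>R b) + norm (e n *\<^sub>R b)"
          using norm_triangle_ineq4[of "x + e n *\<^sub>R b" "e n *\<^sub>R b"] by simp
        moreover have "norm (e n *\<^sub>R b) \<le> norm b" using e[of n] by (simp add: mult_left_le_one_le)
        ultimately have 2: "x + e n *\<^sub>R b \<notin> K" using R[of "x + e n *\<^sub>R b"] nx by linarith
        show ?thesis using z[OF 1] z[OF 2] False by (simp add: D_def)
      qed
    qed
  qed
  then show ?thesis by (simp add: D0 LIMSEQ_const_iff)
qed

text \<open>The product f \<psi> is differentiable everywhere although f is controlled only on S:
  the open sets S and the complement of the support of \<psi> cover the space, and on the second the
  product vanishes.\<close>

lemma integral_by_parts: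
  fixes f \<psi> :: "'a::euclidean_space \<Rightarrow> real"
  assumes S: "open S" and f: "f differentiable_on S" "continuous_on S (\<lambda>x. dir_deriv f x b)"
    and \<psi>: "test_function S \<psi>"
  shows "(\<integral>x. f x * dir_deriv \<psi> x b \<partial>lborel) = - (\<integral>x. dir_deriv f x b * \<psi> x \<partial>lborel)"
proof -
  obtain K where K: "compact K" "K \<subseteq> S" "\<And>x. x \<notin> K \<Longrightarrow> \<psi> x = 0" and sm: "smooth_on UNIV \<psi>"
    using \<psi> by (auto simp: test_function_def)
  have Kc: "closed K" using K by (simp add: compact_imp_closed)
  have \<psi>D: "(\<psi> has_derivative dir_deriv \<psi> x) (at x)" for x
    using differentiable_on_dir_deriv[OF smooth_on_imp_differentiable_on[OF sm]] by simp
  have \<psi>c: "continuous_on UNIV \<psi>" "continuous_on UNIV (\<lambda>x. dir_deriv \<psi> x b)"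
    using smooth_on_imp_continuous_on smooth_on_dir_deriv sm by blast+
  have d\<psi>z: "dir_deriv \<psi> x b = 0" if "x \<notin> K" for x
    by (rule dir_deriv_support[OF Kc _ that]) (rule K(3))
  have fc: "continuous_on S f" using f(1) by (rule differentiable_imp_continuous_on)
  define g where "g x = f x * \<psi> x" for x
  have g1: "(g has_derivative (\<lambda>v. f x * dir_deriv \<psi> x v + dir_deriv f x v * \<psi> x)) (at x)" if "x \<in> S" for x
    unfolding g_def by (rule has_derivative_mult[OF differentiable_on_dir_deriv[OF f(1) S that] \<psi>D])
  have g2: "(g has_derivative (\<lambda>v. 0)) (at x)" if "x \<notin> K" for x
    by (rule has_derivative_transform_within_open[of "\<lambda>_. 0" _ _ _ "- K"]) (use that Kc K(3) in \<open>auto simp: g_def\<close>)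
  have gd: "dir_deriv g x b = f x * dir_deriv \<psi> x b + dir_deriv f x b * \<psi> x" for x
  proof (cases "x \<in> S")
    case True show ?thesis using dir_deriv_eq[OF g1[OF True]] by simp
  next
    case False then have "x \<notin> K" using K by auto
    then show ?thesis using dir_deriv_eq[OF g2] K(3) d\<psi>z by simp
  qed
  have i1: "integrable lborel (\<lambda>x. f x * dir_deriv \<psi> x b)"
    by (rule integrable_compact_support[OF K(1)])
      (use K d\<psi>z in \<open>auto intro!: continuous_intros continuous_on_subset[OF fc] continuous_on_subset[OF \<psi>c(2)]\<close>)
  have i2: "integrable lborel (\<lambda>x. dir_deriv f x b * \<psi> x)"
    by (rule integrable_compact_support[OF K(1)])
      (use K in \<open>auto intro!: continuous_intros continuous_on_subset[OF f(2)] continuous_on_subset[OF \<psi>c(1)]\<close>)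
  have "(\<integral>x. dir_deriv g x b \<partial>lborel) = 0"
  proof (rule integral_dir_deriv_zero[OF _ _ K(1)])
    show "g differentiable_on UNIV"
      using g1 g2 K by (auto simp: differentiable_on_def differentiable_def) blast
    have "continuous_on (S \<union> - K) (\<lambda>x. dir_deriv g x b)"
    proof (rule continuous_on_open_Un[OF S])
      show "open (- K)" using Kc by auto
      show "continuous_on S (\<lambda>x. dir_deriv g x b)" unfolding gd
        by (intro continuous_intros fc f(2) continuous_on_subset[OF \<psi>c(1)] continuous_on_subset[OF \<psi>c(2)]) auto
      have "continuous_on (- K) (\<lambda>x. 0::real)" by simp
      then show "continuous_on (- K) (\<lambda>x. dir_deriv g x b)"
        by (rule continuous_on_eq) (simp add: gd d\<psi>z K(3))
    qed
    moreover have "S \<union> - K = UNIV" using K by auto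
    ultimately show "continuous_on UNIV (\<lambda>x. dir_deriv g x b)" by simp
    show "g x = 0" if "x \<notin> K" for x using K(3)[OF that] by (simp add: g_def)
  qed
  then show ?thesis unfolding gd using i1 i2 by simp
qed

section \<open>Tangent and cotangent spaces\<close>

lemma adjoint_works':
  fixes f :: "'a::euclidean_space \<Rightarrow> 'b::euclidean_space"
  assumes "linear f" shows "adjoint f y \<bullet> x = y \<bullet> f x"
  using adjoint_works[OF assms, of x y] by (simp add: inner_commute)

lemma gradient_vec_inner:
  assumes "(f has_derivative D) (at x)" shows "gradient_vec f x \<bullet> h = D h"
proof -
  have l: "linear D" using has_derivative_bounded_linear[OF assms] bounded_linear.linear by blast
  have "gradient_vec f x \<bullet> h = (\<Sum>b\<in>Basis. D b * (b \<bullet> h))"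
    unfolding gradient_vec_def dir_deriv_eq[OF assms] by (simp add: inner_sum_left)
  also have "\<dots> = D (\<Sum>b\<in>Basis. (h \<bullet> b) *\<^sub>R b)"
    unfolding linear_sum[OF l] by (intro sum.cong refl) (simp add: linear_scale[OF l] inner_commute)
  finally show ?thesis by (simp add: euclidean_representation)
qed

lemma gradient_vec_eq:
  assumes "(f has_derivative (\<lambda>h. v \<bullet> h)) (at x)" shows "gradient_vec f x = v"
  using gradient_vec_inner[OF assms] by (metis vector_eq_rdot)

locale smooth_manifold =
  fixes A :: "('m::{t2_space,second_countable_topology}, 'e::euclidean_space) chart set"
  assumes atlas: "smooth_atlas A"
begin

lemma cdom_open: "c \<in> A \<Longrightarrow> open (cdom c)"
  and cran_open: "c \<in> A \<Longrightarrow> open (cran c)"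
  and chart_homeo: "c \<in> A \<Longrightarrow> homeomorphism (cdom c) (cran c) (cmap c) (cinv c)"
  and charts_cover: "(\<Union>c\<in>A. cdom c) = UNIV"
  and trans_smooth: "c \<in> A \<Longrightarrow> d \<in> A \<Longrightarrow> smooth_on (cmap c ` (cdom c \<inter> cdom d)) (cmap d \<circ> cinv c)"
  using atlas by (auto simp: smooth_atlas_def)

lemma cinv_cmap [simp]: "c \<in> A \<Longrightarrow> p \<in> cdom c \<Longrightarrow> cinv c (cmap c p) = p"
  using chart_homeo[of c] by (simp add: homeomorphism_def)

lemma cmap_cinv [simp]: "c \<in> A \<Longrightarrow> y \<in> cran c \<Longrightarrow> cmap c (cinv c y) = y"
  by (rule homeomorphism_apply2[OF chart_homeo])

lemma cinv_in [simp]: "c \<in> A \<Longrightarrow> y \<in> cran c \<Longrightarrow> cinv c y \<in> cdom c"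
  using chart_homeo[of c] by (auto simp: homeomorphism_def)

lemma cmap_cont: "c \<in> A \<Longrightarrow> continuous_on (cdom c) (cmap c)"
  and cinv_cont: "c \<in> A \<Longrightarrow> continuous_on (cran c) (cinv c)"
  using chart_homeo[of c] by (auto simp: homeomorphism_def)

lemma cmap_open:
  assumes "c \<in> A" "open U" "U \<subseteq> cdom c" shows "open (cmap c ` U)"
proof -
  have "cmap c ` U = cran c \<inter> cinv c -` U"
    using assms by (force simp: image_iff)
  then show ?thesis
    using continuous_open_preimage[OF cinv_cont[OF assms(1)] cran_open[OF assms(1)] assms(2)] by simp
qed

lemma overlap_open: "c \<in> A \<Longrightarrow> d \<in> A \<Longrightarrow> open (cmap c ` (cdom c \<inter> cdom d))"
  by (rule cmap_open) (auto simp: cdom_open open_Int)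

definition T :: "('m,'e) chart \<Rightarrow> ('m,'e) chart \<Rightarrow> 'm \<Rightarrow> 'e \<Rightarrow> 'e" where
  "T c d p = dir_deriv (cmap d \<circ> cinv c) (cmap c p)"

lemma trans_derivative:
  assumes "c \<in> A" "d \<in> A" "p \<in> cdom c" "p \<in> cdom d"
  shows "((cmap d \<circ> cinv c) has_derivative T c d p) (at (cmap c p))"
  unfolding T_def
  by (rule differentiable_on_dir_deriv[OF smooth_on_imp_differentiable_on[OF trans_smooth] overlap_open])
    (use assms in auto)

lemma T_linear: "c \<in> A \<Longrightarrow> d \<in> A \<Longrightarrow> p \<in> cdom c \<Longrightarrow> p \<in> cdom d \<Longrightarrow> linear (T c d p)"
  using has_derivative_bounded_linear[OF trans_derivative] bounded_linear.linear by blast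

text \<open>The chain rule; the two composites agree only on the overlap of charts, but that is an
  open neighbourhood of the point.\<close>

lemma T_cocycle:
  assumes c: "c \<in> A" "p \<in> cdom c" and d: "d \<in> A" "p \<in> cdom d" and e: "e \<in> A" "p \<in> cdom e"
  shows "T d e p (T c d p w) = T c e p w"
proof -
  have 1: "((cmap d \<circ> cinv c) has_derivative T c d p) (at (cmap c p))"
    using trans_derivative c d by blast
  have 2: "((cmap e \<circ> cinv d) has_derivative T d e p) (at ((cmap d \<circ> cinv c) (cmap c p)))"
    using trans_derivative[of d e p] c d e by simp
  have "((\<lambda>y. (cmap e \<circ> cinv d) ((cmap d \<circ> cinv c) y)) has_derivative (\<lambda>w. T d e p (T c d p w))) (at (cmap c p))"
    by (rule has_derivative_compose[OF 1 2])
  then have "((cmap e \<circ> cinv c) has_derivative (\<lambda>w. T d e p (T c d p w))) (at (cmap c p))"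
    by (rule has_derivative_transform_within_open[OF _ overlap_open[OF c(1) d(1)]]) (use c d in auto)
  from dir_deriv_eq[OF this] show ?thesis by (simp add: T_def)
qed

lemma T_id:
  assumes c: "c \<in> A" "p \<in> cdom c" shows "T c c p w = w"
proof -
  have "((\<lambda>y. y) has_derivative (\<lambda>w. w)) (at (cmap c p))" by (rule has_derivative_ident)
  then have "((cmap c \<circ> cinv c) has_derivative (\<lambda>w. w)) (at (cmap c p))"
    by (rule has_derivative_transform_within_open[OF _ cran_open[OF c(1)]]) (use c in auto)
  from dir_deriv_eq[OF this] show ?thesis by (simp add: T_def)
qed

lemma charts_at_iff: "c \<in> charts_at A p \<longleftrightarrow> c \<in> A \<and> p \<in> cdom c"
  by (simp add: charts_at_def)

lemma charts_at_ne: "\<exists>c. c \<in> charts_at A p"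
  using charts_cover unfolding charts_at_def by blast

lemma tvec_of_at: "d \<in> charts_at A p \<Longrightarrow> tvec_of A c p w d = T c d p w"
  by (simp add: tvec_of_def T_def)

lemma covec_of_at: "d \<in> charts_at A p \<Longrightarrow> covec_of A c p a d = adjoint (T d c p) a"
  by (simp add: covec_of_def T_def)

lemma tvec_of_self: "c \<in> charts_at A p \<Longrightarrow> tvec_of A c p w c = w"
  by (simp add: tvec_of_at T_id charts_at_iff)

lemma tvec_of_tangent:
  assumes "c \<in> charts_at A p" shows "tvec_of A c p w \<in> tangent_space A p"
  unfolding tangent_space_def
proof (safe)
  fix d assume d: "d \<in> charts_at A p"
  show "tvec_of A c p w = tvec_of A d p (tvec_of A c p w d)"
  proof
    fix e show "tvec_of A c p w e = tvec_of A d p (tvec_of A c p w d) e"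
      using assms d T_cocycle[of c p d e w]
      by (cases "e \<in> charts_at A p") (auto simp: tvec_of_at charts_at_iff tvec_of_def T_def)
  qed
qed

lemma tangent_space_eq: "c \<in> charts_at A p \<Longrightarrow> v \<in> tangent_space A p \<Longrightarrow> v = tvec_of A c p (v c)"
  by (simp add: tangent_space_def)

lemma tvec_of_change: "c \<in> charts_at A p \<Longrightarrow> d \<in> charts_at A p \<Longrightarrow> tvec_of A c p w = tvec_of A d p (T c d p w)"
  using tangent_space_eq[OF _ tvec_of_tangent, of d p c w] by (simp add: tvec_of_at)

lemma covec_inner:
  assumes "c \<in> charts_at A p" "d \<in> charts_at A p"
  shows "covec_of A c p a d \<bullet> w = a \<bullet> T d c p w"
  using assms by (simp add: covec_of_at adjoint_works' T_linear charts_at_iff)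

lemma covec_of_self: "c \<in> charts_at A p \<Longrightarrow> covec_of A c p a c = a"
  by (rule vector_eq_rdot[THEN iffD1]) (simp add: covec_inner T_id charts_at_iff)

lemma covec_of_change:
  assumes c: "c \<in> charts_at A p" and d: "d \<in> charts_at A p"
  shows "covec_of A d p (covec_of A c p a d) = covec_of A c p a"
proof
  fix e show "covec_of A d p (covec_of A c p a d) e = covec_of A c p a e"
  proof (cases "e \<in> charts_at A p")
    case True
    have "covec_of A d p (covec_of A c p a d) e \<bullet> w = covec_of A c p a e \<bullet> w" for w
      using c d True T_cocycle[of e p d c w] by (simp add: covec_inner charts_at_iff)
    then show ?thesis by (rule vector_eq_rdot[THEN iffD1, OF allI])
  qed (simp add: covec_of_def)
qed

lemma covec_of_cotangent: "c \<in> charts_at A p \<Longrightarrow> covec_of A c p a \<in> cotangent_space A p"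
  unfolding cotangent_space_def by (simp add: covec_of_change)

lemma cotangent_space_eq: "c \<in> charts_at A p \<Longrightarrow> \<alpha> \<in> cotangent_space A p \<Longrightarrow> \<alpha> = covec_of A c p (\<alpha> c)"
  by (simp add: cotangent_space_def)

lemma covec_of_add:
  assumes "c \<in> charts_at A p"
  shows "covec_of A c p (a + r *\<^sub>R b) d = covec_of A c p a d + r *\<^sub>R covec_of A c p b d"
proof (cases "d \<in> charts_at A p")
  case True
  show ?thesis
    by (rule vector_eq_rdot[THEN iffD1]) (simp add: covec_inner[OF assms True] inner_add_left)
qed (simp add: covec_of_def)

lemma covec_of_0: "c \<in> charts_at A p \<Longrightarrow> covec_of A c p 0 = (\<lambda>_. 0)"
proof
  fix d assume c: "c \<in> charts_at A p"
  show "covec_of A c p 0 d = 0"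
  proof (cases "d \<in> charts_at A p")
    case True show ?thesis by (rule vector_eq_rdot[THEN iffD1]) (simp add: covec_inner[OF c True])
  qed (simp add: covec_of_def)
qed

lemma tvec_of_0: "c \<in> charts_at A p \<Longrightarrow> tvec_of A c p 0 = (\<lambda>_. 0)"
proof
  fix d assume c: "c \<in> charts_at A p"
  show "tvec_of A c p 0 d = 0"
  proof (cases "d \<in> charts_at A p")
    case True then show ?thesis using c linear_0[OF T_linear, of c d p] by (simp add: tvec_of_at charts_at_iff)
  qed (simp add: tvec_of_def)
qed

text \<open>Vectors change by the Jacobian and covectors by its adjoint, so the inner product of the
  components is independent of the chart chosen in \<open>pairing\<close>.\<close>

lemma pairing_eq:
  assumes \<alpha>: "\<alpha> \<in> cotangent_space A p" and v: "v \<in> tangent_space A p" and c: "c \<in> charts_at A p"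
  shows "pairing A p \<alpha> v = \<alpha> c \<bullet> v c"
proof -
  define d where "d = (SOME c. c \<in> charts_at A p)"
  have d: "d \<in> charts_at A p" unfolding d_def using charts_at_ne by (rule someI_ex)
  have "\<alpha> d \<bullet> v d = covec_of A c p (\<alpha> c) d \<bullet> v d" using cotangent_space_eq[OF c \<alpha>] by simp
  also have "\<dots> = \<alpha> c \<bullet> T d c p (v d)" by (rule covec_inner[OF c d])
  also have "T d c p (v d) = v c"
    using tangent_space_eq[OF d v] tvec_of_at[OF c, of d "v d"] by simp
  finally show ?thesis unfolding pairing_def Let_def d_def .
qed

lemma pairing_covec_tvec: "c \<in> charts_at A p \<Longrightarrow> pairing A p (covec_of A c p a) (tvec_of A c p w) = a \<bullet> w"
  using pairing_eq[OF covec_of_cotangent tvec_of_tangent] by (simp add: covec_of_self tvec_of_self)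

lemma tangent_space_range: "c \<in> charts_at A p \<Longrightarrow> tangent_space A p = range (tvec_of A c p)"
  using tvec_of_tangent tangent_space_eq by blast

lemma hamiltonian_covec_of:
  assumes c: "c \<in> charts_at A p"
  shows "hamiltonian A L p (covec_of A c p a) = (SUP w. ereal (a \<bullet> w - L p (tvec_of A c p w)))"
  unfolding hamiltonian_def tangent_space_range[OF c] image_image
  by (simp add: pairing_covec_tvec[OF c])

lemma differential_covec:
  assumes f: "smooth_fun A f" and c: "c \<in> charts_at A p"
  shows "differential A f p = covec_of A c p (gradient_vec (f \<circ> cinv c) (cmap c p))"
proof
  fix d show "differential A f p d = covec_of A c p (gradient_vec (f \<circ> cinv c) (cmap c p)) d"
  proof (cases "d \<in> charts_at A p")
    case True
    have cA: "c \<in> A" "p \<in> cdom c" and dA: "d \<in> A" "p \<in> cdom d" using c True by (auto simp: charts_at_iff)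
    have fd: "((f \<circ> cinv e) has_derivative dir_deriv (f \<circ> cinv e) (cmap e p)) (at (cmap e p))" if "e \<in> A" "p \<in> cdom e" for e
      using f that cran_open[OF that(1)] unfolding smooth_fun_def
      by (intro differentiable_on_dir_deriv[OF smooth_on_imp_differentiable_on]) auto
    have "((f \<circ> cinv c) has_derivative dir_deriv (f \<circ> cinv c) (cmap c p)) (at ((cmap c \<circ> cinv d) (cmap d p)))"
      using fd[OF cA] dA by simp
    from has_derivative_compose[OF trans_derivative[OF dA(1) cA(1) dA(2) cA(2)] this]
    have "((f \<circ> cinv d) has_derivative (\<lambda>w. dir_deriv (f \<circ> cinv c) (cmap c p) (T d c p w))) (at (cmap d p))"
      by (rule has_derivative_transform_within_open[OF _ overlap_open[OF dA(1) cA(1)]]) (use cA dA in auto)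
    note g = gradient_vec_inner[OF this]
    show ?thesis
      by (rule vector_eq_rdot[THEN iffD1])
        (simp add: differential_def True g covec_inner[OF c True] gradient_vec_inner[OF fd[OF cA]])
  qed (simp add: differential_def covec_of_def)
qed

lemma differential_at:
  assumes "smooth_fun A f" "c \<in> charts_at A p"
  shows "differential A f p c = gradient_vec (f \<circ> cinv c) (cmap c p)"
  using differential_covec[OF assms] covec_of_self[OF assms(2)] by simp

end

section \<open>The Lagrangian in a chart\<close>

locale lagrangian_manifold = smooth_manifold A for A :: "('m::{t2_space,second_countable_topology}, 'e::euclidean_space) chart set" +
  fixes L :: "'m \<Rightarrow> ('m, 'e) tvec \<Rightarrow> real"
  assumes lagr: "lagrangian A L"
begin

definition Lc :: "('m,'e) chart \<Rightarrow> 'e \<Rightarrow> 'e \<Rightarrow> real" where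
  "Lc c y w = L (cinv c y) (tvec_of A c (cinv c y) w)"

text \<open>The fibre derivative as a vector. It is read off from the derivative in both variables
  so that its joint continuity in y and v is part of the C1 assumption.\<close>

definition Pc :: "('m,'e) chart \<Rightarrow> 'e \<Rightarrow> 'e \<Rightarrow> 'e" where
  "Pc c y v = (\<Sum>b\<in>Basis. dir_deriv (\<lambda>(y, w). Lc c y w) (y, v) (0, b) *\<^sub>R b)"

lemma Lc_C1: "c \<in> A \<Longrightarrow> Ck_on 1 (cran c \<times> UNIV) (\<lambda>(y, w). Lc c y w)"
  and Lc_smooth: "c \<in> A \<Longrightarrow> smooth_on (cran c \<times> (UNIV - {0})) (\<lambda>(y, w). Lc c y w)"
  and L_nonneg: "z \<in> tangent_space A p \<Longrightarrow> 0 \<le> L p z"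
  and L_zero: "L p (\<lambda>_. 0) = 0"
  and L_hessian: "c \<in> charts_at A p \<Longrightarrow> v \<noteq> 0 \<Longrightarrow> w \<noteq> 0 \<Longrightarrow> 0 < hessian (\<lambda>v. L p (tvec_of A c p v)) v w w"
  using lagr unfolding lagrangian_def Lc_def by auto

lemma at_cinv: "c \<in> A \<Longrightarrow> y \<in> cran c \<Longrightarrow> c \<in> charts_at A (cinv c y)"
  by (simp add: charts_at_iff)

lemma joint_derivative:
  assumes "c \<in> A" "y \<in> cran c"
  shows "((\<lambda>(y, w). Lc c y w) has_derivative dir_deriv (\<lambda>(y, w). Lc c y w) (y, v)) (at (y, v))"
proof (rule differentiable_on_dir_deriv[of _ "cran c \<times> UNIV"])
  show "(\<lambda>(y, w). Lc c y w) differentiable_on cran c \<times> UNIV" using Lc_C1[OF assms(1)] by simp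
qed (use assms cran_open in \<open>auto intro: open_Times\<close>)

lemma slice_derivative: "((\<lambda>w. (y, w)) has_derivative (\<lambda>h. (0, h))) (at v)"
  by (auto intro!: derivative_eq_intros)

lemma Pc_inner:
  assumes "c \<in> A" "y \<in> cran c"
  shows "Pc c y v \<bullet> h = dir_deriv (\<lambda>(y, w). Lc c y w) (y, v) (0, h)"
proof -
  let ?D = "dir_deriv (\<lambda>(y, w). Lc c y w) (y, v)"
  have l: "linear (\<lambda>h. ?D (0, h))"
    using linear_compose[OF bounded_linear.linear[OF has_derivative_bounded_linear[OF slice_derivative]]
      bounded_linear.linear[OF has_derivative_bounded_linear[OF joint_derivative[OF assms]]]] by (simp add: o_def)
  have "?D (0, h) = ?D (0, \<Sum>b\<in>Basis. (h \<bullet> b) *\<^sub>R b)" by (simp add: euclidean_representation)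
  also have "\<dots> = (\<Sum>b\<in>Basis. (h \<bullet> b) * ?D (0, b))"
    using linear_sum[OF l, of "\<lambda>b. (h \<bullet> b) *\<^sub>R b" Basis] linear_scale[OF l] by simp
  finally show ?thesis unfolding Pc_def by (simp add: inner_sum_right inner_commute[of _ h] mult.commute)
qed

lemma Lc_derivative:
  assumes "c \<in> A" "y \<in> cran c"
  shows "(Lc c y has_derivative (\<lambda>h. Pc c y v \<bullet> h)) (at v)"
  using has_derivative_compose[OF slice_derivative joint_derivative[OF assms]]
  by (simp add: Pc_inner[OF assms])

lemma Pc_cont:
  assumes "c \<in> A" shows "continuous_on (cran c \<times> UNIV) (\<lambda>(y, v). Pc c y v)"
proof -
  have "continuous_on (cran c \<times> UNIV) (\<lambda>z. dir_deriv (\<lambda>(y, w). Lc c y w) z (0, b))" for b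
    using Lc_C1[OF assms] by simp
  then have "continuous_on (cran c \<times> UNIV) (\<lambda>z. \<Sum>b\<in>Basis. dir_deriv (\<lambda>(y, w). Lc c y w) z (0, b) *\<^sub>R b)"
    by (intro continuous_intros)
  then show ?thesis by (simp add: Pc_def split_beta')
qed

lemma Pc_directional_derivative:
  assumes c: "c \<in> A" and y: "y \<in> cran c" and v: "v \<noteq> 0" and d: "d \<noteq> 0"
  shows "\<exists>D>0. ((\<lambda>t. Pc c y (v + t *\<^sub>R d) \<bullet> d) has_real_derivative D) (at 0)"
proof -
  let ?J = "\<lambda>(y, w). Lc c y w"
  have op: "open (cran c \<times> (UNIV - {0::'e}))" using cran_open[OF c] by (intro open_Times) auto
  have "(\<lambda>z. dir_deriv ?J z (0, d)) differentiable_on (cran c \<times> (UNIV - {0}))"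
    using smooth_on_imp_differentiable_on[OF smooth_on_dir_deriv[OF Lc_smooth[OF c]]] .
  from differentiable_on_dir_deriv[OF this op, of "(y, v)"] y v
  have j: "((\<lambda>z. dir_deriv ?J z (0, d)) has_derivative dir_deriv (\<lambda>z. dir_deriv ?J z (0, d)) (y, v)) (at (y, v))" by auto
  let ?D = "\<lambda>h. dir_deriv (\<lambda>z. dir_deriv ?J z (0, d)) (y, v) (0, h)"
  have pd: "((\<lambda>w. Pc c y w \<bullet> d) has_derivative ?D) (at v)"
    using has_derivative_compose[OF slice_derivative j] by (simp add: Pc_inner[OF c y])
  have dL: "dir_deriv (Lc c y) w d = Pc c y w \<bullet> d" for w
    using dir_deriv_eq[OF Lc_derivative[OF c y]] by simp
  have "0 < hessian (Lc c y) v d d"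
    using L_hessian[OF at_cinv[OF c y] v d] unfolding Lc_def .
  then have pos: "0 < ?D d"
    unfolding hessian_def dL using dir_deriv_eq[OF pd] by simp
  have "((\<lambda>t. v + t *\<^sub>R d) has_derivative (\<lambda>h. h *\<^sub>R d)) (at 0)" by (auto intro!: derivative_eq_intros)
  moreover have "((\<lambda>w. Pc c y w \<bullet> d) has_derivative ?D) (at (v + 0 *\<^sub>R d))" using pd by simp
  ultimately have "((\<lambda>t. Pc c y (v + t *\<^sub>R d) \<bullet> d) has_derivative (\<lambda>h. ?D (h *\<^sub>R d))) (at 0)"
    by (rule has_derivative_compose)
  moreover have "?D (h *\<^sub>R d) = ?D d * h" for h
    using linear_scale[OF bounded_linear.linear[OF has_derivative_bounded_linear[OF pd]]] by simp
  ultimately have "((\<lambda>t. Pc c y (v + t *\<^sub>R d) \<bullet> d) has_real_derivative ?D d) (at 0)"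
    by (simp add: has_field_derivative_def)
  then show ?thesis using pos by blast
qed

text \<open>Along the segment from w to v the component of the fibre derivative in direction v - w
  is continuous, and has positive derivative except possibly where the segment meets the origin,
  since the Hessian is controlled only off the zero section. This happens for at most one parameter
  s, and the function increases strictly on both sides of s.\<close>

lemma Pc_mono:
  assumes c: "c \<in> A" and y: "y \<in> cran c" and vw: "v \<noteq> w"
  shows "0 < (Pc c y v - Pc c y w) \<bullet> (v - w)"
proof -
  define d where "d = v - w"
  have d: "d \<noteq> 0" using vw by (simp add: d_def)
  define \<phi> where "\<phi> t = Pc c y (w + t *\<^sub>R d) \<bullet> d" for t
  have der: "\<exists>D>0. (\<phi> has_real_derivative D) (at t)" if nz: "w + t *\<^sub>R d \<noteq> 0" for t
  proof -
    obtain D where D: "D > 0" "((\<lambda>s. Pc c y (w + t *\<^sub>R d + s *\<^sub>R d) \<bullet> d) has_real_derivative D) (at 0)"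
      using Pc_directional_derivative[OF c y nz d] by blast
    then have "((\<lambda>s. \<phi> (s + t)) has_real_derivative D) (at 0)"
      unfolding \<phi>_def by (simp add: algebra_simps)
    then have "(\<phi> has_real_derivative D) (at t)" using DERIV_shift[of \<phi> D 0 t] by simp
    then show ?thesis using D by blast
  qed
  have cont: "continuous_on X \<phi>" for X
  proof -
    have "continuous_on X (\<lambda>t. (\<lambda>(y, v). Pc c y v) (y, w + t *\<^sub>R d))"
      by (rule continuous_on_compose2[OF Pc_cont[OF c]]) (use y in \<open>auto intro!: continuous_intros\<close>)
    then show ?thesis unfolding \<phi>_def by (auto intro!: continuous_intros)
  qed
  have inc: "\<phi> a < \<phi> b" if ab: "a < b" and nz: "\<And>t. a < t \<Longrightarrow> t < b \<Longrightarrow> w + t *\<^sub>R d \<noteq> 0" for a b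
    by (rule DERIV_pos_imp_increasing_open[OF ab _ cont]) (use der nz in blast)
  have "\<phi> 0 < \<phi> 1"
  proof (cases "\<exists>s. 0 < s \<and> s < 1 \<and> w + s *\<^sub>R d = 0")
    case True
    then obtain s where s: "0 < s" "s < 1" "w + s *\<^sub>R d = 0" by blast
    have "w + t *\<^sub>R d \<noteq> 0" if "t \<noteq> s" for t
    proof
      assume "w + t *\<^sub>R d = 0"
      then have "(t - s) *\<^sub>R d = 0" using s(3) by (simp add: scaleR_diff_left add_eq_0_iff)
      then show False using d that by simp
    qed
    then have "\<phi> 0 < \<phi> s" "\<phi> s < \<phi> 1" using s by (auto intro!: inc)
    then show ?thesis by simp
  next
    case False
    then show ?thesis by (intro inc) auto
  qed
  then show ?thesis unfolding \<phi>_def by (simp add: d_def inner_diff_left)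
qed

lemma legendre_family_chart: "c \<in> A \<Longrightarrow> legendre_family (cran c) (Lc c) (Pc c)"
proof
  assume c: "c \<in> A"
  show "open (cran c)" by (rule cran_open[OF c])
  show "(Lc c y has_derivative (\<lambda>h. Pc c y v \<bullet> h)) (at v)" if "y \<in> cran c" for y v
    by (rule Lc_derivative[OF c that])
  show "continuous_on (cran c \<times> UNIV) (\<lambda>(x, v). Pc c x v)" by (rule Pc_cont[OF c])
  show "continuous_on (cran c \<times> UNIV) (\<lambda>(x, v). Lc c x v)"
    using Lc_C1[OF c] by (auto intro: differentiable_imp_continuous_on)
  show "0 < (Pc c y v - Pc c y w) \<bullet> (v - w)" if "y \<in> cran c" "v \<noteq> w" for y v w
    by (rule Pc_mono[OF c that])
qed

lemma Lc_zero: "c \<in> A \<Longrightarrow> y \<in> cran c \<Longrightarrow> Lc c y 0 = 0"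
  by (simp add: Lc_def tvec_of_0 at_cinv L_zero)

text \<open>The Lagrangian is nonnegative and vanishes on the zero section, so zero is a minimum of
  each fibre.\<close>

lemma Pc_zero:
  assumes c: "c \<in> A" and y: "y \<in> cran c" shows "Pc c y 0 = 0"
proof -
  have "(\<lambda>h. Pc c y 0 \<bullet> h) = (\<lambda>h. 0)"
  proof (rule has_derivative_local_min[OF Lc_derivative[OF c y]])
    have "0 \<le> Lc c y w" for w unfolding Lc_def by (rule L_nonneg[OF tvec_of_tangent[OF at_cinv[OF c y]]])
    then show "\<forall>\<^sub>F w in at 0. Lc c y 0 \<le> Lc c y w" by (simp add: Lc_zero[OF c y])
  qed
  then have "Pc c y 0 \<bullet> Pc c y 0 = 0" by metis
  then show ?thesis by simp
qed

abbreviation Hc :: "('m,'e) chart \<Rightarrow> 'e \<Rightarrow> 'e \<Rightarrow> real" where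
  "Hc c \<equiv> legendre_family.fenchel (Lc c)"

lemma hamiltonian_fenchel_e:
  assumes "c \<in> charts_at A p"
  shows "hamiltonian A L p (covec_of A c p a) = legendre_family.fenchel_e (Lc c) (cmap c p) a"
  using assms hamiltonian_covec_of[OF assms, of L a] legendre_family_chart[of c]
  by (simp add: legendre_family.fenchel_e_def Lc_def charts_at_iff)

text \<open>Differentiating the change of chart of the Lagrangian along a fibre, where it is a
  linear substitution, shows that fibre derivatives transform as covectors.\<close>

lemma Pc_change:
  assumes c: "c \<in> charts_at A p" and d: "d \<in> charts_at A p"
  shows "Pc d (cmap d p) (T c d p v) = covec_of A c p (Pc c (cmap c p) v) d"
proof (rule vector_eq_rdot[THEN iffD1, OF allI])
  fix h
  have cA: "c \<in> A" "p \<in> cdom c" and dA: "d \<in> A" "p \<in> cdom d" using c d by (auto simp: charts_at_iff)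
  have eq: "Lc d (cmap d p) = (\<lambda>w. Lc c (cmap c p) (T d c p w))"
    unfolding Lc_def using cA dA tvec_of_change[OF d c] by auto
  have l: "(T d c p has_derivative T d c p) (at w)" for w
    by (rule bounded_linear_imp_has_derivative) (use T_linear cA dA in \<open>simp add: linear_conv_bounded_linear\<close>)
  have "T d c p (T c d p v) = v" using T_cocycle[OF cA dA cA] T_id[OF cA] by simp
  then have "(Lc c (cmap c p) has_derivative (\<lambda>h. Pc c (cmap c p) v \<bullet> h)) (at (T d c p (T c d p v)))"
    using Lc_derivative[OF cA(1), of "cmap c p" v] cA by simp
  from has_derivative_compose[OF l this]
  have 1: "(Lc d (cmap d p) has_derivative (\<lambda>h. Pc c (cmap c p) v \<bullet> T d c p h)) (at (T c d p v))"
    unfolding eq .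
  have 2: "(Lc d (cmap d p) has_derivative (\<lambda>h. Pc d (cmap d p) (T c d p v) \<bullet> h)) (at (T c d p v))"
    using Lc_derivative[OF dA(1)] dA by simp
  from has_derivative_unique[OF 1 2]
  show "Pc d (cmap d p) (T c d p v) \<bullet> h = covec_of A c p (Pc c (cmap c p) v) d \<bullet> h"
    unfolding covec_inner[OF c d] by metis
qed

text \<open>This covers only covectors of the form P v, before P is known to be onto, and the order
  matters: the growth hypothesis is phrased through \<open>legendre\<close>, and surjectivity of P
  will be derived from it. The Hamiltonian is differentiable at P v because the range of P is
  open.\<close>

lemma legendre_Pc:
  assumes c: "c \<in> charts_at A p"
  shows "legendre A L p (covec_of A c p (Pc c (cmap c p) v)) = tvec_of A c p v"
proof
  fix d show "legendre A L p (covec_of A c p (Pc c (cmap c p) v)) d = tvec_of A c p v d"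
  proof (cases "d \<in> charts_at A p")
    case True
    have dA: "d \<in> A" "p \<in> cdom d" using True by (auto simp: charts_at_iff)
    have eq: "(\<lambda>a. real_of_ereal (hamiltonian A L p (covec_of A d p a))) = Hc d (cmap d p)"
      using hamiltonian_fenchel_e[OF True] legendre_family.fenchel_def[OF legendre_family_chart[OF dA(1)]] by (auto simp: fun_eq_iff)
    have "(Hc d (cmap d p) has_derivative (\<lambda>h. T c d p v \<bullet> h)) (at (Pc d (cmap d p) (T c d p v)))"
      by (rule legendre_family.fenchel_has_derivative[OF legendre_family_chart[OF dA(1)]]) (use dA in auto)
    from gradient_vec_eq[OF this]
    show ?thesis using True by (simp add: legendre_def eq Pc_change[OF c True] tvec_of_at)
  qed (simp add: legendre_def tvec_of_def)
qed

end

section \<open>Growth of the fibre derivative\<close>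

locale heat_geometry = lagrangian_manifold A L
  for A :: "('m::{t2_space,second_countable_topology}, 'e::euclidean_space) chart set"
    and L :: "'m \<Rightarrow> ('m, 'e) tvec \<Rightarrow> real" +
  fixes m :: "'m measure" and g :: "'m \<Rightarrow> ('m, 'e) tvec \<Rightarrow> ('m, 'e) tvec \<Rightarrow> real"
  assumes compact_M: "compact (UNIV :: 'm set)"
    and m_smooth: "smooth_measure A m" and g_metric: "riemannian_metric A g"
    and legendre_growth: "\<forall>\<epsilon>>0. \<exists>C>0. \<forall>x. \<forall>\<alpha>\<in>cotangent_space A x. \<forall>\<beta>\<in>cotangent_space A x.
           tnorm g x (legendre A L x \<alpha> - legendre A L x \<beta>) \<ge> \<epsilon> \<longrightarrow>
           tnorm g x (legendre A L x \<alpha> - legendre A L x \<beta>) \<le> C * conorm A g x (\<alpha> - \<beta>)"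
begin

definition Gc :: "('m,'e) chart \<Rightarrow> 'm \<Rightarrow> 'e \<Rightarrow> 'e \<Rightarrow> real" where
  "Gc c p v w = g p (tvec_of A c p v) (tvec_of A c p w)"

lemma Gc_bilinear: "c \<in> charts_at A p \<Longrightarrow> bilinear (Gc c p)"
  using g_metric unfolding riemannian_metric_def Gc_def by simp

lemma Gc_pos:
  assumes c: "c \<in> charts_at A p" and w: "w \<noteq> 0" shows "0 < Gc c p w w"
proof -
  have "tvec_of A c p w \<noteq> (\<lambda>_. 0)" using w tvec_of_self[OF c, of w] by metis
  then show ?thesis using g_metric tvec_of_tangent[OF c] unfolding riemannian_metric_def Gc_def by blast
qed

lemma Gc_scale: "c \<in> charts_at A p \<Longrightarrow> Gc c p (r *\<^sub>R w) (r *\<^sub>R w) = r\<^sup>2 * Gc c p w w"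
  using Gc_bilinear[of c p] by (simp add: bilinear_lmul bilinear_rmul power2_eq_square)

lemma Gc_cont:
  assumes c: "c \<in> A"
  shows "continuous_on (cran c \<times> UNIV) (\<lambda>(y, w). Gc c (cinv c y) w w)"
proof -
  have gc: "continuous_on (cran c) (\<lambda>y. Gc c (cinv c y) b b')" for b b'
    using g_metric c unfolding riemannian_metric_def Gc_def by (auto intro: smooth_on_imp_continuous_on)
  have *: "continuous_on (cran c \<times> UNIV) (\<lambda>z. \<Sum>b\<in>Basis. \<Sum>b'\<in>Basis. (snd z \<bullet> b) * (snd z \<bullet> b') * Gc c (cinv c (fst z)) b b')"
    by (intro continuous_intros continuous_on_compose2[OF gc]) auto
  have **: "(\<Sum>b\<in>Basis. \<Sum>b'\<in>Basis. (w \<bullet> b) * (w \<bullet> b') * Gc c (cinv c y) b b') = Gc c (cinv c y) w w"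
    if y: "y \<in> cran c" for y w
  proof -
    note bl = Gc_bilinear[OF at_cinv[OF c y]]
    have "Gc c (cinv c y) w w = Gc c (cinv c y) (\<Sum>b\<in>Basis. (w \<bullet> b) *\<^sub>R b) (\<Sum>b\<in>Basis. (w \<bullet> b) *\<^sub>R b)"
      by (simp add: euclidean_representation)
    also have "\<dots> = (\<Sum>(b, b')\<in>Basis \<times> Basis. Gc c (cinv c y) ((w \<bullet> b) *\<^sub>R b) ((w \<bullet> b') *\<^sub>R b'))"
      by (rule bilinear_sum[OF bl])
    also have "\<dots> = (\<Sum>b\<in>Basis. \<Sum>b'\<in>Basis. (w \<bullet> b) * (w \<bullet> b') * Gc c (cinv c y) b b')"
      unfolding sum.cartesian_product[symmetric]
      by (intro sum.cong refl) (simp add: bilinear_lmul[OF bl] bilinear_rmul[OF bl])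
    finally show ?thesis ..
  qed
  show ?thesis
    by (rule continuous_on_eq[OF *]) (use ** in auto)
qed

text \<open>The quadratic form of the metric is continuous and positive on the compact product of K
  with the unit sphere, so it has a positive minimum there; homogeneity does the rest.\<close>

lemma tnorm_lower:
  assumes c: "c \<in> A" and K: "compact K" "K \<subseteq> cdom c"
  shows "\<exists>k>0. \<forall>p\<in>K. \<forall>w. k * norm w \<le> tnorm g p (tvec_of A c p w)"
proof (cases "K = {}")
  case True then show ?thesis by (intro exI[of _ 1]) auto
next
  case False
  have cK: "compact (cmap c ` K)" by (rule compact_continuous_image[OF continuous_on_subset[OF cmap_cont[OF c] K(2)] K(1)])
  have ne: "sphere 0 1 \<noteq> ({} :: 'e set)" by simp
  have cc: "continuous_on (cmap c ` K \<times> sphere 0 1) (\<lambda>(y, w). Gc c (cinv c y) w w)"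
    by (rule continuous_on_subset[OF Gc_cont[OF c]]) (use K in auto)
  obtain z where z: "z \<in> cmap c ` K \<times> sphere 0 1"
    "\<And>z'. z' \<in> cmap c ` K \<times> sphere 0 1 \<Longrightarrow> (\<lambda>(y, w). Gc c (cinv c y) w w) z \<le> (\<lambda>(y, w). Gc c (cinv c y) w w) z'"
    using continuous_attains_inf[OF compact_Times[OF cK compact_sphere] _ cc] False ne by blast
  obtain y0 w0 where zz: "z = (y0, w0)" by (cases z)
  define k where "k = Gc c (cinv c y0) w0 w0"
  have y0: "y0 \<in> cran c" "w0 \<noteq> 0" using z(1) K(2) unfolding zz by auto
  have k: "k > 0" unfolding k_def using Gc_pos[OF at_cinv[OF c y0(1)] y0(2)] .
  have "sqrt k * norm w \<le> tnorm g p (tvec_of A c p w)" if p: "p \<in> K" for p w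
  proof (cases "w = 0")
    case False
    have pc: "c \<in> charts_at A p" using p K c by (auto simp: charts_at_iff)
    have "(cmap c p, sgn w) \<in> cmap c ` K \<times> sphere 0 1" using p False by (simp add: norm_sgn)
    then have "k \<le> Gc c p (sgn w) (sgn w)" using z(2)[of "(cmap c p, sgn w)"] pc unfolding zz k_def by (simp add: charts_at_iff)
    then have "(norm w)\<^sup>2 * k \<le> (norm w)\<^sup>2 * Gc c p (sgn w) (sgn w)" by (intro mult_left_mono) auto
    also have "\<dots> = Gc c p w w" using Gc_scale[OF pc, of "norm w" "sgn w"] False by (simp add: sgn_div_norm)
    finally have "sqrt ((norm w)\<^sup>2 * k) \<le> tnorm g p (tvec_of A c p w)"
      unfolding tnorm_def Gc_def by (rule real_sqrt_le_mono)
    then show ?thesis by (simp add: real_sqrt_mult mult.commute)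
  next
    case True
    have "c \<in> charts_at A p" using p K c by (auto simp: charts_at_iff)
    then have "Gc c p w w = 0" using Gc_scale[of c p 0 w] True by simp
    then show ?thesis using True by (simp add: tnorm_def Gc_def)
  qed
  then show ?thesis using k by (intro exI[of _ "sqrt k"]) auto
qed

text \<open>The unit ball of the metric lies in the Euclidean ball of radius 1 / k in the
  chart.\<close>

lemma conorm_upper:
  assumes c: "c \<in> charts_at A p" and k: "k > 0" "\<And>w. k * norm w \<le> tnorm g p (tvec_of A c p w)"
  shows "conorm A g p (covec_of A c p a) \<le> norm a / k"
  unfolding conorm_def
proof (rule cSUP_least)
  have "tvec_of A c p 0 \<in> {v \<in> tangent_space A p. tnorm g p v \<le> 1}"
    using tvec_of_tangent[OF c] Gc_scale[OF c, of 0 0] by (simp add: tnorm_def Gc_def)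
  then show "{v \<in> tangent_space A p. tnorm g p v \<le> 1} \<noteq> {}" by blast
  fix v assume v: "v \<in> {v \<in> tangent_space A p. tnorm g p v \<le> 1}"
  then obtain w where w: "v = tvec_of A c p w" using tangent_space_range[OF c] by auto
  have "k * norm w \<le> 1" using k(2)[of w] v w by simp
  then have "norm w \<le> 1 / k" using k(1) by (simp add: field_simps)
  have "pairing A p (covec_of A c p a) v = a \<bullet> w" unfolding w by (rule pairing_covec_tvec[OF c])
  also have "\<dots> \<le> norm a * norm w" by (rule norm_cauchy_schwarz)
  also have "\<dots> \<le> norm a * (1 / k)" using \<open>norm w \<le> 1 / k\<close> by (intro mult_left_mono) auto
  finally show "pairing A p (covec_of A c p a) v \<le> norm a / k" by simp
qed

text \<open>Here the growth hypothesis is used, with \<epsilon> = 1 and the covectors P v and 0,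
  which the Legendre transform sends to v and 0. Either v is shorter than 1 in the metric, or its
  length is at most C times that of P v. Passing from the metric to the Euclidean norm costs a
  factor 1 / k for vectors and another one for covectors.\<close>

lemma Pc_growth:
  assumes c: "c \<in> A" and K: "compact K" "K \<subseteq> cdom c"
  shows "\<exists>B\<ge>0. \<forall>p\<in>K. \<forall>v. norm v \<le> B * (1 + norm (Pc c (cmap c p) v))"
proof -
  obtain k where k: "k > 0" "\<And>p w. p \<in> K \<Longrightarrow> k * norm w \<le> tnorm g p (tvec_of A c p w)"
    using tnorm_lower[OF c K] by blast
  obtain C where C: "C > 0" "\<And>x \<alpha> \<beta>. \<alpha> \<in> cotangent_space A x \<Longrightarrow> \<beta> \<in> cotangent_space A x \<Longrightarrow>
      1 \<le> tnorm g x (legendre A L x \<alpha> - legendre A L x \<beta>) \<Longrightarrow>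
      tnorm g x (legendre A L x \<alpha> - legendre A L x \<beta>) \<le> C * conorm A g x (\<alpha> - \<beta>)"
    using legendre_growth[rule_format, of 1] by auto
  have "norm v \<le> (1 / k + C / k\<^sup>2) * (1 + norm (Pc c (cmap c p) v))" if p: "p \<in> K" for p v
  proof -
    have pc: "c \<in> charts_at A p" using p K c by (auto simp: charts_at_iff)
    define a where "a = Pc c (cmap c p) v"
    have l1: "legendre A L p (covec_of A c p a) = tvec_of A c p v" unfolding a_def by (rule legendre_Pc[OF pc])
    have "Pc c (cmap c p) 0 = 0" using Pc_zero[OF c] pc by (simp add: charts_at_iff)
    then have l2: "legendre A L p (covec_of A c p 0) = (\<lambda>_. 0)"
      using legendre_Pc[OF pc, of 0] tvec_of_0[OF pc] by simp
    have d: "legendre A L p (covec_of A c p a) - legendre A L p (covec_of A c p 0) = tvec_of A c p v"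
      unfolding l1 l2 by (simp add: fun_diff_def)
    have d2: "covec_of A c p a - covec_of A c p 0 = covec_of A c p a"
      unfolding covec_of_0[OF pc] by (simp add: fun_diff_def)
    have "tnorm g p (tvec_of A c p v) \<le> 1 + C * (norm a / k)"
    proof (cases "1 \<le> tnorm g p (tvec_of A c p v)")
      case True
      then have "tnorm g p (tvec_of A c p v) \<le> C * conorm A g p (covec_of A c p a)"
        using C(2)[OF covec_of_cotangent[OF pc] covec_of_cotangent[OF pc], of a 0] unfolding d d2 by blast
      also have "\<dots> \<le> C * (norm a / k)"
        using conorm_upper[OF pc k(1)] k(2)[OF p] C(1) by (intro mult_left_mono) auto
      finally show ?thesis by simp
    next
      case False
      have "0 \<le> C * (norm a / k)" using C(1) k(1) by simp
      then show ?thesis using False by simp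
    qed
    then have "k * norm v \<le> 1 + C * (norm a / k)" using k(2)[OF p, of v] by simp
    then have "norm v \<le> (1 + C * (norm a / k)) / k" using k(1) by (simp add: field_simps)
    also have "\<dots> = 1 / k + C / k\<^sup>2 * norm a" by (simp add: add_divide_distrib power2_eq_square)
    also have "\<dots> \<le> (1 / k + C / k\<^sup>2) * (1 + norm a)"
      using C(1) k(1) by (simp add: distrib_left distrib_right)
    finally show ?thesis unfolding a_def .
  qed
  moreover have "0 \<le> 1 / k + C / k\<^sup>2" using k C by simp
  ultimately show ?thesis by blast
qed

lemma legendre_full_chart: "c \<in> A \<Longrightarrow> legendre_full (cran c) (Lc c) (Pc c)"
proof (intro legendre_full.intro legendre_family_chart legendre_full_axioms.intro)
  assume c: "c \<in> A"
  show "surj (Pc c y)" if y: "y \<in> cran c" for y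
  proof -
    \<comment> \<open>For surjectivity on a single fibre the compact set may be one point.\<close>
    obtain B where B: "\<And>v. norm v \<le> B * (1 + norm (Pc c (cmap c (cinv c y)) v))"
      using Pc_growth[OF c, of "{cinv c y}"] c y by auto
    show ?thesis
    proof (rule legendre_family.P_surj[OF legendre_family_chart[OF c] y])
      show "norm v \<le> B + B * norm (Pc c y v)" for v using B[of v] c y by (simp add: distrib_left)
    qed
  qed
  show "Lc c y 0 = 0" if "y \<in> cran c" for y by (rule Lc_zero[OF c that])
qed

abbreviation Qc :: "('m,'e) chart \<Rightarrow> 'e \<Rightarrow> 'e \<Rightarrow> 'e" where
  "Qc c \<equiv> legendre_full.Q (Pc c)"

lemma Qc_bound:
  assumes c: "c \<in> A" and K: "compact K" "K \<subseteq> cdom c"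
  shows "\<exists>B\<ge>0. \<forall>p\<in>K. \<forall>a. norm (Qc c (cmap c p) a) \<le> B * (1 + norm a)"
proof -
  obtain B where B: "B \<ge> 0" "\<And>p v. p \<in> K \<Longrightarrow> norm v \<le> B * (1 + norm (Pc c (cmap c p) v))"
    using Pc_growth[OF assms] by blast
  have "norm (Qc c (cmap c p) a) \<le> B * (1 + norm a)" if p: "p \<in> K" for p a
    using B(2)[OF p, of "Qc c (cmap c p) a"] legendre_full.P_Q[OF legendre_full_chart[OF c], of "cmap c p" a] p K by auto
  then show ?thesis using B by blast
qed

lemma hamiltonian_Hc:
  assumes c: "c \<in> charts_at A p"
  shows "hamiltonian A L p (covec_of A c p a) = ereal (Hc c (cmap c p) a)"
  using legendre_full.fenchel_e_eq[OF legendre_full_chart, of c "cmap c p" a] c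
  unfolding hamiltonian_fenchel_e[OF c] by (simp add: charts_at_iff)

lemma legendre_Qc:
  assumes c: "c \<in> charts_at A p"
  shows "legendre A L p (covec_of A c p a) = tvec_of A c p (Qc c (cmap c p) a)"
  using legendre_Pc[OF c, of "Qc c (cmap c p) a"] legendre_full.P_Q[OF legendre_full_chart, of c "cmap c p" a] c
  by (simp add: charts_at_iff)

section \<open>The measure in a chart\<close>

lemma sets_m: "sets m = sets borel"
  using m_smooth by (simp add: smooth_measure_def)

lemma space_m: "space m = UNIV"
  using sets_eq_imp_space_eq[OF sets_m] by simp

lemma chart_density:
  assumes c: "c \<in> A"
  obtains \<rho> where "continuous_on (cran c) \<rho>" "\<And>y. y \<in> cran c \<Longrightarrow> \<rho> y > 0"
    "distr (restrict_space m (cdom c)) borel (cmap c) = density lborel (\<lambda>x. ennreal (indicator (cran c) x * \<rho> x))"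
    "(\<lambda>y. indicator (cran c) y * \<rho> y) \<in> borel_measurable borel"
proof -
  obtain \<rho> where \<rho>: "smooth_on (cran c) \<rho>" "\<And>y. y \<in> cran c \<Longrightarrow> \<rho> y > 0"
    "distr (restrict_space m (cdom c)) borel (cmap c) = density lborel (\<lambda>x. ennreal (indicator (cran c) x * \<rho> x))"
    using m_smooth c unfolding smooth_measure_def by blast
  have "(\<lambda>y. indicator (cran c) y *\<^sub>R \<rho> y) \<in> borel_measurable borel"
    using smooth_on_imp_continuous_on[OF \<rho>(1)] cran_open[OF c] by (intro borel_measurable_continuous_on_indicator) auto
  then show ?thesis using that[OF smooth_on_imp_continuous_on[OF \<rho>(1)] \<rho>(2,3)] by simp
qed

lemma cmap_measurable:
  assumes "c \<in> A" shows "cmap c \<in> measurable (restrict_space m (cdom c)) borel"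
proof -
  have "measurable (restrict_space m (cdom c)) borel = measurable (restrict_space borel (cdom c)) (borel :: 'e measure)"
    by (rule measurable_cong_sets[OF sets_restrict_space_cong[OF sets_m] refl])
  then show ?thesis using borel_measurable_continuous_on_restrict[OF cmap_cont[OF assms]] by blast
qed

lemma cinv_measurable:
  assumes "c \<in> A" shows "cinv c \<in> measurable (restrict_space borel (cran c)) m"
proof -
  have "measurable (restrict_space borel (cran c)) m = measurable (restrict_space borel (cran c)) (borel :: 'm measure)"
    by (rule measurable_cong_sets[OF refl sets_m])
  then show ?thesis using borel_measurable_continuous_on_restrict[OF cinv_cont[OF assms]] by blast
qed

lemma pullback_measurable_ennreal:
  fixes f :: "'m \<Rightarrow> ennreal"
  assumes "c \<in> A" "f \<in> borel_measurable m"
  shows "(\<lambda>y. f (cinv c y) * indicator (cran c) y) \<in> borel_measurable borel"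
  using measurable_compose[OF cinv_measurable[OF assms(1)] assms(2)] cran_open[OF assms(1)]
  by (subst borel_measurable_restrict_space_iff_ennreal[symmetric]) auto

lemma pullback_measurable:
  fixes f :: "'m \<Rightarrow> 'b::real_normed_vector"
  assumes "c \<in> A" "f \<in> borel_measurable m"
  shows "(\<lambda>y. indicator (cran c) y *\<^sub>R f (cinv c y)) \<in> borel_measurable borel"
  using measurable_compose[OF cinv_measurable[OF assms(1)] assms(2)] cran_open[OF assms(1)]
  by (subst borel_measurable_restrict_space_iff[symmetric]) auto

lemma pushforward_measurable:
  fixes f :: "'e \<Rightarrow> 'b::real_normed_vector"
  assumes "c \<in> A" "(\<lambda>y. indicator (cran c) y *\<^sub>R f y) \<in> borel_measurable borel"
  shows "(\<lambda>x. indicator (cdom c) x *\<^sub>R f (cmap c x)) \<in> borel_measurable m"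
proof -
  have "(\<lambda>x. indicator (cran c) (cmap c x) *\<^sub>R f (cmap c x)) \<in> borel_measurable (restrict_space m (cdom c))"
    using measurable_compose[OF cmap_measurable[OF assms(1)] assms(2)] .
  then have "(\<lambda>x. indicator (cdom c) x *\<^sub>R (indicator (cran c) (cmap c x) *\<^sub>R f (cmap c x))) \<in> borel_measurable m"
    using cdom_open[OF assms(1)] sets_m space_m by (subst borel_measurable_restrict_space_iff[symmetric]) auto
  moreover have "(\<lambda>x. indicator (cdom c) x *\<^sub>R (indicator (cran c) (cmap c x) *\<^sub>R f (cmap c x))) = (\<lambda>x. indicator (cdom c) x *\<^sub>R f (cmap c x))"
    by (auto simp: fun_eq_iff indicator_def)
  ultimately show ?thesis by simp
qed

lemma nn_transfer:
  fixes f :: "'m \<Rightarrow> ennreal"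
  assumes c: "c \<in> A" and f: "f \<in> borel_measurable m"
    and d: "distr (restrict_space m (cdom c)) borel (cmap c) = density lborel (\<lambda>x. ennreal (indicator (cran c) x * \<rho> x))"
    and \<rho>: "(\<lambda>y. indicator (cran c) y * \<rho> y) \<in> borel_measurable borel"
  shows "(\<integral>\<^sup>+x. f x * indicator (cdom c) x \<partial>m) = (\<integral>\<^sup>+y. ennreal (indicator (cran c) y * \<rho> y) * f (cinv c y) \<partial>lborel)"
proof -
  let ?F = "\<lambda>y. f (cinv c y) * indicator (cran c) y"
  have F: "?F \<in> borel_measurable borel" by (rule pullback_measurable_ennreal[OF c f])
  have "(\<integral>\<^sup>+x. f x * indicator (cdom c) x \<partial>m) = (\<integral>\<^sup>+x. f x \<partial>restrict_space m (cdom c))"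
    using cdom_open[OF c] sets_m space_m by (subst nn_integral_restrict_space) auto
  also have "\<dots> = (\<integral>\<^sup>+x. ?F (cmap c x) \<partial>restrict_space m (cdom c))"
    by (rule nn_integral_cong) (use c in \<open>auto simp: space_restrict_space\<close>)
  also have "\<dots> = (\<integral>\<^sup>+y. ?F y \<partial>distr (restrict_space m (cdom c)) borel (cmap c))"
    using F by (subst nn_integral_distr[OF cmap_measurable[OF c]]) auto
  also have "\<dots> = (\<integral>\<^sup>+y. ennreal (indicator (cran c) y * \<rho> y) * ?F y \<partial>lborel)"
    unfolding d using F \<rho> by (subst nn_integral_density) auto
  also have "\<dots> = (\<integral>\<^sup>+y. ennreal (indicator (cran c) y * \<rho> y) * f (cinv c y) \<partial>lborel)"
    by (rule nn_integral_cong) (auto simp: indicator_def)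
  finally show ?thesis .
qed

lemma AE_transfer:
  assumes c: "c \<in> A" and ae: "AE y in lborel. y \<in> cran c \<longrightarrow> R y"
  shows "AE x in m. x \<in> cdom c \<longrightarrow> R (cmap c x)"
proof -
  obtain \<rho> where d: "distr (restrict_space m (cdom c)) borel (cmap c) = density lborel (\<lambda>x. ennreal (indicator (cran c) x * \<rho> x))"
    and \<rho>: "(\<lambda>y. indicator (cran c) y * \<rho> y) \<in> borel_measurable borel"
    by (rule chart_density[OF c]) blast
  have "AE y in density lborel (\<lambda>x. ennreal (indicator (cran c) x * \<rho> x)). y \<in> cran c \<longrightarrow> R y"
    using ae \<rho> by (subst AE_density) auto
  then have "AE x in restrict_space m (cdom c). cmap c x \<in> cran c \<longrightarrow> R (cmap c x)"
    unfolding d[symmetric] by (rule AE_distrD[OF cmap_measurable[OF c]])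
  then show ?thesis using cdom_open[OF c] sets_m space_m by (subst (asm) AE_restrict_space_iff) auto
qed

text \<open>On the compact image of K the density of m is bounded above and away from 0, so m and
  Lebesgue measure dominate each other with one constant for all f. Stated for nonnegative
  integrals, it decides integrability as well as size.\<close>

lemma transfer_compare:
  assumes c: "c \<in> A" and K: "compact K" "K \<subseteq> cdom c"
  shows "\<exists>\<kappa>>0. \<forall>f \<in> borel_measurable m.
     (\<integral>\<^sup>+x. f x * indicator K x \<partial>m) \<le> ennreal \<kappa> * (\<integral>\<^sup>+y. f (cinv c y) * indicator (cmap c ` K) y \<partial>lborel) \<and>
     (\<integral>\<^sup>+y. f (cinv c y) * indicator (cmap c ` K) y \<partial>lborel) \<le> ennreal \<kappa> * (\<integral>\<^sup>+x. f x * indicator K x \<partial>m)"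
proof -
  obtain \<rho> where r: "continuous_on (cran c) \<rho>" "\<And>y. y \<in> cran c \<Longrightarrow> \<rho> y > 0"
    and d: "distr (restrict_space m (cdom c)) borel (cmap c) = density lborel (\<lambda>x. ennreal (indicator (cran c) x * \<rho> x))"
    and \<rho>: "(\<lambda>y. indicator (cran c) y * \<rho> y) \<in> borel_measurable borel"
    by (rule chart_density[OF c]) blast
  have cK: "compact (cmap c ` K)" by (rule compact_continuous_image[OF continuous_on_subset[OF cmap_cont[OF c] K(2)] K(1)])
  have sub: "cmap c ` K \<subseteq> cran c" using K by auto
  have rc: "continuous_on (cmap c ` K) \<rho>" by (rule continuous_on_subset[OF r(1) sub])
  obtain B where B: "\<And>y. y \<in> cmap c ` K \<Longrightarrow> norm (\<rho> y) \<le> B"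
    using compact_imp_bounded[OF compact_continuous_image[OF rc cK]] by (auto simp: bounded_iff)
  have ic: "continuous_on (cmap c ` K) (\<lambda>y. 1 / \<rho> y)" using rc r(2) sub by (intro continuous_intros) (auto, force)
  obtain B' where B': "\<And>y. y \<in> cmap c ` K \<Longrightarrow> norm (1 / \<rho> y) \<le> B'"
    using compact_imp_bounded[OF compact_continuous_image[OF ic cK]] by (auto simp: bounded_iff)
  define \<kappa> where "\<kappa> = 1 + \<bar>B\<bar> + \<bar>B'\<bar>"
  have \<kappa>: "\<kappa> > 0" unfolding \<kappa>_def by linarith
  have bnd: "\<rho> y \<le> \<kappa>" "1 \<le> \<kappa> * \<rho> y" if y: "y \<in> cmap c ` K" for y
  proof -
    have p: "\<rho> y > 0" using r(2) y sub by auto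
    show "\<rho> y \<le> \<kappa>" using B[OF y] unfolding \<kappa>_def by simp
    have "1 / \<rho> y \<le> \<kappa>" using B'[OF y] p unfolding \<kappa>_def by simp
    then show "1 \<le> \<kappa> * \<rho> y" using p by (simp add: field_simps)
  qed
  have Ks: "K \<in> sets m" using K(1) sets_m by (simp add: compact_imp_closed)
  have Km: "cmap c ` K \<in> sets borel" using cK by (simp add: compact_imp_closed)
  have main: "(\<integral>\<^sup>+x. f x * indicator K x \<partial>m) \<le> ennreal \<kappa> * (\<integral>\<^sup>+y. f (cinv c y) * indicator (cmap c ` K) y \<partial>lborel) \<and>
     (\<integral>\<^sup>+y. f (cinv c y) * indicator (cmap c ` K) y \<partial>lborel) \<le> ennreal \<kappa> * (\<integral>\<^sup>+x. f x * indicator K x \<partial>m)"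
    if f: "f \<in> borel_measurable m" for f :: "'m \<Rightarrow> ennreal"
  proof -
    have fK: "(\<lambda>x. f x * indicator K x) \<in> borel_measurable m" using f Ks by auto
    have "(\<lambda>y. f (cinv c y) * indicator (cran c) y * indicator (cmap c ` K) y) \<in> borel_measurable borel"
      by (rule borel_measurable_times_ennreal[OF pullback_measurable_ennreal[OF c f] borel_measurable_indicator[OF Km]])
    moreover have "(\<lambda>y. f (cinv c y) * indicator (cran c) y * indicator (cmap c ` K) y) = (\<lambda>y. f (cinv c y) * indicator (cmap c ` K) y)"
      using sub by (auto simp: fun_eq_iff indicator_def)
    ultimately have Fm: "(\<lambda>y. f (cinv c y) * indicator (cmap c ` K) y) \<in> borel_measurable lborel" by simp
    have "(\<integral>\<^sup>+x. f x * indicator K x \<partial>m) = (\<integral>\<^sup>+x. (f x * indicator K x) * indicator (cdom c) x \<partial>m)"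
      using K(2) by (intro nn_integral_cong) (auto simp: indicator_def)
    also have "\<dots> = (\<integral>\<^sup>+y. ennreal (indicator (cran c) y * \<rho> y) * (f (cinv c y) * indicator K (cinv c y)) \<partial>lborel)"
      by (rule nn_transfer[OF c fK d \<rho>])
    also have "\<dots> = (\<integral>\<^sup>+y. ennreal (\<rho> y) * (f (cinv c y) * indicator (cmap c ` K) y) \<partial>lborel)"
    proof (rule nn_integral_cong)
      fix y
      show "ennreal (indicator (cran c) y * \<rho> y) * (f (cinv c y) * indicator K (cinv c y)) = ennreal (\<rho> y) * (f (cinv c y) * indicator (cmap c ` K) y)"
      proof (cases "y \<in> cran c")
        case True
        have "cinv c y \<in> K \<longleftrightarrow> y \<in> cmap c ` K"
        proof
          assume "cinv c y \<in> K"
          then show "y \<in> cmap c ` K" using cmap_cinv[OF c True] by (intro image_eqI[of _ _ "cinv c y"]) auto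
        next
          assume "y \<in> cmap c ` K"
          then show "cinv c y \<in> K" using c K(2) by auto
        qed
        then show ?thesis using True by (simp add: indicator_def)
      next
        case False then show ?thesis using sub by (auto simp: indicator_def)
      qed
    qed
    finally have eq: "(\<integral>\<^sup>+x. f x * indicator K x \<partial>m) = (\<integral>\<^sup>+y. ennreal (\<rho> y) * (f (cinv c y) * indicator (cmap c ` K) y) \<partial>lborel)" .
    have le1: "(\<integral>\<^sup>+y. ennreal (\<rho> y) * (f (cinv c y) * indicator (cmap c ` K) y) \<partial>lborel)
      \<le> (\<integral>\<^sup>+y. ennreal \<kappa> * (f (cinv c y) * indicator (cmap c ` K) y) \<partial>lborel)"
      using bnd(1) by (intro nn_integral_mono) (auto simp: indicator_def intro!: mult_right_mono ennreal_leI)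
    have le2: "(\<integral>\<^sup>+y. f (cinv c y) * indicator (cmap c ` K) y \<partial>lborel)
      \<le> (\<integral>\<^sup>+y. ennreal \<kappa> * (ennreal (\<rho> y) * (f (cinv c y) * indicator (cmap c ` K) y)) \<partial>lborel)"
    proof (rule nn_integral_mono)
      fix y
      show "f (cinv c y) * indicator (cmap c ` K) y \<le> ennreal \<kappa> * (ennreal (\<rho> y) * (f (cinv c y) * indicator (cmap c ` K) y))"
      proof (cases "y \<in> cmap c ` K")
        case True
        have "1 \<le> ennreal (\<kappa> * \<rho> y)" using bnd(2)[OF True] ennreal_leI by fastforce
        then have "1 * f (cinv c y) \<le> ennreal (\<kappa> * \<rho> y) * f (cinv c y)" by (rule mult_right_mono) simp
        then show ?thesis using True \<kappa> r(2)[of y] sub by (simp add: ennreal_mult' mult.assoc)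
      qed simp
    qed
    have e1: "(\<integral>\<^sup>+y. ennreal \<kappa> * (f (cinv c y) * indicator (cmap c ` K) y) \<partial>lborel) = ennreal \<kappa> * (\<integral>\<^sup>+y. f (cinv c y) * indicator (cmap c ` K) y \<partial>lborel)"
      by (rule nn_integral_cmult[OF Fm])
    have "(\<lambda>y. ennreal (indicator (cran c) y * \<rho> y) * (f (cinv c y) * indicator (cmap c ` K) y)) \<in> borel_measurable lborel"
      using borel_measurable_times_ennreal[OF measurable_compose[OF \<rho> measurable_ennreal], of "\<lambda>y. f (cinv c y) * indicator (cmap c ` K) y"] Fm by simp
    moreover have "(\<lambda>y. ennreal (indicator (cran c) y * \<rho> y) * (f (cinv c y) * indicator (cmap c ` K) y)) = (\<lambda>y. ennreal (\<rho> y) * (f (cinv c y) * indicator (cmap c ` K) y))"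
      using sub by (auto simp: fun_eq_iff indicator_def)
    ultimately have Gm: "(\<lambda>y. ennreal (\<rho> y) * (f (cinv c y) * indicator (cmap c ` K) y)) \<in> borel_measurable lborel" by simp
    have e2: "(\<integral>\<^sup>+y. ennreal \<kappa> * (ennreal (\<rho> y) * (f (cinv c y) * indicator (cmap c ` K) y)) \<partial>lborel) = ennreal \<kappa> * (\<integral>\<^sup>+y. ennreal (\<rho> y) * (f (cinv c y) * indicator (cmap c ` K) y) \<partial>lborel)"
      by (rule nn_integral_cmult[OF Gm])
    show ?thesis using le1 le2 unfolding e1 e2 eq by blast
  qed
  then show ?thesis using \<kappa> by blast
qed

lemma compact_emeasure_finite:
  assumes c: "c \<in> A" and K: "compact K" "K \<subseteq> cdom c"
  shows "emeasure m K < \<infinity>"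
proof -
  have cK: "compact (cmap c ` K)" by (rule compact_continuous_image[OF continuous_on_subset[OF cmap_cont[OF c] K(2)] K(1)])
  have Ks: "K \<in> sets m" using K(1) sets_m by (simp add: compact_imp_closed)
  have Km: "cmap c ` K \<in> sets lborel" using cK by (simp add: compact_imp_closed)
  obtain \<kappa> where \<kappa>: "\<kappa> > 0" "\<And>f. f \<in> borel_measurable m \<Longrightarrow> (\<integral>\<^sup>+x. f x * indicator K x \<partial>m) \<le> ennreal \<kappa> * (\<integral>\<^sup>+y. f (cinv c y) * indicator (cmap c ` K) y \<partial>lborel)"
    using transfer_compare[OF assms] by blast
  have "emeasure m K = (\<integral>\<^sup>+x. 1 * indicator K x \<partial>m)" using Ks by simp
  also have "\<dots> \<le> ennreal \<kappa> * (\<integral>\<^sup>+y. 1 * indicator (cmap c ` K) y \<partial>lborel)" by (rule \<kappa>(2)) simp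
  also have "\<dots> = ennreal \<kappa> * emeasure lborel (cmap c ` K)" using Km by simp
  also have "\<dots> < \<infinity>" using emeasure_lborel_cbox_finite emeasure_compact_finite[OF cK] by (simp add: ennreal_mult_less_top)
  finally show ?thesis .
qed

text \<open>The compact sets are preimages of closed balls in charts whose open balls already cover.
  Taking the least index of an open set containing p makes the choice Borel: each level set is an
  open set minus finitely many open sets.\<close>

lemma finite_cover:
  obtains N :: nat and C :: "nat \<Rightarrow> ('m,'e) chart" and K :: "nat \<Rightarrow> 'm set" and idx :: "'m \<Rightarrow> nat"
  where "\<And>i. i < N \<Longrightarrow> C i \<in> A" "\<And>i. i < N \<Longrightarrow> compact (K i)" "\<And>i. i < N \<Longrightarrow> K i \<subseteq> cdom (C i)"
    "\<And>p. idx p < N" "\<And>p. p \<in> K (idx p)" "\<And>i. {p. idx p = i} \<in> sets borel"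
proof -
  have "\<exists>c U K. c \<in> A \<and> open U \<and> p \<in> U \<and> U \<subseteq> K \<and> compact K \<and> K \<subseteq> cdom c" for p
  proof -
    obtain c where c: "c \<in> A" "p \<in> cdom c" using charts_at_ne[of p] by (auto simp: charts_at_iff)
    obtain e where e: "e > 0" "cball (cmap c p) e \<subseteq> cran c"
      using cran_open[OF c(1)] c open_contains_cball by blast
    have op: "open (cinv c ` ball (cmap c p) e)"
    proof -
      have b: "ball (cmap c p) e \<subseteq> cran c" using e ball_subset_cball by blast
      have "cinv c ` ball (cmap c p) e = cdom c \<inter> cmap c -` ball (cmap c p) e"
      proof (intro set_eqI iffI)
        fix x assume "x \<in> cinv c ` ball (cmap c p) e"
        then show "x \<in> cdom c \<inter> cmap c -` ball (cmap c p) e" using b c(1) by auto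
      next
        fix x assume "x \<in> cdom c \<inter> cmap c -` ball (cmap c p) e"
        then show "x \<in> cinv c ` ball (cmap c p) e" using c(1) by (intro image_eqI[of _ _ "cmap c x"]) auto
      qed
      then show ?thesis
        using continuous_open_preimage[OF cmap_cont[OF c(1)] cdom_open[OF c(1)], of "ball (cmap c p) e"] by simp
    qed
    have "compact (cinv c ` cball (cmap c p) e)"
      by (rule compact_continuous_image[OF continuous_on_subset[OF cinv_cont[OF c(1)] e(2)] compact_cball])
    moreover have "cinv c ` cball (cmap c p) e \<subseteq> cdom c" using e(2) c(1) by auto
    moreover have "p \<in> cinv c ` ball (cmap c p) e" using c e(1) by (auto simp: image_iff intro!: bexI[of _ "cmap c p"])
    moreover have "cinv c ` ball (cmap c p) e \<subseteq> cinv c ` cball (cmap c p) e" by auto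
    ultimately show ?thesis using op c(1) by blast
  qed
  note ex = this
  define R where "R p c U K \<longleftrightarrow> c \<in> A \<and> open U \<and> p \<in> U \<and> U \<subseteq> K \<and> compact K \<and> K \<subseteq> cdom c" for p c U K
  have "\<forall>p. \<exists>c. \<exists>U K. R p c U K" using ex unfolding R_def by blast
  from choice[OF this] obtain c where "\<forall>p. \<exists>U. \<exists>K. R p (c p) U K" by blast
  from choice[OF this] obtain U where "\<forall>p. \<exists>K. R p (c p) (U p) K" by blast
  from choice[OF this] obtain K where "\<forall>p. R p (c p) (U p) (K p)" by blast
  note z = this[unfolded R_def]
  have s: "\<And>p. c p \<in> A" "\<And>p. open (U p)" "\<And>p. p \<in> U p" "\<And>p. U p \<subseteq> K p" "\<And>p. compact (K p)" "\<And>p. K p \<subseteq> cdom (c p)"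
    using spec[OF z] by simp_all
  obtain F where F: "finite F" "UNIV \<subseteq> (\<Union>p\<in>F. U p)"
  proof (rule compactE_image[OF compact_M, of UNIV U])
    show "UNIV \<subseteq> (\<Union>p\<in>UNIV. U p)" using s(3) by auto
  qed (use s(2) in auto)
  obtain xs where xs: "set xs = F" using finite_list[OF F(1)] by blast
  define idx where "idx p = (LEAST i. i < length xs \<and> p \<in> U (xs ! i))" for p
  have ex: "\<exists>i. i < length xs \<and> p \<in> U (xs ! i)" for p
  proof -
    have "p \<in> (\<Union>p\<in>F. U p)" using F(2) by auto
    then obtain q where q: "q \<in> F" "p \<in> U q" by (elim UN_E)
    then obtain i where "i < length xs" "xs ! i = q" using xs in_set_conv_nth[of q xs] by auto
    then show ?thesis using q(2) by blast
  qed
  have idx: "idx p < length xs \<and> p \<in> U (xs ! idx p)" for p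
    unfolding idx_def by (rule LeastI_ex[OF ex])
  show ?thesis
  proof (rule that[of "length xs" "\<lambda>i. c (xs ! i)" "\<lambda>i. K (xs ! i)" idx])
    show "{p. idx p = i} \<in> sets borel" for i
    proof -
      have "{p. idx p = i} = (if i < length xs then U (xs ! i) - (\<Union>j<i. U (xs ! j)) else {})"
      proof (cases "i < length xs")
        case True
        have "idx p = i \<longleftrightarrow> p \<in> U (xs ! i) \<and> (\<forall>j<i. p \<notin> U (xs ! j))" for p
        proof
          assume "idx p = i"
          then show "p \<in> U (xs ! i) \<and> (\<forall>j<i. p \<notin> U (xs ! j))"
            using idx[of p] not_less_Least[of _ "\<lambda>i. i < length xs \<and> p \<in> U (xs ! i)"] True unfolding idx_def by auto
        next
          assume a: "p \<in> U (xs ! i) \<and> (\<forall>j<i. p \<notin> U (xs ! j))"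
          show "idx p = i" unfolding idx_def
            by (rule Least_equality) (use a True in \<open>auto simp: not_less[symmetric]\<close>)
        qed
        then show ?thesis using True by auto
      next
        case False then show ?thesis using idx by auto
      qed
      then show ?thesis using s(2) by (auto intro!: sets.Diff sets.finite_UN borel_open)
    qed
    show "p \<in> K (xs ! idx p)" for p using s(4) idx by blast
  qed (use s idx in simp_all)
qed

lemma finite_measure_m: "finite_measure m"
proof -
  obtain N and C :: "nat \<Rightarrow> ('m,'e) chart" and K and idx :: "'m \<Rightarrow> nat" where
    s: "\<And>i. i < N \<Longrightarrow> C i \<in> A" "\<And>i. i < N \<Longrightarrow> compact (K i)" "\<And>i. i < N \<Longrightarrow> K i \<subseteq> cdom (C i)"
    "\<And>p. idx p < N" "\<And>p. p \<in> K (idx p)"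
    by (rule finite_cover) blast
  have "space m = (\<Union>i<N. K i)" using s(4,5) space_m by auto
  moreover have "emeasure m (\<Union>i<N. K i) \<le> (\<Sum>i<N. emeasure m (K i))"
    using s(2) sets_m by (intro emeasure_subadditive_finite) (auto simp: compact_imp_closed)
  moreover have "(\<Sum>i<N. emeasure m (K i)) < \<infinity>"
  proof -
    have "emeasure m (K i) < top" if "i < N" for i
      using compact_emeasure_finite[OF s(1-3)[OF that]] by simp
    then show ?thesis by (simp add: ennreal_sum_less_top)
  qed
  ultimately have "emeasure m (space m) < \<infinity>" by (simp only: order.strict_trans1)
  then show ?thesis by (intro finite_measureI) simp
qed

end

section \<open>Weak differentials as vector-valued functions\<close>

text \<open>A choice of chart \<open>C (idx p)\<close> at each point \<open>p\<close>, measurable in \<open>p\<close>, turns covector fields into maps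
  to the model space; that \<open>p\<close> stays in the compact part \<open>K (idx p)\<close> keeps all bounds uniform.\<close>

locale heat_cover = heat_geometry A L m g
  for A :: "('m::{t2_space,second_countable_topology}, 'e::euclidean_space) chart set"
    and L :: "'m \<Rightarrow> ('m, 'e) tvec \<Rightarrow> real" and m g +
  fixes N :: nat and C :: "nat \<Rightarrow> ('m,'e) chart" and K :: "nat \<Rightarrow> 'm set" and idx :: "'m \<Rightarrow> nat"
  assumes C_A: "i < N \<Longrightarrow> C i \<in> A" and K_compact: "i < N \<Longrightarrow> compact (K i)"
    and K_sub: "i < N \<Longrightarrow> K i \<subseteq> cdom (C i)"
    and idx_less: "idx p < N" and idx_K: "p \<in> K (idx p)" and idx_borel: "{p. idx p = i} \<in> sets borel"
begin

definition chi :: "'m \<Rightarrow> ('m,'e) chart" where "chi p = C (idx p)"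

definition fld :: "('m \<Rightarrow> 'e) \<Rightarrow> 'm \<Rightarrow> ('m,'e) covec" where
  "fld \<alpha> p = covec_of A (chi p) p (\<alpha> p)"

text \<open>Measurability on the manifold is required separately, because
  \<open>is_weak_differential\<close> speaks only of the components in charts.\<close>

definition W :: "('m \<Rightarrow> real) \<Rightarrow> ('m \<Rightarrow> 'e) \<Rightarrow> bool" where
  "W u \<alpha> \<longleftrightarrow> \<alpha> \<in> borel_measurable m \<and> is_weak_differential A u (fld \<alpha>)"

definition hh :: "'m \<Rightarrow> 'e \<Rightarrow> real" where "hh p a = Hc (chi p) (cmap (chi p) p) a"
definition qq :: "'m \<Rightarrow> 'e \<Rightarrow> 'e" where "qq p a = Qc (chi p) (cmap (chi p) p) a"

lemma chi_at: "chi p \<in> charts_at A p"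
  using C_A[OF idx_less] K_sub[OF idx_less] idx_K by (auto simp: chi_def charts_at_iff)

lemma chi_A: "chi p \<in> A" and chi_dom: "p \<in> cdom (chi p)"
  using chi_at[of p] by (auto simp: charts_at_iff)

lemma chi_ran: "cmap (chi p) p \<in> cran (chi p)"
  using chi_dom by blast

lemma hh_full: "legendre_full (cran (chi p)) (Lc (chi p)) (Pc (chi p))"
  by (rule legendre_full_chart[OF chi_A])

lemma hh_nonneg: "0 \<le> hh p a"
  unfolding hh_def by (rule legendre_full.fenchel_nonneg[OF hh_full chi_ran])

lemma hh_tangent: "hh p a + qq p a \<bullet> (b - a) \<le> hh p b"
  unfolding hh_def qq_def by (rule legendre_full.fenchel_tangent[OF hh_full chi_ran])

lemma hh_cont: "isCont (hh p) a"
  unfolding hh_def[abs_def] by (rule has_derivative_continuous[OF legendre_full.fenchel_derivative[OF hh_full chi_ran]])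

lemma qq_cont: "isCont (qq p) a"
proof -
  have "continuous_on UNIV (\<lambda>a. (\<lambda>(y, a). Qc (chi p) y a) (cmap (chi p) p, a))"
    by (rule continuous_on_compose2[OF legendre_full.Q_cont[OF hh_full[of p]]])
      (use chi_ran[of p] in \<open>auto intro!: continuous_intros\<close>)
  then show ?thesis unfolding qq_def[abs_def] by (simp add: continuous_on_eq_continuous_at)
qed

lemma idx_sets: "{p. idx p = i} \<in> sets m"
  using idx_borel sets_m by simp

text \<open>Each f i needs to be controlled only on the domain of its chart, since the Borel piece
  on which it is used lies inside that domain.\<close>

lemma pieces_measurable:
  fixes f :: "nat \<Rightarrow> 'm \<Rightarrow> 'b::{real_normed_vector, second_countable_topology}"
  assumes "\<And>i. i < N \<Longrightarrow> (\<lambda>p. indicator (cdom (C i)) p *\<^sub>R f i p) \<in> borel_measurable m"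
  shows "(\<lambda>p. f (idx p) p) \<in> borel_measurable m"
proof -
  have "(\<lambda>p. \<Sum>i<N. indicator {p. idx p = i} p *\<^sub>R (indicator (cdom (C i)) p *\<^sub>R f i p)) \<in> borel_measurable m"
    by (intro borel_measurable_sum) (rule borel_measurable_scaleR[OF borel_measurable_indicator[OF idx_sets] assms], simp)
  moreover have "(\<Sum>i<N. indicator {p. idx p = i} p *\<^sub>R (indicator (cdom (C i)) p *\<^sub>R f i p)) = f (idx p) p" for p
  proof -
    have "(\<Sum>i<N. indicator {p. idx p = i} p *\<^sub>R (indicator (cdom (C i)) p *\<^sub>R f i p)) = (\<Sum>i<N. if i = idx p then f (idx p) p else 0)"
      using chi_dom[of p] by (intro sum.cong refl) (auto simp: indicator_def chi_def)
    also have "\<dots> = f (idx p) p" using idx_less by simp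
    finally show ?thesis .
  qed
  ultimately show ?thesis by simp
qed

lemma chart_compose_measurable:
  fixes \<Phi> :: "'e \<Rightarrow> 'e \<Rightarrow> 'b::{real_normed_vector, second_countable_topology}"
  assumes c: "c \<in> A" and \<Phi>: "continuous_on (cran c \<times> UNIV) (\<lambda>(y, a). \<Phi> y a)" and \<alpha>: "\<alpha> \<in> borel_measurable m"
  shows "(\<lambda>p. indicator (cdom c) p *\<^sub>R \<Phi> (cmap c p) (\<alpha> p)) \<in> borel_measurable m"
proof -
  have S: "cran c \<times> (UNIV :: 'e set) \<in> sets borel" using cran_open[OF c] by (intro borel_open open_Times) auto
  have F: "(\<lambda>z. indicator (cran c \<times> UNIV) z *\<^sub>R (\<lambda>(y, a). \<Phi> y a) z) \<in> borel_measurable borel"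
    by (rule borel_measurable_continuous_on_indicator[OF S \<Phi>])
  have \<alpha>': "\<alpha> \<in> borel_measurable (restrict_space m (cdom c))" using \<alpha> by (rule measurable_restrict_space1)
  have "(\<lambda>p. (cmap c p, \<alpha> p)) \<in> measurable (restrict_space m (cdom c)) borel"
    using cmap_measurable[OF c] \<alpha>' by (rule borel_measurable_Pair)
  from measurable_compose[OF this F]
  have "(\<lambda>p. indicator (cran c \<times> UNIV) (cmap c p, \<alpha> p) *\<^sub>R \<Phi> (cmap c p) (\<alpha> p)) \<in> borel_measurable (restrict_space m (cdom c))" by simp
  then have "(\<lambda>p. indicator (cdom c) p *\<^sub>R (indicator (cran c \<times> UNIV) (cmap c p, \<alpha> p) *\<^sub>R \<Phi> (cmap c p) (\<alpha> p))) \<in> borel_measurable m"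
    using cdom_open[OF c] sets_m space_m by (subst borel_measurable_restrict_space_iff[symmetric]) auto
  moreover have "(\<lambda>p. indicator (cdom c) p *\<^sub>R (indicator (cran c \<times> UNIV) (cmap c p, \<alpha> p) *\<^sub>R \<Phi> (cmap c p) (\<alpha> p))) =
     (\<lambda>p. indicator (cdom c) p *\<^sub>R \<Phi> (cmap c p) (\<alpha> p))"
    by (auto simp: fun_eq_iff indicator_def)
  ultimately show ?thesis by simp
qed

lemma hh_meas: "\<alpha> \<in> borel_measurable m \<Longrightarrow> (\<lambda>p. hh p (\<alpha> p)) \<in> borel_measurable m"
  unfolding hh_def chi_def
  by (rule pieces_measurable[of "\<lambda>i p. Hc (C i) (cmap (C i) p) (\<alpha> p)"])
    (rule chart_compose_measurable[OF C_A legendre_full.fenchel_cont[OF legendre_full_chart[OF C_A]]])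

lemma qq_meas: "\<alpha> \<in> borel_measurable m \<Longrightarrow> (\<lambda>p. qq p (\<alpha> p)) \<in> borel_measurable m"
  unfolding qq_def chi_def
  by (rule pieces_measurable[of "\<lambda>i p. Qc (C i) (cmap (C i) p) (\<alpha> p)"])
    (rule chart_compose_measurable[OF C_A legendre_full.Q_cont[OF legendre_full_chart[OF C_A]]])

lemma cmapK:
  assumes "i < N" shows "compact (cmap (C i) ` K i)" "cmap (C i) ` K i \<subseteq> cran (C i)"
  using compact_continuous_image[OF continuous_on_subset[OF cmap_cont[OF C_A[OF assms]] K_sub[OF assms]] K_compact[OF assms]]
    K_sub[OF assms] by auto

lemma sum_bound:
  fixes B :: "nat \<Rightarrow> real"
  assumes "\<And>i. i < N \<Longrightarrow> 0 \<le> B i" shows "B (idx p) \<le> (\<Sum>i<N. B i)"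
  by (rule member_le_sum) (use assms idx_less in auto)

lemma qq_bound: "\<exists>B\<ge>0. \<forall>p a. norm (qq p a) \<le> B * (1 + norm a)"
proof -
  have "\<forall>i. \<exists>B. i < N \<longrightarrow> B \<ge> 0 \<and> (\<forall>p\<in>K i. \<forall>a. norm (Qc (C i) (cmap (C i) p) a) \<le> B * (1 + norm a))"
    using Qc_bound[OF C_A K_compact K_sub] by blast
  from choice[OF this] obtain B where B: "\<And>i. i < N \<Longrightarrow> B i \<ge> 0"
    "\<And>i p a. i < N \<Longrightarrow> p \<in> K i \<Longrightarrow> norm (Qc (C i) (cmap (C i) p) a) \<le> B i * (1 + norm a)" by blast
  have "norm (qq p a) \<le> (\<Sum>i<N. B i) * (1 + norm a)" for p a
  proof -
    have "norm (qq p a) \<le> B (idx p) * (1 + norm a)" unfolding qq_def chi_def by (rule B(2)[OF idx_less idx_K])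
    also have "\<dots> \<le> (\<Sum>i<N. B i) * (1 + norm a)" by (intro mult_right_mono sum_bound B(1)) auto
    finally show ?thesis .
  qed
  moreover have "0 \<le> (\<Sum>i<N. B i)" using B(1) by (intro sum_nonneg) auto
  ultimately show ?thesis by blast
qed

lemma hh_uniform:
  assumes \<eta>: "\<eta> > 0"
  shows "\<exists>\<kappa>\<ge>0. \<forall>p a b. norm (a - b) \<le> \<eta> * (1 + hh p a + hh p b) +
      \<kappa> * ((hh p a + hh p b) / 2 - hh p ((1/2) *\<^sub>R a + (1/2) *\<^sub>R b))"
proof -
  define d where "d p a b = (hh p a + hh p b) / 2 - hh p ((1/2) *\<^sub>R a + (1/2) *\<^sub>R b)" for p a b
  have d0: "0 \<le> d p a b" for p a b
  proof (cases "a = b")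
    case True then show ?thesis by (simp add: d_def flip: scaleR_left_distrib)
  next
    case False then show ?thesis
      using legendre_full.fenchel_midpoint[OF hh_full chi_ran False] by (simp add: d_def hh_def less_imp_le)
  qed
  have "\<forall>i. \<exists>k. i < N \<longrightarrow> k \<ge> 0 \<and> (\<forall>y\<in>cmap (C i) ` K i. \<forall>a b. norm (a - b) \<le> \<eta> * (1 + Hc (C i) y a + Hc (C i) y b) +
      k * ((Hc (C i) y a + Hc (C i) y b) / 2 - Hc (C i) y ((1/2) *\<^sub>R a + (1/2) *\<^sub>R b)))"
    using legendre_full.fenchel_uniform_convex[OF legendre_full_chart[OF C_A] cmapK \<eta>] by blast
  from choice[OF this] obtain k where k0: "\<And>i. i < N \<Longrightarrow> k i \<ge> 0"
    and k: "\<And>i y a b. i < N \<Longrightarrow> y \<in> cmap (C i) ` K i \<Longrightarrow> norm (a - b) \<le> \<eta> * (1 + Hc (C i) y a + Hc (C i) y b) +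
      k i * ((Hc (C i) y a + Hc (C i) y b) / 2 - Hc (C i) y ((1/2) *\<^sub>R a + (1/2) *\<^sub>R b))" by blast
  have "norm (a - b) \<le> \<eta> * (1 + hh p a + hh p b) + (\<Sum>i<N. k i) * d p a b" for p a b
  proof -
    have "norm (a - b) \<le> \<eta> * (1 + hh p a + hh p b) + k (idx p) * d p a b"
      unfolding d_def hh_def chi_def by (rule k[OF idx_less imageI[OF idx_K]])
    also have "\<dots> \<le> \<eta> * (1 + hh p a + hh p b) + (\<Sum>i<N. k i) * d p a b"
      by (intro add_left_mono mult_right_mono sum_bound k0 d0)
    finally show ?thesis .
  qed
  moreover have "0 \<le> (\<Sum>i<N. k i)" using k0 by (intro sum_nonneg) auto
  ultimately show ?thesis unfolding d_def by blast
qed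

section \<open>Covector fields and their components in the chosen charts\<close>

lemma fld_cotangent: "fld \<alpha> p \<in> cotangent_space A p"
  unfolding fld_def by (rule covec_of_cotangent[OF chi_at])

lemma fld_chi: "fld \<alpha> p (chi p) = \<alpha> p"
  unfolding fld_def by (rule covec_of_self[OF chi_at])

lemma fld_lin: "fld (\<lambda>p. \<alpha> p + r *\<^sub>R \<beta> p) p d = fld \<alpha> p d + r *\<^sub>R fld \<beta> p d"
  unfolding fld_def by (rule covec_of_add[OF chi_at])

lemma fld_zero: "fld (\<lambda>p. 0) p d = 0"
  unfolding fld_def by (simp add: covec_of_0[OF chi_at])

lemma weak_differential_components:
  assumes "is_weak_differential A u \<eta>" "c \<in> A" "b \<in> Basis"
  shows "locally_integrable (cran c) (\<lambda>x. \<eta> (cinv c x) c \<bullet> b)"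
    "locally_integrable (cran c) (\<lambda>x. u (cinv c x))"
    "\<And>\<psi>. test_function (cran c) \<psi> \<Longrightarrow>
      (\<integral>x. u (cinv c x) * dir_deriv \<psi> x b \<partial>lborel) = - (\<integral>x. (\<eta> (cinv c x) c \<bullet> b) * \<psi> x \<partial>lborel)"
  using assms unfolding is_weak_differential_def by blast+

text \<open>On the piece where the index is i, \<alpha> coincides with the components of its
  covector field in the chart C i. These are integrable over the compact image of K i, and
  \<open>transfer_compare\<close> carries this over to m. Finitely many pieces make up the
  manifold.\<close>

lemma W_integrable:
  assumes W: "W u \<alpha>" shows "integrable m \<alpha>"
proof -
  have \<alpha>: "\<alpha> \<in> borel_measurable m" and wd: "is_weak_differential A u (fld \<alpha>)" using W by (auto simp: W_def)
  have piece: "(\<integral>\<^sup>+p. ennreal (norm (indicator {p. idx p = i} p *\<^sub>R \<alpha> p)) \<partial>m) < \<infinity>" if i: "i < N" for i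
  proof -
    define f where "f p = ennreal (norm (indicator {p. idx p = i} p *\<^sub>R \<alpha> p))" for p
    have fm: "f \<in> borel_measurable m" unfolding f_def using \<alpha> idx_sets[of i] by measurable
    obtain \<kappa> where \<kappa>: "\<kappa> > 0" "(\<integral>\<^sup>+x. f x * indicator (K i) x \<partial>m) \<le> ennreal \<kappa> * (\<integral>\<^sup>+y. f (cinv (C i) y) * indicator (cmap (C i) ` K i) y \<partial>lborel)"
      using transfer_compare[OF C_A[OF i] K_compact[OF i] K_sub[OF i]] fm by blast
    have "(\<integral>\<^sup>+p. f p \<partial>m) = (\<integral>\<^sup>+x. f x * indicator (K i) x \<partial>m)"
    proof (rule nn_integral_cong)
      show "f p = f p * indicator (K i) p" for p
        using idx_K[of p] by (auto simp: f_def indicator_def)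
    qed
    also note \<kappa>(2)
    finally have 1: "(\<integral>\<^sup>+p. f p \<partial>m) \<le> ennreal \<kappa> * (\<integral>\<^sup>+y. f (cinv (C i) y) * indicator (cmap (C i) ` K i) y \<partial>lborel)" .
    have "(\<integral>\<^sup>+y. f (cinv (C i) y) * indicator (cmap (C i) ` K i) y \<partial>lborel) \<le>
       (\<integral>\<^sup>+y. (\<Sum>b\<in>Basis. ennreal (norm (indicator (cmap (C i) ` K i) y *\<^sub>R (fld \<alpha> (cinv (C i) y) (C i) \<bullet> b)))) \<partial>lborel)"
    proof (rule nn_integral_mono)
      fix y
      show "f (cinv (C i) y) * indicator (cmap (C i) ` K i) y \<le> (\<Sum>b\<in>Basis. ennreal (norm (indicator (cmap (C i) ` K i) y *\<^sub>R (fld \<alpha> (cinv (C i) y) (C i) \<bullet> b))))"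
      proof (cases "y \<in> cmap (C i) ` K i \<and> idx (cinv (C i) y) = i")
        case True
        then have a: "\<alpha> (cinv (C i) y) = fld \<alpha> (cinv (C i) y) (C i)" using fld_chi[of \<alpha> "cinv (C i) y"] by (simp add: chi_def)
        have "f (cinv (C i) y) * indicator (cmap (C i) ` K i) y = ennreal (norm (fld \<alpha> (cinv (C i) y) (C i)))"
          using True by (simp add: f_def a)
        also have "\<dots> \<le> ennreal (\<Sum>b\<in>Basis. \<bar>fld \<alpha> (cinv (C i) y) (C i) \<bullet> b\<bar>)"
          by (intro ennreal_leI norm_le_l1)
        also have "\<dots> = (\<Sum>b\<in>Basis. ennreal (norm (indicator (cmap (C i) ` K i) y *\<^sub>R (fld \<alpha> (cinv (C i) y) (C i) \<bullet> b))))"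
          using True by (simp add: sum_ennreal)
        finally show ?thesis .
      next
        case False
        then show ?thesis by (auto simp: f_def indicator_def)
      qed
    qed
    also have "\<dots> < \<infinity>"
    proof -
      have I: "integrable lborel (\<lambda>y. indicator (cmap (C i) ` K i) y *\<^sub>R (fld \<alpha> (cinv (C i) y) (C i) \<bullet> b))" if b: "b \<in> Basis" for b
        using weak_differential_components(1)[OF wd C_A[OF i] b] cmapK[OF i] unfolding locally_integrable_def set_integrable_def by blast
      have "(\<integral>\<^sup>+y. (\<Sum>b\<in>Basis. ennreal (norm (indicator (cmap (C i) ` K i) y *\<^sub>R (fld \<alpha> (cinv (C i) y) (C i) \<bullet> b)))) \<partial>lborel) =
        (\<Sum>b\<in>Basis. \<integral>\<^sup>+y. ennreal (norm (indicator (cmap (C i) ` K i) y *\<^sub>R (fld \<alpha> (cinv (C i) y) (C i) \<bullet> b))) \<partial>lborel)"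
      proof (rule nn_integral_sum)
        fix b :: 'e assume "b \<in> Basis"
        from borel_measurable_integrable[OF I[OF this]]
        show "(\<lambda>y. ennreal (norm (indicator (cmap (C i) ` K i) y *\<^sub>R (fld \<alpha> (cinv (C i) y) (C i) \<bullet> b)))) \<in> borel_measurable lborel"
          by measurable
      qed
      moreover have "(\<integral>\<^sup>+y. ennreal (norm (indicator (cmap (C i) ` K i) y *\<^sub>R (fld \<alpha> (cinv (C i) y) (C i) \<bullet> b))) \<partial>lborel) < \<infinity>" if b: "b \<in> Basis" for b
        using I[OF b] unfolding integrable_iff_bounded by blast
      ultimately show ?thesis by (simp add: ennreal_sum_less_top del: real_norm_def norm_scaleR)
    qed
    finally have "ennreal \<kappa> * (\<integral>\<^sup>+y. f (cinv (C i) y) * indicator (cmap (C i) ` K i) y \<partial>lborel) < \<infinity>"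
      by (simp add: ennreal_mult_less_top)
    with 1 show ?thesis unfolding f_def[symmetric] by (rule le_less_trans)
  qed
  have "integrable m (\<lambda>p. \<Sum>i<N. indicator {p. idx p = i} p *\<^sub>R \<alpha> p)"
  proof (intro Bochner_Integration.integrable_sum)
    fix i assume "i \<in> {..<N}"
    then have "(\<integral>\<^sup>+p. ennreal (norm (indicator {p. idx p = i} p *\<^sub>R \<alpha> p)) \<partial>m) < \<infinity>" using piece by simp
    then show "integrable m (\<lambda>p. indicator {p. idx p = i} p *\<^sub>R \<alpha> p)"
      using \<alpha> idx_sets[of i] by (intro integrableI_bounded) auto
  qed
  moreover have "(\<Sum>i<N. indicator {p. idx p = i} p *\<^sub>R \<alpha> p) = \<alpha> p" for p
  proof -
    have "(\<Sum>i<N. indicator {p. idx p = i} p *\<^sub>R \<alpha> p) = (\<Sum>i<N. if i = idx p then \<alpha> p else 0)"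
      by (intro sum.cong refl) (auto simp: indicator_def)
    then show ?thesis using idx_less by simp
  qed
  ultimately show ?thesis by simp
qed

lemma locally_integrable_test:
  assumes f: "locally_integrable S f" and \<psi>: "test_function S \<psi>"
  shows "integrable lborel (\<lambda>x. f x * \<psi> x)" "integrable lborel (\<lambda>x. f x * dir_deriv \<psi> x b)"
proof -
  obtain K' where K': "compact K'" "K' \<subseteq> S" "\<And>x. x \<notin> K' \<Longrightarrow> \<psi> x = 0" and sm: "smooth_on UNIV \<psi>"
    using \<psi> by (auto simp: test_function_def)
  show "integrable lborel (\<lambda>x. f x * \<psi> x)"
    by (rule locally_integrable_mult[OF f K'(1,2) continuous_on_subset[OF smooth_on_imp_continuous_on[OF sm]]]) (use K'(3) in auto)
  have z: "dir_deriv \<psi> x b = 0" if "x \<notin> K'" for x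
    by (rule dir_deriv_support[OF compact_imp_closed[OF K'(1)] _ that]) (rule K'(3))
  show "integrable lborel (\<lambda>x. f x * dir_deriv \<psi> x b)"
    by (rule locally_integrable_mult[OF f K'(1,2) continuous_on_subset[OF smooth_on_imp_continuous_on[OF smooth_on_dir_deriv[OF sm]]]]) (use z in auto)
qed

lemma locally_integrable_lin:
  assumes "locally_integrable S f" "locally_integrable S h"
  shows "locally_integrable S (\<lambda>x. f x + r * h x)"
  unfolding locally_integrable_def
proof (intro allI impI)
  fix K' assume "compact K' \<and> K' \<subseteq> S"
  then have "set_integrable lborel K' f" "set_integrable lborel K' h" using assms by (auto simp: locally_integrable_def)
  then show "set_integrable lborel K' (\<lambda>x. f x + r * h x)"
    by (intro set_integral_add(1) set_integrable_mult_right) auto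
qed

text \<open>In each chart of the cover the components of the two fields have equal integrals against
  test functions, so the fundamental lemma applies to their difference, and null sets are
  transferred to m.\<close>

lemma W_unique:
  assumes W1: "W u \<alpha>" and W2: "W u \<beta>" shows "AE p in m. \<alpha> p = \<beta> p"
proof -
  have wd: "is_weak_differential A u (fld \<alpha>)" "is_weak_differential A u (fld \<beta>)" using W1 W2 by (auto simp: W_def)
  have ch: "AE p in m. p \<in> cdom (C i) \<longrightarrow> fld \<alpha> p (C i) = fld \<beta> p (C i)" if i: "i < N" for i
  proof -
    let ?c = "C i"
    have c: "?c \<in> A" by (rule C_A[OF i])
    have comp: "AE y in lborel. y \<in> cran ?c \<longrightarrow> fld \<alpha> (cinv ?c y) ?c \<bullet> b + (-1) * (fld \<beta> (cinv ?c y) ?c \<bullet> b) = 0" if b: "b \<in> Basis" for b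
    proof (rule fundamental_lemma[OF cran_open[OF c]])
      note A = weak_differential_components[OF wd(1) c b]
      note B = weak_differential_components[OF wd(2) c b]
      show "locally_integrable (cran ?c) (\<lambda>y. fld \<alpha> (cinv ?c y) ?c \<bullet> b + (-1) * (fld \<beta> (cinv ?c y) ?c \<bullet> b))"
        by (rule locally_integrable_lin[OF A(1) B(1)])
      fix \<psi> :: "'e \<Rightarrow> real" assume \<psi>: "test_function (cran ?c) \<psi>"
      have "(\<integral>y. (fld \<alpha> (cinv ?c y) ?c \<bullet> b + (-1) * (fld \<beta> (cinv ?c y) ?c \<bullet> b)) * \<psi> y \<partial>lborel) =
        (\<integral>y. (fld \<alpha> (cinv ?c y) ?c \<bullet> b) * \<psi> y - (fld \<beta> (cinv ?c y) ?c \<bullet> b) * \<psi> y \<partial>lborel)"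
        by (simp add: algebra_simps)
      also have "\<dots> = (\<integral>y. (fld \<alpha> (cinv ?c y) ?c \<bullet> b) * \<psi> y \<partial>lborel) - (\<integral>y. (fld \<beta> (cinv ?c y) ?c \<bullet> b) * \<psi> y \<partial>lborel)"
        by (rule Bochner_Integration.integral_diff[OF locally_integrable_test(1)[OF A(1) \<psi>] locally_integrable_test(1)[OF B(1) \<psi>]])
      also have "\<dots> = 0" using A(3)[OF \<psi>] B(3)[OF \<psi>] by simp
      finally show "(\<integral>y. (fld \<alpha> (cinv ?c y) ?c \<bullet> b + (-1) * (fld \<beta> (cinv ?c y) ?c \<bullet> b)) * \<psi> y \<partial>lborel) = 0" .
    qed
    have "AE y in lborel. \<forall>b\<in>Basis. y \<in> cran ?c \<longrightarrow> fld \<alpha> (cinv ?c y) ?c \<bullet> b + (-1) * (fld \<beta> (cinv ?c y) ?c \<bullet> b) = 0"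
      by (subst AE_ball_countable) (use comp in \<open>auto simp: countable_finite\<close>)
    then have "AE y in lborel. y \<in> cran ?c \<longrightarrow> fld \<alpha> (cinv ?c y) ?c = fld \<beta> (cinv ?c y) ?c"
    proof eventually_elim
      case (elim y)
      show ?case
      proof
        assume y: "y \<in> cran ?c"
        show "fld \<alpha> (cinv ?c y) ?c = fld \<beta> (cinv ?c y) ?c"
        proof (rule euclidean_eqI)
          fix b :: 'e assume "b \<in> Basis"
          with elim y have "fld \<alpha> (cinv ?c y) ?c \<bullet> b + (-1) * (fld \<beta> (cinv ?c y) ?c \<bullet> b) = 0" by blast
          then show "fld \<alpha> (cinv ?c y) ?c \<bullet> b = fld \<beta> (cinv ?c y) ?c \<bullet> b" by simp
        qed
      qed
    qed
    from AE_transfer[OF c this] show ?thesis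
    proof eventually_elim
      case (elim p)
      then show ?case using cinv_cmap[OF c, of p] by simp
    qed
  qed
  have "AE p in m. \<forall>i\<in>{..<N}. p \<in> cdom (C i) \<longrightarrow> fld \<alpha> p (C i) = fld \<beta> p (C i)"
    by (subst AE_ball_countable) (use ch in \<open>auto simp: countable_finite\<close>)
  then show ?thesis
  proof eventually_elim
    case (elim p)
    then have "fld \<alpha> p (chi p) = fld \<beta> p (chi p)" using idx_less[of p] chi_dom[of p] by (simp add: chi_def)
    then show ?case by (simp add: fld_chi)
  qed
qed

lemma W_lin:
  assumes W1: "W u \<alpha>" and W2: "W v \<beta>" shows "W (\<lambda>x. u x + r * v x) (\<lambda>x. \<alpha> x + r *\<^sub>R \<beta> x)"
  unfolding W_def is_weak_differential_def
proof (intro conjI allI ballI impI)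
  have wd: "is_weak_differential A u (fld \<alpha>)" "is_weak_differential A v (fld \<beta>)" using W1 W2 by (auto simp: W_def)
  show "(\<lambda>x. \<alpha> x + r *\<^sub>R \<beta> x) \<in> borel_measurable m" using W1 W2 by (auto simp: W_def)
  show "fld (\<lambda>x. \<alpha> x + r *\<^sub>R \<beta> x) p \<in> cotangent_space A p" for p by (rule fld_cotangent)
  fix c assume c: "c \<in> A"
  obtain b0 :: 'e where b0: "b0 \<in> Basis" using nonempty_Basis by blast
  show "locally_integrable (cran c) (\<lambda>x. u (cinv c x) + r * v (cinv c x))"
    by (rule locally_integrable_lin[OF weak_differential_components(2)[OF wd(1) c b0] weak_differential_components(2)[OF wd(2) c b0]])
  fix b :: 'e assume b: "b \<in> Basis"
  note A = weak_differential_components[OF wd(1) c b]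
  note B = weak_differential_components[OF wd(2) c b]
  show "locally_integrable (cran c) (\<lambda>x. fld (\<lambda>x. \<alpha> x + r *\<^sub>R \<beta> x) (cinv c x) c \<bullet> b)"
    using locally_integrable_lin[OF A(1) B(1)] by (simp add: fld_lin inner_add_left)
  fix \<psi> :: "'e \<Rightarrow> real" assume \<psi>: "test_function (cran c) \<psi>"
  have "(\<integral>x. (u (cinv c x) + r * v (cinv c x)) * dir_deriv \<psi> x b \<partial>lborel) =
      (\<integral>x. u (cinv c x) * dir_deriv \<psi> x b + r * (v (cinv c x) * dir_deriv \<psi> x b) \<partial>lborel)"
    by (simp add: algebra_simps)
  also have "\<dots> = (\<integral>x. u (cinv c x) * dir_deriv \<psi> x b \<partial>lborel) + r * (\<integral>x. v (cinv c x) * dir_deriv \<psi> x b \<partial>lborel)"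
    using locally_integrable_test(2)[OF A(2) \<psi>, of b] locally_integrable_test(2)[OF B(2) \<psi>, of b] by simp
  also have "\<dots> = - ((\<integral>x. (fld \<alpha> (cinv c x) c \<bullet> b) * \<psi> x \<partial>lborel) + r * (\<integral>x. (fld \<beta> (cinv c x) c \<bullet> b) * \<psi> x \<partial>lborel))"
    unfolding A(3)[OF \<psi>] B(3)[OF \<psi>] by simp
  also have "(\<integral>x. (fld \<alpha> (cinv c x) c \<bullet> b) * \<psi> x \<partial>lborel) + r * (\<integral>x. (fld \<beta> (cinv c x) c \<bullet> b) * \<psi> x \<partial>lborel) =
     (\<integral>x. (fld \<alpha> (cinv c x) c \<bullet> b) * \<psi> x + r * ((fld \<beta> (cinv c x) c \<bullet> b) * \<psi> x) \<partial>lborel)"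
    using locally_integrable_test(1)[OF A(1) \<psi>] locally_integrable_test(1)[OF B(1) \<psi>] by simp
  also have "\<dots> = (\<integral>x. (fld (\<lambda>x. \<alpha> x + r *\<^sub>R \<beta> x) (cinv c x) c \<bullet> b) * \<psi> x \<partial>lborel)"
    by (simp add: fld_lin inner_add_left algebra_simps)
  finally show "(\<integral>x. (u (cinv c x) + r * v (cinv c x)) * dir_deriv \<psi> x b \<partial>lborel) =
     - (\<integral>x. (fld (\<lambda>x. \<alpha> x + r *\<^sub>R \<beta> x) (cinv c x) c \<bullet> b) * \<psi> x \<partial>lborel)" .
qed

lemma W_zero: "W (\<lambda>x. 0) (\<lambda>x. 0)"
  unfolding W_def is_weak_differential_def using fld_cotangent
  by (simp add: fld_zero locally_integrable_def set_integrable_def)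

end

lemma (in finite_measure) L1_le_L2norm:
  assumes v: "v \<in> L2 M" shows "(\<integral>x. \<bar>v x\<bar> \<partial>M) \<le> sqrt (measure M (space M)) * L2norm M v"
proof -
  interpret semi_hilbert "L2 M" "L2ip M" by (rule L2_semi_hilbert)
  have 1: "(\<lambda>x. \<bar>v x\<bar>) \<in> L2 M" "(\<lambda>x. 1) \<in> L2 M" using v by (auto simp: L2_def)
  have "\<bar>L2ip M (\<lambda>x. \<bar>v x\<bar>) (\<lambda>x. 1)\<bar> \<le> nrm (\<lambda>x. \<bar>v x\<bar>) * nrm (\<lambda>x. 1)" by (rule Cauchy_Schwarz[OF 1])
  moreover have "nrm (\<lambda>x. \<bar>v x\<bar>) = L2norm M v" by (simp add: nrm_def nsq_def L2norm_eq L2ip_def)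
  moreover have "nrm (\<lambda>x. 1) = sqrt (measure M (space M))" by (simp add: nrm_def nsq_def L2ip_def)
  ultimately show ?thesis by (simp add: L2ip_def mult.commute)
qed

lemma integral_mult_limit:
  fixes f :: "'a::euclidean_space \<Rightarrow> real" and fs :: "nat \<Rightarrow> 'a \<Rightarrow> real"
  assumes K: "compact K" and G: "continuous_on K G" "\<And>x. x \<notin> K \<Longrightarrow> G x = 0"
    and fs: "\<And>k. set_integrable lborel K (fs k)" and f: "set_integrable lborel K f"
    and lim: "(\<lambda>k. LINT x:K|lborel. norm (fs k x - f x)) \<longlonglongrightarrow> 0"
  shows "(\<lambda>k. \<integral>x. fs k x * G x \<partial>lborel) \<longlonglongrightarrow> (\<integral>x. f x * G x \<partial>lborel)"
proof -
  have li: "integrable lborel (\<lambda>x. h x * G x)" if h: "set_integrable lborel K h" for h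
  proof -
    have "locally_integrable K h" unfolding locally_integrable_def
      using set_integrable_subset[OF h] by (simp add: compact_imp_closed)
    then show ?thesis by (rule locally_integrable_mult[OF _ K subset_refl G])
  qed
  obtain B0 where B0: "\<And>x. x \<in> K \<Longrightarrow> norm (G x) \<le> B0"
    using compact_imp_bounded[OF compact_continuous_image[OF G(1) K]] by (auto simp: bounded_iff)
  define B where "B = \<bar>B0\<bar>"
  have B: "norm (G x) \<le> B" "0 \<le> B" if "x \<in> K" for x using B0[OF that] unfolding B_def by auto
  have est: "norm ((\<integral>x. fs k x * G x \<partial>lborel) - (\<integral>x. f x * G x \<partial>lborel)) \<le> B * (LINT x:K|lborel. norm (fs k x - f x))" for k
  proof -
    have d: "set_integrable lborel K (\<lambda>x. fs k x - f x)" using fs f by (rule set_integral_diff(1))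
    have dn: "integrable lborel (\<lambda>x. indicator K x *\<^sub>R norm (fs k x - f x))"
      using set_integrable_norm[OF d] unfolding set_integrable_def .
    have "(\<integral>x. fs k x * G x \<partial>lborel) - (\<integral>x. f x * G x \<partial>lborel) = (\<integral>x. fs k x * G x - f x * G x \<partial>lborel)"
      by (rule Bochner_Integration.integral_diff[symmetric, OF li[OF fs] li[OF f]])
    also have "norm \<dots> \<le> (\<integral>x. norm (fs k x * G x - f x * G x) \<partial>lborel)"
      by (rule integral_norm_bound)
    also have "\<dots> \<le> (\<integral>x. B * (indicator K x *\<^sub>R norm (fs k x - f x)) \<partial>lborel)"
    proof (rule integral_mono)
      show "integrable lborel (\<lambda>x. norm (fs k x * G x - f x * G x))"
        using Bochner_Integration.integrable_diff[OF li[OF fs] li[OF f]] by (rule integrable_norm)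
      show "integrable lborel (\<lambda>x. B * (indicator K x *\<^sub>R norm (fs k x - f x)))" by (rule integrable_mult_right[OF dn])
      show "norm (fs k x * G x - f x * G x) \<le> B * (indicator K x *\<^sub>R norm (fs k x - f x))" for x
      proof (cases "x \<in> K")
        case True
        have "fs k x * G x - f x * G x = G x * (fs k x - f x)" by (simp add: right_diff_distrib mult.commute)
        then have "norm (fs k x * G x - f x * G x) = norm (G x) * norm (fs k x - f x)" by (simp only: norm_mult)
        also have "\<dots> \<le> B * norm (fs k x - f x)" using B[OF True] by (intro mult_right_mono) auto
        finally show ?thesis using True by simp
      qed (simp add: G(2))
    qed
    also have "\<dots> = B * (LINT x:K|lborel. norm (fs k x - f x))"
      unfolding set_lebesgue_integral_def by (rule integral_mult_right_zero)
    finally show ?thesis .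
  qed
  have "(\<lambda>k. (\<integral>x. fs k x * G x \<partial>lborel) - (\<integral>x. f x * G x \<partial>lborel)) \<longlonglongrightarrow> 0"
    by (rule Lim_null_comparison[OF always_eventually[OF allI[OF est]]]) (use tendsto_mult_right_zero[OF lim] in simp)
  then show ?thesis by (simp add: LIM_zero_iff)
qed

context heat_cover
begin

sublocale finite_measure m by (rule finite_measure_m)

section \<open>Transport of L1 bounds to charts, and closedness of the weak differential\<close>

lemma T_cont:
  assumes c: "c \<in> A" and d: "d \<in> A" shows "continuous_on (cdom c \<inter> cdom d) (\<lambda>p. T c d p b)"
  unfolding T_def
  by (rule continuous_on_compose2[OF smooth_on_imp_continuous_on[OF smooth_on_dir_deriv[OF trans_smooth[OF c d]]]
      continuous_on_subset[OF cmap_cont[OF c]]]) auto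

text \<open>The chart d is arbitrary while the components refer to the charts of the cover; on the
  compact sets K' \<inter> K i the Jacobians between them are bounded, and there are finitely many
  of these sets.\<close>

lemma covec_bound:
  assumes d: "d \<in> A" and K': "compact K'" "K' \<subseteq> cdom d"
  shows "\<exists>J\<ge>0. \<forall>p\<in>K'. \<forall>a. norm (covec_of A (chi p) p a d) \<le> J * norm a"
proof -
  have ex: "\<exists>J. i < N \<longrightarrow> 0 \<le> J \<and> (\<forall>p\<in>K' \<inter> K i. \<forall>a. norm (covec_of A (C i) p a d) \<le> J * norm a)" for i
  proof (cases "i < N")
    case i: True
    have Z: "compact (K' \<inter> K i)" "K' \<inter> K i \<subseteq> cdom d \<inter> cdom (C i)"
      using K' K_compact[OF i] K_sub[OF i] by (auto simp: compact_Int_closed compact_imp_closed)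
    have "\<forall>b. \<exists>J. \<forall>p\<in>K' \<inter> K i. norm (T d (C i) p b) \<le> J"
    proof
      fix b
      have "bounded ((\<lambda>p. T d (C i) p b) ` (K' \<inter> K i))"
        by (rule compact_imp_bounded[OF compact_continuous_image[OF continuous_on_subset[OF T_cont[OF d C_A[OF i]] Z(2)] Z(1)]])
      then obtain J where "\<forall>x\<in>(\<lambda>p. T d (C i) p b) ` (K' \<inter> K i). norm x \<le> J" unfolding bounded_iff by blast
      then show "\<exists>J. \<forall>p\<in>K' \<inter> K i. norm (T d (C i) p b) \<le> J" by blast
    qed
    from choice[OF this] obtain J where J: "\<And>b p. p \<in> K' \<inter> K i \<Longrightarrow> norm (T d (C i) p b) \<le> J b" by blast
    have "norm (covec_of A (C i) p a d) \<le> (\<Sum>b\<in>Basis. \<bar>J b\<bar>) * norm a" if p: "p \<in> K' \<inter> K i" for p a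
    proof -
      have at: "C i \<in> charts_at A p" "d \<in> charts_at A p" using p Z(2) C_A[OF i] d by (auto simp: charts_at_iff)
      have "norm (covec_of A (C i) p a d) \<le> (\<Sum>b\<in>Basis. \<bar>covec_of A (C i) p a d \<bullet> b\<bar>)" by (rule norm_le_l1)
      also have "\<dots> \<le> (\<Sum>b\<in>Basis. \<bar>J b\<bar> * norm a)"
      proof (rule sum_mono)
        fix b :: 'e
        have "\<bar>covec_of A (C i) p a d \<bullet> b\<bar> \<le> norm a * norm (T d (C i) p b)"
          unfolding covec_inner[OF at] by (rule Cauchy_Schwarz_ineq2)
        also have "\<dots> \<le> norm a * \<bar>J b\<bar>" using J[OF p, of b] by (intro mult_left_mono) auto
        finally show "\<bar>covec_of A (C i) p a d \<bullet> b\<bar> \<le> \<bar>J b\<bar> * norm a" by (simp add: mult.commute)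
      qed
      finally show ?thesis by (simp add: sum_distrib_right)
    qed
    moreover have "0 \<le> (\<Sum>b\<in>(Basis::'e set). \<bar>J b\<bar>)" by (simp add: sum_nonneg)
    ultimately show ?thesis by blast
  qed simp
  from choice[OF allI[OF ex]] obtain J
    where "\<forall>i. i < N \<longrightarrow> 0 \<le> J i \<and> (\<forall>p\<in>K' \<inter> K i. \<forall>a. norm (covec_of A (C i) p a d) \<le> J i * norm a)" ..
  then have J: "\<And>i. i < N \<Longrightarrow> 0 \<le> J i" "\<And>i p a. i < N \<Longrightarrow> p \<in> K' \<inter> K i \<Longrightarrow> norm (covec_of A (C i) p a d) \<le> J i * norm a"
    by simp_all
  have "norm (covec_of A (chi p) p a d) \<le> (\<Sum>i<N. J i) * norm a" if p: "p \<in> K'" for p a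
  proof -
    have "norm (covec_of A (chi p) p a d) \<le> J (idx p) * norm a"
      unfolding chi_def by (rule J(2)[OF idx_less IntI[OF p idx_K]])
    also have "\<dots> \<le> (\<Sum>i<N. J i) * norm a" by (intro mult_right_mono sum_bound J(1)) auto
    finally show ?thesis .
  qed
  moreover have "0 \<le> (\<Sum>i<N. J i)" using J(1) by (intro sum_nonneg) auto
  ultimately show ?thesis by blast
qed

lemma fld_meas:
  assumes d: "d \<in> A" and \<alpha>: "\<alpha> \<in> borel_measurable m"
  shows "(\<lambda>p. indicator (cdom d) p *\<^sub>R fld \<alpha> p d) \<in> borel_measurable m"
proof -
  have "(\<lambda>p. (\<lambda>i p. indicator (cdom d) p *\<^sub>R covec_of A (C i) p (\<alpha> p) d) (idx p) p) \<in> borel_measurable m"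
  proof (rule pieces_measurable)
    fix i assume i: "i < N"
    define U where "U = cdom d \<inter> cdom (C i)"
    have U: "open U" unfolding U_def using cdom_open d C_A[OF i] by (intro open_Int)
    have Tm: "(\<lambda>p. indicator U p *\<^sub>R T d (C i) p b) \<in> borel_measurable m" for b
    proof -
      have "(\<lambda>p. indicator U p *\<^sub>R T d (C i) p b) \<in> borel_measurable borel"
        unfolding U_def by (rule borel_measurable_continuous_on_indicator[OF borel_open[OF U[unfolded U_def]] T_cont[OF d C_A[OF i]]])
      then show ?thesis using measurable_cong_sets[OF sets_m refl] by blast
    qed
    have "(\<lambda>p. \<Sum>b\<in>Basis. (\<alpha> p \<bullet> (indicator U p *\<^sub>R T d (C i) p b)) *\<^sub>R b) \<in> borel_measurable m"
      by (intro borel_measurable_sum borel_measurable_scaleR borel_measurable_inner \<alpha> Tm borel_measurable_const)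
    moreover have "(\<Sum>b\<in>Basis. (\<alpha> p \<bullet> (indicator U p *\<^sub>R T d (C i) p b)) *\<^sub>R b) =
        indicator (cdom (C i)) p *\<^sub>R (indicator (cdom d) p *\<^sub>R covec_of A (C i) p (\<alpha> p) d)" for p
    proof (cases "p \<in> U")
      case True
      then have at: "C i \<in> charts_at A p" "d \<in> charts_at A p" using C_A[OF i] d by (auto simp: charts_at_iff U_def)
      have "(\<Sum>b\<in>Basis. (\<alpha> p \<bullet> T d (C i) p b) *\<^sub>R b) = (\<Sum>b\<in>Basis. (covec_of A (C i) p (\<alpha> p) d \<bullet> b) *\<^sub>R b)"
        by (simp add: covec_inner[OF at])
      then show ?thesis using True by (simp add: euclidean_representation U_def)
    next
      case False
      then show ?thesis by (auto simp: U_def indicator_def)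
    qed
    ultimately show "(\<lambda>p. indicator (cdom (C i)) p *\<^sub>R (\<lambda>i p. indicator (cdom d) p *\<^sub>R covec_of A (C i) p (\<alpha> p) d) i p) \<in> borel_measurable m"
      by simp
  qed
  then show ?thesis by (simp add: fld_def chi_def)
qed

text \<open>The point is that \<kappa> does not depend on f: applied to differences, the estimate
  transports L1 convergence on the manifold to every compact part of a chart.\<close>

lemma pull_L1:
  assumes d: "d \<in> A" and K': "compact K'" "K' \<subseteq> cran d"
  shows "\<exists>\<kappa>>0. \<forall>f::'m \<Rightarrow> 'b::{banach, second_countable_topology}. integrable m f \<longrightarrow>
    set_integrable lborel K' (\<lambda>y. f (cinv d y)) \<and>
    (LINT y:K'|lborel. norm (f (cinv d y))) \<le> \<kappa> * (\<integral>x. norm (f x) \<partial>m)"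
proof -
  let ?Z = "cinv d ` K'"
  have Z: "compact ?Z" "?Z \<subseteq> cdom d"
    using compact_continuous_image[OF continuous_on_subset[OF cinv_cont[OF d] K'(2)] K'(1)] K'(2) d by auto
  have im: "cmap d ` ?Z = K'"
  proof -
    have "cmap d ` ?Z = (\<lambda>y. cmap d (cinv d y)) ` K'" by (simp add: image_image)
    also have "\<dots> = (\<lambda>y. y) ` K'" by (rule image_cong[OF refl]) (use K'(2) cmap_cinv[OF d] in blast)
    finally show ?thesis by simp
  qed
  obtain \<kappa> where \<kappa>: "\<kappa> > 0" "\<And>f. f \<in> borel_measurable m \<Longrightarrow>
     (\<integral>\<^sup>+y. f (cinv d y) * indicator K' y \<partial>lborel) \<le> ennreal \<kappa> * (\<integral>\<^sup>+x. f x * indicator ?Z x \<partial>m)"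
    using transfer_compare[OF d Z] unfolding im by blast
  have "set_integrable lborel K' (\<lambda>y. f (cinv d y)) \<and> (LINT y:K'|lborel. norm (f (cinv d y))) \<le> \<kappa> * (\<integral>x. norm (f x) \<partial>m)"
    if f: "integrable m f" for f :: "'m \<Rightarrow> 'b"
  proof -
    have fm: "f \<in> borel_measurable m" using f by (rule borel_measurable_integrable)
    have "(\<lambda>y. indicator K' y *\<^sub>R (indicator (cran d) y *\<^sub>R f (cinv d y))) \<in> borel_measurable borel"
      by (rule borel_measurable_scaleR[OF borel_measurable_indicator pullback_measurable[OF d fm]])
        (use K' in \<open>simp add: compact_imp_closed\<close>)
    moreover have "(\<lambda>y. indicator K' y *\<^sub>R (indicator (cran d) y *\<^sub>R f (cinv d y))) = (\<lambda>y. indicator K' y *\<^sub>R f (cinv d y))"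
      using K'(2) by (auto simp: fun_eq_iff indicator_def)
    ultimately have M: "(\<lambda>y. indicator K' y *\<^sub>R f (cinv d y)) \<in> borel_measurable lborel" by simp
    have "(\<integral>\<^sup>+y. ennreal (norm (indicator K' y *\<^sub>R f (cinv d y))) \<partial>lborel) = (\<integral>\<^sup>+y. ennreal (norm (f (cinv d y))) * indicator K' y \<partial>lborel)"
      by (rule nn_integral_cong) (simp add: indicator_def)
    also have "\<dots> \<le> ennreal \<kappa> * (\<integral>\<^sup>+x. ennreal (norm (f x)) * indicator ?Z x \<partial>m)"
      by (rule \<kappa>(2)) (use fm in measurable)
    also have "\<dots> \<le> ennreal \<kappa> * (\<integral>\<^sup>+x. ennreal (norm (f x)) \<partial>m)"
      by (intro mult_left_mono nn_integral_mono) (auto simp: indicator_def)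
    also have "\<dots> = ennreal \<kappa> * ennreal (\<integral>x. norm (f x) \<partial>m)"
      by (subst nn_integral_eq_integral[OF integrable_norm[OF f]]) auto
    also have "\<dots> = ennreal (\<kappa> * (\<integral>x. norm (f x) \<partial>m))" using \<kappa>(1) by (simp add: ennreal_mult)
    finally have le: "(\<integral>\<^sup>+y. ennreal (norm (indicator K' y *\<^sub>R f (cinv d y))) \<partial>lborel) \<le> ennreal (\<kappa> * (\<integral>x. norm (f x) \<partial>m))" .
    have I: "integrable lborel (\<lambda>y. indicator K' y *\<^sub>R f (cinv d y))"
      by (rule integrableI_bounded[OF M]) (use le in \<open>simp add: order_le_less_trans\<close>)
    have "ennreal (\<integral>y. norm (indicator K' y *\<^sub>R f (cinv d y)) \<partial>lborel) \<le> ennreal (\<kappa> * (\<integral>x. norm (f x) \<partial>m))"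
      using le nn_integral_eq_integral[OF integrable_norm[OF I]] by simp
    then have "(\<integral>y. norm (indicator K' y *\<^sub>R f (cinv d y)) \<partial>lborel) \<le> \<kappa> * (\<integral>x. norm (f x) \<partial>m)"
      using \<kappa>(1) by (subst (asm) ennreal_le_iff) auto
    moreover have "(LINT y:K'|lborel. norm (f (cinv d y))) = (\<integral>y. norm (indicator K' y *\<^sub>R f (cinv d y)) \<partial>lborel)"
      unfolding set_lebesgue_integral_def by (rule Bochner_Integration.integral_cong) auto
    ultimately show ?thesis using I unfolding set_integrable_def by simp
  qed
  then show ?thesis using \<kappa>(1) by blast
qed

lemma fld_pull:
  assumes d: "d \<in> A" and K': "compact K'" "K' \<subseteq> cran d"
  shows "\<exists>\<kappa>>0. \<forall>\<alpha>. integrable m \<alpha> \<longrightarrow> set_integrable lborel K' (\<lambda>y. fld \<alpha> (cinv d y) d) \<and>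
    (LINT y:K'|lborel. norm (fld \<alpha> (cinv d y) d)) \<le> \<kappa> * (\<integral>x. norm (\<alpha> x) \<partial>m)"
proof -
  let ?Z = "cinv d ` K'"
  have Z: "compact ?Z" "?Z \<subseteq> cdom d"
    using compact_continuous_image[OF continuous_on_subset[OF cinv_cont[OF d] K'(2)] K'(1)] K'(2) d by auto
  have Zs: "?Z \<in> sets m" using Z(1) sets_m by (simp add: compact_imp_closed)
  obtain J where J: "J \<ge> 0" "\<And>p a. p \<in> ?Z \<Longrightarrow> norm (covec_of A (chi p) p a d) \<le> J * norm a"
    using covec_bound[OF d Z] by blast
  obtain \<kappa> where \<kappa>: "\<kappa> > 0" "\<And>f::'m \<Rightarrow> 'e. integrable m f \<Longrightarrow> set_integrable lborel K' (\<lambda>y. f (cinv d y))"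
    "\<And>f::'m \<Rightarrow> 'e. integrable m f \<Longrightarrow> (LINT y:K'|lborel. norm (f (cinv d y))) \<le> \<kappa> * (\<integral>x. norm (f x) \<partial>m)"
    using pull_L1[OF d K', where 'b='e] by blast
  have "set_integrable lborel K' (\<lambda>y. fld \<alpha> (cinv d y) d) \<and>
    (LINT y:K'|lborel. norm (fld \<alpha> (cinv d y) d)) \<le> (\<kappa> * (J + 1)) * (\<integral>x. norm (\<alpha> x) \<partial>m)" if \<alpha>: "integrable m \<alpha>" for \<alpha>
  proof -
    define f where "f p = indicator ?Z p *\<^sub>R fld \<alpha> p d" for p
    have fe: "f p = indicator ?Z p *\<^sub>R (indicator (cdom d) p *\<^sub>R fld \<alpha> p d)" for p
      using Z(2) by (auto simp: f_def indicator_def)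
    have fm: "f \<in> borel_measurable m"
      unfolding fe[abs_def] by (rule borel_measurable_scaleR[OF borel_measurable_indicator[OF Zs] fld_meas[OF d borel_measurable_integrable[OF \<alpha>]]])
    have fb: "norm (f p) \<le> J * norm (\<alpha> p)" for p
      using J unfolding f_def fld_def by (cases "p \<in> ?Z") auto
    have fi: "integrable m f"
      by (rule Bochner_Integration.integrable_bound[OF integrable_mult_right[OF integrable_norm[OF \<alpha>], of J] fm])
        (use fb J(1) in \<open>auto simp: abs_mult\<close>)
    have n: "(\<integral>x. norm (f x) \<partial>m) \<le> (J + 1) * (\<integral>x. norm (\<alpha> x) \<partial>m)"
    proof -
      have "(\<integral>x. norm (f x) \<partial>m) \<le> (\<integral>x. J * norm (\<alpha> x) \<partial>m)"
        by (rule integral_mono[OF integrable_norm[OF fi] integrable_mult_right[OF integrable_norm[OF \<alpha>]] fb])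
      also have "\<dots> = J * (\<integral>x. norm (\<alpha> x) \<partial>m)" by simp
      also have "\<dots> \<le> (J + 1) * (\<integral>x. norm (\<alpha> x) \<partial>m)" by (intro mult_right_mono) auto
      finally show ?thesis .
    qed
    have e: "indicator K' y *\<^sub>R f (cinv d y) = indicator K' y *\<^sub>R fld \<alpha> (cinv d y) d" for y
      by (auto simp: f_def indicator_def)
    have e2: "indicator K' y *\<^sub>R norm (f (cinv d y)) = indicator K' y *\<^sub>R norm (fld \<alpha> (cinv d y) d)" for y
      by (auto simp: f_def indicator_def)
    have "(LINT y:K'|lborel. norm (f (cinv d y))) \<le> \<kappa> * ((J + 1) * (\<integral>x. norm (\<alpha> x) \<partial>m))"
      using order_trans[OF \<kappa>(3)[OF fi] mult_left_mono[OF n less_imp_le[OF \<kappa>(1)]]] .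
    then show ?thesis using \<kappa>(2)[OF fi] unfolding set_integrable_def set_lebesgue_integral_def e e2 by (simp add: mult.assoc)
  qed
  moreover have "\<kappa> * (J + 1) > 0" using \<kappa>(1) J(1) by simp
  ultimately show ?thesis by blast
qed

lemma fld_locally_integrable:
  assumes d: "d \<in> A" and \<alpha>: "integrable m \<alpha>"
  shows "locally_integrable (cran d) (\<lambda>y. fld \<alpha> (cinv d y) d \<bullet> b)"
  unfolding locally_integrable_def
proof (intro allI impI)
  fix K' assume K': "compact K' \<and> K' \<subseteq> cran d"
  then have "set_integrable lborel K' (\<lambda>y. fld \<alpha> (cinv d y) d)" using fld_pull[OF d] \<alpha> by blast
  then have "integrable lborel (\<lambda>y. (indicator K' y *\<^sub>R fld \<alpha> (cinv d y) d) \<bullet> b)"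
    unfolding set_integrable_def by (rule integrable_inner_left)
  then show "set_integrable lborel K' (\<lambda>y. fld \<alpha> (cinv d y) d \<bullet> b)" unfolding set_integrable_def by simp
qed

lemma L1_locally_integrable:
  fixes u :: "'m \<Rightarrow> real"
  assumes d: "d \<in> A" and u: "integrable m u" shows "locally_integrable (cran d) (\<lambda>y. u (cinv d y))"
  unfolding locally_integrable_def using pull_L1[OF d, where 'b=real] u by blast

text \<open>Both sides of the defining identity converge for a fixed test function: the functions
  converge in L1 because m is finite, the components of the differentials by
  \<open>fld_pull\<close>, and the test function and its derivative are bounded with compact
  support.\<close>

lemma W_closed:
  assumes W: "\<And>k::nat. W (us k) (as k)" and usL: "\<And>k. us k \<in> L2 m" and u: "u \<in> L2 m"
    and lim: "(\<lambda>k. L2norm m (us k - u)) \<longlonglongrightarrow> 0" and \<alpha>: "integrable m \<alpha>"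
    and alim: "(\<lambda>k. \<integral>x. norm (as k x - \<alpha> x) \<partial>m) \<longlonglongrightarrow> 0"
  shows "W u \<alpha>"
  unfolding W_def is_weak_differential_def
proof (intro conjI allI ballI impI)
  show "\<alpha> \<in> borel_measurable m" using \<alpha> by (rule borel_measurable_integrable)
  show "fld \<alpha> p \<in> cotangent_space A p" for p by (rule fld_cotangent)
  fix d assume d: "d \<in> A"
  have u1: "integrable m u" and us1: "\<And>k. integrable m (us k)" using L2_integrable u usL by auto
  have wd: "is_weak_differential A (us k) (fld (as k))" for k using W by (simp add: W_def)
  have ai: "integrable m (as k)" for k by (rule W_integrable[OF W])
  show "locally_integrable (cran d) (\<lambda>x. u (cinv d x))" by (rule L1_locally_integrable[OF d u1])
  fix b :: 'e assume b: "b \<in> Basis"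
  show "locally_integrable (cran d) (\<lambda>x. fld \<alpha> (cinv d x) d \<bullet> b)" by (rule fld_locally_integrable[OF d \<alpha>])
  fix \<psi> :: "'e \<Rightarrow> real" assume \<psi>: "test_function (cran d) \<psi>"
  obtain K' where K': "compact K'" "K' \<subseteq> cran d" "\<And>x. x \<notin> K' \<Longrightarrow> \<psi> x = 0" and sm: "smooth_on UNIV \<psi>"
    using \<psi> by (auto simp: test_function_def)
  have c1: "continuous_on K' \<psi>" and c2: "continuous_on K' (\<lambda>x. dir_deriv \<psi> x b)"
    using continuous_on_subset[OF smooth_on_imp_continuous_on[OF sm]] continuous_on_subset[OF smooth_on_imp_continuous_on[OF smooth_on_dir_deriv[OF sm]]] by auto
  have z: "dir_deriv \<psi> x b = 0" if "x \<notin> K'" for x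
    by (rule dir_deriv_support[OF compact_imp_closed[OF K'(1)] _ that]) (rule K'(3))
  have A: "(\<lambda>k. \<integral>y. us k (cinv d y) * dir_deriv \<psi> y b \<partial>lborel) \<longlonglongrightarrow> (\<integral>y. u (cinv d y) * dir_deriv \<psi> y b \<partial>lborel)"
  proof (rule integral_mult_limit[OF K'(1) c2 z])
    obtain \<kappa> where \<kappa>: "\<kappa> > 0" "\<And>f::'m \<Rightarrow> real. integrable m f \<Longrightarrow> set_integrable lborel K' (\<lambda>y. f (cinv d y)) \<and>
      (LINT y:K'|lborel. norm (f (cinv d y))) \<le> \<kappa> * (\<integral>x. norm (f x) \<partial>m)"
      using pull_L1[OF d K'(1,2), where 'b=real] by blast
    show "set_integrable lborel K' (\<lambda>y. us k (cinv d y))" for k using \<kappa>(2)[OF us1] by blast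
    show "set_integrable lborel K' (\<lambda>y. u (cinv d y))" using \<kappa>(2)[OF u1] by blast
    have le: "(LINT y:K'|lborel. norm (us k (cinv d y) - u (cinv d y))) \<le> \<kappa> * (sqrt (measure m (space m)) * L2norm m (us k - u))" for k
    proof -
      have dL: "us k - u \<in> L2 m" using L2_lin[OF usL[of k] u, of "-1"] by (simp add: fun_diff_def)
      have "(LINT y:K'|lborel. norm (us k (cinv d y) - u (cinv d y))) \<le> \<kappa> * (\<integral>x. norm (us k x - u x) \<partial>m)"
        using \<kappa>(2)[OF Bochner_Integration.integrable_diff[OF us1[of k] u1]] by blast
      also have "(\<integral>x. norm (us k x - u x) \<partial>m) = (\<integral>x. \<bar>(us k - u) x\<bar> \<partial>m)" by simp
      also have "\<kappa> * \<dots> \<le> \<kappa> * (sqrt (measure m (space m)) * L2norm m (us k - u))"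
        using L1_le_L2norm[OF dL] \<kappa>(1) by (intro mult_left_mono) auto
      finally show ?thesis .
    qed
    have "(\<lambda>k. \<kappa> * (sqrt (measure m (space m)) * L2norm m (us k - u))) \<longlonglongrightarrow> \<kappa> * (sqrt (measure m (space m)) * 0)"
      by (intro tendsto_mult tendsto_const lim)
    then have l0: "(\<lambda>k. \<kappa> * (sqrt (measure m (space m)) * L2norm m (us k - u))) \<longlonglongrightarrow> 0" by simp
    have nn: "0 \<le> (LINT y:K'|lborel. norm (us k (cinv d y) - u (cinv d y)))" for k
      unfolding set_lebesgue_integral_def by (rule integral_nonneg_AE) simp
    show "(\<lambda>k. LINT y:K'|lborel. norm (us k (cinv d y) - u (cinv d y))) \<longlonglongrightarrow> 0"
      by (rule tendsto_sandwich[OF always_eventually[OF allI[OF nn]] always_eventually[OF allI[OF le]] tendsto_const l0])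
  qed
  have B: "(\<lambda>k. \<integral>y. (fld (as k) (cinv d y) d \<bullet> b) * \<psi> y \<partial>lborel) \<longlonglongrightarrow> (\<integral>y. (fld \<alpha> (cinv d y) d \<bullet> b) * \<psi> y \<partial>lborel)"
  proof (rule integral_mult_limit[OF K'(1) c1 K'(3)])
    obtain \<kappa> where \<kappa>: "\<kappa> > 0" "\<And>\<alpha>. integrable m \<alpha> \<Longrightarrow> set_integrable lborel K' (\<lambda>y. fld \<alpha> (cinv d y) d) \<and>
      (LINT y:K'|lborel. norm (fld \<alpha> (cinv d y) d)) \<le> \<kappa> * (\<integral>x. norm (\<alpha> x) \<partial>m)"
      using fld_pull[OF d K'(1,2)] by blast
    show s1: "set_integrable lborel K' (\<lambda>y. fld (as k) (cinv d y) d \<bullet> b)" for k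
      using fld_locally_integrable[OF d ai] K' unfolding locally_integrable_def by blast
    show s2: "set_integrable lborel K' (\<lambda>y. fld \<alpha> (cinv d y) d \<bullet> b)"
      using fld_locally_integrable[OF d \<alpha>] K' unfolding locally_integrable_def by blast
    have le: "(LINT y:K'|lborel. norm (fld (as k) (cinv d y) d \<bullet> b - fld \<alpha> (cinv d y) d \<bullet> b)) \<le> \<kappa> * (\<integral>x. norm (as k x - \<alpha> x) \<partial>m)" for k
    proof -
      define \<beta> where "\<beta> x = as k x + (-1) *\<^sub>R \<alpha> x" for x
      have \<beta>: "integrable m \<beta>" unfolding \<beta>_def using ai[of k] \<alpha> by auto
      have fb: "fld \<beta> p d = fld (as k) p d - fld \<alpha> p d" for p
        unfolding \<beta>_def fld_lin by simp
      have "(LINT y:K'|lborel. norm (fld (as k) (cinv d y) d \<bullet> b - fld \<alpha> (cinv d y) d \<bullet> b)) \<le> (LINT y:K'|lborel. norm (fld \<beta> (cinv d y) d))"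
      proof (rule set_integral_mono)
        show "set_integrable lborel K' (\<lambda>y. norm (fld (as k) (cinv d y) d \<bullet> b - fld \<alpha> (cinv d y) d \<bullet> b))"
          by (rule set_integrable_norm[OF set_integral_diff(1)[OF s1 s2]])
        show "set_integrable lborel K' (\<lambda>y. norm (fld \<beta> (cinv d y) d))"
          using set_integrable_norm \<kappa>(2)[OF \<beta>] by blast
        show "norm (fld (as k) (cinv d y) d \<bullet> b - fld \<alpha> (cinv d y) d \<bullet> b) \<le> norm (fld \<beta> (cinv d y) d)" for y
          using Basis_le_norm[OF b, of "fld \<beta> (cinv d y) d"] by (simp add: fb inner_diff_left)
      qed
      also have "\<dots> \<le> \<kappa> * (\<integral>x. norm (\<beta> x) \<partial>m)" using \<kappa>(2)[OF \<beta>] by blast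
      finally show ?thesis by (simp add: \<beta>_def)
    qed
    have l0: "(\<lambda>k. \<kappa> * (\<integral>x. norm (as k x - \<alpha> x) \<partial>m)) \<longlonglongrightarrow> 0"
      using tendsto_mult_right_zero[OF alim] by simp
    have nn: "0 \<le> (LINT y:K'|lborel. norm (fld (as k) (cinv d y) d \<bullet> b - fld \<alpha> (cinv d y) d \<bullet> b))" for k
      unfolding set_lebesgue_integral_def by (rule integral_nonneg_AE) simp
    show "(\<lambda>k. LINT y:K'|lborel. norm (fld (as k) (cinv d y) d \<bullet> b - fld \<alpha> (cinv d y) d \<bullet> b)) \<longlonglongrightarrow> 0"
      by (rule tendsto_sandwich[OF always_eventually[OF allI[OF nn]] always_eventually[OF allI[OF le]] tendsto_const l0])
  qed
  have eq: "(\<integral>y. us k (cinv d y) * dir_deriv \<psi> y b \<partial>lborel) = - (\<integral>y. (fld (as k) (cinv d y) d \<bullet> b) * \<psi> y \<partial>lborel)" for k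
    by (rule weak_differential_components(3)[OF wd d b \<psi>])
  show "(\<integral>x. u (cinv d x) * dir_deriv \<psi> x b \<partial>lborel) = - (\<integral>x. (fld \<alpha> (cinv d x) d \<bullet> b) * \<psi> x \<partial>lborel)"
    by (rule LIMSEQ_unique[OF A[unfolded eq] tendsto_minus[OF B]])
qed

lemma convex_integrand_ex: "\<exists>C0. convex_integrand m hh qq W C0"
proof -
  obtain C0 where C0: "\<And>p a. norm (qq p a) \<le> C0 * (1 + norm a)" using qq_bound by blast
  have "convex_integrand m hh qq W C0"
  proof (intro convex_integrand.intro[OF finite_measure_m] convex_integrand_axioms.intro)
    show "W u \<alpha>"
      if "\<And>k::nat. W (us k) (as k)" "\<And>k. us k \<in> L2 m" "u \<in> L2 m" "(\<lambda>k. L2norm m (us k - u)) \<longlonglongrightarrow> 0"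
        "integrable m \<alpha>" "(\<lambda>k. \<integral>x. norm (as k x - \<alpha> x) \<partial>m) \<longlonglongrightarrow> 0" for us as u \<alpha>
      by (rule W_closed[OF that])
    show "AE x in m. \<alpha> x = \<beta> x" if "W u \<alpha>" "W u \<beta>" for u \<alpha> \<beta> by (rule W_unique[OF that])
    show "integrable m \<alpha>" if "W u \<alpha>" for u \<alpha> by (rule W_integrable[OF that])
    show "W (\<lambda>x. u x + c * v x) (\<lambda>x. \<alpha> x + c *\<^sub>R \<beta> x)" if "W u \<alpha>" "W v \<beta>" for u \<alpha> v \<beta> c by (rule W_lin[OF that])
  qed (fact hh_nonneg hh_tangent C0 qq_cont hh_cont W_zero | rule hh_meas qq_meas hh_uniform, assumption)+
  then show ?thesis ..
qed

section \<open>Differentials of smooth functions\<close>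

definition gr :: "('m \<Rightarrow> real) \<Rightarrow> 'm \<Rightarrow> 'e" where
  "gr \<phi> p = gradient_vec (\<phi> \<circ> cinv (chi p)) (cmap (chi p) p)"

lemma smooth_fun_chart: "smooth_fun A \<phi> \<Longrightarrow> c \<in> A \<Longrightarrow> smooth_on (cran c) (\<phi> \<circ> cinv c)"
  by (simp add: smooth_fun_def)

lemma smooth_fun_continuous:
  assumes "smooth_fun A \<phi>" shows "continuous_on UNIV \<phi>"
proof -
  have "isCont \<phi> p" for p
  proof -
    obtain c where c: "c \<in> A" "p \<in> cdom c" using charts_at_ne[of p] by (auto simp: charts_at_iff)
    have "continuous_on (cdom c) (\<lambda>p. (\<phi> \<circ> cinv c) (cmap c p))"
      by (rule continuous_on_compose2[OF smooth_on_imp_continuous_on[OF smooth_fun_chart[OF assms c(1)]] cmap_cont[OF c(1)]]) auto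
    then have "continuous_on (cdom c) \<phi>" by (rule continuous_on_eq) (use c(1) in auto)
    then show ?thesis using c cdom_open[OF c(1)] by (simp add: continuous_on_eq_continuous_at)
  qed
  then show ?thesis by (simp add: continuous_at_imp_continuous_on)
qed

lemma continuous_bounded:
  fixes f :: "'m \<Rightarrow> real"
  assumes "continuous_on UNIV f" obtains B where "\<And>p. \<bar>f p\<bar> \<le> B"
proof -
  have "bounded (range f)" by (rule compact_imp_bounded[OF compact_continuous_image[OF assms compact_M]])
  then obtain B where "\<forall>y\<in>range f. norm y \<le> B" unfolding bounded_iff by blast
  then show ?thesis using that[of B] by simp
qed

lemma continuous_measurable:
  fixes f :: "'m \<Rightarrow> real"
  assumes "continuous_on UNIV f" shows "f \<in> borel_measurable m"
  using borel_measurable_continuous_onI[OF assms] measurable_cong_sets[OF sets_m refl] by blast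

lemma continuous_L2:
  fixes f :: "'m \<Rightarrow> real"
  assumes "continuous_on UNIV f" shows "f \<in> L2 m"
proof -
  obtain B where B: "\<And>p. \<bar>f p\<bar> \<le> B" using continuous_bounded[OF assms] by blast
  have fm: "f \<in> borel_measurable m" by (rule continuous_measurable[OF assms])
  have "integrable m (\<lambda>x. (f x)\<^sup>2)"
  proof (rule integrable_const_bound[of _ "B\<^sup>2"])
    have "(f x)\<^sup>2 \<le> B\<^sup>2" for x using B[of x] abs_ge_zero[of "f x"] by (intro abs_le_square_iff[THEN iffD1]) linarith
    then show "AE x in m. norm ((f x)\<^sup>2) \<le> B\<^sup>2" by simp
  qed (use fm in simp)
  then show ?thesis using fm by (simp add: L2_def)
qed

lemma grad_chart_cont:
  assumes "smooth_fun A \<phi>" "c \<in> A"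
  shows "continuous_on (cran c) (\<lambda>y. gradient_vec (\<phi> \<circ> cinv c) y)"
  unfolding gradient_vec_def
  by (intro continuous_intros smooth_on_imp_continuous_on[OF smooth_on_dir_deriv[OF smooth_fun_chart[OF assms]]])

lemma gr_measurable:
  assumes "smooth_fun A \<phi>" shows "gr \<phi> \<in> borel_measurable m"
proof -
  have "(\<lambda>p. (\<lambda>i p. gradient_vec (\<phi> \<circ> cinv (C i)) (cmap (C i) p)) (idx p) p) \<in> borel_measurable m"
  proof (rule pieces_measurable)
    fix i assume i: "i < N"
    show "(\<lambda>p. indicator (cdom (C i)) p *\<^sub>R gradient_vec (\<phi> \<circ> cinv (C i)) (cmap (C i) p)) \<in> borel_measurable m"
      by (rule pushforward_measurable[OF C_A[OF i]])
        (rule borel_measurable_continuous_on_indicator[OF borel_open[OF cran_open[OF C_A[OF i]]] grad_chart_cont[OF assms C_A[OF i]]])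
  qed
  then show ?thesis by (simp add: gr_def[abs_def] chi_def)
qed

lemma gr_bounded:
  assumes "smooth_fun A \<phi>" shows "\<exists>B. \<forall>p. norm (gr \<phi> p) \<le> B"
proof -
  have "\<exists>B. i < N \<longrightarrow> 0 \<le> B \<and> (\<forall>y\<in>cmap (C i) ` K i. norm (gradient_vec (\<phi> \<circ> cinv (C i)) y) \<le> B)" for i
  proof (cases "i < N")
    case i: True
    have "bounded ((\<lambda>y. gradient_vec (\<phi> \<circ> cinv (C i)) y) ` (cmap (C i) ` K i))"
      by (rule compact_imp_bounded[OF compact_continuous_image[OF continuous_on_subset[OF grad_chart_cont[OF assms C_A[OF i]] cmapK(2)[OF i]] cmapK(1)[OF i]]])
    then obtain B where "\<forall>y\<in>cmap (C i) ` K i. norm (gradient_vec (\<phi> \<circ> cinv (C i)) y) \<le> B" unfolding bounded_iff by blast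
    then have "\<forall>y\<in>cmap (C i) ` K i. norm (gradient_vec (\<phi> \<circ> cinv (C i)) y) \<le> \<bar>B\<bar>"
      by (meson abs_ge_self order_trans)
    then show ?thesis by (intro exI[of _ "\<bar>B\<bar>"]) simp
  qed simp
  from choice[OF allI[OF this]] obtain B
    where B0: "\<forall>i. i < N \<longrightarrow> 0 \<le> B i \<and> (\<forall>y\<in>cmap (C i) ` K i. norm (gradient_vec (\<phi> \<circ> cinv (C i)) y) \<le> B i)" ..
  then have B: "\<And>i. i < N \<Longrightarrow> 0 \<le> B i" "\<And>i y. i < N \<Longrightarrow> y \<in> cmap (C i) ` K i \<Longrightarrow> norm (gradient_vec (\<phi> \<circ> cinv (C i)) y) \<le> B i"
    by blast+
  have "norm (gr \<phi> p) \<le> (\<Sum>i<N. B i)" for p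
  proof -
    have "norm (gr \<phi> p) \<le> B (idx p)" unfolding gr_def chi_def by (rule B(2)[OF idx_less imageI[OF idx_K]])
    also have "\<dots> \<le> (\<Sum>i<N. B i)" by (rule sum_bound[of B, OF B(1)])
    finally show ?thesis .
  qed
  then show ?thesis by blast
qed

lemma fld_gr: "smooth_fun A \<phi> \<Longrightarrow> fld (gr \<phi>) p = differential A \<phi> p"
  unfolding fld_def gr_def by (rule differential_covec[symmetric, OF _ chi_at])

lemma smooth_fun_weak_differential:
  assumes sf: "smooth_fun A \<phi>" shows "is_weak_differential A \<phi> (fld (gr \<phi>))"
  unfolding is_weak_differential_def
proof (intro conjI allI ballI impI)
  show "fld (gr \<phi>) p \<in> cotangent_space A p" for p by (rule fld_cotangent)
  fix c assume c: "c \<in> A"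
  note sm = smooth_fun_chart[OF sf c]
  show "locally_integrable (cran c) (\<lambda>x. \<phi> (cinv c x))"
    unfolding locally_integrable_def set_integrable_def
  proof (intro allI impI)
    fix K' assume K': "compact K' \<and> K' \<subseteq> cran c"
    have "integrable lborel (\<lambda>x. indicator K' x *\<^sub>R (\<phi> \<circ> cinv c) x)"
      by (rule borel_integrable_compact[OF _ continuous_on_subset[OF smooth_on_imp_continuous_on[OF sm]]]) (use K' in auto)
    then show "integrable lborel (\<lambda>x. indicator K' x *\<^sub>R \<phi> (cinv c x))" by (simp add: o_def)
  qed
  fix b :: 'e assume b: "b \<in> Basis"
  have D: "fld (gr \<phi>) (cinv c y) c \<bullet> b = dir_deriv (\<phi> \<circ> cinv c) y b" if y: "y \<in> cran c" for y
  proof -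
    have "fld (gr \<phi>) (cinv c y) c = gradient_vec (\<phi> \<circ> cinv c) y"
      unfolding fld_gr[OF sf] using differential_at[OF sf at_cinv[OF c y]] cmap_cinv[OF c y] by simp
    then show ?thesis
      using gradient_vec_inner[OF differentiable_on_dir_deriv[OF smooth_on_imp_differentiable_on[OF sm] cran_open[OF c] y]] by simp
  qed
  have dc: "continuous_on (cran c) (\<lambda>y. dir_deriv (\<phi> \<circ> cinv c) y b)"
    by (rule smooth_on_imp_continuous_on[OF smooth_on_dir_deriv[OF sm]])
  show "locally_integrable (cran c) (\<lambda>x. fld (gr \<phi>) (cinv c x) c \<bullet> b)"
    unfolding locally_integrable_def set_integrable_def
  proof (intro allI impI)
    fix K' assume K': "compact K' \<and> K' \<subseteq> cran c"
    have "integrable lborel (\<lambda>x. indicator K' x *\<^sub>R dir_deriv (\<phi> \<circ> cinv c) x b)"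
      using borel_integrable_compact continuous_on_subset[OF dc] K' by blast
    moreover have "indicator K' x *\<^sub>R dir_deriv (\<phi> \<circ> cinv c) x b = indicator K' x *\<^sub>R (fld (gr \<phi>) (cinv c x) c \<bullet> b)" for x
    proof (cases "x \<in> K'")
      case True
      then have "x \<in> cran c" using K' by blast
      then show ?thesis by (simp only: D)
    qed simp
    ultimately show "integrable lborel (\<lambda>x. indicator K' x *\<^sub>R (fld (gr \<phi>) (cinv c x) c \<bullet> b))" by (simp only:)
  qed
  fix \<psi> :: "'e \<Rightarrow> real" assume \<psi>: "test_function (cran c) \<psi>"
  then obtain K' where K': "K' \<subseteq> cran c" "\<And>x. x \<notin> K' \<Longrightarrow> \<psi> x = 0" unfolding test_function_def by blast
  have "(\<integral>x. (\<phi> \<circ> cinv c) x * dir_deriv \<psi> x b \<partial>lborel) = - (\<integral>x. dir_deriv (\<phi> \<circ> cinv c) x b * \<psi> x \<partial>lborel)"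
    by (rule integral_by_parts[OF cran_open[OF c] smooth_on_imp_differentiable_on[OF sm] dc \<psi>])
  also have "(\<lambda>x. dir_deriv (\<phi> \<circ> cinv c) x b * \<psi> x) = (\<lambda>x. (fld (gr \<phi>) (cinv c x) c \<bullet> b) * \<psi> x)"
  proof
    fix x show "dir_deriv (\<phi> \<circ> cinv c) x b * \<psi> x = (fld (gr \<phi>) (cinv c x) c \<bullet> b) * \<psi> x"
    proof (cases "x \<in> K'")
      case True
      then have "x \<in> cran c" using K' by blast
      then show ?thesis by (simp only: D)
    qed (simp add: K'(2))
  qed
  finally show "(\<integral>x. \<phi> (cinv c x) * dir_deriv \<psi> x b \<partial>lborel) = - (\<integral>x. (fld (gr \<phi>) (cinv c x) c \<bullet> b) * \<psi> x \<partial>lborel)"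
    by (simp add: o_def)
qed

lemma W_gr: "smooth_fun A \<phi> \<Longrightarrow> W \<phi> (gr \<phi>)"
  unfolding W_def using gr_measurable smooth_fun_weak_differential by blast

section \<open>The energy in terms of the convex integrand\<close>

definition rep :: "('m \<Rightarrow> ('m,'e) covec) \<Rightarrow> 'm \<Rightarrow> 'e" where
  "rep \<eta> p = \<eta> p (chi p)"

lemma fld_rep:
  assumes "\<And>p. \<eta> p \<in> cotangent_space A p" shows "fld (rep \<eta>) = \<eta>"
proof
  fix p show "fld (rep \<eta>) p = \<eta> p"
    unfolding fld_def rep_def by (rule cotangent_space_eq[OF chi_at assms, symmetric])
qed

text \<open>Measurability of the components is not assumed of \<eta>; it follows from their local
  integrability in charts. Cutting off to the compact set K i makes local integrability applicable
  and loses nothing, since every p lies in the set with its own index.\<close>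

lemma W_rep:
  assumes wd: "is_weak_differential A u \<eta>" shows "W u (rep \<eta>)" "fld (rep \<eta>) = \<eta>"
proof -
  show f: "fld (rep \<eta>) = \<eta>" by (rule fld_rep) (use wd in \<open>simp add: is_weak_differential_def\<close>)
  have "(\<lambda>p. (\<lambda>i p. indicator (K i) p *\<^sub>R \<eta> p (C i)) (idx p) p) \<in> borel_measurable m"
  proof (rule pieces_measurable)
    fix i assume i: "i < N"
    note c = C_A[OF i]
    have comp: "(\<lambda>y. indicator (cmap (C i) ` K i) y *\<^sub>R (\<eta> (cinv (C i) y) (C i) \<bullet> b)) \<in> borel_measurable lborel" if b: "b \<in> Basis" for b
      using weak_differential_components(1)[OF wd c b] cmapK[OF i]
      unfolding locally_integrable_def set_integrable_def by (blast intro: borel_measurable_integrable)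
    have "(\<lambda>y. \<Sum>b\<in>Basis. (indicator (cmap (C i) ` K i) y *\<^sub>R (\<eta> (cinv (C i) y) (C i) \<bullet> b)) *\<^sub>R b) \<in> borel_measurable lborel"
      by (intro borel_measurable_sum) (rule borel_measurable_scaleR[OF comp borel_measurable_const])
    moreover have "(\<Sum>b\<in>Basis. (indicator (cmap (C i) ` K i) y *\<^sub>R (\<eta> (cinv (C i) y) (C i) \<bullet> b)) *\<^sub>R b) =
        indicator (cran (C i)) y *\<^sub>R (indicator (cmap (C i) ` K i) y *\<^sub>R \<eta> (cinv (C i) y) (C i))" for y
      using cmapK(2)[OF i] by (cases "y \<in> cmap (C i) ` K i") (auto simp: euclidean_representation)
    ultimately have "(\<lambda>y. indicator (cran (C i)) y *\<^sub>R (indicator (cmap (C i) ` K i) y *\<^sub>R \<eta> (cinv (C i) y) (C i))) \<in> borel_measurable borel"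
      by simp
    from pushforward_measurable[OF c this]
    have "(\<lambda>p. indicator (cdom (C i)) p *\<^sub>R (indicator (cmap (C i) ` K i) (cmap (C i) p) *\<^sub>R \<eta> (cinv (C i) (cmap (C i) p)) (C i))) \<in> borel_measurable m" .
    moreover have "indicator (cdom (C i)) p *\<^sub>R (indicator (cmap (C i) ` K i) (cmap (C i) p) *\<^sub>R \<eta> (cinv (C i) (cmap (C i) p)) (C i)) =
       indicator (cdom (C i)) p *\<^sub>R (indicator (K i) p *\<^sub>R \<eta> p (C i))" for p
    proof (cases "p \<in> cdom (C i)")
      case True
      have "cmap (C i) p \<in> cmap (C i) ` K i \<longleftrightarrow> p \<in> K i"
      proof
        assume "cmap (C i) p \<in> cmap (C i) ` K i"
        then obtain q where q: "q \<in> K i" "cmap (C i) p = cmap (C i) q" by blast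
        then have "cinv (C i) (cmap (C i) p) = cinv (C i) (cmap (C i) q)" by simp
        then show "p \<in> K i" using cinv_cmap[OF c True] cinv_cmap[OF c, of q] q(1) K_sub[OF i] by auto
      qed auto
      then show ?thesis using cinv_cmap[OF c True] by (simp add: indicator_def)
    qed simp
    ultimately show "(\<lambda>p. indicator (cdom (C i)) p *\<^sub>R (\<lambda>i p. indicator (K i) p *\<^sub>R \<eta> p (C i)) i p) \<in> borel_measurable m" by simp
  qed
  then have "rep \<eta> \<in> borel_measurable m" using idx_K by (simp add: rep_def[abs_def] chi_def)
  then show "W u (rep \<eta>)" unfolding W_def f using wd by simp
qed

lemma W_weakly_differentiable: "(\<exists>\<alpha>. W u \<alpha>) \<longleftrightarrow> weakly_differentiable A u"
  unfolding weakly_differentiable_def using W_rep(1) by (auto simp: W_def)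

definition wrep :: "('m \<Rightarrow> real) \<Rightarrow> 'm \<Rightarrow> 'e" where
  "wrep u = rep (weak_differential A u)"

lemma W_wrep:
  assumes "weakly_differentiable A u" shows "W u (wrep u)" "fld (wrep u) = weak_differential A u"
proof -
  have "is_weak_differential A u (weak_differential A u)"
    using assms unfolding weakly_differentiable_def weak_differential_def by (rule someI_ex)
  from W_rep[OF this] show "W u (wrep u)" "fld (wrep u) = weak_differential A u" unfolding wrep_def by auto
qed

lemma hamiltonian_wrep:
  assumes "weakly_differentiable A u"
  shows "hamiltonian A L x (weak_differential A u x) = ereal (hh x (wrep u x))"
proof -
  have "weak_differential A u x = covec_of A (chi x) x (wrep u x)"
    unfolding W_wrep(2)[OF assms, symmetric] fld_def ..
  then show ?thesis using hamiltonian_Hc[OF chi_at] by (simp add: hh_def)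
qed

lemma H1_eq: "H1 A L m = convex_integrand.fin_dom m hh W"
proof -
  obtain C0 where "convex_integrand m hh qq W C0" using convex_integrand_ex by blast
  then interpret convex_integrand m hh qq W C0 .
  show ?thesis
  proof (intro set_eqI iffI)
    fix u assume u: "u \<in> H1 A L m"
    then have wd: "weakly_differentiable A u" by (simp add: H1_def)
    have "integrable m (\<lambda>x. hh x (wrep u x))" using u by (simp add: H1_def hamiltonian_wrep[OF wd])
    then show "u \<in> fin_dom" using domI[OF _ W_wrep(1)[OF wd]] u by (simp add: H1_def)
  next
    fix u assume u: "u \<in> fin_dom"
    obtain \<alpha> where \<alpha>: "W u \<alpha>" "u \<in> L2 m" using u by (rule domE)
    have wd: "weakly_differentiable A u" using \<alpha>(1) W_weakly_differentiable by blast
    have "integrable m (\<lambda>x. hh x (wrep u x))" by (rule dom_integrable[OF u W_wrep(1)[OF wd]])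
    then show "u \<in> H1 A L m" using \<alpha>(2) wd by (simp add: H1_def hamiltonian_wrep[OF wd])
  qed
qed

lemma energy_eq:
  assumes u: "u \<in> H1 A L m" shows "energy A L m u = ereal (convex_integrand.en m hh W u)"
proof -
  obtain C0 where "convex_integrand m hh qq W C0" using convex_integrand_ex by blast
  then interpret convex_integrand m hh qq W C0 .
  have wd: "weakly_differentiable A u" using u by (simp add: H1_def)
  show ?thesis using u by (simp add: energy_def hamiltonian_wrep[OF wd] en_eq[OF W_wrep(1)[OF wd]])
qed

lemma H1_weakly_differentiable: "u \<in> H1 A L m \<Longrightarrow> weakly_differentiable A u"
  by (simp add: H1_def)

lemma dpair_eq:
  assumes sf: "smooth_fun A \<phi>" and wd: "weakly_differentiable A u"
  shows "dpair A L \<phi> u x = qq x (wrep u x) \<bullet> gr \<phi> x"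
proof -
  have 1: "weak_differential A u x = covec_of A (chi x) x (wrep u x)"
    unfolding W_wrep(2)[OF wd, symmetric] fld_def ..
  have 2: "differential A \<phi> x = covec_of A (chi x) x (gr \<phi> x)"
    using fld_gr[OF sf, of x] by (simp add: fld_def)
  show ?thesis
    unfolding dpair_def gradient_field_def 1 2 legendre_Qc[OF chi_at]
    by (simp add: pairing_covec_tvec[OF chi_at] qq_def inner_commute)
qed

section \<open>Smooth functions determine densities\<close>

text \<open>The range of any chart d is covered by two open sets: the image of the overlap with c,
  where the extension is a composition of smooth maps, and the image of the complement of the
  support, where it is 0. The support is closed in the manifold because it is compact and the space
  is Hausdorff.\<close>

lemma extend_test_function:
  assumes c: "c \<in> A" and \<psi>: "test_function (cran c) \<psi>"
  shows "smooth_fun A (\<lambda>p. if p \<in> cdom c then \<psi> (cmap c p) else 0)" (is "smooth_fun A ?\<phi>")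
  unfolding smooth_fun_def
proof
  fix d assume d: "d \<in> A"
  obtain K' where K': "compact K'" "K' \<subseteq> cran c" "\<And>x. x \<notin> K' \<Longrightarrow> \<psi> x = 0" and sm: "smooth_on UNIV \<psi>"
    using \<psi> by (auto simp: test_function_def)
  have Z: "compact (cinv c ` K')" by (rule compact_continuous_image[OF continuous_on_subset[OF cinv_cont[OF c] K'(2)] K'(1)])
  define U1 where "U1 = cmap d ` (cdom d \<inter> cdom c)"
  define U2 where "U2 = cmap d ` (cdom d - cinv c ` K')"
  have U1: "open U1" unfolding U1_def by (rule overlap_open[OF d c])
  have U2: "open U2" unfolding U2_def
    by (rule cmap_open[OF d]) (use cdom_open[OF d] compact_imp_closed[OF Z] in auto)
  have "cinv c ` K' \<subseteq> cdom c" using K'(2) cinv_in[OF c] by blast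
  then have "cran d = U1 \<union> U2" unfolding U1_def U2_def by blast
  moreover have "smooth_on (U1 \<union> U2) (?\<phi> \<circ> cinv d)"
  proof (rule smooth_on_open_cover[OF U1 U2])
    have "smooth_on U1 (\<lambda>y. \<psi> ((cmap c \<circ> cinv d) y))"
      by (rule smooth_on_compose[OF U1 open_UNIV _ sm]) (use trans_smooth[OF d c] in \<open>simp_all add: U1_def o_def\<close>)
    then show "smooth_on U1 (?\<phi> \<circ> cinv d)"
      by (rule smooth_on_cong[OF U1, rotated]) (use d in \<open>auto simp: U1_def\<close>)
    have "smooth_on U2 (\<lambda>y. 0 :: real)" by (simp add: smooth_on_def Ck_on_const)
    then show "smooth_on U2 (?\<phi> \<circ> cinv d)"
    proof (rule smooth_on_cong[OF U2, rotated])
      fix y assume "y \<in> U2"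
      then obtain p where p: "p \<in> cdom d" "p \<notin> cinv c ` K'" "y = cmap d p" unfolding U2_def by blast
      have "\<psi> (cmap c p) = 0" if "p \<in> cdom c"
      proof (rule K'(3), rule notI)
        assume "cmap c p \<in> K'"
        then have "cinv c (cmap c p) \<in> cinv c ` K'" by (rule imageI)
        then show False using p(2) cinv_cmap[OF c that] by simp
      qed
      then show "0 = (?\<phi> \<circ> cinv d) y" using p cinv_cmap[OF d p(1)] by simp
    qed
  qed
  ultimately show "smooth_on (cran d) (?\<phi> \<circ> cinv d)" by simp
qed

text \<open>Test functions of a chart, extended by zero, are admissible. Pulled back to the chart,
  the hypothesis says that f times the density of m is orthogonal to all test functions; that
  density is positive.\<close>

lemma density_zero:
  assumes f: "integrable m f" and z: "\<And>\<phi>. smooth_fun A \<phi> \<Longrightarrow> (\<integral>x. \<phi> x * f x \<partial>m) = 0"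
  shows "AE x in m. f x = 0"
proof -
  have ch: "AE p in m. p \<in> cdom c \<longrightarrow> f p = 0" if c: "c \<in> A" for c
  proof -
    obtain \<rho> where r: "continuous_on (cran c) \<rho>" "\<And>y. y \<in> cran c \<Longrightarrow> \<rho> y > 0"
      and d: "distr (restrict_space m (cdom c)) borel (cmap c) = density lborel (\<lambda>x. ennreal (indicator (cran c) x * \<rho> x))"
      and \<rho>: "(\<lambda>y. indicator (cran c) y * \<rho> y) \<in> borel_measurable borel"
      by (rule chart_density[OF c]) blast
    have fm: "f \<in> borel_measurable m" using f by (rule borel_measurable_integrable)
    have li: "locally_integrable (cran c) (\<lambda>y. f (cinv c y))" by (rule L1_locally_integrable[OF c f])
    have lr: "locally_integrable (cran c) (\<lambda>y. f (cinv c y) * \<rho> y)" unfolding locally_integrable_def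
    proof (intro allI impI)
      fix K' assume K': "compact K' \<and> K' \<subseteq> cran c"
      have "integrable lborel (\<lambda>y. f (cinv c y) * (indicator K' y * \<rho> y))"
        by (rule locally_integrable_mult[OF li, of K'])
          (use K' continuous_on_subset[OF r(1)] in \<open>auto intro!: continuous_on_eq[of K' \<rho>]\<close>)
      then show "set_integrable lborel K' (\<lambda>y. f (cinv c y) * \<rho> y)"
        unfolding set_integrable_def by (simp add: mult_ac)
    qed
    have "AE y in lborel. y \<in> cran c \<longrightarrow> f (cinv c y) * \<rho> y = 0"
    proof (rule fundamental_lemma[OF cran_open[OF c] lr])
      fix \<psi> :: "'e \<Rightarrow> real" assume \<psi>: "test_function (cran c) \<psi>"
      obtain K' where K': "K' \<subseteq> cran c" "\<And>x. x \<notin> K' \<Longrightarrow> \<psi> x = 0" and sm: "smooth_on UNIV \<psi>"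
        using \<psi> unfolding test_function_def by blast
      have \<psi>m: "\<psi> \<in> borel_measurable borel"
        using borel_measurable_continuous_onI[OF smooth_on_imp_continuous_on[OF sm]] .
      let ?F = "\<lambda>y. \<psi> y * (indicator (cran c) y *\<^sub>R f (cinv c y))"
      have Fm: "?F \<in> borel_measurable borel" by (rule borel_measurable_times[OF \<psi>m pullback_measurable[OF c fm]])
      have "0 = (\<integral>p. (if p \<in> cdom c then \<psi> (cmap c p) else 0) * f p \<partial>m)"
        using z[OF extend_test_function[OF c \<psi>]] by simp
      also have "\<dots> = (\<integral>p. indicator (cdom c) p *\<^sub>R ?F (cmap c p) \<partial>m)"
        by (rule Bochner_Integration.integral_cong) (use cinv_cmap[OF c] in auto)
      also have "\<dots> = (\<integral>p. ?F (cmap c p) \<partial>restrict_space m (cdom c))"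
        using cdom_open[OF c] sets_m space_m by (subst integral_restrict_space) auto
      also have "\<dots> = (\<integral>y. ?F y \<partial>distr (restrict_space m (cdom c)) borel (cmap c))"
        by (rule integral_distr[symmetric, OF cmap_measurable[OF c] Fm])
      also have "\<dots> = (\<integral>y. (indicator (cran c) y * \<rho> y) *\<^sub>R ?F y \<partial>lborel)"
        unfolding d
      proof (rule integral_density)
        show "?F \<in> borel_measurable lborel" using Fm by simp
        show "(\<lambda>y. indicator (cran c) y * \<rho> y) \<in> borel_measurable lborel" using \<rho> by simp
        show "AE y in lborel. 0 \<le> indicator (cran c) y * \<rho> y"
          using r(2) by (intro AE_I2) (auto simp: indicator_def less_imp_le)
      qed
      also have "\<dots> = (\<integral>y. f (cinv c y) * \<rho> y * \<psi> y \<partial>lborel)"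
      proof (rule Bochner_Integration.integral_cong[OF refl])
        fix y show "(indicator (cran c) y * \<rho> y) *\<^sub>R ?F y = f (cinv c y) * \<rho> y * \<psi> y"
          using K' by (cases "y \<in> cran c") (auto simp: mult_ac)
      qed
      finally show "(\<integral>y. f (cinv c y) * \<rho> y * \<psi> y \<partial>lborel) = 0" ..
    qed
    then have "AE y in lborel. y \<in> cran c \<longrightarrow> f (cinv c y) = 0"
    proof eventually_elim
      case (elim y)
      then show ?case using r(2)[of y] by auto
    qed
    from AE_transfer[OF c this] show ?thesis
    proof eventually_elim
      case (elim p)
      then show ?case using cinv_cmap[OF c, of p] by simp
    qed
  qed
  have "AE p in m. \<forall>i\<in>{..<N}. p \<in> cdom (C i) \<longrightarrow> f p = 0"
    by (subst AE_ball_countable) (use ch[OF C_A] in \<open>auto simp: countable_finite\<close>)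
  then show ?thesis
  proof eventually_elim
    case (elim p)
    then show ?case using idx_less[of p] chi_dom[of p] unfolding chi_def by blast
  qed
qed

end

section \<open>The slope and the gradient of the energy\<close>

locale heat_energy = heat_cover A L m g N C K idx
  for A :: "('m::{t2_space,second_countable_topology}, 'e::euclidean_space) chart set"
    and L :: "'m \<Rightarrow> ('m, 'e) tvec \<Rightarrow> real" and m g N C K idx +
  fixes C0 :: real
  assumes ci: "convex_integrand m hh qq W C0"
begin

sublocale ci: convex_integrand m hh qq W C0 by (rule ci)
sublocale fl: energy_flow "L2 m" "L2ip m" ci.fin_dom ci.en by (rule ci.energy_flow)

abbreviation "H \<equiv> H1 A L m"
abbreviation "E \<equiv> ci.en"
abbreviation "nrm \<equiv> fl.nrm"

lemma fin_dom_H: "ci.fin_dom = H"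
  by (rule H1_eq[symmetric])

lemma nrm_eq: "L2norm m = nrm"
  by (rule ci.nrm_L2norm[symmetric])

lemma H_L2: "v \<in> H \<Longrightarrow> v \<in> L2 m"
  by (simp add: H1_def)

lemma energy_H: "v \<in> H \<Longrightarrow> energy A L m v = ereal (E v)"
  by (rule energy_eq)

lemma energy_not_H: "v \<notin> H \<Longrightarrow> energy A L m v = \<infinity>"
  by (simp add: energy_def)

lemma eventually_L2_at:
  "eventually P (L2_at m w) \<longleftrightarrow> (\<exists>\<delta>>0. \<forall>z\<in>L2 m. 0 < nrm (z - w) \<longrightarrow> nrm (z - w) < \<delta> \<longrightarrow> P z)"
proof -
  have "eventually P (L2_at m w) \<longleftrightarrow> (\<exists>Q. eventually Q (at_right (0::real)) \<and> (\<forall>z. Q (nrm (z - w)) \<longrightarrow> z \<in> L2 m \<longrightarrow> P z))"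
    unfolding L2_at_def nrm_eq eventually_inf_principal eventually_filtercomap by blast
  also have "\<dots> \<longleftrightarrow> (\<exists>\<delta>>0. \<forall>z\<in>L2 m. 0 < nrm (z - w) \<longrightarrow> nrm (z - w) < \<delta> \<longrightarrow> P z)"
  proof
    assume "\<exists>Q. eventually Q (at_right (0::real)) \<and> (\<forall>z. Q (nrm (z - w)) \<longrightarrow> z \<in> L2 m \<longrightarrow> P z)"
    then obtain Q where Q: "eventually Q (at_right (0::real))" "\<And>z. Q (nrm (z - w)) \<Longrightarrow> z \<in> L2 m \<Longrightarrow> P z" by blast
    obtain \<delta> where "\<delta> > 0" "\<forall>y>0. y < \<delta> \<longrightarrow> Q y" using Q(1) unfolding eventually_at_right_field by blast
    then show "\<exists>\<delta>>0. \<forall>z\<in>L2 m. 0 < nrm (z - w) \<longrightarrow> nrm (z - w) < \<delta> \<longrightarrow> P z" using Q(2) by blast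
  next
    assume "\<exists>\<delta>>0. \<forall>z\<in>L2 m. 0 < nrm (z - w) \<longrightarrow> nrm (z - w) < \<delta> \<longrightarrow> P z"
    then obtain \<delta> where \<delta>: "\<delta> > 0" "\<And>z. z \<in> L2 m \<Longrightarrow> 0 < nrm (z - w) \<Longrightarrow> nrm (z - w) < \<delta> \<Longrightarrow> P z" by blast
    have "eventually (\<lambda>y. 0 < y \<and> y < \<delta>) (at_right (0::real))"
      unfolding eventually_at_right_field using \<delta>(1) by blast
    then show "\<exists>Q. eventually Q (at_right (0::real)) \<and> (\<forall>z. Q (nrm (z - w)) \<longrightarrow> z \<in> L2 m \<longrightarrow> P z)"
      using \<delta>(2) by blast
  qed
  finally show ?thesis .
qed

lemma slope_quotient:
  assumes "u \<in> H" "v \<in> H" "nrm (v - u) > 0"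
  shows "(energy A L m u - energy A L m v) / ereal (nrm (v - u)) = ereal ((E u - E v) / nrm (v - u))"
  using assms by (simp add: energy_H)

definition slope_lim :: "('m \<Rightarrow> real) \<Rightarrow> ereal" where
  "slope_lim u = Limsup (inf (L2_at m u) (principal H)) (\<lambda>v. (energy A L m u - energy A L m v) / ereal (nrm (v - u)))"

lemma slope_eq: "slope A L m u = max (slope_lim u) 0"
  unfolding slope_def slope_lim_def nrm_eq ..

lemma slope_lim_le:
  assumes u: "u \<in> H" and S: "\<And>z. z \<in> H \<Longrightarrow> E u - S * nrm (z - u) \<le> E z"
  shows "slope_lim u \<le> ereal S"
  unfolding slope_lim_def
proof (rule Limsup_bounded)
  have "eventually (\<lambda>v. v \<in> H \<longrightarrow> (energy A L m u - energy A L m v) / ereal (nrm (v - u)) \<le> ereal S) (L2_at m u)"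
    unfolding eventually_L2_at
  proof (intro exI[of _ 1] conjI ballI impI)
    fix v assume v: "0 < nrm (v - u)" "v \<in> H"
    have "(E u - E v) / nrm (v - u) \<le> S" using S[OF v(2)] v(1) by (simp add: field_simps)
    then show "(energy A L m u - energy A L m v) / ereal (nrm (v - u)) \<le> ereal S"
      unfolding slope_quotient[OF u v(2,1)] by simp
  qed simp
  then show "eventually (\<lambda>v. (energy A L m u - energy A L m v) / ereal (nrm (v - u)) \<le> ereal S) (inf (L2_at m u) (principal H))"
    by (simp add: eventually_inf_principal)
qed

lemma slope_lim_frequently:
  assumes c: "c < slope_lim u" and \<delta>: "\<delta> > 0"
  obtains v where "v \<in> H" "0 < nrm (v - u)" "nrm (v - u) < \<delta>" "c < (energy A L m u - energy A L m v) / ereal (nrm (v - u))"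
proof -
  have "\<not> (\<forall>z\<in>L2 m. 0 < nrm (z - u) \<longrightarrow> nrm (z - u) < \<delta> \<longrightarrow> z \<in> H \<longrightarrow> (energy A L m u - energy A L m z) / ereal (nrm (z - u)) \<le> c)"
  proof
    assume "\<forall>z\<in>L2 m. 0 < nrm (z - u) \<longrightarrow> nrm (z - u) < \<delta> \<longrightarrow> z \<in> H \<longrightarrow> (energy A L m u - energy A L m z) / ereal (nrm (z - u)) \<le> c"
    then have "eventually (\<lambda>v. v \<in> H \<longrightarrow> (energy A L m u - energy A L m v) / ereal (nrm (v - u)) \<le> c) (L2_at m u)"
      unfolding eventually_L2_at using \<delta> by blast
    then have "slope_lim u \<le> c" unfolding slope_lim_def by (intro Limsup_bounded) (simp add: eventually_inf_principal)
    then show False using c by simp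
  qed
  then show ?thesis using that by (auto simp: not_le)
qed

text \<open>By convexity the difference quotient along the segment from u to z can only increase
  towards u, so the local slope dominates every global quotient.\<close>

lemma slope_lim_lower:
  assumes u: "u \<in> H" and z: "z \<in> H" "nrm (z - u) > 0"
  shows "ereal ((E u - E z) / nrm (z - u)) \<le> slope_lim u"
proof (rule ccontr)
  define c where "c = (E u - E z) / nrm (z - u)"
  assume "\<not> ?thesis"
  then have "slope_lim u < ereal c" unfolding c_def by simp
  then have "eventually (\<lambda>v. (energy A L m u - energy A L m v) / ereal (nrm (v - u)) < ereal c) (inf (L2_at m u) (principal H))"
    unfolding slope_lim_def by (rule Limsup_lessD)
  then obtain \<delta> where \<delta>: "\<delta> > 0" "\<And>v. v \<in> L2 m \<Longrightarrow> 0 < nrm (v - u) \<Longrightarrow> nrm (v - u) < \<delta> \<Longrightarrow> v \<in> H \<Longrightarrow>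
      (energy A L m u - energy A L m v) / ereal (nrm (v - u)) < ereal c"
    unfolding eventually_inf_principal eventually_L2_at by blast
  define r where "r = nrm (z - u)"
  have r: "r > 0" using z by (simp add: r_def)
  \<comment> \<open>Brings v within \<delta> / 2 of u while staying on the segment to z.\<close>
  define \<tau> where "\<tau> = min 1 (\<delta> / (2 * r))"
  have \<tau>: "0 < \<tau>" "\<tau> \<le> 1" using \<delta>(1) r by (auto simp: \<tau>_def)
  have "\<tau> * r \<le> \<delta> / (2 * r) * r" using r by (intro mult_right_mono) (auto simp: \<tau>_def)
  then have \<tau>r: "\<tau> * r < \<delta>" using r \<delta>(1) by simp
  define v where "v = (1 - \<tau>) *\<^sub>R u + \<tau> *\<^sub>R z"
  have vH: "v \<in> H" unfolding v_def using fl.D_convex[of u z \<tau>] u z \<tau> unfolding fin_dom_H by simp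
  have uz: "u \<in> L2 m" "z \<in> L2 m" using u z H_L2 by auto
  have "v - u = \<tau> *\<^sub>R (z - u)" unfolding v_def by (simp add: algebra_simps)
  then have nv: "nrm (v - u) = \<tau> * r" using uz \<tau> by (simp add: fl.nrm_scale r_def)
  have Ev: "E v \<le> (1 - \<tau>) * E u + \<tau> * E z" unfolding v_def using fl.E_convex[of u z \<tau>] u z \<tau> unfolding fin_dom_H by simp
  have pos: "0 < nrm (v - u)" unfolding nv using \<tau> r by simp
  have "(energy A L m u - energy A L m v) / ereal (nrm (v - u)) < ereal c"
    using \<delta>(2)[OF H_L2[OF vH] pos _ vH] nv \<tau>r by simp
  then have "(E u - E v) / nrm (v - u) < c" unfolding slope_quotient[OF u vH pos] by (simp only: less_ereal.simps(1))
  then have "(E u - E v) / (\<tau> * r) < c" unfolding nv .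
  moreover have "c \<le> (E u - E v) / (\<tau> * r)"
  proof -
    have "\<tau> * (E u - E z) \<le> E u - E v" using Ev by (simp add: algebra_simps)
    then have "\<tau> * (E u - E z) / (\<tau> * r) \<le> (E u - E v) / (\<tau> * r)" using \<tau> r by (intro divide_right_mono) auto
    then show ?thesis using \<tau> by (simp add: c_def r_def)
  qed
  ultimately show False by simp
qed

text \<open>The slope is the norm of some subgradient: being local and global at once it satisfies
  the hypothesis of \<open>slope_bound_subgrad\<close>, which gives a subgradient no longer than the
  slope, and the norm of any subgradient is an upper bound for the slope.\<close>

lemma slope_subgrad:
  assumes u: "u \<in> H" and S: "S \<ge> 0" "\<And>z. z \<in> H \<Longrightarrow> E u - S * nrm (z - u) \<le> E z"
  obtains \<xi> where "fl.subgrad \<xi> u" "slope A L m u = ereal (nrm \<xi>)"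
proof -
  have "slope A L m u \<le> ereal S" unfolding slope_eq using slope_lim_le[OF u S(2)] S(1) by simp
  moreover have "0 \<le> slope A L m u" unfolding slope_eq by simp
  ultimately obtain s where s: "slope A L m u = ereal s" "0 \<le> s"
    by (cases "slope A L m u") auto
  have sv: "E u - s * nrm (z - u) \<le> E z" if z: "z \<in> H" for z
  proof (cases "nrm (z - u) > 0")
    case True
    have "slope_lim u \<le> ereal s" unfolding s(1)[symmetric] slope_eq by (rule max.cobounded1)
    from order_trans[OF slope_lim_lower[OF u z True] this]
    have "(E u - E z) / nrm (z - u) \<le> s" by (simp only: ereal_less_eq(3))
    then show ?thesis using True by (simp add: field_simps)
  next
    case False
    have "0 \<le> nrm (z - u)" using H_L2[OF z] H_L2[OF u] by simp
    then have "nrm (z - u) = 0" using False by simp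
    then show ?thesis using S(2)[OF z] by simp
  qed
  obtain \<xi> where \<xi>: "fl.subgrad \<xi> u" "nrm \<xi> \<le> s"
    using fl.slope_bound_subgrad[of u s] u s(2) sv unfolding fin_dom_H by blast
  have "slope_lim u \<le> ereal (nrm \<xi>)"
    by (rule slope_lim_le[OF u]) (use fl.subgrad_lower[OF \<xi>(1)] in \<open>simp add: fin_dom_H\<close>)
  moreover have "0 \<le> nrm \<xi>" using \<xi>(1) by (simp add: fl.subgrad_def)
  ultimately have "slope A L m u \<le> ereal (nrm \<xi>)" unfolding slope_eq by simp
  then have "s = nrm \<xi>" using \<xi>(2) s(1) by simp
  then show ?thesis using that[OF \<xi>(1)] s(1) by simp
qed

section \<open>Directional derivatives of the energy and the vector of steepest descent\<close>

definition dir_quot :: "('m \<Rightarrow> real) \<Rightarrow> ('m \<Rightarrow> real) \<Rightarrow> real \<Rightarrow> ereal" where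
  "dir_quot u z t = (energy A L m u - energy A L m (\<lambda>x. u x + t * z x)) / ereal (t * nrm z)"

definition dir_slope :: "('m \<Rightarrow> real) \<Rightarrow> ('m \<Rightarrow> real) \<Rightarrow> ereal" where
  "dir_slope u z = Lim (at_right 0) (dir_quot u z)"

lemma line_eq: "(\<lambda>x. u x + t * z x) = u + t *\<^sub>R z" for u z :: "'m \<Rightarrow> real"
  by (simp add: scaleR_fun_def plus_fun_def)

lemma dir_quot_H:
  assumes "u \<in> H" "u + t *\<^sub>R z \<in> H" "t > 0" "nrm z > 0"
  shows "dir_quot u z t = ereal ((E u - E (u + t *\<^sub>R z)) / (t * nrm z))"
  using assms by (simp add: dir_quot_def line_eq energy_H)

lemma dir_quot_not_H:
  assumes "u \<in> H" "u + t *\<^sub>R z \<notin> H" "t > 0" "nrm z > 0"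
  shows "dir_quot u z t = -\<infinity>"
  using assms by (simp add: dir_quot_def line_eq energy_H energy_not_H)

text \<open>Convexity along the ray; leaving the domain makes the quotient -\<infinity>,
  consistently with monotonicity. The inner limit in the definition of the gradient is therefore a
  supremum.\<close>

lemma dir_quot_mono:
  assumes u: "u \<in> H" and z: "z \<in> L2 m" "nrm z > 0" and t: "0 < t" "t \<le> t'"
  shows "dir_quot u z t' \<le> dir_quot u z t"
proof (cases "u + t' *\<^sub>R z \<in> H")
  case True
  define \<tau> where "\<tau> = t / t'"
  have \<tau>: "0 < \<tau>" "\<tau> \<le> 1" "t = \<tau> * t'" using t by (auto simp: \<tau>_def)
  have e: "u + t *\<^sub>R z = (1 - \<tau>) *\<^sub>R u + \<tau> *\<^sub>R (u + t' *\<^sub>R z)" unfolding \<tau>(3) by (simp add: algebra_simps)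
  have tH: "u + t *\<^sub>R z \<in> H" unfolding e using fl.D_convex[of u "u + t' *\<^sub>R z" \<tau>] u True \<tau> unfolding fin_dom_H by simp
  have "E (u + t *\<^sub>R z) \<le> (1 - \<tau>) * E u + \<tau> * E (u + t' *\<^sub>R z)"
    unfolding e using fl.E_convex[of u "u + t' *\<^sub>R z" \<tau>] u True \<tau> unfolding fin_dom_H by simp
  then have "\<tau> * (E u - E (u + t' *\<^sub>R z)) \<le> E u - E (u + t *\<^sub>R z)" by (simp add: algebra_simps)
  then have "\<tau> * (E u - E (u + t' *\<^sub>R z)) / (t * nrm z) \<le> (E u - E (u + t *\<^sub>R z)) / (t * nrm z)"
    using t z by (intro divide_right_mono) auto
  moreover have "\<tau> * (E u - E (u + t' *\<^sub>R z)) / (t * nrm z) = (E u - E (u + t' *\<^sub>R z)) / (t' * nrm z)"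
    unfolding \<tau>(3) using \<tau>(1) by simp
  ultimately show ?thesis using dir_quot_H[OF u True _ z(2)] dir_quot_H[OF u tH t(1) z(2)] t by simp
next
  case False
  then show ?thesis using dir_quot_not_H[OF u False _ z(2)] t by simp
qed

lemma dir_slope_eq:
  assumes u: "u \<in> H" and z: "z \<in> L2 m" "nrm z > 0"
  shows "dir_slope u z = (SUP t\<in>{0<..}. dir_quot u z t)"
  unfolding dir_slope_def
proof (rule tendsto_Lim)
  show "(dir_quot u z \<longlongrightarrow> (SUP t\<in>{0<..}. dir_quot u z t)) (at_right 0)"
  proof (rule order_tendstoI)
    fix a assume "a < (SUP t\<in>{0<..}. dir_quot u z t)"
    then obtain t0 where t0: "t0 > 0" "a < dir_quot u z t0" by (auto simp: less_SUP_iff)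
    have "a < dir_quot u z t" if "0 < t" "t < t0" for t
      using t0(2) dir_quot_mono[OF u z that(1), of t0] that(2) by simp
    then show "\<forall>\<^sub>F t in at_right 0. a < dir_quot u z t"
      unfolding eventually_at_right_field using t0(1) by blast
  next
    fix a assume a: "(SUP t\<in>{0<..}. dir_quot u z t) < a"
    have "dir_quot u z t < a" if "t > 0" for t
      using SUP_upper[of t "{0<..}" "dir_quot u z"] that a by (simp add: le_less_trans)
    then show "\<forall>\<^sub>F t in at_right 0. dir_quot u z t < a"
      unfolding eventually_at_right_field by (intro exI[of _ 1]) simp
  qed
qed simp

lemma dir_slope_le:
  assumes u: "u \<in> H" and \<xi>: "fl.subgrad \<xi> u" and z: "z \<in> L2 m" "nrm z > 0"
  shows "dir_slope u z \<le> ereal (- L2ip m \<xi> z / nrm z)"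
  unfolding dir_slope_eq[OF u z]
proof (rule SUP_least)
  fix t :: real assume "t \<in> {0<..}"
  then have t: "t > 0" by simp
  show "dir_quot u z t \<le> ereal (- L2ip m \<xi> z / nrm z)"
  proof (cases "u + t *\<^sub>R z \<in> H")
    case True
    have "u + t *\<^sub>R z \<in> ci.fin_dom" using True fin_dom_H by simp
    then have "E u + L2ip m \<xi> (u + t *\<^sub>R z - u) \<le> E (u + t *\<^sub>R z)"
      using \<xi> unfolding fl.subgrad_def by blast
    moreover have "L2ip m \<xi> (u + t *\<^sub>R z - u) = t * L2ip m \<xi> z"
      using \<xi> z by (simp add: fl.subgrad_def fl.ip_scale_right)
    ultimately have "E u - E (u + t *\<^sub>R z) \<le> t * (- L2ip m \<xi> z)" by simp
    then have "(E u - E (u + t *\<^sub>R z)) / (t * nrm z) \<le> t * (- L2ip m \<xi> z) / (t * nrm z)"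
      using t z by (intro divide_right_mono) auto
    then show ?thesis using dir_quot_H[OF u True t z(2)] t by simp
  next
    case False then show ?thesis using dir_quot_not_H[OF u False t z(2)] by simp
  qed
qed

text \<open>The parameter t = 1 / r on the ray reaches v itself, where the quotient no longer
  depends on r.\<close>

lemma dir_slope_ge:
  assumes u: "u \<in> H" and v: "v \<in> H" "nrm (v - u) > 0" and r: "r > 0"
  shows "ereal ((E u - E v) / nrm (v - u)) \<le> dir_slope u (r *\<^sub>R (v - u))"
proof -
  have L: "v - u \<in> L2 m" using H_L2 u v(1) by simp
  have z: "r *\<^sub>R (v - u) \<in> L2 m" "nrm (r *\<^sub>R (v - u)) > 0"
    using L r v(2) by (auto simp: fl.nrm_scale)
  have e: "u + (1 / r) *\<^sub>R (r *\<^sub>R (v - u)) = v" using r by simp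
  have "dir_quot u (r *\<^sub>R (v - u)) (1 / r) = ereal ((E u - E v) / nrm (v - u))"
    using dir_quot_H[OF u _ _ z(2), of "1 / r"] r v L unfolding e by (simp add: fl.nrm_scale)
  then show ?thesis unfolding dir_slope_eq[OF u z] using r by (metis SUP_upper greaterThan_iff zero_less_divide_1_iff)
qed

definition is_neg_grad :: "('m \<Rightarrow> real) \<Rightarrow> ('m \<Rightarrow> real) \<Rightarrow> bool" where
  "is_neg_grad u w \<longleftrightarrow> w \<in> L2 m \<and> ereal (nrm w) = slope A L m u \<and> Limsup (L2_at m w) (dir_slope u) = slope A L m u"

lemma grad_neg_energy_eq:
  "grad_neg_energy A L m u = (if slope A L m u = 0 then (\<lambda>_. 0) else (SOME w. is_neg_grad u w))"
  unfolding grad_neg_energy_def is_neg_grad_def dir_slope_def dir_quot_def nrm_eq by simp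

text \<open>The upper bound is Cauchy-Schwarz. For the lower bound no point on the ray of -\<xi>
  need lie in the domain, so an almost optimal competitor v supplies the direction; rescaled to the
  length of \<xi>, it must be close to -\<xi> by almost equality in Cauchy-Schwarz. The
  neighbourhoods are punctured, so a direction at distance exactly 0 has to be moved away.\<close>

lemma neg_subgrad_is_neg_grad:
  assumes u: "u \<in> H" and \<xi>: "fl.subgrad \<xi> u" and s: "slope A L m u = ereal (nrm \<xi>)" and pos: "nrm \<xi> > 0"
  shows "is_neg_grad u (- \<xi>)"
  unfolding is_neg_grad_def
proof (intro conjI)
  have \<xi>V: "\<xi> \<in> L2 m" using \<xi> by (simp add: fl.subgrad_def)
  show "- \<xi> \<in> L2 m" using \<xi>V by simp
  have nm: "nrm (- \<xi>) = nrm \<xi>" using fl.nrm_scale[OF \<xi>V, of "-1"] by simp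
  show "ereal (nrm (- \<xi>)) = slope A L m u" using s nm by simp
  have sl: "slope_lim u = ereal (nrm \<xi>)"
  proof -
    have "max (slope_lim u) 0 = ereal (nrm \<xi>)" using s unfolding slope_eq .
    then show ?thesis using pos by (auto simp: max_def split: if_splits)
  qed
  show "Limsup (L2_at m (- \<xi>)) (dir_slope u) = slope A L m u"
  proof (rule antisym)
    show "Limsup (L2_at m (- \<xi>)) (dir_slope u) \<le> slope A L m u"
    proof (rule Limsup_bounded)
      show "eventually (\<lambda>z. dir_slope u z \<le> slope A L m u) (L2_at m (- \<xi>))"
        unfolding eventually_L2_at
      proof (intro exI[of _ "nrm \<xi>"] conjI ballI impI pos)
        fix z assume z: "z \<in> L2 m" "nrm (z - - \<xi>) < nrm \<xi>"
        have "nrm (- \<xi>) - nrm z \<le> nrm (- \<xi> - z)"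
          using fl.nrm_triangle_reverse[of "- \<xi>" z] \<xi>V z(1) by simp
        also have "\<dots> = nrm (z - - \<xi>)" by (rule fl.nrm_minus_commute) (use \<xi>V z(1) in simp_all)
        finally have nz: "nrm z > 0" using z(2) nm by simp
        have "- L2ip m \<xi> z \<le> nrm \<xi> * nrm z" using fl.Cauchy_Schwarz[OF \<xi>V z(1)] by simp
        then have "- L2ip m \<xi> z / nrm z \<le> nrm \<xi>" using nz by (simp add: field_simps)
        then show "dir_slope u z \<le> slope A L m u"
          using dir_slope_le[OF u \<xi> z(1) nz] unfolding s by (meson ereal_less_eq(3) order_trans)
      qed
    qed
    show "slope A L m u \<le> Limsup (L2_at m (- \<xi>)) (dir_slope u)"
    proof (rule ccontr)
      assume "\<not> slope A L m u \<le> Limsup (L2_at m (- \<xi>)) (dir_slope u)"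
      then have lt: "Limsup (L2_at m (- \<xi>)) (dir_slope u) < ereal (nrm \<xi>)" using s by simp
      obtain c where c: "Limsup (L2_at m (- \<xi>)) (dir_slope u) < ereal c" "c < nrm \<xi>"
        using ereal_dense2[OF lt] by auto
      from Limsup_lessD[OF c(1)] obtain \<delta> where \<delta>: "\<delta> > 0"
        "\<And>z. z \<in> L2 m \<Longrightarrow> 0 < nrm (z - - \<xi>) \<Longrightarrow> nrm (z - - \<xi>) < \<delta> \<Longrightarrow> dir_slope u z < ereal c"
        unfolding eventually_L2_at by blast
      define s' where "s' = nrm \<xi>"
      have s': "s' > 0" using pos by (simp add: s'_def)
      \<comment> \<open>With s' the norm of \<xi>, the rescaled direction will satisfy |z 1 +
        \<xi>|^2 < 2 s' (s' - c'), and this c' makes the right-hand side at most \<delta>^2 /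
        2.\<close>
      define c' where "c' = max c (s' - \<delta>\<^sup>2 / (4 * s'))"
      have c': "c \<le> c'" "c' < s'" "s' - \<delta>\<^sup>2 / (4 * s') \<le> c'" using c(2) s' \<delta>(1) by (auto simp: c'_def s'_def[symmetric])
      have "ereal c' < slope_lim u" using sl c'(2) by (simp add: s'_def)
      then obtain v where v: "v \<in> H" "0 < nrm (v - u)" "ereal c' < (energy A L m u - energy A L m v) / ereal (nrm (v - u))"
        by (rule slope_lim_frequently[OF _ zero_less_one]) blast
      have vc: "c' < (E u - E v) / nrm (v - u)" using v(3) unfolding slope_quotient[OF u v(1,2)] by simp
      have L: "v - u \<in> L2 m" using H_L2 u v(1) by simp
      define z where "z r = (r * s' / nrm (v - u)) *\<^sub>R (v - u)" for r :: real
      have zL: "z r \<in> L2 m" for r unfolding z_def using L by simp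
      have nz: "nrm (z r) = r * s'" if "r > 0" for r
        unfolding z_def using L v(2) s' that by (simp add: fl.nrm_scale)
      have big: "ereal c' < dir_slope u (z r)" if r: "r > 0" for r
      proof -
        have "ereal c' < ereal ((E u - E v) / nrm (v - u))" using vc by simp
        also have "\<dots> \<le> dir_slope u (z r)"
          unfolding z_def by (rule dir_slope_ge[OF u v(1,2)]) (use r s' v(2) in simp)
        finally show ?thesis .
      qed
      have nd: "\<not> (0 < nrm (z r - - \<xi>) \<and> nrm (z r - - \<xi>) < \<delta>)" if r: "r > 0" for r
      proof
        assume "0 < nrm (z r - - \<xi>) \<and> nrm (z r - - \<xi>) < \<delta>"
        then have "dir_slope u (z r) < ereal c" using \<delta>(2)[OF zL] by blast
        with big[OF r] have "ereal c' < ereal c" by (rule less_trans)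
        then show False using c'(1) by simp
      qed
      have "ereal c' < ereal (- L2ip m \<xi> (z 1) / nrm (z 1))"
        using less_le_trans[OF big[of 1] dir_slope_le[OF u \<xi> zL]] nz[of 1] s' by simp
      then have "c' < - L2ip m \<xi> (z 1) / s'" using nz[of 1] by simp
      then have ip: "c' * s' < - L2ip m \<xi> (z 1)" using s' by (simp add: field_simps)
      have "fl.nsq (z 1 - - \<xi>) = fl.nsq (z 1) + 2 * L2ip m \<xi> (z 1) + fl.nsq \<xi>"
        unfolding diff_minus_eq_add fl.nsq_add[OF zL \<xi>V] fl.ip_sym[OF zL \<xi>V] ..
      also have "fl.nsq (z 1) = s'\<^sup>2" using fl.nrm_sq[OF zL, of 1] nz[of 1] by simp
      also have "fl.nsq \<xi> = s'\<^sup>2" using fl.nrm_sq[OF \<xi>V] by (simp add: s'_def)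
      finally have "fl.nsq (z 1 - - \<xi>) < 2 * s'\<^sup>2 - 2 * (c' * s')" using ip by linarith
      also have "\<dots> = 2 * s' * (s' - c')" by (simp add: power2_eq_square algebra_simps)
      also have "\<dots> \<le> 2 * s' * (\<delta>\<^sup>2 / (4 * s'))" using c'(3) s' by (intro mult_left_mono) auto
      also have "\<dots> = \<delta>\<^sup>2 / 2" using s' by simp
      also have "\<dots> \<le> \<delta>\<^sup>2" by simp
      finally have "(nrm (z 1 - - \<xi>))\<^sup>2 < \<delta>\<^sup>2" using fl.nrm_sq[of "z 1 - - \<xi>"] zL \<xi>V by simp
      then have l1: "nrm (z 1 - - \<xi>) < \<delta>" using \<delta>(1) by (simp add: power_less_imp_less_base)
      have z1V: "z 1 - - \<xi> \<in> L2 m" using zL[of 1] \<xi>V by simp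
      have n0: "nrm (z 1 - - \<xi>) = 0" using nd[of 1] l1 fl.nrm_nonneg[OF z1V] by simp
      \<comment> \<open>The remaining case: z 1 equals -\<xi> up to a null set and is excluded from
        the punctured neighbourhood. Stretching it by 1 + k keeps the lower bound on the directional
        slope and moves it to distance k s' = \<delta> / 2.\<close>
      define k where "k = \<delta> / (2 * s')"
      have k: "k > 0" "k * s' < \<delta>" using \<delta>(1) s' by (auto simp: k_def)
      have e: "z (1 + k) - - \<xi> = z k + (z 1 - - \<xi>)"
      proof -
        have c: "(1 + k) * s' / nrm (v - u) = k * s' / nrm (v - u) + 1 * s' / nrm (v - u)"
          by (simp add: distrib_right add_divide_distrib)
        have "z (1 + k) = z k + z 1" unfolding z_def c scaleR_add_left ..
        then show ?thesis by (simp only: add_diff_eq)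
      qed
      have up: "nrm (z (1 + k) - - \<xi>) \<le> nrm (z k) + nrm (z 1 - - \<xi>)"
        unfolding e by (rule fl.nrm_triangle[OF zL z1V])
      have "nrm (z k) \<le> nrm (z (1 + k) - - \<xi>) + nrm (z 1 - - \<xi>)"
      proof -
        have "z k = (z (1 + k) - - \<xi>) - (z 1 - - \<xi>)" unfolding e by simp
        then have zk: "nrm (z k) = nrm ((z (1 + k) - - \<xi>) - (z 1 - - \<xi>))" by simp
        have gen: "nrm (a - b) \<le> nrm a + nrm b" if "a \<in> L2 m" "b \<in> L2 m" for a b
          using fl.nrm_triangle[of a "- b"] fl.nrm_scale[of b "-1"] that by simp
        show ?thesis unfolding zk by (rule gen[OF _ z1V]) (use zL[of "1 + k"] \<xi>V in simp)
      qed
      then have "nrm (z (1 + k) - - \<xi>) = k * s'" using up n0 nz[OF k(1)] by simp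
      then show False using nd[of "1 + k"] k s' by simp
    qed
  qed
qed

text \<open>The subgradient bounds the directional slopes near w by a function continuous at w, so
  the limit superior forces |\<xi>| |w| \<le> -(\<xi>, w). As |w| = |\<xi>|, this gives |w +
  \<xi>|^2 \<le> 0, the equality case of Cauchy-Schwarz.\<close>

lemma is_neg_grad_unique:
  assumes u: "u \<in> H" and \<xi>: "fl.subgrad \<xi> u" and s: "slope A L m u = ereal (nrm \<xi>)" and pos: "nrm \<xi> > 0"
    and w: "is_neg_grad u w"
  shows "nrm (w + \<xi>) = 0"
proof -
  have \<xi>V: "\<xi> \<in> L2 m" using \<xi> by (simp add: fl.subgrad_def)
  have wV: "w \<in> L2 m" and nw: "nrm w = nrm \<xi>" and lw: "Limsup (L2_at m w) (dir_slope u) = ereal (nrm \<xi>)"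
    using w s by (auto simp: is_neg_grad_def)
  have evL: "eventually (\<lambda>z. z \<in> L2 m) (L2_at m w)" unfolding eventually_L2_at by (intro exI[of _ 1]) simp
  have lim0: "((\<lambda>z. nrm (z - w)) \<longlongrightarrow> 0) (L2_at m w)"
  proof (rule tendstoI)
    fix e :: real assume "e > 0"
    then show "eventually (\<lambda>z. dist (nrm (z - w)) 0 < e) (L2_at m w)"
      unfolding eventually_L2_at by (intro exI[of _ e]) simp
  qed
  have limi: "((\<lambda>z. L2ip m \<xi> z) \<longlongrightarrow> L2ip m \<xi> w) (L2_at m w)"
  proof (rule LIM_zero_cancel, rule Lim_null_comparison[OF _ tendsto_mult_right_zero[OF lim0, of "nrm \<xi>"]])
    show "eventually (\<lambda>z. norm (L2ip m \<xi> z - L2ip m \<xi> w) \<le> nrm \<xi> * nrm (z - w)) (L2_at m w)"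
      using evL
    proof eventually_elim
      case (elim z)
      then show ?case using fl.Cauchy_Schwarz[of \<xi> "z - w"] \<xi>V wV by (simp add: fl.ip_diff_right)
    qed
  qed
  have limn: "((\<lambda>z. nrm z) \<longlongrightarrow> nrm w) (L2_at m w)"
  proof (rule LIM_zero_cancel, rule Lim_null_comparison[OF _ lim0])
    show "eventually (\<lambda>z. norm (nrm z - nrm w) \<le> nrm (z - w)) (L2_at m w)"
      using evL by eventually_elim (use fl.nrm_triangle_reverse wV in simp)
  qed
  have lim: "((\<lambda>z. - L2ip m \<xi> z / nrm z) \<longlongrightarrow> - L2ip m \<xi> w / nrm w) (L2_at m w)"
    by (intro tendsto_intros limi limn) (use nw pos in simp)
  have evn: "eventually (\<lambda>z. nrm z > 0) (L2_at m w)" using order_tendstoD(1)[OF limn, of 0] nw pos by simp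
  have "nrm \<xi> \<le> - L2ip m \<xi> w / nrm w"
  proof (rule field_le_epsilon)
    fix e :: real assume e: "e > 0"
    have "eventually (\<lambda>z. - L2ip m \<xi> z / nrm z < - L2ip m \<xi> w / nrm w + e) (L2_at m w)"
      by (rule order_tendstoD(2)[OF lim]) (use e in simp)
    then have "eventually (\<lambda>z. dir_slope u z \<le> ereal (- L2ip m \<xi> w / nrm w + e)) (L2_at m w)"
      using evL evn
    proof eventually_elim
      case (elim z)
      have "dir_slope u z \<le> ereal (- L2ip m \<xi> z / nrm z)" by (rule dir_slope_le[OF u \<xi> elim(2,3)])
      also have "\<dots> \<le> ereal (- L2ip m \<xi> w / nrm w + e)" using elim(1) by simp
      finally show ?case .
    qed
    then have "Limsup (L2_at m w) (dir_slope u) \<le> ereal (- L2ip m \<xi> w / nrm w + e)" by (rule Limsup_bounded)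
    then show "nrm \<xi> \<le> - L2ip m \<xi> w / nrm w + e" unfolding lw by simp
  qed
  then have "nrm \<xi> * nrm \<xi> \<le> - L2ip m \<xi> w" using nw pos by (simp add: field_simps)
  moreover have "fl.nsq (w + \<xi>) = fl.nsq w + 2 * L2ip m \<xi> w + fl.nsq \<xi>"
    using fl.nsq_add[OF wV \<xi>V] fl.ip_sym[OF wV \<xi>V] by simp
  moreover have "fl.nsq w = nrm \<xi> * nrm \<xi>" "fl.nsq \<xi> = nrm \<xi> * nrm \<xi>"
    using fl.nrm_sq[OF wV] fl.nrm_sq[OF \<xi>V] nw by (auto simp: power2_eq_square)
  ultimately have "fl.nsq (w + \<xi>) \<le> 0" by simp
  moreover have "0 \<le> fl.nsq (w + \<xi>)" using wV \<xi>V by simp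
  ultimately show ?thesis by (simp add: fl.nrm_def)
qed

text \<open>If the slope is 0 the gradient is 0 by convention, which agrees with -\<xi> up to a null
  set since |\<xi>| = 0. Otherwise existence and uniqueness of \<open>is_neg_grad\<close> determine
  the choice up to a null set.\<close>

lemma grad_neg_energy_subgrad:
  assumes u: "u \<in> H" and \<xi>: "fl.subgrad \<xi> u" and s: "slope A L m u = ereal (nrm \<xi>)"
  shows "grad_neg_energy A L m u \<in> L2 m" "ereal (nrm (grad_neg_energy A L m u)) = slope A L m u"
    "nrm (grad_neg_energy A L m u + \<xi>) = 0"
proof -
  have \<xi>V: "\<xi> \<in> L2 m" using \<xi> by (simp add: fl.subgrad_def)
  let ?w = "grad_neg_energy A L m u"
  have "?w \<in> L2 m \<and> ereal (nrm ?w) = slope A L m u \<and> nrm (?w + \<xi>) = 0"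
  proof (cases "nrm \<xi> = 0")
    case True
    then have "?w = 0" using s by (simp add: grad_neg_energy_eq zero_fun_def)
    then show ?thesis using True s fl.nsq_zero by (simp add: L2_zero fl.nrm_def)
  next
    case False
    then have pos: "nrm \<xi> > 0" using fl.nrm_nonneg[OF \<xi>V] by simp
    have "slope A L m u \<noteq> 0" using s pos by simp
    then have "?w = (SOME w. is_neg_grad u w)" by (simp add: grad_neg_energy_eq)
    then have w: "is_neg_grad u ?w"
      using someI[of "is_neg_grad u", OF neg_subgrad_is_neg_grad[OF u \<xi> s pos]] by simp
    then show ?thesis using is_neg_grad_unique[OF u \<xi> s pos w] by (simp add: is_neg_grad_def)
  qed
  then show "?w \<in> L2 m" "ereal (nrm ?w) = slope A L m u" "nrm (?w + \<xi>) = 0" by auto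
qed

lemma nrm_zero_AE:
  assumes v: "v \<in> L2 m" and z: "nrm v = 0" shows "AE x in m. v x = 0"
proof -
  have "(\<integral>x. (v x)\<^sup>2 \<partial>m) = 0" using z by (simp add: nrm_eq[symmetric] L2norm_def)
  then have "AE x in m. (v x)\<^sup>2 = 0"
    using v by (subst (asm) integral_nonneg_eq_0_iff_AE) (auto simp: L2_def)
  then show ?thesis by simp
qed

end

section \<open>The gradient curve\<close>

locale heat_curve = heat_energy A L m g N C K idx C0
  for A :: "('m::{t2_space,second_countable_topology}, 'e::euclidean_space) chart set"
    and L :: "'m \<Rightarrow> ('m, 'e) tvec \<Rightarrow> real" and m g N C K idx C0 +
  fixes u0 :: "'m \<Rightarrow> real" and u :: "real \<Rightarrow> 'm \<Rightarrow> real"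
  assumes u0: "u0 \<in> H1 A L m" and curve: "gradient_curve A L m u0 u"
begin

text \<open>\<open>arg_min\<close> is a choice operator and means something only once a minimizer
  exists; on H its extended real objective agrees with the real one of
  \<open>is_min\<close>.\<close>

lemma resolvent_is_min:
  assumes \<delta>: "\<delta> > 0" and v: "v \<in> H"
  shows "fl.is_min \<delta> v (resolvent A L m \<delta> v)"
proof -
  define f where "f z = energy A L m z + ereal ((L2norm m (z - v))\<^sup>2 / (2 * \<delta>))" for z
  have f: "f z = ereal (E z + fl.nsq (z - v) / (2 * \<delta>))" if z: "z \<in> H" for z
    using fl.nrm_sq[of "z - v"] H_L2[OF z] H_L2[OF v] by (simp add: f_def energy_H[OF z] nrm_eq)
  have min_iff: "is_arg_min f (\<lambda>z. z \<in> H) w \<longleftrightarrow> fl.is_min \<delta> v w" for w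
  proof -
    have "f y < f w \<longleftrightarrow> E y + fl.nsq (y - v) / (2 * \<delta>) < E w + fl.nsq (w - v) / (2 * \<delta>)" if "w \<in> H" "y \<in> H" for y
      by (simp only: f[OF that(1)] f[OF that(2)] less_ereal.simps(1))
    then have "is_arg_min f (\<lambda>z. z \<in> H) w \<longleftrightarrow> w \<in> H \<and> (\<forall>z\<in>H. E w + fl.nsq (w - v) / (2 * \<delta>) \<le> E z + fl.nsq (z - v) / (2 * \<delta>))"
      unfolding is_arg_min_def not_less[symmetric] by blast
    also have "\<dots> \<longleftrightarrow> fl.is_min \<delta> v w" unfolding fl.is_min_def by (simp only: fin_dom_H)
    finally show ?thesis .
  qed
  obtain w where "fl.is_min \<delta> v w" using fl.min_exists[OF H_L2[OF v] \<delta>] v fin_dom_H by blast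
  then have "is_arg_min f (\<lambda>z. z \<in> H) w" using min_iff by simp
  then have "is_arg_min f (\<lambda>z. z \<in> H) (arg_min f (\<lambda>z. z \<in> H))"
    unfolding arg_min_def by (rule someI[of "is_arg_min f (\<lambda>z. z \<in> H)" w])
  then show ?thesis unfolding min_iff resolvent_def f_def .
qed

lemma u_H: "t \<ge> 0 \<Longrightarrow> u t \<in> H"
  using curve by (simp add: gradient_curve_def)

lemma evi: "fl.evi_curve u0 u"
proof (rule fl.euler_limit_evi_curve)
  show "fl.resolvent_map (resolvent A L m)"
    unfolding fl.resolvent_map_def using resolvent_is_min fin_dom_H by simp
  show "u0 \<in> ci.fin_dom" using u0 fin_dom_H by simp
  show "u t \<in> L2 m" if "t > 0" for t using H_L2[OF u_H] that by simp
  show "(\<lambda>k. nrm ((resolvent A L m (t / real k) ^^ k) u0 - u t)) \<longlonglongrightarrow> 0" if "t > 0" for t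
    using curve that unfolding gradient_curve_def nrm_eq by blast
qed

lemma xi_ex:
  assumes t: "t > 0"
  shows "\<exists>\<xi>. fl.subgrad \<xi> (u t) \<and> slope A L m (u t) = ereal (nrm \<xi>) \<and> nrm \<xi> \<le> sqrt (2 * E u0 / t)"
proof -
  let ?S = "sqrt (2 * E u0 / t)"
  have S0: "0 \<le> ?S" using ci.en_nonneg[of u0] u0 t fin_dom_H by simp
  have uH: "u t \<in> H" using u_H t by simp
  have sb: "E (u t) - ?S * nrm (z - u t) \<le> E z" if "z \<in> H" for z
    using fl.evi_curve_slope[OF evi t, of z] that fin_dom_H by simp
  obtain \<xi> where \<xi>: "fl.subgrad \<xi> (u t)" "slope A L m (u t) = ereal (nrm \<xi>)"
    using slope_subgrad[OF uH S0 sb] by blast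
  have "slope A L m (u t) \<le> ereal ?S"
    unfolding slope_eq by (rule max.boundedI[OF slope_lim_le[OF uH sb]]) (use S0 in simp_all)
  then have "nrm \<xi> \<le> ?S" unfolding \<xi>(2) by (simp only: ereal_less_eq(3))
  then show ?thesis using \<xi> by blast
qed

text \<open>A subgradient at u t whose norm is the slope, chosen separately for each t; no
  measurability in t is built in.\<close>

definition xi :: "real \<Rightarrow> 'm \<Rightarrow> real" where
  "xi t = (SOME \<xi>. fl.subgrad \<xi> (u t) \<and> slope A L m (u t) = ereal (nrm \<xi>) \<and> nrm \<xi> \<le> sqrt (2 * E u0 / t))"

lemma xi:
  assumes "t > 0"
  shows "fl.subgrad (xi t) (u t)" "slope A L m (u t) = ereal (nrm (xi t))" "nrm (xi t) \<le> sqrt (2 * E u0 / t)"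
    "xi t \<in> L2 m"
  using someI_ex[OF xi_ex[OF assms]] unfolding xi_def[symmetric] by (auto simp: fl.subgrad_def)

lemma smooth_dir_gr:
  assumes "smooth_fun A \<phi>" shows "ci.smooth_dir \<phi> (gr \<phi>)"
  unfolding ci.smooth_dir_def using continuous_L2[OF smooth_fun_continuous[OF assms]] W_gr[OF assms] gr_bounded[OF assms] by blast

text \<open>In the chosen charts d\<phi>(\<nabla>u) is the integrand of the first variation, whose
  integral the subgradient represents.\<close>

lemma dpair_integral:
  assumes sf: "smooth_fun A \<phi>" and t: "t > 0"
  shows "integrable m (dpair A L \<phi> (u t))" "(\<integral>x. dpair A L \<phi> (u t) x \<partial>m) = L2ip m (xi t) \<phi>"
proof -
  have uH: "u t \<in> H" using u_H t by simp
  have wd: "weakly_differentiable A (u t)" by (rule H1_weakly_differentiable[OF uH])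
  have eq: "dpair A L \<phi> (u t) = (\<lambda>x. qq x (wrep (u t) x) \<bullet> gr \<phi> x)"
    using dpair_eq[OF sf wd] by blast
  obtain B where B: "\<And>p. norm (gr \<phi> p) \<le> B" using gr_bounded[OF sf] by blast
  show "integrable m (dpair A L \<phi> (u t))" unfolding eq
    by (rule ci.q_pair_integrable[OF W_integrable[OF W_wrep(1)[OF wd]] gr_measurable[OF sf] B])
  show "(\<integral>x. dpair A L \<phi> (u t) x \<partial>m) = L2ip m (xi t) \<phi>" unfolding eq
    by (rule ci.subgrad_smooth_dir[OF xi(1)[OF t] W_wrep(1)[OF wd] smooth_dir_gr[OF sf], symmetric])
qed

lemma density_grad:
  assumes t: "t > 0"
  shows "has_distr_density A m (laplacian A L m (u t)) (grad_neg_energy A L m (u t))"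
  unfolding has_distr_density_def
proof (intro conjI allI impI)
  let ?w = "grad_neg_energy A L m (u t)"
  have uH: "u t \<in> H" using u_H t by simp
  note w = grad_neg_energy_subgrad[OF uH xi(1,2)[OF t]]
  show "integrable m ?w" by (rule L2_integrable[OF w(1)])
  fix \<phi> assume sf: "smooth_fun A \<phi>"
  have "AE x in m. (?w + xi t) x = 0" by (rule nrm_zero_AE[OF _ w(3)]) (use w(1) xi(4)[OF t] in simp)
  then have ae: "AE x in m. - (xi t x * \<phi> x) = \<phi> x * ?w x"
  proof eventually_elim
    case (elim x)
    then have "?w x = - xi t x" by simp
    then show ?case by simp
  qed
  have \<phi>m: "\<phi> \<in> borel_measurable m" by (rule continuous_measurable[OF smooth_fun_continuous[OF sf]])
  have "laplacian A L m (u t) \<phi> = - L2ip m (xi t) \<phi>" unfolding laplacian_def dpair_integral(2)[OF sf t] ..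
  also have "\<dots> = (\<integral>x. - (xi t x * \<phi> x) \<partial>m)" by (simp add: L2ip_def)
  also have "\<dots> = (\<integral>x. \<phi> x * ?w x \<partial>m)"
    by (rule integral_cong_AE) (use ae \<phi>m w(1) xi(4)[OF t] in \<open>auto simp: L2_def\<close>)
  finally show "laplacian A L m (u t) \<phi> = (\<integral>x. \<phi> x * ?w x \<partial>m)" .
qed

text \<open>\<open>distr_density\<close> is a choice; smooth functions separate integrable
  densities, so any choice agrees almost everywhere with the gradient.\<close>

lemma distr_density_norm:
  assumes t: "t > 0"
  shows "L2norm m (distr_density A m (laplacian A L m (u t))) = L2norm m (grad_neg_energy A L m (u t))"
proof -
  let ?w = "grad_neg_energy A L m (u t)" and ?f = "distr_density A m (laplacian A L m (u t))"
  note w = density_grad[OF t]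
  have f: "has_distr_density A m (laplacian A L m (u t)) ?f"
    unfolding distr_density_def by (rule someI[of _ ?w]) (rule w)
  have wi: "integrable m ?w" and fi: "integrable m ?f" using w f by (auto simp: has_distr_density_def)
  have "AE x in m. ?f x - ?w x = 0"
  proof (rule density_zero)
    show "integrable m (\<lambda>x. ?f x - ?w x)" by (rule Bochner_Integration.integrable_diff[OF fi wi])
    fix \<phi> assume sf: "smooth_fun A \<phi>"
    obtain B where B: "\<And>p. \<bar>\<phi> p\<bar> \<le> B" using continuous_bounded[OF smooth_fun_continuous[OF sf]] by blast
    have \<phi>m: "\<phi> \<in> borel_measurable m" by (rule continuous_measurable[OF smooth_fun_continuous[OF sf]])
    have I: "integrable m (\<lambda>x. \<phi> x * h x)" if h: "integrable m h" for h :: "'m \<Rightarrow> real"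
    proof (rule Bochner_Integration.integrable_bound)
      show "integrable m (\<lambda>x. B * norm (h x))" using h by auto
      show "(\<lambda>x. \<phi> x * h x) \<in> borel_measurable m" using \<phi>m borel_measurable_integrable[OF h] by measurable
      show "AE x in m. norm (\<phi> x * h x) \<le> norm (B * norm (h x))"
      proof (rule AE_I2)
        fix x
        have "\<bar>\<phi> x\<bar> * \<bar>h x\<bar> \<le> B * \<bar>h x\<bar>" using B[of x] by (intro mult_right_mono) auto
        also have "\<dots> \<le> \<bar>B * \<bar>h x\<bar>\<bar>" by (rule abs_ge_self)
        finally show "norm (\<phi> x * h x) \<le> norm (B * norm (h x))" by (simp only: real_norm_def abs_mult)
      qed
    qed
    have "(\<integral>x. \<phi> x * (?f x - ?w x) \<partial>m) = (\<integral>x. \<phi> x * ?f x - \<phi> x * ?w x \<partial>m)" by (simp add: right_diff_distrib)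
    also have "\<dots> = (\<integral>x. \<phi> x * ?f x \<partial>m) - (\<integral>x. \<phi> x * ?w x \<partial>m)"
      by (rule Bochner_Integration.integral_diff[OF I[OF fi] I[OF wi]])
    also have "\<dots> = 0" using w f sf unfolding has_distr_density_def by simp
    finally show "(\<integral>x. \<phi> x * (?f x - ?w x) \<partial>m) = 0" .
  qed
  then have "AE x in m. (?f x)\<^sup>2 = (?w x)\<^sup>2" by eventually_elim simp
  then have "(\<integral>x. (?f x)\<^sup>2 \<partial>m) = (\<integral>x. (?w x)\<^sup>2 \<partial>m)"
    by (intro integral_cong_AE borel_measurable_power borel_measurable_integrable fi wi)
  then show ?thesis by (simp add: L2norm_def)
qed

lemma grad_norm_slope:
  assumes t: "t > 0"
  shows "ereal (L2norm m (grad_neg_energy A L m (u t))) = slope A L m (u t)"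
  using grad_neg_energy_subgrad(2)[OF u_H xi(1,2)[OF t]] t unfolding nrm_eq by simp

lemma u_V: "t > 0 \<Longrightarrow> u t \<in> L2 m"
  using H_L2[OF u_H] by simp

lemma u_lipschitz: "0 < s \<Longrightarrow> s \<le> t \<Longrightarrow> nrm (u t - u s) \<le> 2 * (t - s) * nrm (xi s)"
  by (rule fl.evi_lipschitz[OF evi _ _ xi(1)]) auto

text \<open>The two-sided competitors required by the abstract statement come from the first
  variation of the energy at u t, whose value the subgradient represents.\<close>

lemma u_right_derivative:
  assumes t: "t > 0" and sf: "smooth_fun A \<phi>"
  shows "((\<lambda>h. (L2ip m (u (t + h)) \<phi> - L2ip m (u t) \<phi>) / h) \<longlongrightarrow> - L2ip m (xi t) \<phi>) (at_right 0)"
proof (rule fl.evi_right_derivative[OF evi t xi(1)[OF t]])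
  show "\<phi> \<in> L2 m" by (rule continuous_L2[OF smooth_fun_continuous[OF sf]])
  have uD: "u t \<in> ci.fin_dom" using u_H t fin_dom_H by simp
  have wd: "weakly_differentiable A (u t)" by (rule H1_weakly_differentiable[OF u_H]) (use t in simp)
  have eq: "L2ip m (xi t) \<phi> = (\<integral>x. qq x (wrep (u t) x) \<bullet> gr \<phi> x \<partial>m)"
    by (rule ci.subgrad_smooth_dir[OF xi(1)[OF t] W_wrep(1)[OF wd] smooth_dir_gr[OF sf]])
  show "\<exists>\<epsilon>>0. u t + (\<sigma> * \<epsilon>) *\<^sub>R \<phi> \<in> ci.fin_dom \<and> E (u t + (\<sigma> * \<epsilon>) *\<^sub>R \<phi>) - E (u t) \<le> \<epsilon> * (\<sigma> * L2ip m (xi t) \<phi> + \<eta>)"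
    if "\<sigma> \<in> {1, -1}" "\<eta> > 0" for \<sigma> \<eta> :: real
    unfolding eq by (rule ci.first_variation[OF uD W_wrep(1)[OF wd] smooth_dir_gr[OF sf] that])
qed

lemma nrm_bounded:
  assumes "v \<in> L2 m" "\<And>x. \<bar>v x\<bar> \<le> B" shows "nrm v \<le> B * sqrt (measure m (space m))"
proof -
  have B0: "0 \<le> B" using assms(2)[of undefined] abs_ge_zero order_trans by blast
  have "fl.nsq v \<le> (\<integral>x. B\<^sup>2 \<partial>m)"
    unfolding fl.nsq_def L2ip_def
  proof (rule integral_mono)
    show "integrable m (\<lambda>x. v x * v x)" by (rule L2_mult_integrable[OF assms(1,1)])
    show "v x * v x \<le> B\<^sup>2" for x
      using assms(2)[of x] abs_le_square_iff[of "v x" B] B0 by (simp add: power2_eq_square)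
  qed simp
  also have "\<dots> = B\<^sup>2 * measure m (space m)" by simp
  finally have "nrm v \<le> sqrt (B\<^sup>2 * measure m (space m))" unfolding fl.nrm_def by (rule real_sqrt_le_mono)
  then show ?thesis using B0 by (simp add: real_sqrt_mult)
qed

section \<open>The weak heat equation\<close>

context
  fixes \<phi> :: "real \<Rightarrow> 'm \<Rightarrow> real"
  assumes stf: "spacetime_test_function A \<phi>"
begin

definition dt :: "real \<Rightarrow> 'm \<Rightarrow> real" where "dt t x = deriv (\<lambda>s. \<phi> s x) t"

lemma spacetime_smooth: "c \<in> A \<Longrightarrow> smooth_on ({0<..} \<times> cran c) (\<lambda>(t, y). \<phi> t (cinv c y))"
  using stf by (simp add: spacetime_test_function_def)

lemma spacetime_open: "c \<in> A \<Longrightarrow> open ({0<..} \<times> cran c :: (real \<times> 'e) set)"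
  using cran_open by (intro open_Times) auto

lemma slice_smooth:
  assumes t: "t > 0" shows "smooth_fun A (\<phi> t)"
  unfolding smooth_fun_def
proof
  fix c assume c: "c \<in> A"
  have "smooth_on (cran c) (\<lambda>y. (t, y))"
    unfolding smooth_on_def
  proof
    fix k
    have "Ck_on k (cran c) (\<lambda>y. (t, 0) + (0, y))"
      by (intro Ck_on_add Ck_on_const cran_open[OF c] Ck_on_bounded_linear) (auto intro: bounded_linear_intros)
    then show "Ck_on k (cran c) (\<lambda>y. (t, y))" by simp
  qed
  from smooth_on_compose[OF cran_open[OF c] spacetime_open[OF c] _ spacetime_smooth[OF c] this]
  show "smooth_on (cran c) (\<phi> t \<circ> cinv c)" using t by (auto simp: o_def)
qed

lemma time_derivative_chart:
  assumes c: "c \<in> A" and t: "t > 0" and p: "p \<in> cdom c"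
  shows "((\<lambda>s. \<phi> s p) has_real_derivative dir_deriv (\<lambda>(t, y). \<phi> t (cinv c y)) (t, cmap c p) (1, 0)) (at t)"
proof -
  let ?J = "\<lambda>(t, y). \<phi> t (cinv c y)"
  have j: "(?J has_derivative dir_deriv ?J (t, cmap c p)) (at (t, cmap c p))"
    by (rule differentiable_on_dir_deriv[OF smooth_on_imp_differentiable_on[OF spacetime_smooth[OF c]] spacetime_open[OF c]])
      (use t p in auto)
  have s: "((\<lambda>s. (s, cmap c p)) has_derivative (\<lambda>h. (h, 0))) (at t)" by (auto intro!: derivative_eq_intros)
  have 1: "((\<lambda>s. \<phi> s p) has_derivative (\<lambda>h. dir_deriv ?J (t, cmap c p) (h, 0))) (at t)"
    using has_derivative_compose[OF s j] cinv_cmap[OF c p] by simp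
  have 2: "(\<lambda>h. dir_deriv ?J (t, cmap c p) (h, 0)) = (*) (dir_deriv ?J (t, cmap c p) (1, 0))"
  proof
    fix h
    show "dir_deriv ?J (t, cmap c p) (h, 0) = dir_deriv ?J (t, cmap c p) (1, 0) * h"
      using linear_scale[OF bounded_linear.linear[OF has_derivative_bounded_linear[OF j]], of h "(1, 0)"] by simp
  qed
  show ?thesis unfolding has_field_derivative_def using 1 unfolding 2 .
qed

lemma dt_derivative:
  assumes t: "t > 0" shows "((\<lambda>s. \<phi> s x) has_real_derivative dt t x) (at t)"
proof -
  obtain c where c: "c \<in> A" "x \<in> cdom c" using charts_at_ne[of x] by (auto simp: charts_at_iff)
  note d = time_derivative_chart[OF c(1) t c(2)]
  show ?thesis unfolding dt_def DERIV_imp_deriv[OF d] by (rule d)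
qed

text \<open>Continuity is local, so it may be checked over the open cover by chart domains; this
  serves both \<phi> and its time derivative.\<close>

lemma spacetime_continuous_glue:
  fixes F :: "real \<Rightarrow> 'm \<Rightarrow> real"
  assumes G: "\<And>c. c \<in> A \<Longrightarrow> continuous_on ({0<..} \<times> cran c) (G c)"
    and eq: "\<And>c t p. c \<in> A \<Longrightarrow> t > 0 \<Longrightarrow> p \<in> cdom c \<Longrightarrow> F t p = G c (t, cmap c p)"
  shows "continuous_on ({0<..} \<times> UNIV) (\<lambda>(t, x). F t x)"
proof -
  have "continuous_on (\<Union>c\<in>A. {0<..} \<times> cdom c) (\<lambda>(t, x). F t x)"
  proof (rule continuous_on_open_UN)
    fix c assume c: "c \<in> A"
    show "open ({0<..} \<times> cdom c :: (real \<times> 'm) set)" using cdom_open[OF c] by (intro open_Times) auto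
    have cc: "continuous_on ({0<..} \<times> cdom c) (\<lambda>z::real \<times> 'm. (fst z, cmap c (snd z)))"
      by (intro continuous_on_Pair continuous_on_fst continuous_on_id continuous_on_compose2[OF cmap_cont[OF c]] continuous_on_snd) auto
    have "continuous_on ({0<..} \<times> cdom c) (\<lambda>z. G c (fst z, cmap c (snd z)))"
      by (rule continuous_on_compose2[OF G[OF c] cc]) auto
    then show "continuous_on ({0<..} \<times> cdom c) (\<lambda>(t, x). F t x)"
      by (rule continuous_on_eq) (use eq[OF c] in auto)
  qed
  moreover have "(\<Union>c\<in>A. {0<..} \<times> cdom c) = ({0<..} \<times> UNIV :: (real \<times> 'm) set)" using charts_cover by auto
  ultimately show ?thesis by simp
qed

lemma phi_cont: "continuous_on ({0<..} \<times> UNIV) (\<lambda>(t, x). \<phi> t x)"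
proof (rule spacetime_continuous_glue)
  show "continuous_on ({0<..} \<times> cran c) (\<lambda>(t, y). \<phi> t (cinv c y))" if "c \<in> A" for c
    by (rule smooth_on_imp_continuous_on[OF spacetime_smooth[OF that]])
qed (use cinv_cmap in simp)

lemma dt_cont: "continuous_on ({0<..} \<times> UNIV) (\<lambda>(t, x). dt t x)"
proof (rule spacetime_continuous_glue)
  show "continuous_on ({0<..} \<times> cran c) (\<lambda>z. dir_deriv (\<lambda>(t, y). \<phi> t (cinv c y)) z (1, 0))" if "c \<in> A" for c
    by (rule smooth_on_imp_continuous_on[OF smooth_on_dir_deriv[OF spacetime_smooth[OF that]]])
  show "dt t p = dir_deriv (\<lambda>(t, y). \<phi> t (cinv c y)) (t, cmap c p) (1, 0)" if "c \<in> A" "t > 0" "p \<in> cdom c" for c t p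
    unfolding dt_def by (rule DERIV_imp_deriv[OF time_derivative_chart[OF that]])
qed

lemma slice_cont:
  fixes F :: "real \<Rightarrow> 'm \<Rightarrow> real"
  assumes "continuous_on ({0<..} \<times> UNIV) (\<lambda>(t, x). F t x)" "t > 0" shows "continuous_on UNIV (F t)"
proof -
  have "continuous_on UNIV (\<lambda>x. (\<lambda>(t, x). F t x) (t, x))"
    by (rule continuous_on_compose2[OF assms(1)]) (use assms(2) in \<open>auto intro!: continuous_intros\<close>)
  then show ?thesis by simp
qed

lemma time_support:
  obtains a b where "0 < a" "a \<le> b" "\<And>t x. t > 0 \<Longrightarrow> t < a \<or> b < t \<Longrightarrow> \<phi> t x = 0"
    "\<And>t x. t > 0 \<Longrightarrow> t < a \<or> b < t \<Longrightarrow> dt t x = 0"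
proof -
  obtain S where S: "compact S" "S \<subseteq> {0<..} \<times> UNIV" "\<And>t x. t > 0 \<Longrightarrow> (t, x) \<notin> S \<Longrightarrow> \<phi> t x = 0"
    using stf unfolding spacetime_test_function_def by blast
  have cS: "compact (fst ` S)" by (rule compact_continuous_image[OF continuous_on_fst[OF continuous_on_id] S(1)])
  have "\<exists>a b. 0 < a \<and> a \<le> b \<and> (\<forall>t\<in>fst ` S. a \<le> t \<and> t \<le> b)"
  proof (cases "S = {}")
    case True then show ?thesis by (intro exI[of _ 1]) simp
  next
    case False
    then have ne: "fst ` S \<noteq> {}" by simp
    obtain a where a: "a \<in> fst ` S" "\<forall>t\<in>fst ` S. a \<le> t" using compact_attains_inf[OF cS ne] by blast
    obtain b where b: "b \<in> fst ` S" "\<forall>t\<in>fst ` S. t \<le> b" using compact_attains_sup[OF cS ne] by blast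
    have "0 < a" using a(1) S(2) by auto
    then show ?thesis using a b by blast
  qed
  then obtain a b where ab: "0 < a" "a \<le> b" "\<And>t. t \<in> fst ` S \<Longrightarrow> a \<le> t \<and> t \<le> b" by blast
  have z: "\<phi> t x = 0" if "t > 0" "t < a \<or> b < t" for t x
  proof (rule S(3)[OF that(1)], rule notI)
    assume "(t, x) \<in> S"
    then have "t \<in> fst ` S" by force
    then show False using ab(3) that(2) by force
  qed
  have zd: "dt t x = 0" if t: "t > 0" "t < a \<or> b < t" for t x
  proof -
    define U where "U = {s. s > 0 \<and> (s < a \<or> b < s)}"
    have U: "open U" unfolding U_def by (intro open_Collect_conj open_Collect_disj open_Collect_less continuous_intros)
    have "((\<lambda>s. 0) has_real_derivative 0) (at t)" by simp
    then have "((\<lambda>s. \<phi> s x) has_real_derivative 0) (at t)"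
      by (rule has_field_derivative_transform_within_open[OF _ U]) (use t z in \<open>auto simp: U_def\<close>)
    then show ?thesis unfolding dt_def by (rule DERIV_imp_deriv)
  qed
  show ?thesis by (rule that[OF ab(1,2) z zd])
qed

lemma spacetime_bounded:
  fixes F :: "real \<Rightarrow> 'm \<Rightarrow> real"
  assumes c: "continuous_on ({0<..} \<times> UNIV) (\<lambda>(t, x). F t x)" and ab: "0 < a"
    and z: "\<And>t x. t > 0 \<Longrightarrow> t < a \<or> b < t \<Longrightarrow> F t x = 0"
  obtains B where "B \<ge> 0" "\<And>t x. t > 0 \<Longrightarrow> \<bar>F t x\<bar> \<le> B"
proof -
  have "compact ((\<lambda>(t, x). F t x) ` ({a..b} \<times> UNIV))"
    by (rule compact_continuous_image[OF continuous_on_subset[OF c] compact_Times[OF compact_Icc compact_M]]) (use ab in auto)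
  from compact_imp_bounded[OF this]
  obtain B where B: "\<And>y. y \<in> (\<lambda>(t, x). F t x) ` ({a..b} \<times> UNIV) \<Longrightarrow> norm y \<le> B"
    by (auto simp only: bounded_iff)
  have "\<bar>F t x\<bar> \<le> \<bar>B\<bar>" if t: "t > 0" for t x
  proof (cases "t \<in> {a..b}")
    case True
    then have "F t x \<in> (\<lambda>(t, x). F t x) ` ({a..b} \<times> UNIV)"
      by (intro image_eqI[where x="(t, x)"]) auto
    from B[OF this] show ?thesis by simp
  next
    case False
    then have "F t x = 0" using z[OF t] by auto
    then show ?thesis by simp
  qed
  then show ?thesis by (rule that[of "\<bar>B\<bar>", OF abs_ge_zero])
qed

text \<open>The function f t = (u t, \<phi> t) is Lipschitz with compact support in time, and its
  right difference quotients converge everywhere to (u, \<partial>\<phi>) - (\<xi>, \<phi>). They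
  all integrate to 0, so dominated convergence gives the equation. Only right derivatives enter, so
  one-sided differentiability of the curve is enough.\<close>

lemma weak_heat:
  "(\<forall>t>0. integrable m (\<lambda>x. dt t x * u t x)) \<and>
   (\<forall>t>0. integrable m (dpair A L (\<phi> t) (u t))) \<and>
   set_integrable lborel {0<..} (\<lambda>t. \<integral>x. dt t x * u t x \<partial>m) \<and>
   set_integrable lborel {0<..} (\<lambda>t. \<integral>x. dpair A L (\<phi> t) (u t) x \<partial>m) \<and>
   (LINT t:{0<..}|lborel. (\<integral>x. dt t x * u t x \<partial>m)) = (LINT t:{0<..}|lborel. (\<integral>x. dpair A L (\<phi> t) (u t) x \<partial>m))"
proof -
  obtain a b where ab: "0 < a" "a \<le> b" and z\<phi>: "\<And>t x. t > 0 \<Longrightarrow> t < a \<or> b < t \<Longrightarrow> \<phi> t x = 0"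
    and zdt: "\<And>t x. t > 0 \<Longrightarrow> t < a \<or> b < t \<Longrightarrow> dt t x = 0"
    by (rule time_support) blast
  obtain B1 where B1: "B1 \<ge> 0" "\<And>t x. t > 0 \<Longrightarrow> \<bar>\<phi> t x\<bar> \<le> B1"
    using spacetime_bounded[OF phi_cont ab(1) z\<phi>] by blast
  obtain B2 where B2: "B2 \<ge> 0" "\<And>t x. t > 0 \<Longrightarrow> \<bar>dt t x\<bar> \<le> B2"
    using spacetime_bounded[OF dt_cont ab(1) zdt] by blast
  define M where "M = sqrt (measure m (space m))"
  have M0: "M \<ge> 0" by (simp add: M_def)
  have \<phi>V: "\<phi> t \<in> L2 m" and dV: "dt t \<in> L2 m" if "t > 0" for t
    using continuous_L2 slice_cont[OF phi_cont that] slice_cont[OF dt_cont that] by auto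
  have n\<phi>: "nrm (\<phi> t) \<le> B1 * M" if t: "t > 0" for t
    unfolding M_def by (rule nrm_bounded[OF \<phi>V[OF t] B1(2)[OF t]])
  have lip\<phi>: "\<bar>\<phi> (t + h) x - \<phi> t x\<bar> \<le> B2 * h" if t: "t > 0" and h: "h > 0" for t h x
  proof -
    obtain s where s: "t < s" "s < t + h" "\<phi> (t + h) x - \<phi> t x = (t + h - t) * dt s x"
      using MVT2[of t "t + h" "\<lambda>s. \<phi> s x" "\<lambda>s. dt s x"] dt_derivative t h by force
    have "\<bar>\<phi> (t + h) x - \<phi> t x\<bar> = h * \<bar>dt s x\<bar>" unfolding s(3) using h by (simp add: abs_mult)
    also have "\<dots> \<le> h * B2" using B2(2)[of s x] s(1) t h by (intro mult_left_mono) auto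
    finally show ?thesis by (simp add: mult.commute)
  qed
  have nlip: "nrm (\<phi> (t + h) - \<phi> t) \<le> B2 * h * M" if t: "t > 0" and h: "h > 0" for t h
    unfolding M_def by (rule nrm_bounded) (use \<phi>V[of t] \<phi>V[of "t + h"] t h lip\<phi>[OF t h] in auto)
  define f where "f t = (if t > 0 then L2ip m (u t) (\<phi> t) else 0)" for t
  have fz: "f t = 0" if "t < a \<or> b < t" for t
    using z\<phi>[of t] that by (auto simp: f_def L2ip_def)
  \<comment> \<open>The support of \<phi> begins at a, and quotients with shifts up to a / 2 reach
    back no further than a / 2. From that time on sqrt (2 E(u0) / t) bounds all slopes by S0, hence
    also the Lipschitz constant of u by 2 S0.\<close>
  define S0 where "S0 = sqrt (2 * E u0 / (a / 2))"
  have S0: "S0 \<ge> 0" unfolding S0_def using ci.en_nonneg[of u0] u0 fin_dom_H ab(1) by simp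
  have xiS: "nrm (xi t) \<le> S0" if "t \<ge> a / 2" for t
  proof -
    have t: "t > 0" using that ab(1) by linarith
    have "2 * E u0 / t \<le> 2 * E u0 / (a / 2)"
      using that ab(1) ci.en_nonneg[of u0] u0 fin_dom_H by (intro divide_left_mono) auto
    then show ?thesis unfolding S0_def using xi(3)[OF t] by (meson order_trans real_sqrt_le_mono)
  qed
  define U0 where "U0 = nrm (u (a / 2)) + 2 * (b + 1) * S0"
  have U0b: "nrm (u t) \<le> U0" if t: "a / 2 \<le> t" "t \<le> b + 1" for t
  proof -
    have a2: "a / 2 > 0" using ab(1) by simp
    have V: "u t \<in> L2 m" "u (a / 2) \<in> L2 m" using u_V a2 t by auto
    have "nrm (u t) \<le> nrm (u t - u (a / 2)) + nrm (u (a / 2))"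
      using fl.nrm_triangle[of "u t - u (a / 2)" "u (a / 2)"] V by simp
    also have "nrm (u t - u (a / 2)) \<le> 2 * (t - a / 2) * nrm (xi (a / 2))" by (rule u_lipschitz[OF a2 t(1)])
    also have "\<dots> \<le> 2 * (b + 1) * S0"
      using t ab xiS[of "a / 2"] xi(4)[OF a2] by (intro mult_mono) auto
    finally show ?thesis by (simp add: U0_def)
  qed
  define Cc where "Cc = U0 * (B2 * M) + 2 * S0 * (B1 * M)"
  have a2: "a / 2 > 0" using ab(1) by simp
  have U00: "U0 \<ge> 0"
  proof -
    have "0 \<le> nrm (u (a / 2))" using u_V[OF a2] by simp
    then show ?thesis unfolding U0_def using ab S0 by simp
  qed
  have Cc0: "Cc \<ge> 0" unfolding Cc_def using U00 B1(1) B2(1) M0 S0 by simp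
  \<comment> \<open>For t in [a / 2, b] and h \<le> h0 the time t + h stays in [a / 2, b + 1], where
    S0 and U0 are valid; for t < a / 2 it stays below a, so both values of f vanish.\<close>
  define h0 where "h0 = min (a / 2) 1"
  have h0: "h0 > 0" "h0 \<le> a / 2" "h0 \<le> 1" using ab by (auto simp: h0_def)
  have flip: "\<bar>f (t + h) - f t\<bar> \<le> Cc * h * indicator {0..b} t" if h: "0 < h" "h \<le> h0" for t h
  proof (cases "t < a / 2 \<or> b < t")
    case True
    then have "f t = 0" "f (t + h) = 0" using fz h h0 ab by auto
    then show ?thesis using Cc0 h by simp
  next
    case False
    then have t: "a / 2 \<le> t" "t \<le> b" "t > 0" "t + h > 0" using ab(1) h by auto
    have V: "u t \<in> L2 m" "u (t + h) \<in> L2 m" "\<phi> t \<in> L2 m" "\<phi> (t + h) \<in> L2 m" using u_V \<phi>V t by auto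
    have "f (t + h) - f t = L2ip m (u (t + h)) (\<phi> (t + h) - \<phi> t) + L2ip m (u (t + h) - u t) (\<phi> t)"
      using t V by (simp add: f_def fl.ip_simps)
    moreover have "\<bar>L2ip m (u (t + h)) (\<phi> (t + h) - \<phi> t)\<bar> \<le> U0 * (B2 * h * M)"
    proof -
      have "\<bar>L2ip m (u (t + h)) (\<phi> (t + h) - \<phi> t)\<bar> \<le> nrm (u (t + h)) * nrm (\<phi> (t + h) - \<phi> t)"
        by (rule fl.Cauchy_Schwarz) (use V in auto)
      also have "\<dots> \<le> U0 * (B2 * h * M)"
        by (intro mult_mono U0b nlip U00) (use t h h0 V in auto)
      finally show ?thesis .
    qed
    moreover have "\<bar>L2ip m (u (t + h) - u t) (\<phi> t)\<bar> \<le> (2 * h * S0) * (B1 * M)"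
    proof -
      have "nrm (u (t + h) - u t) \<le> 2 * h * nrm (xi t)" using u_lipschitz[of t "t + h"] t h by simp
      also have "\<dots> \<le> 2 * h * S0" using xiS[OF t(1)] h by (intro mult_left_mono) auto
      finally have 1: "nrm (u (t + h) - u t) \<le> 2 * h * S0" .
      have "\<bar>L2ip m (u (t + h) - u t) (\<phi> t)\<bar> \<le> nrm (u (t + h) - u t) * nrm (\<phi> t)"
        by (rule fl.Cauchy_Schwarz) (use V in auto)
      also have "\<dots> \<le> (2 * h * S0) * (B1 * M)"
        by (intro mult_mono 1 n\<phi>) (use t h S0 V in auto)
      finally show ?thesis .
    qed
    ultimately have "\<bar>f (t + h) - f t\<bar> \<le> U0 * (B2 * h * M) + (2 * h * S0) * (B1 * M)" by linarith
    also have "\<dots> = Cc * h" unfolding Cc_def by (simp add: algebra_simps)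
    finally show ?thesis using t by simp
  qed
  have fcont: "continuous_on UNIV f"
  proof -
    have "isCont f t" for t
    proof -
      have "f \<midarrow>t\<rightarrow> f t"
      proof (rule LIM_I)
        fix r :: real assume r: "r > 0"
        define s where "s = min h0 (r / (Cc + 1))"
        have s: "s > 0" "s \<le> h0" unfolding s_def using h0 r Cc0 by auto
        have small: "Cc * h < r" if "0 < h" "h < s" for h
        proof -
          have "Cc * h \<le> (Cc + 1) * h" using that by simp
          also have "\<dots> < (Cc + 1) * (r / (Cc + 1))" using that Cc0 unfolding s_def by (intro mult_strict_left_mono) auto
          also have "\<dots> = r" using Cc0 by simp
          finally show ?thesis .
        qed
        have step: "\<bar>f (x + h) - f x\<bar> < r" if h: "0 < h" "h < s" for x h
        proof -
          have "\<bar>f (x + h) - f x\<bar> \<le> Cc * h * indicator {0..b} x" using flip[of h x] h s by simp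
          also have "\<dots> \<le> Cc * h" using Cc0 h by (simp add: indicator_def)
          finally show ?thesis using small[OF h] by simp
        qed
        show "\<exists>s>0. \<forall>x. x \<noteq> t \<and> norm (x - t) < s \<longrightarrow> norm (f x - f t) < r"
        proof (intro exI[of _ s] conjI allI impI s(1))
          fix x assume x: "x \<noteq> t \<and> norm (x - t) < s"
          show "norm (f x - f t) < r"
          proof (cases "t < x")
            case True then show ?thesis using step[of "x - t" t] x by simp
          next
            case False then show ?thesis using step[of "t - x" x] x by (simp add: abs_minus_commute)
          qed
        qed
      qed
      then show ?thesis by (simp add: isCont_def)
    qed
    then show ?thesis by (simp add: continuous_at_imp_continuous_on)
  qed
  have fi: "integrable lborel f"
    by (rule integrable_compact_support[OF compact_Icc[of 0 b] continuous_on_subset[OF fcont]])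
      (use fz ab in auto)
  define e where "e n = h0 / real (Suc n)" for n
  have e: "0 < e n" "e n \<le> h0" for n using h0 by (auto simp: e_def field_simps)
  have el: "e \<longlonglongrightarrow> 0" unfolding e_def by (rule LIMSEQ_Suc[OF lim_const_over_n])
  have er: "filterlim e (at_right 0) sequentially"
    unfolding filterlim_at using el e(1)[THEN less_imp_neq] e(1) by (auto intro!: always_eventually)
  \<comment> \<open>The pointwise limit of the difference quotients. Its measurability is inherited
    from theirs, which avoids any question about how xi depends on t.\<close>
  define G where "G t = (if t > 0 then L2ip m (u t) (dt t) - L2ip m (xi t) (\<phi> t) else 0)" for t
  have Dlim: "(\<lambda>n. (f (t + e n) - f t) / e n) \<longlonglongrightarrow> G t" for t
  proof (cases "t > 0")
    case False
    have "f (t + e n) = 0" "f t = 0" for n using fz[of "t + e n"] fz[of t] e[of n] h0 ab False by auto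
    then show ?thesis using False by (simp add: G_def)
  next
    case t: True
    have V: "u t \<in> L2 m" "\<phi> t \<in> L2 m" and Vn: "u (t + e n) \<in> L2 m" "\<phi> (t + e n) \<in> L2 m" for n
      using u_V \<phi>V t e(1)[of n] by auto
    define q where "q n x = (\<phi> (t + e n) x - \<phi> t x) / e n" for n x
    have qe: "q n = (1 / e n) *\<^sub>R (\<phi> (t + e n) - \<phi> t)" for n by (simp add: q_def fun_eq_iff)
    have qV: "q n \<in> L2 m" for n unfolding qe using V Vn by simp
    have qb: "\<bar>q n x\<bar> \<le> B2" for n x
      unfolding q_def using lip\<phi>[OF t e(1)[of n], of x] e(1)[of n] by (simp add: abs_divide field_simps)
    have ql: "(\<lambda>n. q n x) \<longlonglongrightarrow> dt t x" for x
    proof -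
      have "((\<lambda>h. (\<phi> (t + h) x - \<phi> t x) / h) \<longlongrightarrow> dt t x) (at 0)" using dt_derivative[OF t, of x] by (simp add: DERIV_def)
      then have "((\<lambda>h. (\<phi> (t + h) x - \<phi> t x) / h) \<longlongrightarrow> dt t x) (at_right 0)" by (rule tendsto_within_subset) simp
      from filterlim_compose[OF this er] show ?thesis by (simp add: q_def)
    qed
    \<comment> \<open>A discrete product rule. The first summand vanishes in the limit by the
      Lipschitz bound of u, the second converges because the quotients of \<phi> do so boundedly,
      and the third is the right difference quotient of u against the fixed function \<phi>
      t.\<close>
    have split: "(f (t + e n) - f t) / e n = L2ip m (u (t + e n) - u t) (q n) + L2ip m (u t) (q n) + (L2ip m (u (t + e n)) (\<phi> t) - L2ip m (u t) (\<phi> t)) / e n" for n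
    proof -
      have "L2ip m (u (t + e n) - u t) (q n) + L2ip m (u t) (q n) = L2ip m (u (t + e n)) (q n)"
        using V Vn[of n] qV[of n] by (simp add: fl.ip_simps)
      also have "\<dots> = (L2ip m (u (t + e n)) (\<phi> (t + e n)) - L2ip m (u (t + e n)) (\<phi> t)) / e n"
        unfolding qe using V Vn[of n] by (simp add: fl.ip_simps)
      finally show ?thesis using t e(1)[of n] by (simp add: f_def diff_divide_distrib)
    qed
    have l1: "(\<lambda>n. L2ip m (u (t + e n) - u t) (q n)) \<longlonglongrightarrow> 0"
    proof (rule Lim_null_comparison)
      show "\<forall>\<^sub>F n in sequentially. norm (L2ip m (u (t + e n) - u t) (q n)) \<le> (2 * e n * nrm (xi t)) * (B2 * M)"
      proof (intro always_eventually allI)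
        fix n
        have "norm (L2ip m (u (t + e n) - u t) (q n)) \<le> nrm (u (t + e n) - u t) * nrm (q n)"
          using fl.Cauchy_Schwarz[of "u (t + e n) - u t" "q n"] V Vn[of n] qV[of n] by simp
        also have "\<dots> \<le> (2 * e n * nrm (xi t)) * (B2 * M)"
        proof (intro mult_mono)
          show "nrm (u (t + e n) - u t) \<le> 2 * e n * nrm (xi t)" using u_lipschitz[of t "t + e n"] t e(1)[of n] by simp
          show "nrm (q n) \<le> B2 * M" unfolding M_def by (rule nrm_bounded[OF qV qb])
        qed (use e(1)[of n] xi(4)[OF t] qV in auto)
        finally show "norm (L2ip m (u (t + e n) - u t) (q n)) \<le> (2 * e n * nrm (xi t)) * (B2 * M)" .
      qed
      have "(\<lambda>n. (2 * e n * nrm (xi t)) * (B2 * M)) \<longlonglongrightarrow> (2 * 0 * nrm (xi t)) * (B2 * M)" by (intro tendsto_intros el)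
      then show "(\<lambda>n. (2 * e n * nrm (xi t)) * (B2 * M)) \<longlonglongrightarrow> 0" by simp
    qed
    have l2: "(\<lambda>n. L2ip m (u t) (q n)) \<longlonglongrightarrow> L2ip m (u t) (dt t)"
      unfolding L2ip_def
    proof (rule integral_dominated_convergence[where w="\<lambda>x. norm (u t x) * B2"])
      show "(\<lambda>x. u t x * dt t x) \<in> borel_measurable m" using L2_mult_integrable[OF V(1) dV[OF t]] by (rule borel_measurable_integrable)
      show "(\<lambda>x. u t x * q n x) \<in> borel_measurable m" for n using L2_mult_integrable[OF V(1) qV[of n]] by (rule borel_measurable_integrable)
      show "integrable m (\<lambda>x. norm (u t x) * B2)" using L2_integrable[OF V(1)] by auto
      show "AE x in m. (\<lambda>n. u t x * q n x) \<longlonglongrightarrow> u t x * dt t x" by (intro AE_I2 tendsto_mult tendsto_const ql)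
      show "AE x in m. norm (u t x * q n x) \<le> norm (u t x) * B2" for n
        using qb by (intro AE_I2) (simp add: abs_mult mult_left_mono)
    qed
    have l3: "(\<lambda>n. (L2ip m (u (t + e n)) (\<phi> t) - L2ip m (u t) (\<phi> t)) / e n) \<longlonglongrightarrow> - L2ip m (xi t) (\<phi> t)"
      by (rule filterlim_compose[OF u_right_derivative[OF t slice_smooth[OF t]] er])
    have "(\<lambda>n. L2ip m (u (t + e n) - u t) (q n) + L2ip m (u t) (q n) + (L2ip m (u (t + e n)) (\<phi> t) - L2ip m (u t) (\<phi> t)) / e n)
      \<longlonglongrightarrow> 0 + L2ip m (u t) (dt t) + - L2ip m (xi t) (\<phi> t)"
      by (intro tendsto_add l1 l2 l3)
    then show ?thesis unfolding split using t by (simp add: G_def)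
  qed
  \<comment> \<open>Translation invariance in time: this is where the boundary terms of an
    integration by parts disappear, since f vanishes outside a compact set of positive
    times.\<close>
  have ti: "integrable lborel (\<lambda>t. f (t + h))" "(\<integral>t. f (t + h) \<partial>lborel) = (\<integral>t. f t \<partial>lborel)" for h
    using lborel_integrable_real_affine[OF fi, of 1 h] lborel_integral_real_affine[of 1 f h] by (auto simp: add.commute)
  have D0: "(\<integral>t. (f (t + e n) - f t) / e n \<partial>lborel) = 0" for n
    using ti[of "e n"] fi by simp
  have "integrable lborel (indicator {0..b} :: real \<Rightarrow> real)" by (rule integrable_real_indicator) (auto simp: emeasure_lborel_Icc_eq)
  then have wI: "integrable lborel (\<lambda>t. Cc * indicator {0..b} t :: real)" by simp
  have Dm: "(\<lambda>t. (f (t + e n) - f t) / e n) \<in> borel_measurable lborel" for n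
    using borel_measurable_integrable[OF ti(1)[of "e n"]] borel_measurable_integrable[OF fi] by simp
  have Gm: "G \<in> borel_measurable lborel" by (rule borel_measurable_LIMSEQ_real[OF Dlim Dm])
  have Db: "AE t in lborel. norm ((f (t + e n) - f t) / e n) \<le> Cc * indicator {0..b} t" for n
  proof (rule AE_I2)
    fix t
    show "norm ((f (t + e n) - f t) / e n) \<le> Cc * indicator {0..b} t"
      using flip[OF e, of t n] e(1)[of n] by (simp add: abs_divide field_simps)
  qed
  have DlimAE: "AE t in lborel. (\<lambda>n. (f (t + e n) - f t) / e n) \<longlonglongrightarrow> G t" using Dlim by simp
  have Gi: "integrable lborel G" by (rule integrable_dominated_convergence[OF Gm Dm wI DlimAE Db])
  have "(\<lambda>n. \<integral>t. (f (t + e n) - f t) / e n \<partial>lborel) \<longlonglongrightarrow> (\<integral>t. G t \<partial>lborel)"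
    by (rule integral_dominated_convergence[OF Gm Dm wI DlimAE Db])
  then have "(\<lambda>n. 0::real) \<longlonglongrightarrow> (\<integral>t. G t \<partial>lborel)" unfolding D0 .
  then have G0: "(\<integral>t. G t \<partial>lborel) = 0" using LIMSEQ_unique tendsto_const by blast
  \<comment> \<open>g1 is integrable because it is continuous on [a, b] and zero elsewhere. Then g2
    = g1 - G shows that the pairing with xi is integrable, and the equation says that G integrates
    to 0.\<close>
  define g1 where "g1 t = (if t > 0 then L2ip m (u t) (dt t) else 0)" for t
  have g1z: "g1 t = 0" if "t \<notin> {a..b}" for t
    using zdt[of t] that by (auto simp: g1_def L2ip_def)
  have g1i: "integrable lborel g1"
  proof (rule integrable_compact_support[OF compact_Icc[of a b] _ g1z])
    show "continuous_on {a..b} g1"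
      unfolding continuous_on_sequentially
    proof (intro allI ballI impI, elim conjE)
      fix x :: "nat \<Rightarrow> real" and t assume t: "t \<in> {a..b}" and x: "\<forall>n. x n \<in> {a..b}" and xt: "x \<longlonglongrightarrow> t"
      have pos: "t > 0" "x n > 0" for n using t x[rule_format, of n] ab(1) by auto
      have V: "u t \<in> L2 m" "u (x n) \<in> L2 m" "dt t \<in> L2 m" "dt (x n) \<in> L2 m" for n using u_V dV pos by auto
      have ul: "nrm (u (x n) - u t) \<le> 2 * \<bar>x n - t\<bar> * S0" for n
      proof (cases "t \<le> x n")
        case True
        have "nrm (u (x n) - u t) \<le> 2 * (x n - t) * nrm (xi t)" by (rule u_lipschitz[OF pos(1) True])
        also have "\<dots> \<le> 2 * (x n - t) * S0" using True xiS[of t] t ab(1) by (intro mult_left_mono) auto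
        finally show ?thesis using True by simp
      next
        case False
        have "nrm (u (x n) - u t) = nrm (u t - u (x n))" by (rule fl.nrm_minus_commute[OF V(2,1)])
        also have "\<dots> \<le> 2 * (t - x n) * nrm (xi (x n))" by (rule u_lipschitz[OF pos(2)]) (use False in simp)
        also have "\<dots> \<le> 2 * (t - x n) * S0" using False xiS[of "x n"] x[rule_format, of n] ab(1) by (intro mult_left_mono) auto
        finally show ?thesis using False by simp
      qed
      have l1: "(\<lambda>n. L2ip m (u (x n) - u t) (dt (x n))) \<longlonglongrightarrow> 0"
      proof (rule Lim_null_comparison)
        show "\<forall>\<^sub>F n in sequentially. norm (L2ip m (u (x n) - u t) (dt (x n))) \<le> (2 * \<bar>x n - t\<bar> * S0) * (B2 * M)"
        proof (intro always_eventually allI)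
          fix n
          have "norm (L2ip m (u (x n) - u t) (dt (x n))) \<le> nrm (u (x n) - u t) * nrm (dt (x n))"
            using fl.Cauchy_Schwarz[of "u (x n) - u t" "dt (x n)"] V(1,2,4) by simp
          also have "\<dots> \<le> (2 * \<bar>x n - t\<bar> * S0) * (B2 * M)"
          proof (intro mult_mono ul)
            show "nrm (dt (x n)) \<le> B2 * M" unfolding M_def by (rule nrm_bounded[OF V(4) B2(2)[OF pos(2)]])
          qed (use S0 V in auto)
          finally show "norm (L2ip m (u (x n) - u t) (dt (x n))) \<le> (2 * \<bar>x n - t\<bar> * S0) * (B2 * M)" .
        qed
        have "(\<lambda>n. (2 * \<bar>x n - t\<bar> * S0) * (B2 * M)) \<longlonglongrightarrow> (2 * \<bar>t - t\<bar> * S0) * (B2 * M)" by (intro tendsto_intros xt)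
        then show "(\<lambda>n. (2 * \<bar>x n - t\<bar> * S0) * (B2 * M)) \<longlonglongrightarrow> 0" by simp
      qed
      have l2: "(\<lambda>n. L2ip m (u t) (dt (x n))) \<longlonglongrightarrow> L2ip m (u t) (dt t)"
        unfolding L2ip_def
      proof (rule integral_dominated_convergence[where w="\<lambda>y. norm (u t y) * B2"])
        show "(\<lambda>y. u t y * dt t y) \<in> borel_measurable m" using L2_mult_integrable[OF V(1,3)] by (rule borel_measurable_integrable)
        show "(\<lambda>y. u t y * dt (x n) y) \<in> borel_measurable m" for n using L2_mult_integrable[OF V(1,4)] by (rule borel_measurable_integrable)
        show "integrable m (\<lambda>y. norm (u t y) * B2)" using L2_integrable[OF V(1)] by auto
        show "AE y in m. (\<lambda>n. u t y * dt (x n) y) \<longlonglongrightarrow> u t y * dt t y"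
        proof (intro AE_I2 tendsto_mult tendsto_const)
          fix y :: 'm
          have "(\<lambda>n. (x n, y)) \<longlonglongrightarrow> (t, y)" by (intro tendsto_Pair xt tendsto_const)
          from continuous_on_tendsto_compose[OF dt_cont this] pos
          show "(\<lambda>n. dt (x n) y) \<longlonglongrightarrow> dt t y" by simp
        qed
        show "AE y in m. norm (u t y * dt (x n) y) \<le> norm (u t y) * B2" for n
          using B2(2)[OF pos(2)] by (intro AE_I2) (simp add: abs_mult mult_left_mono)
      qed
      have "(\<lambda>n. L2ip m (u (x n) - u t) (dt (x n)) + L2ip m (u t) (dt (x n))) \<longlonglongrightarrow> 0 + L2ip m (u t) (dt t)"
        by (intro tendsto_add l1 l2)
      moreover have "L2ip m (u (x n) - u t) (dt (x n)) + L2ip m (u t) (dt (x n)) = g1 (x n)" for n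
        using V(1,2,4) pos(2) by (simp add: fl.ip_simps g1_def)
      ultimately show "(g1 \<circ> x) \<longlonglongrightarrow> g1 t" using pos(1) by (simp add: g1_def o_def)
    qed
  qed
  define g2 where "g2 t = (if t > 0 then L2ip m (xi t) (\<phi> t) else 0)" for t
  have g2: "g2 t = g1 t - G t" for t by (simp add: g1_def g2_def G_def)
  have g2i: "integrable lborel g2" unfolding g2[abs_def] by (rule Bochner_Integration.integrable_diff[OF g1i Gi])
  have e1: "indicator {0<..} t *\<^sub>R (\<integral>x. dt t x * u t x \<partial>m) = g1 t" for t
    by (simp add: g1_def L2ip_def mult.commute)
  have e2: "indicator {0<..} t *\<^sub>R (\<integral>x. dpair A L (\<phi> t) (u t) x \<partial>m) = g2 t" for t
    using dpair_integral(2)[OF slice_smooth, of t t] by (simp add: g2_def)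
  show ?thesis
  proof (intro conjI allI impI)
    show "integrable m (\<lambda>x. dt t x * u t x)" if "t > 0" for t by (rule L2_mult_integrable[OF dV[OF that] u_V[OF that]])
    show "integrable m (dpair A L (\<phi> t) (u t))" if "t > 0" for t by (rule dpair_integral(1)[OF slice_smooth[OF that] that])
    show "set_integrable lborel {0<..} (\<lambda>t. \<integral>x. dt t x * u t x \<partial>m)" unfolding set_integrable_def e1 by (rule g1i)
    show "set_integrable lborel {0<..} (\<lambda>t. \<integral>x. dpair A L (\<phi> t) (u t) x \<partial>m)" unfolding set_integrable_def e2 by (rule g2i)
    have "(\<integral>t. g2 t \<partial>lborel) = (\<integral>t. g1 t \<partial>lborel) - (\<integral>t. G t \<partial>lborel)"
      unfolding g2 by (rule Bochner_Integration.integral_diff[OF g1i Gi])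
    then have "(\<integral>t. g1 t \<partial>lborel) = (\<integral>t. g2 t \<partial>lborel)" unfolding G0 diff_0_right by (rule sym)
    then show "(LINT t:{0<..}|lborel. (\<integral>x. dt t x * u t x \<partial>m)) = (LINT t:{0<..}|lborel. (\<integral>x. dpair A L (\<phi> t) (u t) x \<partial>m))"
      unfolding set_lebesgue_integral_def e1 e2 .
  qed
qed

end

lemma gradient_curve_heat_equation:
  "weak_heat_solution A L m u \<and>
    (\<forall>t>0. laplacian_defined A L m (u t) \<and>
       has_distr_density A m (laplacian A L m (u t)) (grad_neg_energy A L m (u t))) \<and>
    (\<forall>t>0. L2norm m (distr_density A m (laplacian A L m (u t)))
             = L2norm m (grad_neg_energy A L m (u t)) \<and>
           ereal (L2norm m (grad_neg_energy A L m (u t))) = slope A L m (u t))"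
proof (intro conjI allI impI)
  show "weak_heat_solution A L m u"
    unfolding weak_heat_solution_def
  proof (intro allI impI)
    fix \<phi> :: "real \<Rightarrow> 'm \<Rightarrow> real" assume stf: "spacetime_test_function A \<phi>"
    \<comment> \<open>Outside its context \<open>dt\<close> takes \<phi> as an argument, and its
      defining equation carries the assumption on \<phi>.\<close>
    have d: "dt \<phi> = (\<lambda>t x. deriv (\<lambda>s. \<phi> s x) t)" by (simp only: fun_eq_iff dt_def[OF stf] simp_thms)
    from weak_heat[OF stf]
    show "(\<forall>t>0. integrable m (\<lambda>x. deriv (\<lambda>s. \<phi> s x) t * u t x)) \<and>
        (\<forall>t>0. integrable m (dpair A L (\<phi> t) (u t))) \<and>
        set_integrable lborel {0<..} (\<lambda>t. \<integral>x. deriv (\<lambda>s. \<phi> s x) t * u t x \<partial>m) \<and>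
        set_integrable lborel {0<..} (\<lambda>t. \<integral>x. dpair A L (\<phi> t) (u t) x \<partial>m) \<and>
        (LINT t:{0<..}|lborel. (\<integral>x. deriv (\<lambda>s. \<phi> s x) t * u t x \<partial>m)) =
        (LINT t:{0<..}|lborel. (\<integral>x. dpair A L (\<phi> t) (u t) x \<partial>m))"
      unfolding d .
  qed
  fix t :: real assume t: "t > 0"
  show "laplacian_defined A L m (u t)"
    unfolding laplacian_defined_def using dpair_integral(1)[OF _ t] by simp
  show "has_distr_density A m (laplacian A L m (u t)) (grad_neg_energy A L m (u t))" by (rule density_grad[OF t])
  show "L2norm m (distr_density A m (laplacian A L m (u t))) = L2norm m (grad_neg_energy A L m (u t))"
    by (rule distr_density_norm[OF t])
  show "ereal (L2norm m (grad_neg_energy A L m (u t))) = slope A L m (u t)" by (rule grad_norm_slope[OF t])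
qed

end

theorem theorem8p4:
  fixes A :: "('m::{t2_space,second_countable_topology}, 'e::euclidean_space) chart set"
    and m :: "'m measure"
    and g :: "'m \<Rightarrow> ('m, 'e) tvec \<Rightarrow> ('m, 'e) tvec \<Rightarrow> real"
    and L :: "'m \<Rightarrow> ('m, 'e) tvec \<Rightarrow> real"
    and u0 :: "'m \<Rightarrow> real"
    and u :: "real \<Rightarrow> 'm \<Rightarrow> real"
  assumes "compact (UNIV :: 'm set)" and "connected (UNIV :: 'm set)" and "DIM('e) \<ge> 2"
    and "smooth_atlas A" and "smooth_measure A m" and "riemannian_metric A g"
    and "lagrangian A L"
    and "\<forall>\<epsilon>>0. \<exists>C>0. \<forall>x. \<forall>\<alpha>\<in>cotangent_space A x. \<forall>\<beta>\<in>cotangent_space A x.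
           tnorm g x (legendre A L x \<alpha> - legendre A L x \<beta>) \<ge> \<epsilon> \<longrightarrow>
           tnorm g x (legendre A L x \<alpha> - legendre A L x \<beta>) \<le> C * conorm A g x (\<alpha> - \<beta>)"
    and "u0 \<in> H1 A L m"
    and "gradient_curve A L m u0 u"
  shows "weak_heat_solution A L m u \<and>
    (\<forall>t>0. laplacian_defined A L m (u t) \<and>
       has_distr_density A m (laplacian A L m (u t)) (grad_neg_energy A L m (u t))) \<and>
    (\<forall>t>0. L2norm m (distr_density A m (laplacian A L m (u t)))
             = L2norm m (grad_neg_energy A L m (u t)) \<and>
           ereal (L2norm m (grad_neg_energy A L m (u t))) = slope A L m (u t))"
proof -
  interpret heat_geometry A L m g
    by unfold_locales (use assms in auto)
  \<comment> \<open>The cover, and below it the constant C0, exist only as witnesses; fixing them as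
    locale parameters lets the preceding constructions refer to them.\<close>
  obtain N and C :: "nat \<Rightarrow> ('m,'e) chart" and K and idx :: "'m \<Rightarrow> nat" where
    cover: "\<And>i. i < N \<Longrightarrow> C i \<in> A" "\<And>i. i < N \<Longrightarrow> compact (K i)" "\<And>i. i < N \<Longrightarrow> K i \<subseteq> cdom (C i)"
    "\<And>p. idx p < N" "\<And>p. p \<in> K (idx p)" "\<And>i. {p. idx p = i} \<in> sets borel"
    by (rule finite_cover) blast
  interpret heat_cover A L m g N C K idx
    by unfold_locales (use cover in auto)
  obtain C0 where ci: "convex_integrand m hh qq W C0" using convex_integrand_ex by blast
  interpret heat_curve A L m g N C K idx C0 u0 u
    by (intro heat_curve.intro heat_energy.intro heat_energy_axioms.intro heat_curve_axioms.intro heat_cover_axioms ci assms)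
  show ?thesis by (rule gradient_curve_heat_equation)
qed

end
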